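(* Let $a,b\in\bar{\mathbb{Q}}(x)$ with $b\neq 0$, and assume that there is exactly one $u\in\bar{\mathbb{Q}}(x)$ with $u\sigma(u)+au+b=0$. Let $G\subseteq H\subseteq\mathrm{GL}_2(C)$ be the $\sigma\delta$-Galois group and the $\sigma$-Galois group of $\sigma^2(y)+a\sigma(y)+by=0$ over $k$, and let $y_1,y_2,y_0,w$ be as in the context. Suppose that $H$ is a connected subgroup of $$\mathbb{G}_m(C)\ltimes\mathbb{G}_a(C)=\left\{\begin{pmatrix}\alpha&\beta\\0&\alpha\end{pmatrix}\ \middle|\ \alpha,\beta\in C,\ \alpha\neq0\right\}$$ with $R_u(H)=\mathbb{G}_a(C)$. Then $w\in\bar{\mathbb{Q}}(x)$, and $G$ is the subgroup of $\mathbb{G}_m(C)\ltimes\mathbb{G}_a(C)$ defined by one of the following conditions. (i) There exists $h\in\bar{\mathbb{Q}}(x)$ such that $u=\frac{\sigma(h)}{h}$ if and only if $\alpha=1$ and $R_u(G)=\mathbb{G}_a(C)$, i.e., $G=H=\mathbb{G}_a(C)$. (ii) Case (i) does not hold and there exists $f\in\bar{\mathbb{Q}}(x)$ such that $\frac{\delta(u)}{u}=\sigma(f)-f$ if and only if $\delta(\alpha)=0$ and $R_u(G)=\mathbb{G}_a(C)$, i.e., $G=\mathbb{G}_m(C^\delta)\ltimes\mathbb{G}_a(C)$. (iii) Cases (i) and (ii) do not hold and there exist $g\in\bar{\mathbb{Q}}(x)$ and a linear $\delta$-polynomial $\mathcal{L}\in\bar{\mathbb{Q}}\{Y\}_\delta$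 such that $\mathcal{L}\left(\frac{\delta(u)}{u}\right)-w=\sigma(g)-g$ if and only if $\beta=\alpha\mathcal{L}\left(\frac{\delta(\alpha)}{\alpha}\right)$, i.e., $G\simeq\mathbb{G}_m(C)$, where the embedding $G\hookrightarrow\mathrm{GL}_2(C)$ associated to the choice of fundamental solution matrix $\begin{pmatrix}y_1&y_2\\ \sigma(y_1)&\sigma(y_2)\end{pmatrix}$ is given by $$\alpha\mapsto\begin{pmatrix}\alpha&\alpha\mathcal{L}\left(\frac{\delta(\alpha)}{\alpha}\right)\\0&\alpha\end{pmatrix}.$$ (iv) If none of (i), (ii), or (iii) holds, then $G=H=\mathbb{G}_m(C)\ltimes\mathbb{G}_a(C)$.
   Context: All fields have characteristic zero. A $\sigma\delta$-ring is a commutative unital ring with an automorphism $\sigma$ and a derivation $\delta$ that commute; $R^\sigma$, $R^\delta$ denote the subrings of elements fixed by $\sigma$, resp. killed by $\delta$. A $\delta$-field $C$ is $\delta$-closed if every finite system of $\delta$-polynomial equations over $C$ in finitely many variables having a solution in some $\delta$-field extension of $C$ has a solution in $C$. $C$ is a $\delta$-closure of $\bar{\mathbb{Q}}$ ($\delta=0$ on $\bar{\mathbb{Q}}$), i.e. a $\delta$-closed extension embedding over $\bar{\mathbb{Q}}$ into every $\delta$-closed extension. $k=C(x)$ is the $\sigma\delta$-field where $\sigma$ is $C$-linear with $\sigma(x)=x+1$, and $\delta$ extends that of $C$ with $\delta(x)=1$. A linear $\delta$-polynomial in $F\{Y\}_\delta$ is a finite $F$-linear combination of the symbols $\delta^i(Y)$,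 $i\ge 0$. For $A\in\mathrm{GL}_n(k)$, a $\sigma\delta$-PV ring over $k$ for $\sigma(Y)=AY$ is a $\sigma\delta$-$k$-algebra $R$ with no ideals other than $0,R$ stable under $\sigma$ and $\delta$, containing a fundamental solution matrix $Z\in\mathrm{GL}_n(R)$, $\sigma(Z)=AZ$, and generated as a $\delta$-$k$-algebra by the entries of $Z$ and $1/\det Z$. It exists, is unique up to isomorphism, and $R^\sigma=C$. $S=k[Z,1/\det Z]\subseteq R$ is then a $\sigma$-PV ring (the same notion with $\delta$ ignored). The $\sigma\delta$-Galois group $G=\mathrm{Gal}_{\sigma\delta}(R/k)$ (automorphisms of $R$ over $k$ commuting with $\sigma,\delta$) and the $\sigma$-Galois group $H=\mathrm{Gal}_\sigma(S/k)$ (automorphisms of $S$ over $k$ commuting with $\sigma$) are viewed in $\mathrm{GL}_n(C)$ via $\gamma(Z)=ZT_\gamma$; $H$ is a linear algebraic group, $G$ a Zariski-dense subgroup of it defined by $\delta$-polynomial equations. For $\sigma^2(y)+a\sigma(y)+by=0$ these notions refer to the system with $A=\begin{pmatrix}0&1\\-b&-a\end{pmatrix}$. Setting: with $u$ the unique solution in $\bar{\mathbb{Q}}(x)$ of the Riccati equation $u\sigma(u)+au+b=0$, there is a $C$-basis of solutions $\{y_1,y_2\}$ in $R$ with $y_1,y_2\neq0$, $\sigma(y_1)=uy_1$ and $\sigma(y_2)-uy_2=y_0$, where $y_0\neq 0$ satisfies $\sigma(y_0)=\frac{b}{u}y_0$ (and $y_1,y_0$ are invertible in $R$). With fundamental solution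 matrix $\begin{pmatrix}y_1&y_2\\ \sigma(y_1)&\sigma(y_2)\end{pmatrix}$ one has $T_\gamma=\begin{pmatrix}\alpha_\gamma&\beta_\gamma\\0&\lambda_\gamma\end{pmatrix}$, i.e. $\gamma(y_1)=\alpha_\gamma y_1$, $\gamma(y_0)=\lambda_\gamma y_0$, $\gamma(y_2)=\lambda_\gamma y_2+\beta_\gamma y_1$. Put $w=\frac{y_0}{uy_1}$. Define $R_u(H)=H\cap\left\{\begin{pmatrix}1&\beta\\0&1\end{pmatrix}:\beta\in C\right\}$ and $R_u(G)=G\cap\left\{\begin{pmatrix}1&\beta\\0&1\end{pmatrix}:\beta\in C\right\}$, regarded as subgroups of $\mathbb{G}_a(C)=(C,+)$.
   Formalization: Replacing y_1 by c·y_1 (c in C nonzero) turns w into w/c, so w∈Q̄(x) fails for some bases; instead it is proved that y_1 can be rescaled to make w∈Q̄(x), and (iii), (iv) are stated for bases with w∈Q̄(x). *)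

theory Defs
  imports
    "HOL-Analysis.Analysis"
    "HOL-Algebra.Algebraic_Closure_Type"
    "HOL-Algebra.Generated_Rings"
begin

section \<open>Rings with an automorphism and a derivation\<close>

text \<open>
  Types are turned into \<open>HOL-Algebra\<close> rings by \<^const>\<open>ring_of_type_algebra\<close>, so that one notion
  of derivation, homomorphism and ideal serves both for types and for structures on arbitrary
  carriers.
\<close>

definition derivation :: "('a, 'm) ring_scheme \<Rightarrow> ('a \<Rightarrow> 'a) \<Rightarrow> bool" where
  "derivation R D \<longleftrightarrow>
     D \<in> carrier R \<rightarrow> carrier R \<and>
     (\<forall>x\<in>carrier R. \<forall>y\<in>carrier R.
        D (x \<oplus>\<^bsub>R\<^esub> y) = D x \<oplus>\<^bsub>R\<^esub> D y \<and>
        D (x \<otimes>\<^bsub>R\<^esub> y) = (D x \<otimes>\<^bsub>R\<^esub> y) \<oplus>\<^bsub>R\<^esub> (x \<otimes>\<^bsub>R\<^esub> D y))"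

definition sd_ring :: "('a, 'm) ring_scheme \<Rightarrow> ('a \<Rightarrow> 'a) \<Rightarrow> ('a \<Rightarrow> 'a) \<Rightarrow> bool" where
  "sd_ring R s D \<longleftrightarrow>
     cring R \<and> s \<in> ring_iso R R \<and> derivation R D \<and> (\<forall>x\<in>carrier R. s (D x) = D (s x))"


section \<open>Differential fields and differential closures\<close>

definition d_field :: "('a, 'm) ring_scheme \<Rightarrow> ('a \<Rightarrow> 'a) \<Rightarrow> bool" where
  "d_field F D \<longleftrightarrow>
     Ring.field F \<and> (\<forall>n::nat. n > 0 \<longrightarrow> [n] \<cdot>\<^bsub>F\<^esub> \<one>\<^bsub>F\<^esub> \<noteq> \<zero>\<^bsub>F\<^esub>) \<and> derivation F D"

text \<open>
  Extensions are given by embeddings: a ring homomorphism between fields is injective.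
\<close>

definition d_hom ::
  "('a, 'm) ring_scheme \<Rightarrow> ('a \<Rightarrow> 'a) \<Rightarrow> ('b, 'n) ring_scheme \<Rightarrow> ('b \<Rightarrow> 'b) \<Rightarrow> ('a \<Rightarrow> 'b) set" where
  "d_hom F D F' D' = {\<phi> \<in> ring_hom F F'. \<forall>x\<in>carrier F. \<phi> (D x) = D' (\<phi> x)}"

text \<open>
  Differential polynomials in the variables \<open>Y\<^sub>0, Y\<^sub>1, \<dots>\<close> are represented by expressions; every
  element of the differential polynomial ring is the value of such an expression, and \<open>d_eval\<close> is
  evaluation at \<open>y\<close> after mapping the coefficients along \<open>\<phi>\<close>.
\<close>

datatype 'a d_poly =
    DConst 'a
  | DVar nat
  | DAdd "'a d_poly" "'a d_poly"
  | DMult "'a d_poly" "'a d_poly"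
  | DDeriv "'a d_poly"

primrec d_eval ::
  "('b, 'm) ring_scheme \<Rightarrow> ('b \<Rightarrow> 'b) \<Rightarrow> ('a \<Rightarrow> 'b) \<Rightarrow> (nat \<Rightarrow> 'b) \<Rightarrow> 'a d_poly \<Rightarrow> 'b" where
  "d_eval F D \<phi> y (DConst c) = \<phi> c"
| "d_eval F D \<phi> y (DVar i) = y i"
| "d_eval F D \<phi> y (DAdd p q) = d_eval F D \<phi> y p \<oplus>\<^bsub>F\<^esub> d_eval F D \<phi> y q"
| "d_eval F D \<phi> y (DMult p q) = d_eval F D \<phi> y p \<otimes>\<^bsub>F\<^esub> d_eval F D \<phi> y q"
| "d_eval F D \<phi> y (DDeriv p) = D (d_eval F D \<phi> y p)"

definition d_solvable ::
  "('b, 'm) ring_scheme \<Rightarrow> ('b \<Rightarrow> 'b) \<Rightarrow> ('a \<Rightarrow> 'b) \<Rightarrow> 'a d_poly set \<Rightarrow> bool" where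
  "d_solvable F D \<phi> P \<longleftrightarrow>
     (\<exists>y. (\<forall>i. y i \<in> carrier F) \<and> (\<forall>p\<in>P. d_eval F D \<phi> y p = \<zero>\<^bsub>F\<^esub>))"

text \<open>
  The extensions \<open>E\<close> live on subsets of the type carrying \<open>F\<close>. This is no restriction: a
  solution in any extension lies in the \<open>\<delta>\<close>-field generated over \<open>F\<close> by finitely many elements,
  which has the cardinality of the infinite field \<open>F\<close>, so it has an isomorphic copy there.
\<close>

definition d_closed :: "'a ring \<Rightarrow> ('a \<Rightarrow> 'a) \<Rightarrow> bool" where
  "d_closed F D \<longleftrightarrow>
     d_field F D \<and>
     (\<forall>P. finite P \<and> (\<forall>p\<in>P. set_d_poly p \<subseteq> carrier F) \<longrightarrow>
        (\<forall>(E :: 'a ring) DE \<phi>.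
           d_field E DE \<and> \<phi> \<in> d_hom F D E DE \<and> d_solvable E DE \<phi> P \<longrightarrow>
           d_solvable F D id P))"

text \<open>
  An algebraically closed field of characteristic \<open>0\<close> (in particular a \<open>\<delta>\<close>-closed one) contains
  exactly one copy of the algebraic closure of the rationals, namely its algebraic elements; every
  derivation vanishes on it.
\<close>

abbreviation Qbar :: "'c::field_char_0 set" where
  "Qbar \<equiv> {c. algebraic c}"

text \<open>
  Here \<open>C\<close> is the whole type. It suffices to embed \<open>C\<close> into the \<open>\<delta>\<close>-closed extensions of \<open>Qbar\<close>
  whose carrier lies in the (infinite) type \<open>'c\<close>: by downward Loewenheim-Skolem every \<open>\<delta>\<close>-closed
  extension of \<open>Qbar\<close> contains a countable \<open>\<delta>\<close>-closed one.
\<close>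

definition d_closure_of_Qbar :: "('c::field_char_0 \<Rightarrow> 'c) \<Rightarrow> bool" where
  "d_closure_of_Qbar dC \<longleftrightarrow>
     d_closed ring_of_type_algebra dC \<and>
     (\<forall>(E :: 'c ring) DE \<psi>.
        d_closed E DE \<and> \<psi> \<in> d_hom (ring_of_type_algebra\<lparr>carrier := Qbar\<rparr>) dC E DE \<longrightarrow>
        (\<exists>\<phi> \<in> d_hom ring_of_type_algebra dC E DE. \<forall>q\<in>Qbar. \<phi> q = \<psi> q))"


section \<open>The base field\<close>

abbreviation const :: "'c::field_char_0 \<Rightarrow> 'c poly fract" where
  "const c \<equiv> to_fract [:c:]"

definition Qbar_x :: "'c::field_char_0 poly fract set" where
  "Qbar_x = {Fract p q | p q.
     q \<noteq> 0 \<and> (\<forall>i. Polynomial.coeff p i \<in> Qbar) \<and> (\<forall>i. Polynomial.coeff q i \<in> Qbar)}"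

definition shift_base_field ::
  "('c::field_char_0 \<Rightarrow> 'c) \<Rightarrow> ('c poly fract \<Rightarrow> 'c poly fract) \<Rightarrow>
   ('c poly fract \<Rightarrow> 'c poly fract) \<Rightarrow> bool" where
  "shift_base_field dC sK dK \<longleftrightarrow>
     sd_ring ring_of_type_algebra sK dK \<and>
     (\<forall>c. sK (const c) = const c) \<and> sK (to_fract [:0, 1:]) = to_fract [:0, 1:] + 1 \<and>
     (\<forall>c. dK (const c) = const (dC c)) \<and> dK (to_fract [:0, 1:]) = 1"

text \<open>
  A linear \<open>\<delta>\<close>-polynomial with coefficients in \<open>C\<close>, \<open>c\<^sub>0 Y + c\<^sub>1 \<delta>(Y) + \<dots> + c\<^sub>m \<delta>\<^sup>m(Y)\<close>,
  is encoded by the polynomial with coefficients \<open>c\<^sub>0, \<dots>, c\<^sub>m\<close>; \<open>e\<close> embeds the coefficients into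
  the ring in which it is evaluated.
\<close>

definition lin_d_eval ::
  "('c::zero \<Rightarrow> 'a) \<Rightarrow> ('a \<Rightarrow> 'a) \<Rightarrow> 'c poly \<Rightarrow> 'a \<Rightarrow> 'a::comm_ring_1" where
  "lin_d_eval e D L y = (\<Sum>i\<le>Polynomial.degree L. e (Polynomial.coeff L i) * (D ^^ i) y)"


section \<open>Picard-Vessiot rings and Galois groups\<close>

text \<open>
  In this section \<open>\<iota>\<close> is the structure map of an algebra over \<open>k = C(x)\<close>.
\<close>

definition fundamental_matrix ::
  "('k::comm_ring_1 \<Rightarrow> 'r::comm_ring_1) \<Rightarrow> ('r \<Rightarrow> 'r) \<Rightarrow> 'k^'n^'n \<Rightarrow> 'r^'n^'n \<Rightarrow> bool" where
  "fundamental_matrix \<iota> sR A Z \<longleftrightarrow> invertible Z \<and> map_matrix sR Z = map_matrix \<iota> A ** Z"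

text \<open>The scalars, the entries of \<open>Z\<close>, and \<open>1/det Z\<close>.\<close>

definition pv_generators :: "('k \<Rightarrow> 'r::comm_ring_1) \<Rightarrow> 'r^'n^'n \<Rightarrow> 'r set" where
  "pv_generators \<iota> Z = range \<iota> \<union> {Z $ i $ j | i j. True} \<union> {v. v * det Z = 1}"

definition sd_pv_ring ::
  "('k::field \<Rightarrow> 'k) \<Rightarrow> ('k \<Rightarrow> 'k) \<Rightarrow> 'k^'n^'n \<Rightarrow>
   ('k \<Rightarrow> 'r::comm_ring_1) \<Rightarrow> ('r \<Rightarrow> 'r) \<Rightarrow> ('r \<Rightarrow> 'r) \<Rightarrow> bool" where
  "sd_pv_ring sK dK A \<iota> sR dR \<longleftrightarrow>
     sd_ring ring_of_type_algebra sR dR \<and>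
     \<iota> \<in> ring_hom ring_of_type_algebra ring_of_type_algebra \<and>
     (\<forall>f. \<iota> (sK f) = sR (\<iota> f)) \<and> (\<forall>f. \<iota> (dK f) = dR (\<iota> f)) \<and>
     (\<forall>I. ideal I ring_of_type_algebra \<and> sR ` I \<subseteq> I \<and> dR ` I \<subseteq> I \<longrightarrow> I = {0} \<or> I = UNIV) \<and>
     (\<exists>Z. fundamental_matrix \<iota> sR A Z \<and>
        (\<forall>B. subring B ring_of_type_algebra \<and> pv_generators \<iota> Z \<subseteq> B \<and> dR ` B \<subseteq> B \<longrightarrow> B = UNIV))"

text \<open>\<open>k[Z, 1/det Z]\<close>\<close>

definition s_pv_subring :: "('k \<Rightarrow> 'r::comm_ring_1) \<Rightarrow> 'r^'n^'n \<Rightarrow> 'r set" where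
  "s_pv_subring \<iota> Z = generate_ring ring_of_type_algebra (pv_generators \<iota> Z)"

text \<open>
  Galois groups as sets of matrices: \<open>T\<close> represents \<open>\<gamma>\<close> if \<open>\<gamma>(Z) = Z T\<close>; such a \<open>T\<close> is
  automatically invertible.
\<close>

definition sd_galois_group ::
  "('c::field_char_0 poly fract \<Rightarrow> 'r::comm_ring_1) \<Rightarrow> ('r \<Rightarrow> 'r) \<Rightarrow> ('r \<Rightarrow> 'r) \<Rightarrow> 'r^'n^'n \<Rightarrow>
   ('c^'n^'n) set" where
  "sd_galois_group \<iota> sR dR Z =
     {T. \<exists>\<gamma> \<in> ring_iso ring_of_type_algebra ring_of_type_algebra.
           (\<forall>f. \<gamma> (\<iota> f) = \<iota> f) \<and> (\<forall>r. \<gamma> (sR r) = sR (\<gamma> r)) \<and> (\<forall>r. \<gamma> (dR r) = dR (\<gamma> r)) \<and>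
           map_matrix \<gamma> Z = Z ** map_matrix (\<lambda>c. \<iota> (const c)) T}"

definition s_galois_group ::
  "('c::field_char_0 poly fract \<Rightarrow> 'r::comm_ring_1) \<Rightarrow> ('r \<Rightarrow> 'r) \<Rightarrow> 'r^'n^'n \<Rightarrow>
   ('c^'n^'n) set" where
  "s_galois_group \<iota> sR Z =
     (let S = s_pv_subring \<iota> Z; SR = ring_of_type_algebra\<lparr>carrier := S\<rparr> in
      {T. \<exists>\<gamma> \<in> ring_iso SR SR.
            (\<forall>f. \<gamma> (\<iota> f) = \<iota> f) \<and> (\<forall>r\<in>S. \<gamma> (sR r) = sR (\<gamma> r)) \<and>
            map_matrix \<gamma> Z = Z ** map_matrix (\<lambda>c. \<iota> (const c)) T})"


section \<open>Zariski topology on matrices\<close>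

inductive_set matrix_polys :: "('a::comm_ring_1^'n^'m \<Rightarrow> 'a) set" where
  "(\<lambda>_. c) \<in> matrix_polys"
| "(\<lambda>T. T $ i $ j) \<in> matrix_polys"
| "p \<in> matrix_polys \<Longrightarrow> q \<in> matrix_polys \<Longrightarrow> (\<lambda>T. p T + q T) \<in> matrix_polys"
| "p \<in> matrix_polys \<Longrightarrow> q \<in> matrix_polys \<Longrightarrow> (\<lambda>T. p T * q T) \<in> matrix_polys"

definition zariski_closed :: "('a::idom^'n^'m) set \<Rightarrow> bool" where
  "zariski_closed V \<longleftrightarrow> (\<exists>P \<subseteq> matrix_polys. V = {T. \<forall>p\<in>P. p T = 0})"

definition zariski_topology :: "('a::idom^'n^'m) topology" where
  "zariski_topology = topology (\<lambda>U. zariski_closed (- U))"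

lemma zariski_closed_Int: "zariski_closed (\<Inter>\<V>)" if "\<And>V. V \<in> \<V> \<Longrightarrow> zariski_closed V"
proof -
  have "\<forall>V\<in>\<V>. \<exists>P \<subseteq> matrix_polys. V = {T. \<forall>p\<in>P. p T = 0}"
    using that unfolding zariski_closed_def by simp
  then obtain P where P: "\<forall>V\<in>\<V>. P V \<subseteq> matrix_polys \<and> V = {T. \<forall>p\<in>P V. p T = 0}"
    by (rule bchoice[THEN exE])
  then have "T \<in> V \<longleftrightarrow> (\<forall>p\<in>P V. p T = 0)" if "V \<in> \<V>" for T V
    using that by auto
  then have "\<Inter>\<V> = {T. \<forall>p \<in> \<Union>(P ` \<V>). p T = 0}"
    by (simp add: set_eq_iff)
  moreover have "\<Union>(P ` \<V>) \<subseteq> matrix_polys"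
    using P by blast
  ultimately show ?thesis
    unfolding zariski_closed_def by blast
qed

lemma zariski_closed_Un: "zariski_closed (V \<union> W)" if "zariski_closed V" "zariski_closed W"
proof -
  from that obtain P Q where PQ: "P \<subseteq> matrix_polys" "Q \<subseteq> matrix_polys"
    and V: "V = {T. \<forall>p\<in>P. p T = 0}" and W: "W = {T. \<forall>q\<in>Q. q T = 0}"
    unfolding zariski_closed_def by blast
  define R where "R = (\<lambda>(p, q) T. p T * q T) ` (P \<times> Q)"
  have "R \<subseteq> matrix_polys"
    unfolding R_def using PQ by (auto intro!: matrix_polys.intros(4))
  moreover have "T \<in> V \<union> W \<longleftrightarrow> (\<forall>r\<in>R. r T = 0)" for T
  proof -
    have "(\<forall>r\<in>R. r T = 0) \<longleftrightarrow> (\<forall>p\<in>P. \<forall>q\<in>Q. p T * q T = 0)"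
      unfolding R_def by simp
    also have "\<dots> \<longleftrightarrow> (\<forall>p\<in>P. p T = 0) \<or> (\<forall>q\<in>Q. q T = 0)"
      unfolding mult_eq_0_iff by blast
    finally show ?thesis
      unfolding V W by simp
  qed
  ultimately show ?thesis
    unfolding zariski_closed_def by blast
qed

lemma openin_zariski: "openin zariski_topology U \<longleftrightarrow> zariski_closed (- U)"
proof -
  have "zariski_closed (- \<Union>\<K>)" if "\<forall>K\<in>\<K>. zariski_closed (- K)"
    for \<K> :: "('a^'b^'c) set set"
  proof -
    have "zariski_closed (\<Inter>(uminus ` \<K>))"
      using that by (intro zariski_closed_Int) blast
    moreover have "\<Inter>(uminus ` \<K>) = - \<Union>\<K>"
      by blast
    ultimately show ?thesis
      by simp
  qed
  moreover have "zariski_closed (- (S \<inter> T))"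
    if "zariski_closed (- S)" "zariski_closed (- T)" for S T :: "('a^'b^'c) set"
    using zariski_closed_Un[OF that] by (simp only: Compl_Int)
  ultimately have "istopology (\<lambda>U :: ('a^'b^'c) set. zariski_closed (- U))"
    unfolding istopology_def by blast
  then show ?thesis
    unfolding zariski_topology_def by (simp add: topology_inverse')
qed


section \<open>Subgroups of \<open>GL\<^sub>2\<close>\<close>

definition mat2 :: "'a::zero \<Rightarrow> 'a \<Rightarrow> 'a \<Rightarrow> 'a \<Rightarrow> 'a^2^2" where
  "mat2 p q r s = vector [vector [p, q], vector [r, s]]"

definition Gm_Ga :: "('c::field^2^2) set" where
  "Gm_Ga = {mat2 \<alpha> \<beta> 0 \<alpha> | \<alpha> \<beta>. \<alpha> \<noteq> 0}"

definition Ru :: "('c::field^2^2) set \<Rightarrow> 'c set" where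
  "Ru M = {\<beta>. mat2 1 \<beta> 0 1 \<in> M}"

definition matrix_group :: "('c::field^2^2) set \<Rightarrow> ('c^2^2) monoid" where
  "matrix_group M = \<lparr>carrier = M, monoid.mult = (**), one = mat 1\<rparr>"

definition log_deriv_embedding :: "('c::field \<Rightarrow> 'c) \<Rightarrow> 'c poly \<Rightarrow> 'c \<Rightarrow> 'c^2^2" where
  "log_deriv_embedding dC L \<alpha> = mat2 \<alpha> (\<alpha> * lin_d_eval id dC L (dC \<alpha> / \<alpha>)) 0 \<alpha>"


section \<open>Second-order equations with a unique Riccati solution\<close>

definition riccati_solution ::
  "('k::field \<Rightarrow> 'k) \<Rightarrow> 'k \<Rightarrow> 'k \<Rightarrow> 'k \<Rightarrow> bool" where
  "riccati_solution sK a b u \<longleftrightarrow> u * sK u + a * u + b = 0"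

definition companion :: "'k::field \<Rightarrow> 'k \<Rightarrow> 'k^2^2" where
  "companion a b = mat2 0 1 (- b) (- a)"

text \<open>
  The last conjunct says \<open>w = y\<^sub>0/(u y\<^sub>1)\<close>; it determines \<open>w\<close> because \<open>y\<^sub>1\<close> and \<open>u\<close> are invertible.
  These conditions survive replacing \<open>y\<^sub>1\<close> by \<open>c y\<^sub>1\<close> for a nonzero \<open>c\<close> in \<open>C\<close>, which replaces
  \<open>w\<close> by \<open>w/c\<close>. So whether \<open>w\<close> lies in \<open>Qbar_x\<close> depends on how the basis is normalised.
\<close>

definition riccati_basis ::
  "('c::field_char_0 poly fract \<Rightarrow> 'r::comm_ring_1) \<Rightarrow> ('r \<Rightarrow> 'r) \<Rightarrow>
   'c poly fract \<Rightarrow> 'c poly fract \<Rightarrow> 'c poly fract \<Rightarrow> 'r \<Rightarrow> 'r \<Rightarrow> 'r \<Rightarrow> 'r \<Rightarrow> bool" where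
  "riccati_basis \<iota> sR a b u y1 y2 y0 w \<longleftrightarrow>
     (\<forall>y. sR (sR y) + \<iota> a * sR y + \<iota> b * y = 0 \<longleftrightarrow>
        (\<exists>!c. y = \<iota> (const (fst c)) * y1 + \<iota> (const (snd c)) * y2)) \<and>
     fundamental_matrix \<iota> sR (companion a b) (mat2 y1 y2 (sR y1) (sR y2)) \<and>
     y1 \<noteq> 0 \<and> y2 \<noteq> 0 \<and> y0 \<noteq> 0 \<and> y1 dvd 1 \<and> y0 dvd 1 \<and>
     sR y1 = \<iota> u * y1 \<and> sR y2 - \<iota> u * y2 = y0 \<and> sR y0 = \<iota> (b / u) * y0 \<and>
     w * (\<iota> u * y1) = y0"


section \<open>The case conditions\<close>

definition case_i :: "('c::field_char_0 poly fract \<Rightarrow> 'c poly fract) \<Rightarrow> 'c poly fract \<Rightarrow> bool" where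
  "case_i sK u \<longleftrightarrow> (\<exists>h\<in>Qbar_x. h \<noteq> 0 \<and> u = sK h / h)"

definition case_ii ::
  "('c::field_char_0 poly fract \<Rightarrow> 'c poly fract) \<Rightarrow> ('c poly fract \<Rightarrow> 'c poly fract) \<Rightarrow>
   'c poly fract \<Rightarrow> bool" where
  "case_ii sK dK u \<longleftrightarrow> \<not> case_i sK u \<and> (\<exists>f\<in>Qbar_x. dK u / u = sK f - f)"

definition case_iii_for ::
  "('c::field_char_0 poly fract \<Rightarrow> 'c poly fract) \<Rightarrow> ('c poly fract \<Rightarrow> 'c poly fract) \<Rightarrow>
   ('c poly fract \<Rightarrow> 'r::comm_ring_1) \<Rightarrow> 'c poly fract \<Rightarrow> 'r \<Rightarrow> 'c poly \<Rightarrow> bool" where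
  "case_iii_for sK dK \<iota> u w L \<longleftrightarrow>
     \<not> case_i sK u \<and> \<not> case_ii sK dK u \<and>
     (\<exists>g\<in>Qbar_x. \<iota> (lin_d_eval const dK L (dK u / u)) - w = \<iota> (sK g - g))"

end

theory Submission
  imports Defs "HOL-Library.Groups_Big_Fun"
begin

text \<open>
  Three elements of \<open>R\<close> carry the proof: the unit \<open>y1\<close>, the quotient \<open>t = y2/y1\<close> with
  \<open>\<sigma>(t) = t + w\<close>, and \<open>z = \<delta>(y1)/y1\<close> with \<open>\<sigma>(z) = z + v\<close>, where \<open>v = \<delta>(u)/u\<close>. Together with
  \<open>1/y1\<close> and their derivatives they generate \<open>R\<close> over \<open>k\<close>, and the automorphism with matrix entries \<open>\<alpha>\<close>,
  \<open>\<beta>\<close>, \<open>\<alpha>\<close> acts on them by \<open>y1 \<mapsto> \<alpha> y1\<close>, \<open>t \<mapsto> t + \<beta>/\<alpha>\<close> and \<open>z \<mapsto> z + \<delta>(\<alpha>)/\<alpha>\<close>. So the group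
  \<open>G\<close> consists of the pairs \<open>(\<alpha>, \<beta>)\<close> which are compatible with the algebraic relations between \<open>y1\<close> and
  the derivatives of \<open>z\<close> and \<open>t\<close>.

  Which relations can occur is controlled by \<open>R\<^sup>\<sigma> = C\<close>. If \<open>B\<close> is a \<open>\<sigma>\<close>-simple subring and
  \<open>\<sigma>(\<tau>) = \<tau> + \<omega>\<close> with \<open>\<omega>\<close> in \<open>B\<close> not of the form \<open>\<sigma>(g) - g\<close>, then \<open>\<tau>\<close> is transcendental over
  \<open>B\<close> and \<open>B[\<tau>]\<close> is again \<open>\<sigma>\<close>-simple (\<open>relation_imp_unit\<close>). Hence a sequence of such elements is
  independent as soon as no nontrivial \<open>C\<close>-linear combination of its increments is summable (\<open>sg_tower\<close>).
  Likewise units multiplied by \<open>\<sigma>\<close> with elements of \<open>k\<close> satisfy only the relations forced by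
  proportional monomials (\<open>monomial_twist\<close>). Images for the generators that respect these relations
  span a single-valued subring of \<open>R \<times> R\<close>, and because \<open>R\<close> has no proper nonzero ideals stable under \<open>\<sigma>\<close>
  and \<open>\<delta>\<close>, this subring is the graph of an automorphism (\<open>torus_in_H\<close> for \<open>H\<close>, \<open>G_intro\<close> for \<open>G\<close>).

  In \<open>H\<close> this yields diagonal elements with entries \<open>\<alpha>\<close>, \<open>\<alpha> \<mu>\<close> for every character \<open>(\<alpha>, \<mu>)\<close>
  that is trivial on the multiplicative relations of \<open>u\<close> and \<open>b/u\<^sup>2\<close>. Since the diagonal entries of elements
  of \<open>H\<close> agree, \<open>b/u\<^sup>2 = \<sigma>(h)/h\<close> (\<open>cob_sr\<close>), so \<open>w\<close> is a constant times an element of \<open>Qbar_x\<close>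
  (\<open>w_normal_form\<close>); since \<open>H\<close> is connected, no power \<open>u\<^sup>m\<close> with \<open>m \<noteq> 0\<close> has the form \<open>\<sigma>(h)/h\<close>
  unless \<open>u\<close> itself does (\<open>cob_power_imp_cob\<close>).

  It remains to decide which combinations of the derivatives of \<open>v\<close> and of the normalised \<open>w\<close> are summable.
  Adding up the polar parts of a function in \<open>Qbar_x\<close> along an orbit of the shift gives an element of
  \<open>C[\<delta>]\<close>; these elements all vanish exactly for summable functions (\<open>qsummable_iff_orbit_polar\<close>), and operators
  in \<open>C[\<delta>]\<close> act on them by multiplication (\<open>orbit_polar_lin\<close>). As \<open>C[\<delta>]\<close> has no zero divisors, an
  unsummable function has independent derivatives. As \<open>v\<close> has simple poles only, its orbit sums are numbers, and a summable
  \<open>M(v) + N(w)\<close> with \<open>N \<noteq> 0\<close> can be divided by \<open>N\<close>, which produces a linear \<open>\<L>\<close> over the algebraic numbers with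
  \<open>\<L>(v) - w\<close> summable (\<open>L_log_deriv_summable_imp_zero\<close>). This leaves exactly four possibilities: \<open>v\<close> is
  summable and \<open>u\<close> is or is not of the form \<open>\<sigma>(h)/h\<close>; \<open>v\<close> is not summable but some \<open>\<L>(v) - w\<close> is;
  neither is. In each case a free sequence of generators is visible, and \<open>G\<close> can be read off.

  Conversely, the four kinds of groups are distinct, and a group of the third kind determines \<open>\<L>\<close>, because
  \<open>\<delta>\<close>-closedness of \<open>C\<close> provides for every \<open>\<L> \<noteq> 0\<close> an \<open>\<alpha>\<close> with \<open>\<L>(\<delta>(\<alpha>)/\<alpha>) \<noteq> 0\<close>
  (\<open>ex_log_deriv_ne_zero\<close>). So the conditions and the groups correspond.
\<close>

section \<open>Types as rings\<close>

lemma ring_of_type_algebra_simps [simp]: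
  "carrier ring_of_type_algebra = UNIV"
  "x \<otimes>\<^bsub>ring_of_type_algebra\<^esub> y = x * y"
  "x \<oplus>\<^bsub>ring_of_type_algebra\<^esub> y = x + y"
  "\<zero>\<^bsub>ring_of_type_algebra\<^esub> = 0"
  "\<one>\<^bsub>ring_of_type_algebra\<^esub> = 1"
  by (simp_all add: ring_of_type_algebra_def)

lemma a_inv_ring_of_type_algebra [simp]:
  "\<ominus>\<^bsub>ring_of_type_algebra\<^esub> (x :: 'a::comm_ring_1) = - x"
proof -
  interpret cring "ring_of_type_algebra :: 'a ring" by (rule cring_from_type_algebra)
  show ?thesis by (rule minus_equality) simp_all
qed

lemma m_inv_ring_of_type_algebra:
  assumes "(x :: 'a::field) \<noteq> 0"
  shows "inv\<^bsub>ring_of_type_algebra\<^esub> x = inverse x"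
proof -
  interpret Ring.field "ring_of_type_algebra :: 'a ring" by (rule field_from_type_algebra)
  show ?thesis by (rule comm_inv_char) (use assms in simp_all)
qed

lemma nat_pow_ring_of_type_algebra [simp]:
  "(x :: 'a::comm_ring_1) [^]\<^bsub>ring_of_type_algebra\<^esub> (n::nat) = x ^ n"
  by (induction n) (simp_all add: mult.commute)

lemma add_pow_ring_of_type_algebra:
  "add_pow (ring_of_type_algebra\<lparr>carrier := S\<rparr>) (n::nat) (x :: 'a::comm_ring_1) = of_nat n * x"
  by (induction n) (simp_all add: add_pow_def nat_pow_def algebra_simps)

lemma subring_ring_of_type_algebra_iff:
  "subring B (ring_of_type_algebra :: 'a::comm_ring_1 ring) \<longleftrightarrow>
     1 \<in> B \<and> (\<forall>x\<in>B. - x \<in> B) \<and> (\<forall>x\<in>B. \<forall>y\<in>B. x + y \<in> B) \<and> (\<forall>x\<in>B. \<forall>y\<in>B. x * y \<in> B)"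
    (is "?L \<longleftrightarrow> ?R")
proof
  interpret cring "ring_of_type_algebra :: 'a ring" by (rule cring_from_type_algebra)
  show "?L \<Longrightarrow> ?R"
    using subringE[of B "ring_of_type_algebra :: 'a ring"] by simp
  show "?R \<Longrightarrow> ?L"
    by (rule subringI) simp_all
qed

section \<open>Differentially closed fields\<close>

text \<open>
  Being \<open>\<delta>\<close>-closed is a condition on extensions carried by subsets of \<open>C\<close> itself, while the extensions
  that matter below, \<open>C(\<theta>)\<close> and \<open>C(x)\<close>, live on other types. They are moved along an injection into \<open>C\<close>,
  which exists because \<open>C\<close> is infinite and hence as large as its set of pairs, of lists, of polynomials
  and of rational functions.
\<close>

lemma ex_inj_pair: "\<exists>f :: 'c::field_char_0 \<times> 'c \<Rightarrow> 'c. inj f"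
proof -
  have "infinite (UNIV :: 'c set)" by (rule infinite_UNIV_char_0)
  from card_of_Times_same_infinite[OF this] obtain f :: "'c \<times> 'c \<Rightarrow> 'c"
    where "bij_betw f (UNIV \<times> UNIV) UNIV"
    unfolding card_of_ordIso[symmetric] by blast
  then show ?thesis by (auto simp: bij_betw_def)
qed

primrec pair_code :: "('c::zero \<times> 'c \<Rightarrow> 'c) \<Rightarrow> 'c list \<Rightarrow> 'c" where
  "pair_code f [] = 0"
| "pair_code f (x # xs) = f (x, pair_code f xs)"

lemma ex_inj_list: "\<exists>f :: 'c::field_char_0 list \<Rightarrow> 'c. inj f"
proof -
  obtain f :: "'c \<times> 'c \<Rightarrow> 'c" where f: "inj f" using ex_inj_pair by blast
  have *: "pair_code f xs = pair_code f ys \<Longrightarrow> length xs = length ys \<Longrightarrow> xs = ys" for xs ys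
  proof (induction xs arbitrary: ys)
    case (Cons x xs)
    then show ?case by (cases ys) (auto dest: injD[OF f])
  qed simp
  have "inj (\<lambda>xs. f (of_nat (length xs), pair_code f xs))"
    by (rule injI) (auto dest!: injD[OF f] intro: *)
  then show ?thesis by blast
qed

lemma ex_inj_poly: "\<exists>f :: 'c::field_char_0 poly \<Rightarrow> 'c. inj f"
proof -
  obtain f :: "'c list \<Rightarrow> 'c" where "inj f" using ex_inj_list by blast
  then have "inj (f \<circ> coeffs)" by (intro inj_compose) (auto intro: injI simp: coeffs_eq_iff)
  then show ?thesis by blast
qed

lemma ex_inj_fract: "\<exists>f :: 'c::field_char_0 poly fract \<Rightarrow> 'c. inj f"
proof -
  obtain f :: "'c \<times> 'c \<Rightarrow> 'c" where f: "inj f" using ex_inj_pair by blast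
  obtain g :: "'c poly \<Rightarrow> 'c" where g: "inj g" using ex_inj_poly by blast
  have "\<forall>r :: 'c poly fract. \<exists>pq. r = Fract (fst pq) (snd pq)"
    by (metis Fract_cases fst_conv snd_conv)
  then obtain rep where rep: "\<And>r :: 'c poly fract. r = Fract (fst (rep r)) (snd (rep r))"
    by metis
  have "inj (\<lambda>r. f (g (fst (rep r)), g (snd (rep r))))"
    by (rule injI) (metis rep f g injD prod.inject)
  then show ?thesis by blast
qed

lemma d_eval_in_carrier:
  assumes "Ring.ring E" "derivation E D" "\<And>c. \<phi> c \<in> carrier E" "\<And>i. y i \<in> carrier E"
  shows "d_eval E D \<phi> y p \<in> carrier E"
proof -
  interpret Ring.ring E by fact
  show ?thesis
    by (induction p) (use assms in \<open>auto simp: derivation_def\<close>)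
qed

text \<open>
  Transport of structure: an extension whose carrier injects into \<open>C\<close> has an isomorphic copy to which
  \<open>\<delta>\<close>-closedness applies.
\<close>

lemma d_closed_imp_solvable:
  fixes E :: "'b ring" and j :: "'b \<Rightarrow> 'c::field_char_0"
  assumes C: "d_closed (ring_of_type_algebra :: 'c ring) dC"
    and E: "d_field E D" and \<phi>: "\<phi> \<in> d_hom ring_of_type_algebra dC E D"
    and j: "inj_on j (carrier E)" and P: "finite P" and sol: "d_solvable E D \<phi> P"
  shows "d_solvable ring_of_type_algebra dC id P"
proof -
  from E have fld: "Ring.field E" and der: "derivation E D"
    and char: "\<And>n::nat. n > 0 \<Longrightarrow> [n] \<cdot>\<^bsub>E\<^esub> \<one>\<^bsub>E\<^esub> \<noteq> \<zero>\<^bsub>E\<^esub>"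
    by (auto simp: d_field_def)
  interpret E: Ring.field E by fact
  define i where "i = inv_into (carrier E) j"
  define E' where "E' = image_ring j E"
  define D' where "D' = (\<lambda>x. j (D (i x)))"
  have ij [simp]: "x \<in> carrier E \<Longrightarrow> i (j x) = x" for x
    unfolding i_def using j by simp
  have E'_simps: "carrier E' = j ` carrier E" "\<one>\<^bsub>E'\<^esub> = j \<one>\<^bsub>E\<^esub>" "\<zero>\<^bsub>E'\<^esub> = j \<zero>\<^bsub>E\<^esub>"
    "x \<oplus>\<^bsub>E'\<^esub> y = j (i x \<oplus>\<^bsub>E\<^esub> i y)" "x \<otimes>\<^bsub>E'\<^esub> y = j (i x \<otimes>\<^bsub>E\<^esub> i y)" for x y
    unfolding E'_def i_def image_ring_def image_group_def monoid.defs by simp_all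
  have D_closed: "x \<in> carrier E \<Longrightarrow> D x \<in> carrier E" for x
    using der by (auto simp: derivation_def)
  have fld': "Ring.field E'"
    unfolding E'_def by (rule E.inj_imp_image_ring_is_field[OF j])
  have der': "derivation E' D'"
    using der D_closed unfolding derivation_def D'_def E'_simps by auto
  have pow: "[n] \<cdot>\<^bsub>E'\<^esub> \<one>\<^bsub>E'\<^esub> = j ([n] \<cdot>\<^bsub>E\<^esub> \<one>\<^bsub>E\<^esub>)" for n :: nat
  proof (induction n)
    case 0
    show ?case by (simp add: add_pow_def nat_pow_def E'_simps)
  next
    case (Suc n)
    have c: "[n] \<cdot>\<^bsub>E\<^esub> \<one>\<^bsub>E\<^esub> \<in> carrier E" by simp
    have "[Suc n] \<cdot>\<^bsub>E'\<^esub> \<one>\<^bsub>E'\<^esub> = [n] \<cdot>\<^bsub>E'\<^esub> \<one>\<^bsub>E'\<^esub> \<oplus>\<^bsub>E'\<^esub> \<one>\<^bsub>E'\<^esub>"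
      by (simp add: add_pow_def nat_pow_def)
    also have "\<dots> = j ([n] \<cdot>\<^bsub>E\<^esub> \<one>\<^bsub>E\<^esub> \<oplus>\<^bsub>E\<^esub> \<one>\<^bsub>E\<^esub>)"
      using c unfolding Suc by (simp add: E'_simps)
    also have "[n] \<cdot>\<^bsub>E\<^esub> \<one>\<^bsub>E\<^esub> \<oplus>\<^bsub>E\<^esub> \<one>\<^bsub>E\<^esub> = [Suc n] \<cdot>\<^bsub>E\<^esub> \<one>\<^bsub>E\<^esub>"
      by (simp add: add_pow_def nat_pow_def)
    finally show ?case .
  qed
  have "[n] \<cdot>\<^bsub>E'\<^esub> \<one>\<^bsub>E'\<^esub> \<noteq> \<zero>\<^bsub>E'\<^esub>" if "n > 0" for n :: nat
    unfolding pow E'_simps(3) using char[OF that] inj_onD[OF j, of "[n] \<cdot>\<^bsub>E\<^esub> \<one>\<^bsub>E\<^esub>" "\<zero>\<^bsub>E\<^esub>"] by auto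
  then have "d_field E' D'"
    unfolding d_field_def using fld' der' by simp
  moreover have \<phi>c: "\<phi> c \<in> carrier E" for c
    using \<phi> by (auto simp: d_hom_def ring_hom_def)
  have "(\<lambda>c. j (\<phi> c)) \<in> d_hom ring_of_type_algebra dC E' D'"
    using \<phi> \<phi>c unfolding d_hom_def ring_hom_def by (auto simp: E'_simps D'_def)
  moreover obtain y where y: "\<And>i. y i \<in> carrier E" "\<And>p. p \<in> P \<Longrightarrow> d_eval E D \<phi> y p = \<zero>\<^bsub>E\<^esub>"
    using sol by (auto simp: d_solvable_def)
  have ev: "d_eval E D \<phi> y p \<in> carrier E" for p
    by (rule d_eval_in_carrier) (use der \<phi>c y in \<open>auto simp: E.ring_axioms\<close>)
  have "d_eval E' D' (\<lambda>c. j (\<phi> c)) (\<lambda>i. j (y i)) p = j (d_eval E D \<phi> y p)" for p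
    by (induction p) (auto simp: E'_simps D'_def \<phi>c y ev)
  then have "d_solvable E' D' (\<lambda>c. j (\<phi> c)) P"
    unfolding d_solvable_def using y
    by (intro exI[of _ "\<lambda>i. j (y i)"]) (auto simp: E'_simps)
  ultimately show ?thesis
    using C P unfolding d_closed_def by auto
qed

lemma map_poly_add_hom:
  assumes "\<And>x y. f (x + y) = f x + f y" "f 0 = 0"
  shows "map_poly f (p + q) = map_poly f p + map_poly f q"
  by (rule poly_eqI) (simp add: coeff_map_poly assms)

lemma map_poly_mult_hom:
  fixes f :: "'a::comm_ring_1 \<Rightarrow> 'b::comm_ring_1"
  assumes "\<And>x y. f (x + y) = f x + f y" "f 0 = 0" "\<And>x y. f (x * y) = f x * f y"
  shows "map_poly f (p * q) = map_poly f p * map_poly f q"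
proof -
  have *: "f (sum g A) = (\<Sum>i\<in>A. f (g i))" for g and A :: "nat set"
    by (induction A rule: infinite_finite_induct) (simp_all add: assms)
  show ?thesis
    by (rule poly_eqI) (simp add: coeff_map_poly assms coeff_mult *)
qed

lemma map_poly_mult_deriv:
  fixes d :: "'a::comm_ring_1 \<Rightarrow> 'a"
  assumes "\<And>x y. d (x + y) = d x + d y" "d 0 = 0" "\<And>x y. d (x * y) = d x * y + x * d y"
  shows "map_poly d (p * q) = map_poly d p * q + p * map_poly d q"
proof -
  have *: "d (sum g A) = (\<Sum>i\<in>A. d (g i))" for g and A :: "nat set"
    by (induction A rule: infinite_finite_induct) (simp_all add: assms)
  show ?thesis
    by (rule poly_eqI) (simp add: coeff_map_poly assms coeff_mult * sum.distrib)
qed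

lemma derivation_typeD:
  fixes d :: "'a::comm_ring_1 \<Rightarrow> 'a"
  assumes "derivation ring_of_type_algebra d"
  shows "d (x + y) = d x + d y" "d (x * y) = d x * y + x * d y" "d 0 = 0" "d 1 = 0"
    "d (- x) = - d x" "d (x - y) = d x - d y"
proof -
  show a: "d (x + y) = d x + d y" for x y
    using assms by (simp add: derivation_def)
  show m: "d (x * y) = d x * y + x * d y" for x y
    using assms by (simp add: derivation_def)
  show z: "d 0 = 0" using a[of 0 0] by simp
  show "d 1 = 0" using m[of 1 1] by simp
  show n: "d (- x) = - d x" for x using a[of x "-x"] z by (simp add: eq_neg_iff_add_eq_0 add.commute)
  show "d (x - y) = d x - d y" using a[of x "-y"] n by simp
qed

primrec dpoly_of_list :: "'a list \<Rightarrow> 'a::zero d_poly" where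
  "dpoly_of_list [] = DConst 0"
| "dpoly_of_list (c # cs) = DAdd (DConst c) (DMult (DVar 0) (dpoly_of_list cs))"

lemma d_eval_dpoly_of_list:
  fixes \<phi> :: "'a::comm_ring_1 \<Rightarrow> 'b::comm_ring_1"
  assumes "\<phi> 0 = 0"
  shows "d_eval (ring_of_type_algebra\<lparr>carrier := S\<rparr>) D \<phi> y (dpoly_of_list cs) =
    poly (map_poly \<phi> (Poly cs)) (y 0)"
  by (induction cs) (simp_all add: assms map_poly_pCons)

text \<open>
  A \<open>\<delta>\<close>-closed field is algebraically closed because a derivation extends to algebraic extensions. Let
  \<open>\<theta>\<close> be a root in the algebraic closure and \<open>P\<close> its minimal polynomial over \<open>C\<close>. Implicit differentiation
  of \<open>P(\<theta>) = 0\<close> dictates \<open>\<delta>(\<theta>)\<close>, so \<open>C(\<theta>) = C[\<theta>]\<close> is a \<open>\<delta>\<close>-extension with a root of the given polynomial.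
\<close>

lemma d_closed_imp_root:
  fixes dC :: "'c::field_char_0 \<Rightarrow> 'c" and p0 :: "'c poly"
  assumes C: "d_closed (ring_of_type_algebra :: 'c ring) dC" and p0: "Polynomial.degree p0 > 0"
  shows "\<exists>x. poly p0 x = 0"
proof -
  have dC: "derivation (ring_of_type_algebra :: 'c ring) dC"
    using C by (simp add: d_closed_def d_field_def)
  note dC = derivation_typeD[OF dC]
  have "Polynomial.degree (map_poly to_ac p0) = Polynomial.degree p0"
    by (rule map_poly_degree_eq) (use p0 in auto)
  then obtain \<theta> where \<theta>: "poly (map_poly to_ac p0) \<theta> = 0"
    using alg_closed_imp_poly_has_root[of "map_poly to_ac p0"] p0 by auto
  \<comment> \<open>Evaluation at the root \<open>\<theta>\<close>; its range is the extension field.\<close>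
  define A where "A = (\<lambda>p. poly (map_poly to_ac p) \<theta>)"
  have A_add: "A (p + q) = A p + A q" for p q
    unfolding A_def by (simp add: map_poly_add_hom)
  have A_mult: "A (p * q) = A p * A q" for p q
    unfolding A_def by (simp add: map_poly_mult_hom)
  have A_const: "A [:c:] = to_ac c" for c
    unfolding A_def by (simp add: map_poly_pCons)
  have A_0: "A 0 = 0" and A_1: "A 1 = 1"
    unfolding A_def by (simp_all)
  have A_minus: "A (- p) = - A p" for p
    using A_add[of p "- p"] A_0 by (simp add: eq_neg_iff_add_eq_0 add.commute)
  define P where "P = arg_min Polynomial.degree (\<lambda>p. p \<noteq> 0 \<and> A p = 0)"
  have "p0 \<noteq> 0 \<and> A p0 = 0" using \<theta> p0 by (auto simp: A_def)
  from arg_min_nat_lemma[of "\<lambda>p. p \<noteq> 0 \<and> A p = 0", OF this, of Polynomial.degree]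
  have P: "P \<noteq> 0" "A P = 0" and P_min: "\<And>q. q \<noteq> 0 \<Longrightarrow> A q = 0 \<Longrightarrow> Polynomial.degree P \<le> Polynomial.degree q"
    unfolding P_def by auto
  have P_dvd: "P dvd q" if "A q = 0" for q
  proof -
    have "A q = A P * A (q div P) + A (q mod P)"
      by (simp flip: A_mult A_add)
    then have "A (q mod P) = 0" using that P by simp
    then have "q mod P = 0"
      using P_min[of "q mod P"] degree_mod_less[OF P(1), of q] by linarith
    then show ?thesis by (simp add: dvd_eq_mod_eq_0)
  qed
  have P_deg: "Polynomial.degree P > 0"
  proof (rule ccontr)
    assume "\<not> ?thesis"
    then obtain c where "P = [:c:]" using degree_eq_zeroE by blast
    then show False using P by (simp add: A_const)
  qed
  have dP: "A (pderiv P) \<noteq> 0"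
    using P_min[of "pderiv P"] P_deg by (auto simp: pderiv_eq_0_iff degree_pderiv)
  \<comment> \<open>The only possible value of \<open>\<delta>(\<theta>)\<close>; then \<open>T p\<close> is the derivative of \<open>p(\<theta>)\<close>.\<close>
  define \<theta>' where "\<theta>' = - A (map_poly dC P) / A (pderiv P)"
  define T where "T = (\<lambda>p. A (map_poly dC p) + A (pderiv p) * \<theta>')"
  have T_add: "T (p + q) = T p + T q" for p q
    unfolding T_def by (simp add: map_poly_add_hom dC A_add pderiv_add algebra_simps)
  have T_mult: "T (p * q) = T p * A q + A p * T q" for p q
    unfolding T_def by (simp add: map_poly_mult_deriv dC A_add A_mult pderiv_mult algebra_simps)
  have T_P: "T P = 0" unfolding T_def \<theta>'_def using dP by simp
  have T_zero: "T q = 0" if "A q = 0" for q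
    using P_dvd[OF that] T_mult T_P P by (auto elim!: dvdE)
  have T_cong: "T p = T q" if "A p = A q" for p q
    using T_zero[of "p + - q"] T_zero[of "- q + q"] that
    by (metis A_add A_minus T_add add.left_inverse add.right_inverse add_diff_cancel_right' A_0 add_left_cancel add.commute)
  \<comment> \<open>Inverses: a generator of the ideal \<open>(f, P)\<close> divides \<open>P\<close>, which has minimal degree, so it is constant.\<close>
  have inv_range: "\<exists>r. A r = inverse (A f)" if Af: "A f \<noteq> 0" for f
  proof -
    define I where "I = {r * f + s * P | r s. True}"
    define g where "g = arg_min Polynomial.degree (\<lambda>g. g \<noteq> 0 \<and> g \<in> I)"
    have "P = 0 * f + 1 * P" by simp
    then have "P \<in> I" unfolding I_def by blast
    then have "P \<noteq> 0 \<and> P \<in> I" using P by simp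
    from arg_min_nat_lemma[of "\<lambda>g. g \<noteq> 0 \<and> g \<in> I", OF this, of Polynomial.degree]
    have g: "g \<noteq> 0" "g \<in> I" and g_min: "\<And>q. q \<noteq> 0 \<Longrightarrow> q \<in> I \<Longrightarrow> Polynomial.degree g \<le> Polynomial.degree q"
      unfolding g_def by auto
    from g(2) obtain r s where rs: "g = r * f + s * P" by (auto simp: I_def)
    have g_dvd: "g dvd h" if h: "h \<in> I" for h
    proof -
      from h obtain r' s' where "h = r' * f + s' * P" by (auto simp: I_def)
      then have "h mod g = (r' - h div g * r) * f + (s' - h div g * s) * P"
        by (simp add: rs minus_div_mult_eq_mod[symmetric] algebra_simps)
      then have "h mod g \<in> I" unfolding I_def by blast
      then have "h mod g = 0" using g_min[of "h mod g"] degree_mod_less[OF g(1), of h] by linarith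
      then show ?thesis by (simp add: dvd_eq_mod_eq_0)
    qed
    have "f = 1 * f + 0 * P" by simp
    then have "f \<in> I" unfolding I_def by blast
    have "A g \<noteq> 0" using g_dvd[OF \<open>f \<in> I\<close>] Af A_mult by (auto elim!: dvdE)
    obtain m where m: "P = g * m" using g_dvd[OF \<open>P \<in> I\<close>] by (auto elim: dvdE)
    then have "A m = 0" "m \<noteq> 0" using P A_mult \<open>A g \<noteq> 0\<close> by auto
    then have "Polynomial.degree g = 0" using P_min[of m] m g(1) by (simp add: degree_mult_eq)
    then obtain c where c: "g = [:c:]" using degree_eq_zeroE by blast
    have "to_ac c = A r * A f"
      using rs c P by (simp add: A_add A_mult flip: A_const)
    moreover have "c \<noteq> 0" using c g by simp
    ultimately have "A ([:inverse c:] * r) = inverse (A f)"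
      unfolding A_mult A_const using Af by (auto simp: field_simps)
    then show ?thesis by blast
  qed
  obtain r where r: "A r = inverse (A (pderiv P))" using inv_range[OF dP] by blast
  have T_range: "T p \<in> range A" for p
  proof -
    have "T p = A (map_poly dC p + pderiv p * (- map_poly dC P * r))"
      unfolding T_def A_add A_mult A_minus r \<theta>'_def by (simp add: field_simps)
    then show ?thesis by simp
  qed
  define L where "L = (ring_of_type_algebra :: 'c alg_closure ring)"
  define E where "E = L\<lparr>carrier := range A\<rparr>"
  define D where "D = (\<lambda>y. T (SOME p. A p = y))"
  have D_A: "D (A p) = T p" for p
    unfolding D_def by (rule T_cong) (rule someI, rule refl)
  interpret L: Ring.field L unfolding L_def by (rule field_from_type_algebra)
  have sub: "subring (range A) L"
    unfolding L_def subring_ring_of_type_algebra_iff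
  proof (intro conjI ballI)
    show "1 \<in> range A" by (metis A_1 rangeI)
  next
    fix x assume "x \<in> range A" then show "- x \<in> range A" by (auto simp flip: A_minus)
  next
    fix x y assume "x \<in> range A" "y \<in> range A"
    then show "x + y \<in> range A" "x * y \<in> range A"
      by (auto simp flip: A_add A_mult)
  qed
  have "subfield (range A) L"
  proof (rule L.subfieldI'[OF sub])
    fix k assume "k \<in> range A - {\<zero>\<^bsub>L\<^esub>}"
    then obtain f where f: "k = A f" "A f \<noteq> 0" by (auto simp: L_def)
    then show "inv\<^bsub>L\<^esub> k \<in> range A"
      using inv_range[OF f(2)] by (auto simp: L_def m_inv_ring_of_type_algebra) (metis rangeI)
  qed
  then have fE: "Ring.field E"
    unfolding E_def by (rule L.subfield_iff(2))
  have derE: "derivation E D"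
    unfolding derivation_def E_def L_def using T_range
    by (auto simp: D_A T_add T_mult simp flip: A_add A_mult)
  have "d_field E D"
    unfolding d_field_def using fE derE
    by (auto simp: E_def L_def add_pow_ring_of_type_algebra)
  moreover have "to_ac \<in> d_hom ring_of_type_algebra dC E D"
  proof -
    have "to_ac c \<in> range A" for c by (metis A_const rangeI)
    moreover have "D (to_ac c) = to_ac (dC c)" for c
      unfolding A_const[symmetric] D_A T_def by (simp add: map_poly_pCons dC A_0 pderiv_pCons)
    ultimately show ?thesis
      by (auto simp: d_hom_def ring_hom_def E_def L_def)
  qed
  moreover have "\<exists>j :: 'c alg_closure \<Rightarrow> 'c. inj_on j (carrier E)"
  proof -
    obtain f :: "'c poly \<Rightarrow> 'c" where f: "inj f" using ex_inj_poly by blast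
    have "inj_on (\<lambda>y. f (SOME p. A p = y)) (range A)"
      by (rule inj_onI) (metis (mono_tags, lifting) f injD rangeE someI)
    then show ?thesis by (auto simp: E_def)
  qed
  moreover have "d_solvable E D to_ac {dpoly_of_list (coeffs p0)}"
  proof -
    have "\<theta> = A [:0, 1:]" unfolding A_def by (simp add: map_poly_pCons)
    then have "\<theta> \<in> range A" by simp
    then show ?thesis
      unfolding d_solvable_def E_def L_def using \<theta>
      by (intro exI[of _ "\<lambda>_. \<theta>"]) (simp add: d_eval_dpoly_of_list)
  qed
  ultimately have "d_solvable ring_of_type_algebra dC id {dpoly_of_list (coeffs p0)}"
    using d_closed_imp_solvable[OF C] by blast
  then show ?thesis
    using d_eval_dpoly_of_list[of id UNIV dC _ "coeffs p0"]
    by (auto simp: d_solvable_def ring_of_type_algebra_def)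
qed

section \<open>The field of algebraic numbers\<close>

lemma eval_ring_of_type_algebra:
  "ring.eval (ring_of_type_algebra :: 'c::field_char_0 ring) p x = poly (Poly (rev p)) x"
proof -
  interpret L: Ring.field "ring_of_type_algebra :: 'c ring" by (rule field_from_type_algebra)
  show ?thesis
    by (induction p) (simp_all add: Poly_snoc poly_monom mult.commute)
qed

text \<open>
  Algebraicity is available both as a statement about polynomials on a type and relative to a subfield of
  a ring structure; the second version has the theory of finite extensions.
\<close>

lemma algebraic_over_iff:
  fixes x :: "'c::field_char_0"
  assumes K: "subfield K (ring_of_type_algebra :: 'c ring)"
  shows "\<not> ring.transcendental ring_of_type_algebra K x \<longleftrightarrow>
    (\<exists>q. (\<forall>i. Polynomial.coeff q i \<in> K) \<and> q \<noteq> 0 \<and> poly q x = 0)"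
proof -
  interpret L: Ring.field "ring_of_type_algebra :: 'c ring" by (rule field_from_type_algebra)
  have K0: "0 \<in> K" using subringE(2)[OF subfieldE(1)[OF K]] by simp
  have "(L.algebraic over K) x \<longleftrightarrow>
    (\<exists>q. (\<forall>i. Polynomial.coeff q i \<in> K) \<and> q \<noteq> 0 \<and> poly q x = 0)"
  proof
    assume "(L.algebraic over K) x"
    then obtain p where p: "p \<in> carrier (K [X]\<^bsub>ring_of_type_algebra\<^esub>)" "p \<noteq> []" "L.eval p x = \<zero>\<^bsub>ring_of_type_algebra\<^esub>"
      using L.algebraicE[OF subfieldE(1)[OF K]] by auto
    then have p': "set p \<subseteq> K" "hd p \<noteq> 0"
      by (auto simp: univ_poly_carrier[symmetric] polynomial_def)
    have "Polynomial.coeff (Poly (rev p)) i \<in> K" for i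
      using p'(1) K0 by (auto simp: coeff_Poly_eq nth_default_def) (metis in_mono nth_mem set_rev length_rev)
    moreover have "Polynomial.coeff (Poly (rev p)) (length p - 1) = hd p"
      using p(2) by (simp add: coeff_Poly_eq nth_default_def rev_nth hd_conv_nth)
    then have "Poly (rev p) \<noteq> 0" using p'(2) by (metis coeff_0)
    moreover have "poly (Poly (rev p)) x = 0"
      using p(3) by (simp add: eval_ring_of_type_algebra)
    ultimately show "\<exists>q. (\<forall>i. Polynomial.coeff q i \<in> K) \<and> q \<noteq> 0 \<and> poly q x = 0" by blast
  next
    assume "\<exists>q. (\<forall>i. Polynomial.coeff q i \<in> K) \<and> q \<noteq> 0 \<and> poly q x = 0"
    then obtain q where q: "\<And>i. Polynomial.coeff q i \<in> K" "q \<noteq> 0" "poly q x = 0" by blast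
    show "(L.algebraic over K) x"
    proof (rule L.algebraicI)
      have "set (coeffs q) \<subseteq> K"
        using q(1) by (auto simp: coeffs_def)
      moreover have "hd (rev (coeffs q)) \<noteq> 0"
        using q(2) by (simp add: hd_rev last_coeffs_eq_coeff_degree)
      ultimately show "rev (coeffs q) \<in> carrier (K [X]\<^bsub>ring_of_type_algebra\<^esub>)"
        by (auto simp: univ_poly_carrier[symmetric] polynomial_def)
      show "rev (coeffs q) \<noteq> []" using q(2) by simp
      show "L.eval (rev (coeffs q)) x = \<zero>\<^bsub>ring_of_type_algebra\<^esub>"
        using q(3) by (simp add: eval_ring_of_type_algebra)
    qed
  qed
  then show ?thesis by (simp add: over_def)
qed

lemma subfield_Rats: "subfield \<rat> (ring_of_type_algebra :: 'c::field_char_0 ring)"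
proof -
  interpret L: Ring.field "ring_of_type_algebra :: 'c ring" by (rule field_from_type_algebra)
  show ?thesis
    by (rule L.subfieldI')
      (auto simp: subring_ring_of_type_algebra_iff m_inv_ring_of_type_algebra)
qed

lemma Qbar_eq: "(Qbar :: 'c::field_char_0 set) = {x. \<not> ring.transcendental ring_of_type_algebra \<rat> x}"
  by (simp add: algebraic_over_iff[OF subfield_Rats] algebraic_altdef)

lemma subfield_Qbar: "subfield Qbar (ring_of_type_algebra :: 'c::field_char_0 ring)"
proof -
  interpret L: Ring.field "ring_of_type_algebra :: 'c ring" by (rule field_from_type_algebra)
  show ?thesis
    using L.subfield_of_algebraics[OF subfield_Rats] by (simp add: Qbar_eq over_def)
qed

lemma Qbar_closed:
  fixes x y :: "'c::field_char_0"
  assumes "algebraic x" "algebraic y"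
  shows "algebraic (x + y)" "algebraic (x - y)" "algebraic (x * y)" "algebraic (x / y)"
proof -
  interpret L: Ring.field "ring_of_type_algebra :: 'c ring" by (rule field_from_type_algebra)
  have s: "subring Qbar (ring_of_type_algebra :: 'c ring)"
    by (rule subfieldE(1)[OF subfield_Qbar])
  have *: "algebraic (x + y)" "algebraic (x * y)" if "algebraic x" "algebraic y" for x y :: 'c
    using s that by (auto simp: subring_ring_of_type_algebra_iff)
  show "algebraic (x + y)" "algebraic (x * y)" using * assms by auto
  show "algebraic (x - y)" using *(1)[of x "-y"] assms by simp
  show "algebraic (x / y)"
    using *(2)[of x "inverse y"] assms by (auto simp: divide_inverse algebraic_inverse)
qed

lemma Qbar_of_int: "algebraic (of_int n :: 'c::field_char_0)"
  by (rule algebraicI[of "[:- of_int n, 1:]"]) (auto simp: coeff_pCons split: nat.splits)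

text \<open>
  Algebraic over algebraic is algebraic: the coefficients generate a finite extension of the rationals.
\<close>

lemma root_of_Qbar_poly:
  fixes p :: "'c::field_char_0 poly"
  assumes p: "\<And>i. algebraic (Polynomial.coeff p i)" "p \<noteq> 0" "poly p x = 0"
  shows "algebraic x"
proof -
  define L where "L = (ring_of_type_algebra :: 'c ring)"
  interpret L: Ring.field L unfolding L_def by (rule field_from_type_algebra)
  define F where "F = L.finite_extension \<rat> (coeffs p)"
  note Q = subfield_Rats[where 'c = 'c, folded L_def]
  have alg: "(L.algebraic over \<rat>) c" if "c \<in> set (coeffs p)" for c
  proof -
    have "c \<in> range (Polynomial.coeff p)" using that by (auto simp: coeffs_def split: if_splits)
    then have "algebraic c" using p(1) by auto
    then show ?thesis using Qbar_eq[where 'c = 'c] by (auto simp: over_def L_def)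
  qed
  have set: "set (coeffs p) \<subseteq> carrier L" by (simp add: L_def)
  have F: "subfield F L" "L.finite_dimension \<rat> F"
    unfolding F_def using L.finite_extension_is_subfield[OF Q set] L.finite_extension_finite_dimension(1)[OF Q set] alg
    by auto
  have mem: "set (coeffs p) \<subseteq> F"
    unfolding F_def using L.finite_extension_mem[OF subfieldE(1)[OF Q] set] .
  have F0: "0 \<in> F" using subringE(2)[OF subfieldE(1)[OF F(1)]] by (simp add: L_def)
  have "Polynomial.coeff p i \<in> F" for i
    using mem F0 coeff_in_coeffs[OF p(2), of i] by (cases "i \<le> Polynomial.degree p") (auto simp: coeff_eq_0)
  then have "(L.algebraic over F) x"
    using algebraic_over_iff[OF F(1)[unfolded L_def], of x] p by (auto simp: over_def L_def)
  then have "L.finite_dimension F (L.simple_extension F x)"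
    using L.finite_dimension_simple_extension[OF F(1)] by (simp add: L_def)
  then have "L.finite_dimension \<rat> (L.simple_extension F x)"
    by (rule L.telescopic_base_dim(1)[OF Q F])
  moreover have "subring (L.simple_extension F x) L"
    by (rule L.simple_extension_is_subring[OF subfieldE(1)[OF F(1)]]) (simp add: L_def)
  moreover have "x \<in> L.simple_extension F x"
    by (rule L.simple_extension_mem[OF subfieldE(1)[OF F(1)]]) (simp add: L_def)
  ultimately have "(L.algebraic over \<rat>) x"
    using L.finite_dimension_imp_algebraic[OF Q] by blast
  then show ?thesis using Qbar_eq[where 'c = 'c] by (auto simp: over_def L_def)
qed

text \<open>
  Differentiating an equation \<open>P(x) = 0\<close> of minimal degree over the integers gives \<open>P'(x) \<delta>(x) = 0\<close> with
  \<open>P'(x) \<noteq> 0\<close>.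
\<close>

lemma derivation_Qbar:
  fixes d :: "'c::field_char_0 \<Rightarrow> 'c"
  assumes d: "derivation ring_of_type_algebra d" and x: "algebraic x"
  shows "d x = 0"
proof -
  note d = derivation_typeD[OF d]
  have d_nat: "d (of_nat n) = 0" for n by (induction n) (simp_all add: d)
  have d_int: "d (of_int n) = 0" for n
    by (cases n rule: int_cases2) (simp_all add: d d_nat)
  define P where "P = arg_min Polynomial.degree (\<lambda>p. (\<forall>i. Polynomial.coeff p i \<in> \<int>) \<and> p \<noteq> 0 \<and> poly p x = 0)"
  from x obtain p where "(\<forall>i. Polynomial.coeff p i \<in> \<int>) \<and> p \<noteq> 0 \<and> poly p x = 0"
    by (auto simp: algebraic_def)
  from arg_min_nat_lemma[of "\<lambda>p. (\<forall>i. Polynomial.coeff p i \<in> \<int>) \<and> p \<noteq> 0 \<and> poly p x = 0", OF this, of Polynomial.degree]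
  have P: "\<And>i. Polynomial.coeff P i \<in> \<int>" "P \<noteq> 0" "poly P x = 0"
    and min: "\<And>q. (\<forall>i. Polynomial.coeff q i \<in> \<int>) \<Longrightarrow> q \<noteq> 0 \<Longrightarrow> poly q x = 0 \<Longrightarrow> Polynomial.degree P \<le> Polynomial.degree q"
    unfolding P_def by blast+
  have deg: "Polynomial.degree P \<noteq> 0"
  proof
    assume "Polynomial.degree P = 0"
    then obtain c where "P = [:c:]" by (rule degree_eq_zeroE)
    then show False using P by simp
  qed
  have "pderiv P \<noteq> 0" using deg by (simp add: pderiv_eq_0_iff)
  moreover have "Polynomial.coeff (pderiv P) i \<in> \<int>" for i
    using P(1) by (simp add: coeff_pderiv)
  ultimately have nz: "poly (pderiv P) x \<noteq> 0"
    using min[of "pderiv P"] deg by (auto simp: degree_pderiv)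
  have "d (poly q x) = poly (map_poly d q) x + poly (pderiv q) x * d x" for q
    by (induction q) (simp_all add: map_poly_pCons d pderiv_pCons algebra_simps)
  moreover have "map_poly d P = 0"
    using P(1) d_int by (intro poly_eqI) (metis Ints_cases coeff_0 coeff_map_poly d(3))
  ultimately have "poly (pderiv P) x * d x = 0" using P(3) d(3) by (metis add_0 poly_0)
  then show ?thesis using nz by simp
qed

section \<open>Rational functions with algebraic coefficients\<close>

definition qpoly :: "'c::field_char_0 poly \<Rightarrow> bool" where
  "qpoly p \<longleftrightarrow> (\<forall>i. Polynomial.coeff p i \<in> Qbar)"

lemma Qbar_sum: "(\<And>i. i \<in> A \<Longrightarrow> algebraic (f i)) \<Longrightarrow> algebraic (\<Sum>i\<in>A. f i :: 'c::field_char_0)"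
  by (induction A rule: infinite_finite_induct) (simp_all add: Qbar_closed)

lemma qpoly_0 [simp]: "qpoly 0" by (simp add: qpoly_def)

lemma qpoly_pCons [simp]: "qpoly (pCons c p) \<longleftrightarrow> algebraic c \<and> qpoly p"
  unfolding qpoly_def by (auto simp: coeff_pCons split: nat.splits)

lemma qpoly_1 [simp]: "qpoly 1" by (simp add: one_pCons)

lemma qpoly_add [intro]: "qpoly p \<Longrightarrow> qpoly q \<Longrightarrow> qpoly (p + q)"
  by (simp add: qpoly_def Qbar_closed)

lemma qpoly_diff [intro]: "qpoly p \<Longrightarrow> qpoly q \<Longrightarrow> qpoly (p - q)"
  by (simp add: qpoly_def Qbar_closed)

lemma qpoly_uminus [intro]: "qpoly p \<Longrightarrow> qpoly (- p)"
  by (simp add: qpoly_def)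

lemma qpoly_mult [intro]: "qpoly p \<Longrightarrow> qpoly q \<Longrightarrow> qpoly (p * q)"
  by (simp add: qpoly_def Qbar_closed coeff_mult Qbar_sum)

lemma qpoly_smult [intro]: "algebraic c \<Longrightarrow> qpoly q \<Longrightarrow> qpoly (Polynomial.smult c q)"
  by (simp add: qpoly_def Qbar_closed)

lemma qpoly_monom [intro]: "algebraic c \<Longrightarrow> qpoly (Polynomial.monom c n)"
  by (simp add: qpoly_def)

lemma Qbar_of_nat [simp]: "algebraic (of_nat n :: 'c::field_char_0)"
  using Qbar_of_int[of "int n"] by simp

lemma qpoly_pderiv [intro]: "qpoly p \<Longrightarrow> qpoly (pderiv p)"
  using Qbar_of_nat[of "Suc n" for n] by (simp add: qpoly_def coeff_pderiv Qbar_closed del: of_nat_Suc)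

lemma qpoly_pcompose [intro]: "qpoly p \<Longrightarrow> qpoly q \<Longrightarrow> qpoly (pcompose p q)"
  by (induction p) (auto simp: pcompose_pCons)

lemma qpoly_poly: "qpoly p \<Longrightarrow> algebraic a \<Longrightarrow> algebraic (poly p a)"
  by (induction p) (auto simp: Qbar_closed)

lemma qpoly_synthetic_div: "qpoly p \<Longrightarrow> algebraic a \<Longrightarrow> qpoly (synthetic_div p a)"
  by (induction p) (auto simp: qpoly_poly)

lemma const_hom:
  fixes c d :: "'c::field_char_0"
  shows "const (c + d) = const c + const d" "const (c * d) = const c * const d"
    "const (c - d) = const c - const d" "const (- c) = - const c" "const (1 :: 'c) = 1" "const (0 :: 'c) = 0"
    "const (c / d) = const c / const d" "const (of_nat n :: 'c) = of_nat n"
proof -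
  show a: "const (c + d) = const c + const d" for c d :: 'c by (simp flip: to_fract_add)
  show m: "const (c * d) = const c * const d" for c d :: 'c by (simp flip: to_fract_mult)
  show "const (c - d) = const c - const d" "const (- c) = - const c"
    by (simp_all flip: to_fract_diff to_fract_uminus)
  show o: "const 1 = (1 :: 'c poly fract)" by (simp flip: one_pCons)
  show z: "const 0 = (0 :: 'c poly fract)" by simp
  show "const (of_nat n) = (of_nat n :: 'c poly fract)"
    by (induction n) (simp_all only: of_nat_Suc of_nat_0 a o z)
  show "const (c / d) = const c / const d"
  proof (cases "d = 0")
    case False
    then have "const (c / d) * const d = const c" by (simp flip: m)
    then show ?thesis using False by (simp add: nonzero_eq_divide_eq)
  qed simp
qed

lemma to_fract_smult: "to_fract (Polynomial.smult c p) = const c * to_fract (p :: 'c::field_char_0 poly)"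
  by (simp flip: to_fract_mult)

lemma Qbar_x_iff:
  "f \<in> Qbar_x \<longleftrightarrow> (\<exists>p q. qpoly p \<and> qpoly q \<and> q \<noteq> 0 \<and> f = to_fract p / to_fract q)"
  by (auto simp: Qbar_x_def qpoly_def Fract_conv_to_fract)

lemma Qbar_xI: "qpoly p \<Longrightarrow> qpoly q \<Longrightarrow> q \<noteq> 0 \<Longrightarrow> to_fract p / to_fract q \<in> Qbar_x"
  by (auto simp: Qbar_x_iff)

lemma Qbar_x_to_fract [intro]: "qpoly p \<Longrightarrow> to_fract p \<in> Qbar_x"
  using Qbar_xI[of p 1] by simp

lemma Qbar_x_closed:
  assumes "f \<in> Qbar_x" "g \<in> Qbar_x"
  shows "f + g \<in> Qbar_x" "f * g \<in> Qbar_x" "f - g \<in> Qbar_x" "f / g \<in> Qbar_x" "- f \<in> Qbar_x"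
proof -
  from assms obtain p q p' q' where *: "qpoly p" "qpoly q" "q \<noteq> 0" "f = to_fract p / to_fract q"
     "qpoly p'" "qpoly q'" "q' \<noteq> 0" "g = to_fract p' / to_fract q'"
    unfolding Qbar_x_iff by blast
  have "f + g = to_fract (p * q' + p' * q) / to_fract (q * q')"
    unfolding *(4) *(8) using *(3,7) by (simp add: field_simps)
  then show "f + g \<in> Qbar_x" using * by (auto intro!: Qbar_xI simp del: to_fract_add to_fract_mult)
  have "f - g = to_fract (p * q' - p' * q) / to_fract (q * q')"
    unfolding *(4) *(8) using *(3,7) by (simp add: field_simps)
  then show "f - g \<in> Qbar_x" using * by (auto intro!: Qbar_xI simp del: to_fract_diff to_fract_mult)
  have "f * g = to_fract (p * p') / to_fract (q * q')"
    unfolding *(4) *(8) using *(3,7) by (simp add: field_simps)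
  then show "f * g \<in> Qbar_x" using * by (auto intro!: Qbar_xI simp del: to_fract_mult)
  have "- f = to_fract (- p) / to_fract q"
    unfolding *(4) *(8) using *(3,7) by (simp add: field_simps)
  then show "- f \<in> Qbar_x" using * by (auto intro!: Qbar_xI simp del: to_fract_diff to_fract_uminus)
  show "f / g \<in> Qbar_x"
  proof (cases "p' = 0")
    case True
    then show ?thesis using * Qbar_x_to_fract[of 0] by simp
  next
    case False
    have "f / g = to_fract (p * q') / to_fract (q * p')"
      unfolding *(4) *(8) using *(3,7) False by (simp add: field_simps)
    then show ?thesis using * False by (auto intro!: Qbar_xI simp del: to_fract_mult)
  qed
qed

lemma Qbar_x_sum: "(\<And>i. i \<in> A \<Longrightarrow> f i \<in> Qbar_x) \<Longrightarrow> sum f A \<in> Qbar_x"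
  using Qbar_x_to_fract[OF qpoly_0] by (induction A rule: infinite_finite_induct) (auto intro: Qbar_x_closed)

section \<open>Laurent expansions\<close>

definition laurent_poly :: "'c::field_char_0 \<Rightarrow> 'c poly \<Rightarrow> 'c fls" where
  "laurent_poly a p = fps_to_fls (fps_of_poly (pcompose p [:a, 1:]))"

definition laurent :: "'c::field_char_0 \<Rightarrow> 'c poly fract \<Rightarrow> 'c fls" where
  "laurent a f = (SOME F. \<exists>p q. q \<noteq> 0 \<and> f = to_fract p / to_fract q \<and>
     F = laurent_poly a p / laurent_poly a q)"

lemma laurent_poly_simps [simp]:
  "laurent_poly a (p + q) = laurent_poly a p + laurent_poly a q"
  "laurent_poly a (p * q) = laurent_poly a p * laurent_poly a q"
  "laurent_poly a 0 = 0" "laurent_poly a 1 = 1"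
  "laurent_poly a [:c:] = fls_const c"
  by (simp_all add: laurent_poly_def pcompose_add pcompose_mult fps_of_poly_add fps_of_poly_mult
      fls_times_fps_to_fls pcompose_1 fps_of_poly_const fps_const_to_fls)

lemma laurent_poly_eq_0_iff [simp]: "laurent_poly a p = 0 \<longleftrightarrow> p = 0"
  using fps_of_poly_eq_iff[of "pcompose p [:a, 1:]" 0] pcompose_eq_0[of p "[:a, 1:]"]
  by (auto simp: laurent_poly_def)

lemma laurent_poly_pderiv: "laurent_poly a (pderiv p) = fls_deriv (laurent_poly a p)"
proof -
  have "pcompose (pderiv p) [:a, 1:] = pderiv (pcompose p [:a, 1:])"
    by (simp add: pderiv_pcompose pderiv_pCons)
  then show ?thesis
    by (simp add: laurent_poly_def fps_of_poly_pderiv fls_deriv_fps_to_fls)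
qed

lemma laurent_quot:
  assumes "q \<noteq> 0"
  shows "laurent a (to_fract p / to_fract q) = laurent_poly a p / laurent_poly a q"
  unfolding laurent_def
proof (rule some_equality)
  show "\<exists>p' q'. q' \<noteq> 0 \<and> to_fract p / to_fract q = to_fract p' / to_fract q' \<and>
      laurent_poly a p / laurent_poly a q = laurent_poly a p' / laurent_poly a q'"
    using assms by blast
next
  fix F assume "\<exists>p' q'. q' \<noteq> 0 \<and> to_fract p / to_fract q = to_fract p' / to_fract q' \<and>
      F = laurent_poly a p' / laurent_poly a q'"
  then obtain p' q' where *: "q' \<noteq> 0" "to_fract p / to_fract q = to_fract p' / to_fract q'"
    "F = laurent_poly a p' / laurent_poly a q'" by blast
  have "to_fract (p * q') = to_fract (p' * q)"
    using * assms by (simp add: field_simps)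
  then have "p * q' = p' * q" by (simp del: to_fract_mult)
  then have "laurent_poly a p * laurent_poly a q' = laurent_poly a p' * laurent_poly a q"
    by (metis laurent_poly_simps(2))
  then show "F = laurent_poly a p / laurent_poly a q"
    unfolding *(3) using *(1) assms by (simp add: field_simps)
qed

lemma fract_poly_cases [case_names quot]:
  obtains p q where "q \<noteq> 0" "(f :: 'c::field poly fract) = to_fract p / to_fract q"
  by (metis Fract_cases_nonzero Fract_conv_to_fract div_0 to_fract_0 zero_neq_one)

lemma laurent_to_fract [simp]: "laurent a (to_fract p) = laurent_poly a p"
  using laurent_quot[of 1 a p] by simp

lemma laurent_add [simp]: "laurent a (f + g) = laurent a f + laurent a g"
proof -
  obtain p q where f: "q \<noteq> 0" "f = to_fract p / to_fract q" by (rule fract_poly_cases)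
  obtain p' q' where g: "q' \<noteq> 0" "g = to_fract p' / to_fract q'" by (rule fract_poly_cases)
  have "f + g = to_fract (p * q' + p' * q) / to_fract (q * q')"
    unfolding f(2) g(2) using f(1) g(1) by (simp add: field_simps)
  also have "laurent a \<dots> = laurent a f + laurent a g"
    unfolding f(2) g(2) using f(1) g(1) by (simp add: laurent_quot field_simps del: to_fract_add to_fract_mult)
  finally show ?thesis .
qed

lemma laurent_mult [simp]: "laurent a (f * g) = laurent a f * laurent a g"
proof -
  obtain p q where f: "q \<noteq> 0" "f = to_fract p / to_fract q" by (rule fract_poly_cases)
  obtain p' q' where g: "q' \<noteq> 0" "g = to_fract p' / to_fract q'" by (rule fract_poly_cases)
  have "f * g = to_fract (p * p') / to_fract (q * q')"
    unfolding f(2) g(2) using f(1) g(1) by (simp add: field_simps)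
  also have "laurent a \<dots> = laurent a f * laurent a g"
    unfolding f(2) g(2) using f(1) g(1) by (simp add: laurent_quot field_simps del: to_fract_add to_fract_mult)
  finally show ?thesis .
qed

lemma laurent_regular:
  assumes "poly q b \<noteq> 0" "f = to_fract p / to_fract q"
  shows "fls_subdegree (laurent b f) \<ge> 0"
proof (cases "p = 0")
  case False
  have q: "q \<noteq> 0" using assms by auto
  have "fps_nth (fps_of_poly (pcompose q [:b, 1:])) 0 \<noteq> 0"
    using assms(1) by (simp add: poly_0_coeff_0[symmetric] poly_pcompose)
  then have "fls_subdegree (laurent_poly b q) = 0"
    unfolding laurent_poly_def by (intro fls_subdegree_eqI) auto
  moreover have "fls_subdegree (laurent_poly b p) \<ge> 0"
    unfolding laurent_poly_def by (rule fls_subdegree_fls_to_fps_gt0)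
  ultimately show ?thesis
    using False q unfolding assms(2) laurent_quot[OF q] by (simp add: fls_divide_subdegree)
qed (use assms laurent_to_fract[of b 0] in simp)

section \<open>Polar parts along orbits of the shift\<close>

text \<open>
  The polar part \<open>\<Sum>\<^sub>n c\<^sub>n (x - a)\<^sup>-\<^sup>n\<^sup>-\<^sup>1\<close> is recorded as the polynomial with coefficients
  \<open>(-1)\<^sup>n c\<^sub>n / n!\<close>, that is, as the constant-coefficient operator in \<open>d/dx\<close> which produces it from
  \<open>1/(x - a)\<close>. With this normalisation differentiation becomes multiplication by the indeterminate.
\<close>

definition polar :: "'c::field_char_0 fls \<Rightarrow> 'c poly" where
  "polar F = Abs_poly (\<lambda>n. (-1) ^ n / fact n * fls_nth F (- 1 - int n))"

lemma coeff_polar: "Polynomial.coeff (polar F) n = (-1) ^ n / fact n * fls_nth F (- 1 - int n)"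
  unfolding polar_def
  by (subst coeff_Abs_poly[of "nat (- fls_subdegree F)"]) (auto intro!: fls_eq0_below_subdegree)

lemma polar_add: "polar (F + G) = polar F + polar G"
  by (rule poly_eqI) (simp add: coeff_polar algebra_simps)

lemma polar_const_mult: "polar (fls_const c * F) = [:c:] * polar F"
  by (rule poly_eqI) (simp add: coeff_polar)

lemma polar_deriv: fixes F :: "'a::field_char_0 fls" shows "polar (fls_deriv F) = [:0, 1:] * polar F"
proof (rule poly_eqI)
  fix n
  show "Polynomial.coeff (polar (fls_deriv F)) n = Polynomial.coeff ([:0, 1:] * polar F) n"
  proof (cases n)
    case (Suc m)
    have "- 1 - int (Suc m) + 1 = - 1 - int m" by simp
    moreover have "(of_int (- 1 - int m) :: 'a) = - of_nat (Suc m)" by simp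
    ultimately show ?thesis using Suc
      by (simp add: coeff_polar coeff_pCons del: of_nat_Suc of_int_diff)
        (rule arg_cong[where f = "fls_nth F"], simp)
  qed (simp add: coeff_polar)
qed

lemma polar_regular: "fls_subdegree F \<ge> 0 \<Longrightarrow> polar F = 0"
  by (rule poly_eqI) (auto simp: coeff_polar intro!: fls_eq0_below_subdegree)

text \<open>
  The shift permutes the points of an orbit \<open>a + \<int>\<close>, so the sum of the polar parts over the orbit is the
  same for \<open>f\<close> and \<open>\<sigma>(f)\<close> and vanishes on \<open>\<sigma>(g) - g\<close>. These sums are the discrete residues that decide
  summability. Only finitely many terms of the sum are nonzero.
\<close>

definition orbit_polar :: "'c::field_char_0 \<Rightarrow> 'c poly fract \<Rightarrow> 'c poly" where
  "orbit_polar a f = Sum_any (\<lambda>j::int. polar (laurent (a + of_int j) f))"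

lemma finite_orbit_polar: "finite {j::int. polar (laurent (a + of_int j) f) \<noteq> 0}"
proof -
  obtain p q where f: "q \<noteq> 0" "f = to_fract p / to_fract q" by (rule fract_poly_cases)
  have "{j::int. polar (laurent (a + of_int j) f) \<noteq> 0} \<subseteq> (\<lambda>j. a + of_int j) -` {x. poly q x = 0}"
    using laurent_regular[OF _ f(2)] polar_regular by blast
  moreover have "finite \<dots>"
    by (rule finite_vimageI) (auto simp: poly_roots_finite[OF f(1)] intro: injI)
  ultimately show ?thesis by (rule finite_subset)
qed

lemma orbit_polar_add: "orbit_polar a (f + g) = orbit_polar a f + orbit_polar a g"
  unfolding orbit_polar_def laurent_add polar_add
  by (rule Sum_any.distrib; rule finite_orbit_polar)

lemma orbit_polar_const_mult: "orbit_polar a (const c * f) = [:c:] * orbit_polar a f"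
  unfolding orbit_polar_def laurent_mult laurent_to_fract laurent_poly_simps polar_const_mult
  by (rule Sum_any_right_distrib[symmetric], rule finite_orbit_polar)

lemma orbit_polar_uminus: fixes a :: "'a::field_char_0" shows "orbit_polar a (- f) = - orbit_polar a f"
proof -
  have "[:- 1:] = (- 1 :: 'a poly)" by (simp add: one_pCons)
  then show ?thesis using orbit_polar_const_mult[of a "-1" f] by simp
qed

lemma orbit_polar_diff: "orbit_polar a (f - g) = orbit_polar a f - orbit_polar a g"
  using orbit_polar_add[of a f "- g"] by (simp add: orbit_polar_uminus)

lemma orbit_polar_0: "orbit_polar a 0 = 0"
  using orbit_polar_diff[of a 0 0] by simp

lemma orbit_polar_sum: "orbit_polar a (sum f A) = (\<Sum>i\<in>A. orbit_polar a (f i))"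
  by (induction A rule: infinite_finite_induct) (simp_all add: orbit_polar_0 orbit_polar_add)

lemma orbit_polar_poly: "orbit_polar a (to_fract p) = 0"
proof -
  have "polar (laurent (a + of_int j) (to_fract p)) = 0" for j
    by (rule polar_regular, rule laurent_regular[of 1 _ _ p]) simp_all
  then show ?thesis by (simp add: orbit_polar_def)
qed

definition simple_pole :: "'c::field_char_0 \<Rightarrow> 'c poly fract" where
  "simple_pole b = 1 / to_fract [:- b, 1:]"

lemma orbit_polar_simple_pole:
  fixes a b :: "'c::field_char_0"
  shows
  "orbit_polar a (simple_pole b) = (if \<exists>j::int. b = a + of_int j then 1 else 0)"
proof -
  have lin: "laurent_poly b [:- b, 1:] = fls_X" for b :: 'c
    by (simp add: laurent_poly_def pcompose_pCons fps_of_poly_linear)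
  have 1: "polar (laurent b (simple_pole b)) = 1"
  proof -
    have "laurent b (simple_pole b) = fls_X_inv"
      unfolding simple_pole_def using laurent_quot[of "[:-b, 1:]" b 1] lin[of b]
      by (simp add: fls_inverse_X divide_inverse)
    then show ?thesis
      by (intro poly_eqI) (auto simp: coeff_polar coeff_1 fls_X_inv_nth)
  qed
  have 0: "polar (laurent c (simple_pole b)) = 0" if "c \<noteq> b" for c
    by (rule polar_regular, rule laurent_regular[of "[:-b, 1:]" _ _ 1])
      (use that in \<open>simp_all add: simple_pole_def\<close>)
  show ?thesis
  proof (cases "\<exists>j::int. b = a + of_int j")
    case True
    then obtain j :: int where j: "b = a + of_int j" by blast
    have "(\<lambda>i::int. polar (laurent (a + of_int i) (simple_pole b))) = (\<lambda>i. if i = j then 1 else 0)"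
      using 0 1 j by auto
    then have "orbit_polar a (simple_pole b) = Sum_any (\<lambda>i. if i = j then 1 else 0)"
      by (simp only: orbit_polar_def)
    then show ?thesis using True by simp
  next
    case False
    then have "polar (laurent (a + of_int j) (simple_pole b)) = 0" for j :: int
      by (intro 0) auto
    then show ?thesis using False by (simp add: orbit_polar_def)
  qed
qed

section \<open>The shift field\<close>

locale shift_field =
  fixes dC :: "'c::field_char_0 \<Rightarrow> 'c" and sK dK :: "'c poly fract \<Rightarrow> 'c poly fract"
  assumes shift: "shift_base_field dC sK dK"
    and der_dC: "derivation ring_of_type_algebra dC"
    and root: "\<And>p :: 'c poly. Polynomial.degree p > 0 \<Longrightarrow> \<exists>x. poly p x = 0"
begin

lemma der_dK: "derivation ring_of_type_algebra dK"
  using shift by (simp add: shift_base_field_def sd_ring_def)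

lemmas dK = derivation_typeD[OF der_dK]
lemmas dC = derivation_typeD[OF der_dC]

lemma dC_Qbar: "algebraic c \<Longrightarrow> dC c = 0"
  by (rule derivation_Qbar[OF der_dC])

lemma sK_hom: "sK (f + g) = sK f + sK g" "sK (f * g) = sK f * sK g" "sK 1 = 1"
  and bij_sK: "bij sK" and sK_dK: "sK (dK f) = dK (sK f)"
  using shift by (auto simp: shift_base_field_def sd_ring_def ring_iso_def ring_hom_def)

lemma sK_0: "sK 0 = 0" using sK_hom(1)[of 0 0] by (metis add.right_neutral add_left_cancel)

lemma sK_uminus: "sK (- f) = - sK f"
  using sK_hom(1)[of f "- f"] by (simp add: sK_0 eq_neg_iff_add_eq_0 add.commute)

lemma sK_eq_0_iff [simp]: "sK f = 0 \<longleftrightarrow> f = 0"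
  using bij_sK sK_0 by (metis bij_def injD)

lemma sK_divide: "sK (f / g) = sK f / sK g"
proof (cases "g = 0")
  case False
  then have "sK (f / g) * sK g = sK f" by (simp flip: sK_hom)
  then show ?thesis using False by (simp add: field_simps)
qed (simp add: sK_0)

lemma sK_const [simp]: "sK (const c) = const c"
  and dK_const [simp]: "dK (const c) = const (dC c)"
  and sK_x: "sK (to_fract [:0, 1:]) = to_fract [:1, 1:]"
  and dK_x: "dK (to_fract [:0, 1:]) = 1"
proof -
  show "sK (const c) = const c" "dK (const c) = const (dC c)" "dK (to_fract [:0, 1:]) = 1"
    using shift by (auto simp: shift_base_field_def)
  have "to_fract [:0, 1:] + 1 = to_fract ([:0, 1:] + 1 :: 'c poly)" by (simp only: to_fract_add to_fract_1)
  also have "[:0, 1:] + 1 = ([:1, 1:] :: 'c poly)" by (simp add: one_pCons)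
  finally show "sK (to_fract [:0, 1:]) = to_fract [:1, 1:]"
    using shift by (auto simp: shift_base_field_def)
qed

lemma to_fract_pCons: "to_fract (pCons c p) = const c + to_fract [:0, 1:] * to_fract (p :: 'c poly)"
proof -
  have "pCons c p = [:c:] + [:0, 1:] * p" by simp
  then show ?thesis by (simp only: to_fract_add to_fract_mult)
qed

lemma sK_to_fract: "sK (to_fract p) = to_fract (pcompose p [:1, 1:])"
proof (induction p)
  case (pCons c p)
  show ?case
    by (subst to_fract_pCons) (simp only: sK_hom sK_const sK_x pCons pcompose_pCons to_fract_add to_fract_mult)
qed (simp add: sK_0)

text \<open>
  Restricted to algebraic coefficients, \<open>\<delta>\<close> is differentiation with respect to \<open>x\<close>; on \<open>C(x)\<close> it also
  differentiates the coefficients.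
\<close>

lemma dK_to_fract: "qpoly p \<Longrightarrow> dK (to_fract p) = to_fract (pderiv p)"
proof (induction p)
  case (pCons c p)
  have "dK (to_fract (pCons c p)) = to_fract p + to_fract [:0, 1:] * to_fract (pderiv p)"
    using pCons by (subst to_fract_pCons) (simp add: dK dK_x dC_Qbar)
  also have "\<dots> = to_fract (pderiv (pCons c p))"
    unfolding pderiv_pCons to_fract_add to_fract_pCons[of 0 "pderiv p"] by simp
  finally show ?case .
qed (simp add: dK)

lemma dK_divide: "g \<noteq> 0 \<Longrightarrow> dK (f / g) = (dK f * g - f * dK g) / (g * g)"
proof -
  assume g: "g \<noteq> 0"
  have "dK f = dK (f / g * g)" using g by simp
  also have "\<dots> = dK (f / g) * g + f / g * dK g" by (simp only: dK)
  finally show ?thesis using g by (simp add: field_simps)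
qed

lemma Qbar_x_dK [intro]: "f \<in> Qbar_x \<Longrightarrow> dK f \<in> Qbar_x"
proof -
  assume "f \<in> Qbar_x"
  then obtain p q where *: "qpoly p" "qpoly q" "q \<noteq> 0" "f = to_fract p / to_fract q"
    unfolding Qbar_x_iff by blast
  then show ?thesis
    by (auto simp: dK_divide dK_to_fract intro!: Qbar_x_closed Qbar_x_to_fract)
qed

lemma Qbar_x_dK_pow [intro]: "f \<in> Qbar_x \<Longrightarrow> (dK ^^ n) f \<in> Qbar_x"
  by (induction n) auto

lemma Qbar_x_lin [intro]: "f \<in> Qbar_x \<Longrightarrow> qpoly M \<Longrightarrow> lin_d_eval const dK M f \<in> Qbar_x"
  unfolding lin_d_eval_def
  by (intro Qbar_x_sum Qbar_x_closed Qbar_x_to_fract Qbar_x_dK_pow) (auto simp: qpoly_def coeff_pCons split: nat.splits)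

lemma laurent_sK: "laurent a (sK f) = laurent (a + 1) f"
proof -
  obtain p q where f: "q \<noteq> 0" "f = to_fract p / to_fract q" by (rule fract_poly_cases)
  have *: "laurent_poly a (pcompose p [:1, 1:]) = laurent_poly (a + 1) p" for p
    unfolding laurent_poly_def pcompose_assoc[symmetric] by (simp add: pcompose_pCons add.commute)
  have "pcompose q [:1, 1:] \<noteq> 0" using f(1) pcompose_eq_0[of q "[:1, 1:]"] by auto
  then show ?thesis
    using f by (simp add: sK_divide sK_to_fract laurent_quot *)
qed

lemma orbit_polar_sK: "orbit_polar a (sK f) = orbit_polar a f"
  unfolding orbit_polar_def
proof (rule Sum_any.reindex_cong[symmetric])
  show "bij (\<lambda>j::int. j + 1)" by (rule bij_betw_byWitness[of _ "\<lambda>j. j - 1"]) auto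
  show "(\<lambda>j. polar (laurent (a + of_int j) f)) \<circ> (\<lambda>j. j + 1) =
      (\<lambda>j. polar (laurent (a + of_int j) (sK f)))"
    by (simp add: fun_eq_iff laurent_sK add.assoc)
qed

lemma laurent_dK:
  assumes "f \<in> Qbar_x"
  shows "laurent a (dK f) = fls_deriv (laurent a f)"
proof -
  from assms obtain p q where *: "qpoly p" "qpoly q" "q \<noteq> 0" "f = to_fract p / to_fract q"
    unfolding Qbar_x_iff by blast
  have f: "f * to_fract q = to_fract p" using * by simp
  then have "dK f * to_fract q + f * dK (to_fract q) = dK (to_fract p)"
    by (metis dK(2))
  then have "dK f * to_fract q + f * to_fract (pderiv q) = to_fract (pderiv p)"
    using * by (simp add: dK_to_fract)
  from arg_cong[OF this, of "laurent a"]
  have 1: "laurent a (dK f) * laurent_poly a q + laurent a f * fls_deriv (laurent_poly a q)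
      = fls_deriv (laurent_poly a p)"
    by (simp add: laurent_poly_pderiv)
  from arg_cong[OF f, of "\<lambda>f. fls_deriv (laurent a f)"]
  have "fls_deriv (laurent a f) * laurent_poly a q + laurent a f * fls_deriv (laurent_poly a q)
      = fls_deriv (laurent_poly a p)"
    by (simp add: algebra_simps)
  with 1 have "laurent a (dK f) * laurent_poly a q = fls_deriv (laurent a f) * laurent_poly a q"
    by (metis add_right_cancel)
  then show ?thesis using *(3) by simp
qed

lemma orbit_polar_dK: "f \<in> Qbar_x \<Longrightarrow> orbit_polar a (dK f) = [:0, 1:] * orbit_polar a f"
  unfolding orbit_polar_def laurent_dK polar_deriv
  by (rule Sum_any_right_distrib[symmetric], rule finite_orbit_polar)

lemma orbit_polar_dK_pow:
  "f \<in> Qbar_x \<Longrightarrow> orbit_polar a ((dK ^^ n) f) = Polynomial.monom 1 n * orbit_polar a f"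
  by (induction n) (simp_all add: orbit_polar_dK Qbar_x_dK_pow monom_Suc)

text \<open>
  On \<open>Qbar_x\<close> applying an operator of \<open>C[\<delta>]\<close> becomes multiplication in \<open>C[\<delta>]\<close>, a ring without zero divisors.
  This is what makes relations between derivatives of rational functions modulo \<open>\<sigma> - 1\<close> tractable.
\<close>

lemma orbit_polar_lin:
  assumes "f \<in> Qbar_x"
  shows "orbit_polar a (lin_d_eval const dK M f) = M * orbit_polar a f"
proof -
  have "orbit_polar a (lin_d_eval const dK M f) =
      (\<Sum>i\<le>Polynomial.degree M. Polynomial.monom (Polynomial.coeff M i) i * orbit_polar a f)"
    unfolding lin_d_eval_def orbit_polar_sum orbit_polar_const_mult orbit_polar_dK_pow[OF assms]
    by (simp add: smult_monom flip: mult_smult_left)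
  also have "\<dots> = M * orbit_polar a f"
    unfolding sum_distrib_right[symmetric] poly_as_sum_of_monoms ..
  finally show ?thesis .
qed

end

context shift_field begin

section \<open>Summability\<close>

lemma orbit_polar_summable: "orbit_polar a (sK g - g) = 0"
  by (simp add: orbit_polar_diff orbit_polar_sK)

text \<open>
  Asking for \<open>g\<close> with algebraic coefficients is no restriction for \<open>f\<close> in \<open>Qbar_x\<close>: vanishing of all
  \<open>orbit_polar a f\<close> is necessary for summability in \<open>C(x)\<close> and sufficient for summability in \<open>Qbar_x\<close>.
\<close>

definition qsummable :: "'c poly fract \<Rightarrow> bool" where
  "qsummable f \<longleftrightarrow> (\<exists>g\<in>Qbar_x. f = sK g - g)"

lemma qsummable_add: "qsummable f \<Longrightarrow> qsummable g \<Longrightarrow> qsummable (f + g)"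
proof -
  assume "qsummable f" "qsummable g"
  then obtain F G where "F \<in> Qbar_x" "G \<in> Qbar_x" "f = sK F - F" "g = sK G - G"
    by (auto simp: qsummable_def)
  then show ?thesis
    unfolding qsummable_def by (intro bexI[of _ "F + G"]) (auto simp: sK_hom Qbar_x_closed)
qed

lemma qsummable_uminus: "qsummable f \<Longrightarrow> qsummable (- f)"
proof -
  assume "qsummable f"
  then obtain F where "F \<in> Qbar_x" "f = sK F - F"
    by (auto simp: qsummable_def)
  then show ?thesis
    unfolding qsummable_def by (intro bexI[of _ "- F"]) (auto simp: sK_uminus Qbar_x_closed)
qed

lemma Qbar_x_0 [simp]: "0 \<in> Qbar_x"
  using Qbar_x_to_fract[OF qpoly_0] by simp

lemma qsummable_0: "qsummable 0"
  unfolding qsummable_def by (intro bexI[of _ 0]) (auto simp: sK_0)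

end

text \<open>
  The two top coefficients of \<open>p(X + w)\<close>. They are used for \<open>w = 1\<close> to sum polynomials and for
  \<open>\<sigma>(\<tau>) = \<tau> + \<omega>\<close> to compare a polynomial in \<open>\<tau>\<close> with its image under \<open>\<sigma>\<close>.
\<close>

lemma pcompose_linear_coeff:
  fixes p :: "'a::comm_ring_1 poly"
  assumes "\<And>i. i > n \<Longrightarrow> Polynomial.coeff p i = 0"
  shows "(\<forall>i>n. Polynomial.coeff (pcompose p [:w, 1:]) i = 0) \<and>
    Polynomial.coeff (pcompose p [:w, 1:]) n = Polynomial.coeff p n \<and>
    (n > 0 \<longrightarrow> Polynomial.coeff (pcompose p [:w, 1:]) (n - 1) =
       Polynomial.coeff p (n - 1) + of_nat n * w * Polynomial.coeff p n)"
  using assms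
proof (induction p arbitrary: n)
  case (pCons a p)
  show ?case
  proof (cases n)
    case 0
    then have "p = 0" using pCons.prems[of "Suc i" for i] by (intro poly_eqI) simp
    then show ?thesis using 0 by (auto simp: coeff_pCons split: nat.splits)
  next
    case (Suc m)
    have IH: "(\<forall>i>m. Polynomial.coeff (pcompose p [:w, 1:]) i = 0) \<and>
      Polynomial.coeff (pcompose p [:w, 1:]) m = Polynomial.coeff p m \<and>
      (m > 0 \<longrightarrow> Polynomial.coeff (pcompose p [:w, 1:]) (m - 1) =
       Polynomial.coeff p (m - 1) + of_nat m * w * Polynomial.coeff p m)"
      using pCons.prems[of "Suc i" for i] Suc by (intro pCons.IH) auto
    have c: "Polynomial.coeff (pcompose (pCons a p) [:w, 1:]) i =
        (if i = 0 then a else Polynomial.coeff (pcompose p [:w, 1:]) (i - 1)) + w * Polynomial.coeff (pcompose p [:w, 1:]) i" for i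
      by (auto simp: pcompose_pCons coeff_pCons split: nat.splits)
    show ?thesis
      using IH Suc unfolding c by (cases m) (auto simp: coeff_pCons algebra_simps split: nat.splits)
  qed
qed simp

context shift_field begin

lemma qpoly_difference:
  assumes "qpoly P" "\<And>i. i \<ge> n \<Longrightarrow> Polynomial.coeff P i = 0"
  shows "\<exists>Q. qpoly Q \<and> P = pcompose Q [:1, 1:] - Q"
  using assms
proof (induction n arbitrary: P)
  case 0
  then have "P = 0" by (intro poly_eqI) simp
  then show ?case by (intro exI[of _ 0]) simp
next
  case (Suc n)
  \<comment> \<open>The difference of \<open>c x\<^sup>n\<^sup>+\<^sup>1\<close> has leading term \<open>(n + 1) c x\<^sup>n\<close>.\<close>
  define c where "c = Polynomial.coeff P n / of_nat (Suc n)"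
  define Q0 where "Q0 = Polynomial.monom c (Suc n)"
  have c: "algebraic c" unfolding c_def
    using Suc.prems(1) Qbar_of_nat[of "Suc n"] by (auto simp: qpoly_def Qbar_closed)
  have *: "(\<forall>i>Suc n. Polynomial.coeff (pcompose Q0 [:1, 1:]) i = 0) \<and>
    Polynomial.coeff (pcompose Q0 [:1, 1:]) (Suc n) = Polynomial.coeff Q0 (Suc n) \<and>
    (Suc n > 0 \<longrightarrow> Polynomial.coeff (pcompose Q0 [:1, 1:]) (Suc n - 1) =
       Polynomial.coeff Q0 (Suc n - 1) + of_nat (Suc n) * 1 * Polynomial.coeff Q0 (Suc n))"
    by (rule pcompose_linear_coeff) (auto simp: Q0_def)
  define D where "D = pcompose Q0 [:1, 1:] - Q0"
  have qD: "qpoly D" "qpoly Q0" unfolding D_def Q0_def using c Qbar_of_nat[of 1]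
    by (auto intro!: qpoly_diff qpoly_pcompose qpoly_monom)
  have "Polynomial.coeff (P - D) i = 0" if "i \<ge> n" for i
  proof -
    consider "i = n" | "i = Suc n" | "i > Suc n" using \<open>i \<ge> n\<close> by linarith
    then show ?thesis
      by cases (use Suc.prems(2)[of i] * in \<open>auto simp: D_def Q0_def c_def simp del: of_nat_Suc\<close>)
  qed
  then obtain Q where "qpoly Q" "P - D = pcompose Q [:1, 1:] - Q"
    using Suc.IH[of "P - D"] Suc.prems(1) qD by auto
  then show ?case
    using qD by (intro exI[of _ "Q + Q0"]) (auto simp: D_def pcompose_add algebra_simps)
qed

lemma qsummable_poly: "qpoly P \<Longrightarrow> qsummable (to_fract P)"
proof -
  assume P: "qpoly P"
  obtain Q where Q: "qpoly Q" "P = pcompose Q [:1, 1:] - Q"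
    using qpoly_difference[OF P, of "Suc (Polynomial.degree P)"] by (auto simp: coeff_eq_0)
  have "to_fract P = sK (to_fract Q) - to_fract Q"
    unfolding sK_to_fract by (subst Q(2)) simp
  then show ?thesis using Q(1) by (auto simp: qsummable_def)
qed

section \<open>Partial fractions\<close>

lemma simple_pole_Qbar_x [intro]: "algebraic b \<Longrightarrow> simple_pole b \<in> Qbar_x"
  unfolding simple_pole_def using Qbar_xI[of 1 "[:-b, 1:]"] by simp

lemma dK_simple_pole_power:
  assumes "algebraic b"
  shows "(dK ^^ n) (simple_pole b) = const ((-1) ^ n * fact n) * simple_pole b ^ Suc n"
proof (induction n)
  case (Suc n)
  have 1: "dK (simple_pole b) = - simple_pole b * simple_pole b"
    unfolding simple_pole_def using assms
    by (simp add: dK_divide dK dK_to_fract pderiv_pCons flip: one_pCons)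
  have 2: "dK (simple_pole b ^ m) = - of_nat m * simple_pole b ^ Suc m" for m
    by (induction m) (simp_all add: dK 1 algebra_simps)
  have 3: "const (c * of_nat m) = const c * of_nat m" for c :: 'c and m
    by (simp only: const_hom)
  have "algebraic ((-1) ^ n * fact n :: 'c)"
    using Qbar_of_int[of "(-1) ^ n * fact n"] by simp
  then have "(dK ^^ Suc n) (simple_pole b) =
      const ((-1) ^ n * fact n) * (- of_nat (Suc n) * simple_pole b ^ Suc (Suc n))"
    unfolding funpow.simps comp_def Suc dK(2) 2 by (simp add: dC_Qbar)
  also have "\<dots> = - (const ((-1) ^ n * fact n * of_nat (Suc n))) * simple_pole b ^ Suc (Suc n)"
    unfolding 3 by (simp del: of_nat_Suc power_Suc)
  also have "- (const ((-1) ^ n * fact n * of_nat (Suc n))) = const ((-1) ^ Suc n * fact (Suc n) :: 'c)"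
    by (simp add: algebra_simps flip: to_fract_uminus)
  finally show ?case .
qed (simp add: const_hom)

inductive_set pfrac :: "'c poly fract set" where
  poly: "qpoly P \<Longrightarrow> to_fract P \<in> pfrac"
| pole: "algebraic b \<Longrightarrow> algebraic c \<Longrightarrow> const c * simple_pole b ^ Suc n \<in> pfrac"
| add: "f \<in> pfrac \<Longrightarrow> g \<in> pfrac \<Longrightarrow> f + g \<in> pfrac"

lemma pfrac_const_mult: "f \<in> pfrac \<Longrightarrow> algebraic c \<Longrightarrow> const c * f \<in> pfrac"
proof (induction rule: pfrac.induct)
  case (poly P)
  then show ?case using pfrac.poly[of "Polynomial.smult c P"] by (simp add: qpoly_smult to_fract_smult)
next
  case (pole b d n)
  then show ?case using pfrac.pole[of b "c * d" n] Qbar_closed(3)[of c d]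
    by (simp only: const_hom(2) mult.assoc)
next
  case (add f g)
  then show ?case by (simp add: distrib_left pfrac.add)
qed

lemma pfrac_mult_simple_pole:
  assumes a: "algebraic a" and f: "f \<in> pfrac"
  shows "simple_pole a * f \<in> pfrac"
  using f
proof induction
  case (poly P)
  have nz: "to_fract [:- a, 1:] \<noteq> 0" by simp
  have "to_fract P = to_fract [:- a, 1:] * to_fract (synthetic_div P a) + const (poly P a)"
    by (metis synthetic_div_correct' to_fract_add to_fract_mult)
  then have "simple_pole a * to_fract P = to_fract (synthetic_div P a) + const (poly P a) * simple_pole a ^ Suc 0"
    unfolding simple_pole_def using nz by (simp add: field_simps)
  then show ?case
    using poly a pfrac.pole[of a "poly P a" 0]
    by (auto intro!: pfrac.intros simp: qpoly_synthetic_div qpoly_poly)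
next
  case (pole b c n)
  show ?case
  proof (cases "a = b")
    case True
    then show ?thesis using pfrac.pole[OF pole, of "Suc n"] by (simp add: mult_ac)
  next
    case False
    have split: "simple_pole a * simple_pole b = const (1 / (a - b)) * (simple_pole a - simple_pole b)"
    proof -
      have nz: "to_fract [:- a, 1:] \<noteq> 0" "to_fract [:- b, 1:] \<noteq> 0" "const (a - b) \<noteq> 0" using False by simp_all
      have 1: "to_fract [:- b, 1:] - to_fract [:- a, 1:] = const (a - b)"
        by (simp flip: to_fract_diff)
      have 2: "const (1 / (a - b)) = 1 / const (a - b)"
        using nz False by (simp add: field_simps flip: to_fract_mult one_pCons)
      show ?thesis unfolding simple_pole_def 2 1[symmetric] using nz[unfolded 1[symmetric]] by (simp add: field_simps)
    qed
    have ab: "algebraic (1 / (a - b))" using a pole Qbar_of_nat[of 1] by (intro Qbar_closed) auto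
    have "simple_pole a * simple_pole b ^ Suc n \<in> pfrac" for n
    proof (induction n)
      case 0
      have "simple_pole a \<in> pfrac" "const (-1) * simple_pole b \<in> pfrac"
        using pfrac.pole[of a 1 0] pfrac.pole[of b "-1" 0] a pole(1) Qbar_of_nat[of 1]
        by (simp_all add: const_hom(5))
      then have "simple_pole a + const (-1) * simple_pole b \<in> pfrac" by (rule pfrac.add)
      from pfrac_const_mult[OF this ab]
      have "const (1 / (a - b)) * (simple_pole a + const (- 1) * simple_pole b) \<in> pfrac" .
      then show ?case by (simp add: split const_hom(4,5) del: to_fract_uminus)
    next
      case (Suc n)
      have "simple_pole a * simple_pole b ^ Suc (Suc n) =
        const (1 / (a - b)) * (simple_pole a * simple_pole b ^ Suc n + const (-1) * simple_pole b ^ Suc (Suc n))"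
      proof -
        have "simple_pole a * simple_pole b ^ Suc (Suc n) = (simple_pole a * simple_pole b) * simple_pole b ^ Suc n"
          by (simp add: mult_ac)
        then show ?thesis unfolding split by (simp add: const_hom(4,5) algebra_simps del: to_fract_uminus)
      qed
      then show ?case
        using pfrac_const_mult[OF pfrac.add[OF Suc pfrac.pole[OF pole(1), of "-1" "Suc n"]] ab] by simp
    qed
    from pfrac_const_mult[OF this pole(2)] show ?thesis by (simp add: mult_ac)
  qed
next
  case (add f g)
  then show ?case by (simp add: distrib_left pfrac.add)
qed

lemma Qbar_x_subset_pfrac:
  assumes "f \<in> Qbar_x" shows "f \<in> pfrac"
proof -
  from assms obtain p q where "qpoly p" "qpoly q" "q \<noteq> 0" "f = to_fract p / to_fract q"
    unfolding Qbar_x_iff by blast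
  then show ?thesis
  proof (induction "Polynomial.degree q" arbitrary: q f)
    case 0
    then obtain c where c: "q = [:c:]" using degree_eq_zeroE by metis
    then have "f = to_fract (Polynomial.smult (1 / c) p)"
      using 0 c by (simp add: to_fract_smult const_hom(5,7))
    moreover have "qpoly (Polynomial.smult (1 / c) p)"
      using 0 c Qbar_of_nat[of 1] by (intro qpoly_smult Qbar_closed) auto
    ultimately show ?case using pfrac.poly by simp
  next
    case (Suc n)
    obtain a where a: "poly q a = 0" using root[of q] Suc.hyps by auto
    have aa: "algebraic a" using root_of_Qbar_poly[of q a] Suc.prems a by (auto simp: qpoly_def)
    define q' where "q' = synthetic_div q a"
    have q': "q = [:- a, 1:] * q'" using synthetic_div_correct'[of a q] a by (simp add: q'_def)
    have "qpoly q'" unfolding q'_def using Suc.prems aa by (intro qpoly_synthetic_div)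
    moreover have "q' \<noteq> 0" using q' Suc.prems by auto
    moreover have "n = Polynomial.degree q'"
      unfolding q'_def degree_synthetic_div using Suc.hyps(2) by simp
    ultimately have "to_fract p / to_fract q' \<in> pfrac" using Suc by blast
    from pfrac_mult_simple_pole[OF aa this] show ?case
      unfolding Suc.prems q' simple_pole_def to_fract_mult by simp
  qed
qed

abbreviation L :: "'c poly \<Rightarrow> 'c poly fract \<Rightarrow> 'c poly fract" where
  "L \<equiv> lin_d_eval const dK"

lemma L_superset:
  assumes "n \<ge> Polynomial.degree M"
  shows "L M f = (\<Sum>i\<le>n. const (Polynomial.coeff M i) * (dK ^^ i) f)"
  unfolding lin_d_eval_def
  by (rule sum.mono_neutral_left) (use assms in \<open>auto simp: coeff_eq_0\<close>)

lemma L_add: "L (M + N) f = L M f + L N f"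
proof -
  define n where "n = max (Polynomial.degree M) (Polynomial.degree N)"
  have "Polynomial.degree (M + N) \<le> n" "Polynomial.degree M \<le> n" "Polynomial.degree N \<le> n"
    unfolding n_def by (auto intro: degree_add_le_max)
  note this[THEN L_superset]
  then show ?thesis by (simp only: coeff_add const_hom sum.distrib distrib_right)
qed

lemma L_0 [simp]: "L 0 f = 0"
  by (simp add: lin_d_eval_def)

lemma sK_sum: "sK (sum f A) = (\<Sum>i\<in>A. sK (f i))"
  by (induction A rule: infinite_finite_induct) (simp_all add: sK_0 sK_hom)

lemma sK_dK_pow: "sK ((dK ^^ n) f) = (dK ^^ n) (sK f)"
  by (induction n) (simp_all add: sK_dK)

lemma sK_L: "sK (L M f) = L M (sK f)"
  by (simp add: lin_d_eval_def sK_sum sK_hom sK_dK_pow)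

lemma sK_simple_pole: "sK (simple_pole b) = simple_pole (b - 1)"
  by (simp add: simple_pole_def sK_divide sK_hom sK_to_fract pcompose_pCons)

text \<open>
  The shift \<open>\<sigma>\<close> maps \<open>1/(x - b)\<close> to \<open>1/(x - (b - 1))\<close> and commutes with \<open>\<delta>\<close>. So modulo \<open>\<sigma> - 1\<close> a pole may be
  moved along its orbit, together with any operator acting on it.
\<close>

lemma qsummable_pole_shift:
  assumes "algebraic b" "qpoly M"
  shows "qsummable (L M (simple_pole (b + of_int j)) - L M (simple_pole b))"
proof -
  have step: "qsummable (L M (simple_pole (b + 1)) - L M (simple_pole b))" if "algebraic b" for b
  proof -
    have "algebraic (b + 1)" using that Qbar_of_nat[of 1] Qbar_closed(1) by fastforce
    then have "qsummable (- (sK (L M (simple_pole (b + 1))) - L M (simple_pole (b + 1))))"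
      using assms(2) by (intro qsummable_uminus) (auto simp: qsummable_def)
    then show ?thesis by (simp add: sK_L sK_simple_pole)
  qed
  have alg: "algebraic (b + of_int j)" for j
    using assms(1) Qbar_of_int by (rule Qbar_closed)
  have nat: "qsummable (L M (simple_pole (b + of_nat n)) - L M (simple_pole b))" if "algebraic b" for n b
  proof (induction n)
    case (Suc n)
    have "algebraic (b + of_nat n)" using that Qbar_of_nat by (rule Qbar_closed)
    from qsummable_add[OF step[OF this] Suc] show ?case by (simp add: algebra_simps)
  qed (simp add: qsummable_0)
  show ?thesis
  proof (cases "j \<ge> 0")
    case True
    then show ?thesis using nat[OF assms(1), of "nat j"] by simp
  next
    case False
    have "qsummable (- (L M (simple_pole (b + of_int j + of_nat (nat (- j)))) - L M (simple_pole (b + of_int j))))"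
      by (intro qsummable_uminus nat alg)
    moreover have "b + of_int j + of_nat (nat (- j)) = b" using False by simp
    ultimately show ?thesis by simp
  qed
qed

definition pole_sum :: "('c poly \<times> 'c) list \<Rightarrow> 'c poly fract" where
  "pole_sum l = (\<Sum>(M, b)\<leftarrow>l. L M (simple_pole b))"

lemma pole_sum_simps [simp]:
  "pole_sum [] = 0" "pole_sum (Mb # l) = L (fst Mb) (simple_pole (snd Mb)) + pole_sum l"
  "pole_sum (l @ l') = pole_sum l + pole_sum l'"
  by (simp_all add: pole_sum_def case_prod_beta)

definition qpoles :: "('c poly \<times> 'c) list \<Rightarrow> bool" where
  "qpoles l \<longleftrightarrow> (\<forall>(M, b)\<in>set l. qpoly M \<and> algebraic b)"

text \<open>
  Partial fractions, with the terms \<open>(x - b)\<^sup>-\<^sup>n\<^sup>-\<^sup>1\<close> written as derivatives of \<open>1/(x - b)\<close>.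
\<close>

lemma partial_fractions:
  assumes "f \<in> Qbar_x"
  shows "\<exists>P l. qpoly P \<and> qpoles l \<and> f = to_fract P + pole_sum l"
  using Qbar_x_subset_pfrac[OF assms]
proof induction
  case (poly P)
  then show ?case by (intro exI[of _ P] exI[of _ "[]"]) (simp add: qpoles_def)
next
  case (pole b c n)
  define d :: 'c where "d = (-1) ^ n * fact n"
  have d: "algebraic d" "d \<noteq> 0" unfolding d_def using Qbar_of_int[of "(-1) ^ n * fact n"] by simp_all
  have "algebraic (c / d)" using pole d by (intro Qbar_closed)
  moreover have "L (Polynomial.monom (c / d) n) (simple_pole b) = const c * simple_pole b ^ Suc n"
  proof -
    have "L (Polynomial.monom (c / d) n) (simple_pole b) =
        (\<Sum>i\<le>n. const (Polynomial.coeff (Polynomial.monom (c / d) n) i) * (dK ^^ i) (simple_pole b))"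
      by (rule L_superset) (rule degree_monom_le)
    also have "\<dots> = const (c / d) * (dK ^^ n) (simple_pole b)"
      by (subst sum.mono_neutral_right[of _ "{n}"]) auto
    also have "\<dots> = const (c / d * d) * simple_pole b ^ Suc n"
      unfolding dK_simple_pole_power[OF pole(1)] d_def[symmetric] const_hom(2) by (simp only: mult.assoc)
    finally show ?thesis using d by simp
  qed
  ultimately show ?case
    using pole by (intro exI[of _ 0] exI[of _ "[(Polynomial.monom (c / d) n, b)]"]) (auto simp: qpoles_def)
next
  case (add f g)
  then obtain P l P' l' where "qpoly P" "qpoles l" "f = to_fract P + pole_sum l"
    "qpoly P'" "qpoles l'" "g = to_fract P' + pole_sum l'" by blast
  then show ?case
    by (intro exI[of _ "P + P'"] exI[of _ "l @ l'"]) (auto simp: qpoles_def)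
qed

lemma orbit_polar_pole_sum:
  "qpoles l \<Longrightarrow> orbit_polar a (pole_sum l) = (\<Sum>(M, b)\<leftarrow>l. if \<exists>j::int. b = a + of_int j then M else 0)"
  by (induction l)
    (auto simp: qpoles_def orbit_polar_0 orbit_polar_add orbit_polar_lin simple_pole_Qbar_x
      orbit_polar_simple_pole)

lemma qpoly_orbit_polar:
  assumes "(f :: 'c poly fract) \<in> Qbar_x" shows "qpoly (orbit_polar a f)"
proof -
  obtain P l where *: "qpoly P" "qpoles l" "f = to_fract P + pole_sum l"
    using partial_fractions[OF assms] by blast
  have "qpoly (\<Sum>(M, b)\<leftarrow>l. if \<exists>j::int. b = a + of_int j then M else 0)"
    using *(2) by (induction l) (auto simp: qpoles_def)
  then show ?thesis
    using * by (simp add: orbit_polar_add orbit_polar_poly orbit_polar_pole_sum)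
qed

text \<open>
  Poles in the same orbit are merged by moving one onto the other, which shortens the list. A pole alone in
  its orbit contributes its operator \<open>M\<close> to the orbit sum, so \<open>M = 0\<close>.
\<close>

lemma pole_sum_qsummable:
  assumes "qpoles l" "\<And>a. orbit_polar a (pole_sum l) = 0"
  shows "qsummable (pole_sum l)"
  using assms
proof (induction "length l" arbitrary: l rule: less_induct)
  case less
  show ?case
  proof (cases l)
    case (Cons Mb l')
    obtain M b where Mb: "Mb = (M, b)" by (cases Mb)
    have q: "qpoly M" "algebraic b" "qpoles l'" using less.prems Cons Mb by (auto simp: qpoles_def)
    show ?thesis
    proof (cases "\<exists>N j. (N, b + of_int j) \<in> set l'")
      case True
      then obtain N j where Nj: "(N, b + of_int j) \<in> set l'" by blast
      then obtain l1 l2 where l': "l' = l1 @ (N, b + of_int j) # l2" by (meson split_list)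
      define m where "m = l1 @ (M + N, b + of_int j) # l2"
      have qm: "qpoles m" using q(1,3) unfolding m_def l' by (auto simp: qpoles_def)
      have eq: "pole_sum l = pole_sum m - (L M (simple_pole (b + of_int j)) - L M (simple_pole b))"
        unfolding m_def Cons l' Mb by (simp add: L_add)
      have s: "qsummable (L M (simple_pole (b + of_int j)) - L M (simple_pole b))"
        by (rule qsummable_pole_shift[OF q(2,1)])
      then have "orbit_polar a (L M (simple_pole (b + of_int j)) - L M (simple_pole b)) = 0" for a
        by (auto simp: qsummable_def orbit_polar_summable)
      then have "orbit_polar a (pole_sum m) = 0" for a
        using less.prems(2)[of a] unfolding eq by (simp add: orbit_polar_diff)
      then have "qsummable (pole_sum m)"
        by (intro less.hyps qm) (simp_all add: m_def Cons l')
      from qsummable_add[OF this qsummable_uminus[OF s]] show ?thesis unfolding eq diff_conv_add_uminus[of "pole_sum m"] .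
    next
      case False
      have "(\<Sum>(N, c)\<leftarrow>l'. if \<exists>j::int. c = b + of_int j then N else 0) = 0"
      proof -
        have "(if \<exists>j::int. c = b + of_int j then N else 0) = 0" if "(N, c) \<in> set l'" for N c
          using False that by auto
        then show ?thesis by (induction l') auto
      qed
      moreover have "\<exists>j::int. b = b + of_int j" by (rule exI[of _ 0]) simp
      ultimately have "orbit_polar b (pole_sum l) = M"
        by (subst orbit_polar_pole_sum[OF less.prems(1)]) (simp add: Cons Mb)
      then have "M = 0" using less.prems(2) by simp
      then have "pole_sum l = pole_sum l'" by (simp add: Cons Mb)
      then show ?thesis using less.hyps[of l'] q less.prems(2) Cons by simp
    qed
  qed (simp add: qsummable_0)
qed

text \<open>
  The polar parts along orbits are a complete obstruction: polynomials are always summable, and the rest is a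
  sum of poles.
\<close>

theorem qsummable_iff_orbit_polar:
  assumes "(f :: 'c poly fract) \<in> Qbar_x"
  shows "qsummable f \<longleftrightarrow> (\<forall>a. orbit_polar a f = 0)"
proof
  show "qsummable f \<Longrightarrow> \<forall>a. orbit_polar a f = 0"
    by (auto simp: qsummable_def orbit_polar_summable)
  assume 0: "\<forall>a. orbit_polar a f = 0"
  obtain P l where *: "qpoly P" "qpoles l" "f = to_fract P + pole_sum l"
    using partial_fractions[OF assms] by blast
  have "qsummable (pole_sum l)"
    using 0 by (intro pole_sum_qsummable *) (simp add: *(3) orbit_polar_add orbit_polar_poly)
  with qsummable_poly[OF *(1)] show "qsummable f" unfolding *(3) by (rule qsummable_add)
qed

section \<open>Linear operators on logarithmic derivatives\<close>

lemma log_deriv_mult: "f \<noteq> 0 \<Longrightarrow> g \<noteq> 0 \<Longrightarrow> dK (f * g) / (f * g) = dK f / f + dK g / g"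
  by (simp add: dK field_simps)

lemma orbit_polar_log_deriv_poly:
  "qpoly p \<Longrightarrow> p \<noteq> 0 \<Longrightarrow> Polynomial.degree (orbit_polar a (dK (to_fract p) / to_fract p)) = 0"
proof (induction "Polynomial.degree p" arbitrary: p)
  case 0
  then obtain c where c: "p = [:c:]" using degree_eq_zeroE by metis
  then show ?case using 0 by (simp add: dC_Qbar orbit_polar_0)
next
  case (Suc n)
  obtain b where b: "poly p b = 0" using root[of p] Suc.hyps by auto
  have bb: "algebraic b" using root_of_Qbar_poly[of p b] Suc.prems b by (auto simp: qpoly_def)
  define p' where "p' = synthetic_div p b"
  have p': "p = [:- b, 1:] * p'" using synthetic_div_correct'[of b p] b by (simp add: p'_def)
  have "qpoly p'" unfolding p'_def using Suc.prems bb by (intro qpoly_synthetic_div)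
  moreover have "p' \<noteq> 0" using p' Suc.prems by auto
  moreover have "n = Polynomial.degree p'"
    unfolding p'_def degree_synthetic_div using Suc.hyps(2) by simp
  ultimately have *: "qpoly p'" "p' \<noteq> 0" "n = Polynomial.degree p'" by blast+
  have "dK (to_fract p) / to_fract p = simple_pole b + dK (to_fract p') / to_fract p'"
    unfolding p' to_fract_mult using * bb
    by (subst log_deriv_mult) (simp_all add: simple_pole_def dK_to_fract pderiv_pCons flip: one_pCons)
  moreover have "Polynomial.degree (orbit_polar a (simple_pole b)) = 0"
    by (simp add: orbit_polar_simple_pole)
  ultimately show ?case
    using Suc.hyps(1)[OF *(3) *(1,2)] degree_add_le[of "orbit_polar a (simple_pole b)" 0]
    by (simp add: orbit_polar_add)
qed

text \<open>
  A logarithmic derivative has only simple poles, so its orbit sums are numbers rather than proper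
  operators.
\<close>

lemma orbit_polar_log_deriv:
  assumes "f \<in> Qbar_x" "f \<noteq> 0"
  shows "Polynomial.degree (orbit_polar a (dK f / f)) = 0"
proof -
  from assms obtain p q where *: "qpoly p" "qpoly q" "q \<noteq> 0" "f = to_fract p / to_fract q"
    unfolding Qbar_x_iff by blast
  have p: "p \<noteq> 0" using * assms by auto
  have "to_fract p = f * to_fract q" using * by simp
  then have "dK (to_fract p) / to_fract p = dK f / f + dK (to_fract q) / to_fract q"
    using log_deriv_mult[of f "to_fract q"] assms *(3) by simp
  then have "dK f / f = dK (to_fract p) / to_fract p - dK (to_fract q) / to_fract q" by simp
  then show ?thesis
    using orbit_polar_log_deriv_poly[OF *(1) p, of a] orbit_polar_log_deriv_poly[OF *(2,3), of a]
      degree_diff_le[of _ 0]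
    by (simp add: orbit_polar_diff)
qed

text \<open>
  Here \<open>g\<close> and the coefficients of \<open>M\<close> may be transcendental. The conclusion uses that \<open>C[\<delta>]\<close> has no
  zero divisors.
\<close>

lemma L_summable_imp_zero:
  assumes "f \<in> Qbar_x" "\<not> qsummable f" "L M f = sK g - g"
  shows "M = 0"
proof -
  obtain a where "orbit_polar a f \<noteq> 0" using assms by (auto simp: qsummable_iff_orbit_polar)
  moreover have "M * orbit_polar a f = 0"
    using orbit_polar_lin[OF assms(1), of a M] by (simp add: assms(3) orbit_polar_summable)
  ultimately show ?thesis by simp
qed

text \<open>
  The step that produces the trichotomy of the classification. Suppose \<open>M(v) + N(w)\<close> is summable with
  \<open>N \<noteq> 0\<close>, where \<open>v = \<delta>(u)/u\<close>. On an orbit where \<open>v\<close> has nonzero sum, that sum is a number \<open>n\<close>, hence a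
  unit of \<open>C[\<delta>]\<close>, and the relation shows \<open>M = - N K\<close> with \<open>K\<close> the orbit sum of \<open>w\<close> divided by \<open>n\<close>. Cancelling
  \<open>N\<close> on every orbit, \<open>K(v) - w\<close> is summable, and \<open>K\<close> has algebraic coefficients.
\<close>

lemma L_log_deriv_summable_imp_zero:
  assumes u: "u \<in> Qbar_x" "u \<noteq> 0" and w: "w \<in> Qbar_x"
    and nv: "\<not> qsummable (dK u / u)"
    and nM: "\<And>M. qpoly M \<Longrightarrow> \<not> qsummable (L M (dK u / u) - w)"
    and rel: "L M (dK u / u) + L N w = sK g - g"
  shows "M = 0 \<and> N = 0"
proof -
  define v where "v = dK u / u"
  have v: "v \<in> Qbar_x" unfolding v_def using u by (auto intro: Qbar_x_closed)
  have rel': "M * orbit_polar a v + N * orbit_polar a w = 0" for a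
    using arg_cong[OF rel, of "orbit_polar a", folded v_def]
    by (simp add: orbit_polar_add orbit_polar_summable orbit_polar_lin v w)
  obtain a where a: "orbit_polar a v \<noteq> 0"
    using nv v by (auto simp: qsummable_iff_orbit_polar v_def)
  obtain n where n: "orbit_polar a v = [:n:]"
    using orbit_polar_log_deriv[OF u, of a] degree_eq_zeroE unfolding v_def by metis
  have n0: "n \<noteq> 0" using a n by simp
  have "N = 0"
  proof (rule ccontr)
    assume N: "N \<noteq> 0"
    define K where "K = Polynomial.smult (1 / n) (orbit_polar a w)"
    have "algebraic n" using qpoly_orbit_polar[OF v, of a] n by simp
    then have qK: "qpoly K" unfolding K_def
      using Qbar_of_nat[of 1] by (intro qpoly_smult Qbar_closed qpoly_orbit_polar w) auto
    have M: "M = - N * K"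
    proof -
      have "Polynomial.smult n M = - N * orbit_polar a w"
        using rel'[of a] n by (simp add: eq_neg_iff_add_eq_0)
      then have "Polynomial.smult (1 / n) (Polynomial.smult n M) = - N * K"
        by (simp add: K_def)
      then show ?thesis using n0 by simp
    qed
    have "orbit_polar b (L K v - w) = 0" for b
    proof -
      have "N * (K * orbit_polar b v - orbit_polar b w) = 0"
        using rel'[of b] unfolding M by (auto simp: algebra_simps)
      then have "K * orbit_polar b v - orbit_polar b w = 0" using N by (simp only: mult_eq_0_iff simp_thms)
      then show ?thesis using v w by (simp only: orbit_polar_diff orbit_polar_lin)
    qed
    moreover have "L K v - w \<in> Qbar_x" using qK v w by (auto intro: Qbar_x_closed)
    ultimately show False using nM[OF qK] by (simp add: qsummable_iff_orbit_polar v_def)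
  qed
  then show ?thesis using rel'[of a] a by simp
qed

lemma ex_L_log_deriv_ne_zero: "M \<noteq> 0 \<Longrightarrow> L M (dK (to_fract [:0, 1:]) / to_fract [:0, 1:]) \<noteq> 0"
proof -
  assume M: "M \<noteq> 0"
  have "dK (to_fract [:0, 1:]) / to_fract [:0, 1:] = simple_pole 0"
    by (simp add: dK_x simple_pole_def)
  moreover have "orbit_polar 0 (L M (simple_pole 0)) = M"
    by (subst orbit_polar_lin) (auto simp: orbit_polar_simple_pole intro: exI[of _ "0 :: int"])
  ultimately show ?thesis using M by (auto simp: orbit_polar_0)
qed

section \<open>Descent of multiplicative equations to algebraic coefficients\<close>

lemma order_pcompose_shift:
  assumes "p \<noteq> 0"
  shows "Polynomial.order a (pcompose p [:1, 1:]) = Polynomial.order (a + 1) (p :: 'c poly)"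
proof -
  from order_decomp[OF assms, of "a + 1"] obtain q
    where q: "p = [:- (a + 1), 1:] ^ Polynomial.order (a + 1) p * q" "\<not> [:- (a + 1), 1:] dvd q" by blast
  have pw: "pcompose (r ^ n) s = pcompose r s ^ n" for r s :: "'c poly" and n
    by (induction n) (simp_all add: pcompose_mult pcompose_1)
  have "pcompose [:- (a + 1), 1:] [:1, 1:] = [:- a, 1:]"
    by (simp add: pcompose_pCons)
  then have "pcompose p [:1, 1:] = [:- a, 1:] ^ Polynomial.order (a + 1) p * pcompose q [:1, 1:]"
    using q(1) by (metis pcompose_mult pw)
  moreover have qa: "poly (pcompose q [:1, 1:]) a \<noteq> 0"
    using q(2) by (simp add: poly_pcompose add.commute dvd_iff_poly_eq_0)
  then have "[:- a, 1:] ^ Polynomial.order (a + 1) p * pcompose q [:1, 1:] \<noteq> 0" by auto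
  ultimately show ?thesis
    using order_0I[OF qa] by (simp add: order_mult order_power_n_n del: mult_eq_0_iff)
qed

lemma split_Qbar_roots:
  fixes p :: "'c poly"
  assumes "p \<noteq> 0" "\<And>a. poly p a = 0 \<Longrightarrow> algebraic a"
  shows "\<exists>c p'. c \<noteq> 0 \<and> qpoly p' \<and> p = Polynomial.smult c p'"
  using assms
proof (induction "Polynomial.degree p" arbitrary: p)
  case 0
  then obtain c where c: "p = [:c:]" using degree_eq_zeroE by metis
  then show ?case using 0 by (intro exI[of _ c] exI[of _ 1]) auto
next
  case (Suc n)
  obtain b where b: "poly p b = 0" using root[of p] Suc.hyps by auto
  define q where "q = synthetic_div p b"
  have q: "p = [:- b, 1:] * q" using synthetic_div_correct'[of b p] b by (simp add: q_def)
  have "n = Polynomial.degree q"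
    unfolding q_def degree_synthetic_div using Suc.hyps(2) by simp
  moreover have "q \<noteq> 0" using q Suc.prems by auto
  moreover have "poly q a = 0 \<Longrightarrow> algebraic a" for a
    using Suc.prems(2)[of a] unfolding q by simp
  ultimately obtain c p' where "c \<noteq> 0" "qpoly p'" "q = Polynomial.smult c p'"
    using Suc.hyps(1) by blast
  then show ?case
    using Suc.prems(2)[OF b] unfolding q
    by (intro exI[of _ c] exI[of _ "[:- b, 1:] * p'"]) (auto intro!: qpoly_mult simp del: mult_pCons_left)
qed

text \<open>
  Common factors \<open>x - a\<close> with transcendental \<open>a\<close> cancel, and what remains splits into factors \<open>x - a\<close> with
  algebraic \<open>a\<close>.
\<close>

lemma cancel_non_Qbar_roots:
  fixes p q :: "'c poly"
  assumes "p \<noteq> 0" "q \<noteq> 0" "\<And>a. \<not> algebraic a \<Longrightarrow> Polynomial.order a p = Polynomial.order a q"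
  shows "\<exists>c p' q'. c \<noteq> 0 \<and> p' \<noteq> 0 \<and> q' \<noteq> 0 \<and> qpoly p' \<and> qpoly q' \<and>
    to_fract p / to_fract q = const c * (to_fract p' / to_fract q')"
  using assms
proof (induction "Polynomial.degree p" arbitrary: p q rule: less_induct)
  case less
  show ?case
  proof (cases "\<exists>a. poly p a = 0 \<and> \<not> algebraic a")
    case True
    then obtain a where a: "poly p a = 0" "\<not> algebraic a" by blast
    then have b: "poly q a = 0"
      using less.prems by (metis order_root)
    obtain p' where p': "p = [:- a, 1:] * p'" using a(1) by (auto simp: poly_eq_0_iff_dvd elim: dvdE)
    obtain q' where q': "q = [:- a, 1:] * q'" using b by (auto simp: poly_eq_0_iff_dvd elim: dvdE)
    have nz: "p' \<noteq> 0" "q' \<noteq> 0" using p' q' less.prems by auto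
    have "Polynomial.order c p = Polynomial.order c [:- a, 1:] + Polynomial.order c p'"
      "Polynomial.order c q = Polynomial.order c [:- a, 1:] + Polynomial.order c q'" for c
      unfolding p' q' using nz by (simp_all only: order_mult mult_eq_0_iff pCons_eq_0_iff one_neq_zero simp_thms)
    then have "\<not> algebraic c \<Longrightarrow> Polynomial.order c p' = Polynomial.order c q'" for c
      using less.prems(3)[of c] by simp
    moreover have "Polynomial.degree p' < Polynomial.degree p"
      unfolding p' using nz by (subst degree_mult_eq) auto
    ultimately obtain c r s where "c \<noteq> 0" "r \<noteq> 0" "s \<noteq> 0" "qpoly r" "qpoly s"
      "to_fract p' / to_fract q' = const c * (to_fract r / to_fract s)"
      using less.hyps[of p' q'] nz by blast
    moreover have "to_fract p / to_fract q = to_fract p' / to_fract q'"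
      unfolding p' q' to_fract_mult by simp
    ultimately show ?thesis by metis
  next
    case False
    then have "\<And>a. poly q a = 0 \<Longrightarrow> algebraic a"
      using less.prems by (metis order_root)
    with False less.prems obtain c p' d q' where *: "c \<noteq> 0" "qpoly p'" "p = Polynomial.smult c p'"
      "d \<noteq> 0" "qpoly q'" "q = Polynomial.smult d q'"
      using split_Qbar_roots[of p] split_Qbar_roots[of q] by metis
    have "to_fract p / to_fract q = const (c / d) * (to_fract p' / to_fract q')"
      unfolding *(3,6) to_fract_smult const_hom by simp
    moreover have "c / d \<noteq> 0" "p' \<noteq> 0" "q' \<noteq> 0" using * less.prems by auto
    ultimately show ?thesis using *(2,5) by blast
  qed
qed

text \<open>
  Since \<open>r\<close> has no zeros or poles at transcendental points, the order of \<open>h\<close> at a transcendental point \<open>a\<close>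
  does not change along \<open>a + \<nat>\<close>; as \<open>h\<close> has finitely many zeros and poles, this order is \<open>0\<close>.
\<close>

theorem multiplicative_descent:
  assumes r: "r \<in> Qbar_x" and h: "h \<noteq> 0" "sK h = r * h"
  shows "\<exists>c h'. c \<noteq> 0 \<and> h' \<in> Qbar_x \<and> h = const c * h'"
proof -
  obtain p q where pq: "q \<noteq> 0" "h = to_fract p / to_fract q" by (rule fract_poly_cases)
  have p: "p \<noteq> 0" using pq h by auto
  from r obtain r1 r2 where r12: "qpoly r1" "qpoly r2" "r2 \<noteq> 0" "r = to_fract r1 / to_fract r2"
    unfolding Qbar_x_iff by blast
  have "sK h \<noteq> 0" using h(1) by simp
  then have "r \<noteq> 0" using h by auto
  then have r1: "r1 \<noteq> 0" using r12 by auto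
  define sp sq where "sp = pcompose p [:1, 1:]" and "sq = pcompose q [:1, 1:]"
  have s0: "sp \<noteq> 0" "sq \<noteq> 0" using p pq(1) pcompose_eq_0[of p "[:1, 1:]"] pcompose_eq_0[of q "[:1, 1:]"]
    by (auto simp: sp_def sq_def)
  have "to_fract (sp * q * r2) = to_fract (r1 * p * sq)"
    using h(2) pq(1) r12(3) s0 unfolding pq(2) r12(4) sK_divide sK_to_fract sp_def[symmetric] sq_def[symmetric]
    by (simp add: field_simps)
  then have eq: "sp * q * r2 = r1 * p * sq" by (simp del: to_fract_mult)
  define \<phi> where "\<phi> a = int (Polynomial.order a p) - int (Polynomial.order a q)" for a
  have na: "Polynomial.order a s = 0" if "\<not> algebraic a" "qpoly s" "s \<noteq> 0" for a s
    using root_of_Qbar_poly[of s a] that by (auto intro!: order_0I simp: qpoly_def)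
  have step: "\<phi> (a + 1) = \<phi> a" if "\<not> algebraic a" for a
  proof -
    have "Polynomial.order a (sp * q * r2) = Polynomial.order a (r1 * p * sq)" using eq by simp
    then have "Polynomial.order (a + 1) p + Polynomial.order a q = Polynomial.order a p + Polynomial.order (a + 1) q"
      using s0 p pq(1) r12(3) r1 na[OF that r12(2,3)] na[OF that r12(1) r1]
      by (simp add: order_mult order_pcompose_shift sp_def sq_def)
    then show ?thesis by (simp add: \<phi>_def)
  qed
  have na': "\<not> algebraic (a + of_nat n)" if "\<not> algebraic a" for a n
    using Qbar_closed(2)[of "a + of_nat n" "of_nat n"] that by auto
  have steps: "\<phi> (a + of_nat n) = \<phi> a" if "\<not> algebraic a" for a n
  proof (induction n)
    case (Suc n)
    then show ?case using step[OF na'[OF that, of n]] by (simp add: add_ac)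
  qed simp
  have "Polynomial.order a p = Polynomial.order a q" if a: "\<not> algebraic a" for a
  proof (rule ccontr)
    assume "\<not> ?thesis"
    then have "\<phi> (a + of_nat n) \<noteq> 0" for n using steps[OF a] by (simp add: \<phi>_def)
    then have "Polynomial.order (a + of_nat n) p \<noteq> 0 \<or> Polynomial.order (a + of_nat n) q \<noteq> 0" for n
      unfolding \<phi>_def by (metis diff_self of_nat_0)
    then have "poly (p * q) (a + of_nat n) = 0" for n
      using p pq(1) by (metis mult_eq_0_iff order_root poly_mult)
    then have "range (\<lambda>n. a + of_nat n) \<subseteq> {x. poly (p * q) x = 0}" by auto
    moreover have "finite {x. poly (p * q) x = 0}" using p pq(1) by (intro poly_roots_finite) simp
    ultimately have "finite (range (\<lambda>n. a + of_nat n))" by (rule finite_subset)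
    moreover have "inj (\<lambda>n. a + of_nat n)" by (rule injI) simp
    ultimately show False using finite_imageD[of "\<lambda>n. a + of_nat n" UNIV] by simp
  qed
  from cancel_non_Qbar_roots[OF p pq(1) this] obtain c p' q' where
    *: "c \<noteq> 0" "q' \<noteq> 0" "qpoly p'" "qpoly q'" "h = const c * (to_fract p' / to_fract q')"
    unfolding pq(2) by blast
  then show ?thesis using Qbar_xI by blast
qed

end

section \<open>Subrings of a ring and of its square\<close>

definition subring_set :: "'r::comm_ring_1 set \<Rightarrow> bool" where
  "subring_set B \<longleftrightarrow> 1 \<in> B \<and> (\<forall>x\<in>B. \<forall>y\<in>B. x - y \<in> B \<and> x * y \<in> B)"

lemma subring_setD:
  assumes "subring_set B"
  shows "1 \<in> B" "0 \<in> B" "x \<in> B \<Longrightarrow> y \<in> B \<Longrightarrow> x - y \<in> B" "x \<in> B \<Longrightarrow> y \<in> B \<Longrightarrow> x * y \<in> B"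
    "x \<in> B \<Longrightarrow> - x \<in> B" "x \<in> B \<Longrightarrow> y \<in> B \<Longrightarrow> x + y \<in> B"
proof -
  show 1: "1 \<in> B" and d: "x \<in> B \<Longrightarrow> y \<in> B \<Longrightarrow> x - y \<in> B"
    and "x \<in> B \<Longrightarrow> y \<in> B \<Longrightarrow> x * y \<in> B" for x y
    using assms by (auto simp: subring_set_def)
  show 0: "0 \<in> B" using d[OF 1 1] by simp
  show m: "x \<in> B \<Longrightarrow> - x \<in> B" for x using d[OF 0, of x] by simp
  show "x \<in> B \<Longrightarrow> y \<in> B \<Longrightarrow> x + y \<in> B" using d[of x "- y"] m[of y] by simp
qed

lemma subring_set_sum:
  assumes "subring_set B" "\<And>i. i \<in> A \<Longrightarrow> f i \<in> B"
  shows "sum f A \<in> B"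
  using assms(2) by (induction A rule: infinite_finite_induct) (auto simp: subring_setD[OF assms(1)])

definition poly_over :: "'r::comm_ring_1 set \<Rightarrow> 'r poly \<Rightarrow> bool" where
  "poly_over B p \<longleftrightarrow> (\<forall>i. Polynomial.coeff p i \<in> B)"

lemma poly_over_closed:
  assumes B: "subring_set B"
  shows "poly_over B 0" "poly_over B (pCons a p) \<longleftrightarrow> a \<in> B \<and> poly_over B p"
    "poly_over B p \<Longrightarrow> poly_over B q \<Longrightarrow> poly_over B (p + q)"
    "poly_over B p \<Longrightarrow> poly_over B q \<Longrightarrow> poly_over B (p - q)"
    "poly_over B p \<Longrightarrow> poly_over B q \<Longrightarrow> poly_over B (p * q)"
    "poly_over B p \<Longrightarrow> poly_over B q \<Longrightarrow> poly_over B (pcompose p q)"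
proof -
  note B' = subring_setD[OF B]
  show 0: "poly_over B 0" by (simp add: poly_over_def B')
  show c: "poly_over B (pCons a p) \<longleftrightarrow> a \<in> B \<and> poly_over B p" for a p
    unfolding poly_over_def by (auto simp: coeff_pCons split: nat.splits)
  show a: "poly_over B p \<Longrightarrow> poly_over B q \<Longrightarrow> poly_over B (p + q)" for p q
    by (simp add: poly_over_def B')
  show "poly_over B p \<Longrightarrow> poly_over B q \<Longrightarrow> poly_over B (p - q)"
    by (simp add: poly_over_def B')
  show m: "poly_over B p \<Longrightarrow> poly_over B q \<Longrightarrow> poly_over B (p * q)" for p q
    by (simp add: poly_over_def coeff_mult B' subring_set_sum[OF B])
  show "poly_over B p \<Longrightarrow> poly_over B q \<Longrightarrow> poly_over B (pcompose p q)"
    by (induction p) (auto simp: pcompose_pCons 0 c intro!: a m)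
qed

lemma subring_set_poly: "subring_set B \<Longrightarrow> poly_over B p \<Longrightarrow> x \<in> B \<Longrightarrow> poly p x \<in> B"
  by (induction p) (auto simp: poly_over_closed subring_setD)

definition adjoin :: "'r::comm_ring_1 set \<Rightarrow> 'r \<Rightarrow> 'r set" where
  "adjoin B x = {poly p x | p. poly_over B p}"

lemma subring_set_adjoin:
  assumes "subring_set B" shows "subring_set (adjoin B x)"
  unfolding subring_set_def adjoin_def
proof (intro conjI ballI)
  show "1 \<in> {poly p x |p. poly_over B p}"
    using assms by (intro CollectI exI[of _ "[:1:]"]) (auto simp: poly_over_closed subring_setD)
next
  fix y z assume "y \<in> {poly p x |p. poly_over B p}" "z \<in> {poly p x |p. poly_over B p}"
  then show "y - z \<in> {poly p x |p. poly_over B p}" "y * z \<in> {poly p x |p. poly_over B p}"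
    using poly_over_closed[OF assms] by (auto simp flip: poly_diff poly_mult)
qed

lemma adjoin_supset: "subring_set B \<Longrightarrow> B \<subseteq> adjoin B x"
  unfolding adjoin_def by (force intro: exI[of _ "[:b:]" for b] simp: poly_over_closed)

text \<open>
  A ring homomorphism between subrings is handled through its graph, a subring of \<open>R \<times> R\<close>. A graph can be
  enlarged by adjoining a pair of elements without deciding first whether the result is still single-valued.
\<close>

definition subring_rel :: "('r::comm_ring_1 \<times> 'r) set \<Rightarrow> bool" where
  "subring_rel \<Gamma> \<longleftrightarrow> (1, 1) \<in> \<Gamma> \<and>
     (\<forall>(x, x')\<in>\<Gamma>. \<forall>(y, y')\<in>\<Gamma>. (x - y, x' - y') \<in> \<Gamma> \<and> (x * y, x' * y') \<in> \<Gamma>)"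

lemma subring_relD:
  assumes "subring_rel \<Gamma>"
  shows "(1, 1) \<in> \<Gamma>" "(0, 0) \<in> \<Gamma>"
    "(x, x') \<in> \<Gamma> \<Longrightarrow> (y, y') \<in> \<Gamma> \<Longrightarrow> (x - y, x' - y') \<in> \<Gamma>"
    "(x, x') \<in> \<Gamma> \<Longrightarrow> (y, y') \<in> \<Gamma> \<Longrightarrow> (x * y, x' * y') \<in> \<Gamma>"
    "(x, x') \<in> \<Gamma> \<Longrightarrow> (- x, - x') \<in> \<Gamma>"
    "(x, x') \<in> \<Gamma> \<Longrightarrow> (y, y') \<in> \<Gamma> \<Longrightarrow> (x + y, x' + y') \<in> \<Gamma>"
proof -
  show 1: "(1, 1) \<in> \<Gamma>" and d: "(x, x') \<in> \<Gamma> \<Longrightarrow> (y, y') \<in> \<Gamma> \<Longrightarrow> (x - y, x' - y') \<in> \<Gamma>"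
    and "(x, x') \<in> \<Gamma> \<Longrightarrow> (y, y') \<in> \<Gamma> \<Longrightarrow> (x * y, x' * y') \<in> \<Gamma>" for x x' y y'
    using assms by (auto simp: subring_rel_def)
  show 0: "(0, 0) \<in> \<Gamma>" using d[OF 1 1] by simp
  show m: "(x, x') \<in> \<Gamma> \<Longrightarrow> (- x, - x') \<in> \<Gamma>" for x x' using d[OF 0, of x x'] by simp
  show "(x, x') \<in> \<Gamma> \<Longrightarrow> (y, y') \<in> \<Gamma> \<Longrightarrow> (x + y, x' + y') \<in> \<Gamma>"
    using d[of x x' "- y" "- y'"] m[of y y'] by simp
qed

lemma subring_set_fst:
  assumes "subring_rel \<Gamma>" shows "subring_set (fst ` \<Gamma>)"
  unfolding subring_set_def
proof (intro conjI ballI)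
  show "1 \<in> fst ` \<Gamma>" using subring_relD(1)[OF assms] by (rule rev_image_eqI) simp
  fix x y assume "x \<in> fst ` \<Gamma>" "y \<in> fst ` \<Gamma>"
  then obtain x' y' where *: "(x, x') \<in> \<Gamma>" "(y, y') \<in> \<Gamma>" by auto
  show "x - y \<in> fst ` \<Gamma>" using subring_relD(3)[OF assms *] by (rule rev_image_eqI) simp
  show "x * y \<in> fst ` \<Gamma>" using subring_relD(4)[OF assms *] by (rule rev_image_eqI) simp
qed

lemma subring_set_snd:
  assumes "subring_rel \<Gamma>" shows "subring_set (snd ` \<Gamma>)"
  unfolding subring_set_def
proof (intro conjI ballI)
  show "1 \<in> snd ` \<Gamma>" using subring_relD(1)[OF assms] by (rule rev_image_eqI) simp
  fix x y assume "x \<in> snd ` \<Gamma>" "y \<in> snd ` \<Gamma>"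
  then obtain x' y' where *: "(x', x) \<in> \<Gamma>" "(y', y) \<in> \<Gamma>" by auto
  show "x - y \<in> snd ` \<Gamma>" using subring_relD(3)[OF assms *] by (rule rev_image_eqI) simp
  show "x * y \<in> snd ` \<Gamma>" using subring_relD(4)[OF assms *] by (rule rev_image_eqI) simp
qed

lemma subring_rel_sum:
  assumes "subring_rel \<Gamma>" "\<And>i. i \<in> A \<Longrightarrow> (f i, g i) \<in> \<Gamma>"
  shows "(sum f A, sum g A) \<in> \<Gamma>"
  using assms(2) by (induction A rule: infinite_finite_induct) (auto simp: subring_relD[OF assms(1)])

definition poly_rel :: "('r::comm_ring_1 \<times> 'r) set \<Rightarrow> 'r poly \<Rightarrow> 'r poly \<Rightarrow> bool" where
  "poly_rel \<Gamma> p p' \<longleftrightarrow> (\<forall>i. (Polynomial.coeff p i, Polynomial.coeff p' i) \<in> \<Gamma>)"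

definition adjoin_rel :: "('r::comm_ring_1 \<times> 'r) set \<Rightarrow> 'r \<Rightarrow> 'r \<Rightarrow> ('r \<times> 'r) set" where
  "adjoin_rel \<Gamma> x x' = {(poly p x, poly p' x') | p p'. poly_rel \<Gamma> p p'}"

lemma subring_rel_adjoin:
  assumes G: "subring_rel \<Gamma>"
  shows "subring_rel (adjoin_rel \<Gamma> x x')" "\<Gamma> \<subseteq> adjoin_rel \<Gamma> x x'" "(x, x') \<in> adjoin_rel \<Gamma> x x'"
proof -
  note G' = subring_relD[OF G]
  have const: "poly_rel \<Gamma> [:a:] [:b:]" if "(a, b) \<in> \<Gamma>" for a b
    using that by (auto simp: poly_rel_def coeff_pCons G' split: nat.splits)
  show sub: "\<Gamma> \<subseteq> adjoin_rel \<Gamma> x x'"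
  proof
    fix ab assume "ab \<in> \<Gamma>"
    then obtain a b where "ab = (a, b)" "poly_rel \<Gamma> [:a:] [:b:]" using const by (cases ab) auto
    then show "ab \<in> adjoin_rel \<Gamma> x x'"
      unfolding adjoin_rel_def by (intro CollectI exI[of _ "[:a:]"] exI[of _ "[:b:]"]) simp
  qed
  show "(x, x') \<in> adjoin_rel \<Gamma> x x'"
    unfolding adjoin_rel_def
    by (intro CollectI exI[of _ "[:0, 1:]"])
       (auto simp: poly_rel_def coeff_pCons G' split: nat.splits)
  show "subring_rel (adjoin_rel \<Gamma> x x')"
    unfolding subring_rel_def
  proof (intro conjI ballI, goal_cases)
    case 1
    show ?case using sub G'(1) by blast
  next
    case (2 ab)
    show ?case
    proof (cases ab, clarsimp)
      fix a b c d assume *: "ab = (a, b)" "(c, d) \<in> adjoin_rel \<Gamma> x x'"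
      from 2 *(1) obtain p p' where p: "poly_rel \<Gamma> p p'" "a = poly p x" "b = poly p' x'"
        by (auto simp: adjoin_rel_def)
      from * obtain q q' where q: "poly_rel \<Gamma> q q'" "c = poly q x" "d = poly q' x'"
        by (auto simp: adjoin_rel_def)
      have "poly_rel \<Gamma> (p - q) (p' - q')" "poly_rel \<Gamma> (p * q) (p' * q')"
        using p q by (auto simp: poly_rel_def G' coeff_mult intro!: subring_rel_sum[OF G])
      then show "(a - c, b - d) \<in> adjoin_rel \<Gamma> x x' \<and> (a * c, b * d) \<in> adjoin_rel \<Gamma> x x'"
        unfolding p q adjoin_rel_def by (auto simp flip: poly_diff poly_mult)
    qed
  qed
qed

lemma subring_rel_poly:
  assumes G: "subring_rel \<Gamma>" and x: "(x, x') \<in> \<Gamma>"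
  shows "poly_rel \<Gamma> p p' \<Longrightarrow> (poly p x, poly p' x') \<in> \<Gamma>"
proof (induction p arbitrary: p')
  case 0
  have p': "(0, Polynomial.coeff p' i) \<in> \<Gamma>" for i using 0 by (simp add: poly_rel_def)
  have "(0, y) \<in> \<Gamma> \<Longrightarrow> (x, z) \<in> \<Gamma> \<Longrightarrow> (0, z * y) \<in> \<Gamma>" for y z
    using subring_relD(4)[OF G, of x z 0 y] by simp
  have "(0, poly q x') \<in> \<Gamma>" if "\<And>i. (0, Polynomial.coeff q i) \<in> \<Gamma>" for q
    using that
  proof (induction q)
    case (pCons a q)
    have "(0, a) \<in> \<Gamma>" using pCons.prems[of 0] by simp
    moreover have "(0, poly q x') \<in> \<Gamma>"
      using pCons.prems[of "Suc i" for i] by (intro pCons.IH) simp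
    ultimately show ?case
      using subring_relD(6)[OF G, of 0 a "x * 0" "x' * poly q x'"] subring_relD(4)[OF G x, of 0 "poly q x'"] by simp
  qed (simp add: subring_relD[OF G])
  then show ?case using p' by simp
next
  case (pCons a p)
  obtain b q where p': "p' = pCons b q" by (cases p')
  have 1: "(a, b) \<in> \<Gamma>" using pCons.prems[unfolded poly_rel_def, rule_format, of 0] by (simp add: p')
  have "poly_rel \<Gamma> p q"
    using pCons.prems[unfolded poly_rel_def, rule_format, of "Suc i" for i] by (simp add: p' poly_rel_def)
  from pCons.IH[OF this] show ?case
    unfolding p' using 1 x by (simp add: subring_relD[OF G])
qed

lemma adjoin_rel_least:
  assumes "subring_rel \<Delta>" "\<Gamma> \<subseteq> \<Delta>" "(x, x') \<in> \<Delta>"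
  shows "adjoin_rel \<Gamma> x x' \<subseteq> \<Delta>"
  unfolding adjoin_rel_def using assms subring_rel_poly[OF assms(1,3)]
  by (force simp: poly_rel_def)

primrec tower :: "'r::comm_ring_1 set \<Rightarrow> (nat \<Rightarrow> 'r) \<Rightarrow> nat \<Rightarrow> 'r set" where
  "tower B \<xi> 0 = B"
| "tower B \<xi> (Suc n) = adjoin (tower B \<xi> n) (\<xi> n)"

primrec rel_tower :: "('r::comm_ring_1 \<times> 'r) set \<Rightarrow> (nat \<Rightarrow> 'r) \<Rightarrow> (nat \<Rightarrow> 'r) \<Rightarrow> nat \<Rightarrow> ('r \<times> 'r) set" where
  "rel_tower \<Gamma> \<xi> \<xi>' 0 = \<Gamma>"
| "rel_tower \<Gamma> \<xi> \<xi>' (Suc n) = adjoin_rel (rel_tower \<Gamma> \<xi> \<xi>' n) (\<xi> n) (\<xi>' n)"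

text \<open>
  The subring of \<open>R \<times> R\<close> generated over \<open>\<Gamma>\<close> by the pairs \<open>(\<xi> n, \<xi>' n)\<close>.
\<close>

definition rel_lim :: "('r::comm_ring_1 \<times> 'r) set \<Rightarrow> (nat \<Rightarrow> 'r) \<Rightarrow> (nat \<Rightarrow> 'r) \<Rightarrow> ('r \<times> 'r) set" where
  "rel_lim \<Gamma> \<xi> \<xi>' = (\<Union>n. rel_tower \<Gamma> \<xi> \<xi>' n)"

lemma subring_rel_tower: "subring_rel \<Gamma> \<Longrightarrow> subring_rel (rel_tower \<Gamma> \<xi> \<xi>' n)"
  by (induction n) (auto intro: subring_rel_adjoin)

lemma rel_tower_mono:
  assumes "subring_rel \<Gamma>" "m \<le> n" shows "rel_tower \<Gamma> \<xi> \<xi>' m \<subseteq> rel_tower \<Gamma> \<xi> \<xi>' n"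
  using assms(2)
proof (induction rule: dec_induct)
  case (step k)
  then show ?case
    using subring_rel_adjoin(2)[OF subring_rel_tower[OF assms(1), of \<xi> \<xi>' k], of "\<xi> k" "\<xi>' k"] by auto
qed simp

lemma rel_lim_subring:
  assumes G: "subring_rel \<Gamma>"
  shows "subring_rel (rel_lim \<Gamma> \<xi> \<xi>')" "\<Gamma> \<subseteq> rel_lim \<Gamma> \<xi> \<xi>'" "(\<xi> n, \<xi>' n) \<in> rel_lim \<Gamma> \<xi> \<xi>'"
proof -
  show s: "\<Gamma> \<subseteq> rel_lim \<Gamma> \<xi> \<xi>'" unfolding rel_lim_def using rel_tower.simps(1) by blast
  have "(\<xi> n, \<xi>' n) \<in> rel_tower \<Gamma> \<xi> \<xi>' (Suc n)"
    using subring_rel_adjoin(3)[OF subring_rel_tower[OF G]] by simp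
  then show "(\<xi> n, \<xi>' n) \<in> rel_lim \<Gamma> \<xi> \<xi>'" unfolding rel_lim_def by blast
  have *: "\<exists>n. ab \<in> rel_tower \<Gamma> \<xi> \<xi>' n \<and> cd \<in> rel_tower \<Gamma> \<xi> \<xi>' n"
    if "ab \<in> rel_lim \<Gamma> \<xi> \<xi>'" "cd \<in> rel_lim \<Gamma> \<xi> \<xi>'" for ab cd
  proof -
    from that obtain m n where "ab \<in> rel_tower \<Gamma> \<xi> \<xi>' m" "cd \<in> rel_tower \<Gamma> \<xi> \<xi>' n"
      by (auto simp: rel_lim_def)
    then show ?thesis
      using rel_tower_mono[OF G, of m "max m n" \<xi> \<xi>'] rel_tower_mono[OF G, of n "max m n" \<xi> \<xi>']
      by (intro exI[of _ "max m n"]) auto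
  qed
  show "subring_rel (rel_lim \<Gamma> \<xi> \<xi>')"
    unfolding subring_rel_def
  proof (intro conjI ballI, goal_cases)
    case 1 show ?case using s subring_relD(1)[OF G] by blast
  next
    case (2 ab)
    show ?case
    proof (cases ab, clarsimp)
      fix a b c d assume "ab = (a, b)" "(c, d) \<in> rel_lim \<Gamma> \<xi> \<xi>'"
      with 2 obtain n where "(a, b) \<in> rel_tower \<Gamma> \<xi> \<xi>' n" "(c, d) \<in> rel_tower \<Gamma> \<xi> \<xi>' n"
        using *[of "(a, b)" "(c, d)"] by auto
      then have "(a - c, b - d) \<in> rel_tower \<Gamma> \<xi> \<xi>' n" "(a * c, b * d) \<in> rel_tower \<Gamma> \<xi> \<xi>' n"
        by (simp_all add: subring_relD[OF subring_rel_tower[OF G]])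
      then show "(a - c, b - d) \<in> rel_lim \<Gamma> \<xi> \<xi>' \<and> (a * c, b * d) \<in> rel_lim \<Gamma> \<xi> \<xi>'"
        unfolding rel_lim_def by blast
    qed
  qed
qed

lemma rel_lim_least:
  assumes "subring_rel \<Delta>" "\<Gamma> \<subseteq> \<Delta>" "\<And>n. (\<xi> n, \<xi>' n) \<in> \<Delta>"
  shows "rel_lim \<Gamma> \<xi> \<xi>' \<subseteq> \<Delta>"
proof -
  have "rel_tower \<Gamma> \<xi> \<xi>' n \<subseteq> \<Delta>" for n
    by (induction n) (use assms adjoin_rel_least[OF assms(1)] in auto)
  then show ?thesis by (auto simp: rel_lim_def)
qed

section \<open>Adjoining solutions of additive equations\<close>

text \<open>
  A ring with an endomorphism whose fixed ring is a field \<open>C\<close>, embedded by \<open>e\<close>.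
\<close>

locale sigma_ring =
  fixes sg :: "'r::comm_ring_1 \<Rightarrow> 'r" and e :: "'c::field_char_0 \<Rightarrow> 'r"
  assumes sg_add: "sg (x + y) = sg x + sg y" and sg_mult: "sg (x * y) = sg x * sg y" and sg_1: "sg 1 = 1"
    and e_add: "e (c + d) = e c + e d" and e_mult: "e (c * d) = e c * e d" and e_1: "e 1 = 1"
    and sg_fixed: "sg x = x \<longleftrightarrow> x \<in> range e"
begin

lemma sg_0: "sg 0 = 0" using sg_add[of 0 0] by (metis add.right_neutral add_left_cancel)

lemma sg_uminus: "sg (- x) = - sg x"
  using sg_add[of x "- x"] by (simp add: sg_0 eq_neg_iff_add_eq_0 add.commute)

lemma sg_diff: "sg (x - y) = sg x - sg y"
  using sg_add[of x "- y"] by (simp add: sg_uminus)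

lemma sg_sum: "sg (sum f A) = (\<Sum>i\<in>A. sg (f i))"
  by (induction A rule: infinite_finite_induct) (simp_all add: sg_0 sg_add)

lemma sg_e [simp]: "sg (e c) = e c" using sg_fixed by blast

lemma e_0: "e 0 = 0" using e_add[of 0 0] by (metis add.right_neutral add_left_cancel)

lemma e_uminus: "e (- c) = - e c"
  using e_add[of c "- c"] by (simp add: e_0 eq_neg_iff_add_eq_0 add.commute)

lemma e_diff: "e (c - d) = e c - e d"
  using e_add[of c "- d"] by (simp add: e_uminus)

lemma e_of_nat: "e (of_nat n) = of_nat n"
  by (induction n) (simp_all add: e_0 e_1 e_add)

lemma e_inverse: "c \<noteq> 0 \<Longrightarrow> e c * e (inverse c) = 1"
  by (simp add: e_1 flip: e_mult)

lemma e_eq_0_iff [simp]: "e c = 0 \<longleftrightarrow> c = 0"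
  using e_inverse[of c] by (cases "c = 0") (auto simp: e_0)

lemma e_eq_iff: "e c = e d \<longleftrightarrow> c = d"
  using e_eq_0_iff[of "c - d"] by (simp add: e_diff)

lemma sg_poly: "sg (poly p x) = poly (map_poly sg p) (sg x)"
  by (induction p) (simp_all add: map_poly_pCons sg_0 sg_add sg_mult)

definition sg_ideal :: "'r set \<Rightarrow> 'r set \<Rightarrow> bool" where
  "sg_ideal B I \<longleftrightarrow> I \<subseteq> B \<and> 0 \<in> I \<and> (\<forall>x\<in>I. \<forall>y\<in>I. x + y \<in> I) \<and>
     (\<forall>b\<in>B. \<forall>x\<in>I. b * x \<in> I) \<and> (\<forall>x\<in>I. sg x \<in> I)"

definition sg_simple :: "'r set \<Rightarrow> bool" where
  "sg_simple B \<longleftrightarrow> subring_set B \<and> range e \<subseteq> B \<and> sg ` B \<subseteq> B \<and>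
     (\<forall>I. sg_ideal B I \<longrightarrow> I = {0} \<or> 1 \<in> I)"

lemma sg_ideal_0: "0 \<in> B \<Longrightarrow> sg_ideal B {0}"
  by (simp add: sg_ideal_def sg_0)

context
  fixes B :: "'r set" and \<tau> \<omega> :: 'r
  assumes B: "sg_simple B" and \<tau>: "sg \<tau> = \<tau> + \<omega>" and \<omega>: "\<omega> \<in> B"
    and not_summable: "\<And>g. g \<in> B \<Longrightarrow> sg g - g \<noteq> \<omega>"
begin

lemma sub_B: "subring_set B" and e_B: "e c \<in> B" and sg_B: "b \<in> B \<Longrightarrow> sg b \<in> B"
  using B by (auto simp: sg_simple_def)

lemmas BD = subring_setD[OF sub_B]
lemmas BP = poly_over_closed[OF sub_B]

definition sg_poly_shift :: "'r poly \<Rightarrow> 'r poly" where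
  "sg_poly_shift p = pcompose (map_poly sg p) [:\<omega>, 1:]"

lemma poly_over_sg: "poly_over B p \<Longrightarrow> poly_over B (sg_poly_shift p)"
  unfolding sg_poly_shift_def
  by (intro BP) (auto simp: poly_over_def coeff_map_poly sg_0 sg_B \<omega> BD coeff_pCons split: nat.splits)

lemma poly_sg_poly_shift: "poly (sg_poly_shift p) \<tau> = sg (poly p \<tau>)"
  by (simp add: sg_poly_shift_def poly_pcompose sg_poly \<tau> add.commute)

lemma sg_poly_shift_coeff:
  assumes "\<And>i. i > n \<Longrightarrow> Polynomial.coeff p i = 0"
  shows "i > n \<Longrightarrow> Polynomial.coeff (sg_poly_shift p) i = 0"
    "Polynomial.coeff (sg_poly_shift p) n = sg (Polynomial.coeff p n)"
    "n > 0 \<Longrightarrow> Polynomial.coeff (sg_poly_shift p) (n - 1) =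
       sg (Polynomial.coeff p (n - 1)) + of_nat n * \<omega> * sg (Polynomial.coeff p n)"
  using pcompose_linear_coeff[of n "map_poly sg p" \<omega>] assms
  by (auto simp: sg_poly_shift_def coeff_map_poly sg_0)

lemma not_summable_coeff:
  assumes "b \<in> B" "n > 0" "c \<noteq> 0"
  shows "sg b + of_nat n * \<omega> * e c - b \<noteq> 0"
proof
  assume *: "sg b + of_nat n * \<omega> * e c - b = 0"
  define d where "d = e (inverse (of_nat n * c))"
  have "e (of_nat n * c) * d = 1" unfolding d_def using assms by (intro e_inverse) simp
  then have 1: "of_nat n * e c * d = 1" by (simp add: e_mult e_of_nat)
  have dd: "sg d = d" by (simp add: d_def)
  have "sg (- d * b) - (- d * b) = - d * (sg b - b)"
    by (simp add: sg_mult sg_uminus dd algebra_simps)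
  also have "sg b - b = - (of_nat n * \<omega> * e c)" using * by (simp add: algebra_simps eq_neg_iff_add_eq_0)
  also have "- d * (- (of_nat n * \<omega> * e c)) = (of_nat n * e c * d) * \<omega>" by (simp add: algebra_simps)
  also have "\<dots> = \<omega>" using 1 by simp
  finally show False
    using not_summable[of "- d * b"] assms(1) e_B by (simp add: BD d_def)
qed

text \<open>
  The leading coefficients of the polynomials of least degree \<open>n\<close> over \<open>B\<close> whose value at \<open>\<tau>\<close> lies in \<open>I\<close>
  form a \<open>\<sigma>\<close>-stable ideal of \<open>B\<close>, so one of them, \<open>q\<close>, is monic. Then \<open>\<sigma>(q) - q\<close> has smaller degree, hence is
  \<open>0\<close>; if \<open>n > 0\<close>, its coefficient of degree \<open>n - 1\<close> says that \<open>n \<omega>\<close> is summable in \<open>B\<close>. So \<open>n = 0\<close> and \<open>q = 1\<close>.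
  Applied to \<open>I = 0\<close> this is transcendence of \<open>\<tau>\<close>, applied to all \<open>I\<close> it is \<open>\<sigma>\<close>-simplicity of \<open>B[\<tau>]\<close>.
\<close>

lemma relation_imp_unit:
  assumes I: "sg_ideal (adjoin B \<tau>) I" and p: "poly_over B p" "p \<noteq> 0" "poly p \<tau> \<in> I"
  shows "1 \<in> I"
proof -
  define J where "J = {p. poly_over B p \<and> poly p \<tau> \<in> I}"
  define p0 where "p0 = arg_min Polynomial.degree (\<lambda>p. p \<noteq> 0 \<and> p \<in> J)"
  have "p \<noteq> 0 \<and> p \<in> J" using p by (simp add: J_def)
  from arg_min_nat_lemma[of "\<lambda>p. p \<noteq> 0 \<and> p \<in> J", OF this, of Polynomial.degree]
  have p0: "p0 \<noteq> 0" "p0 \<in> J"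
    and min: "\<And>q. q \<noteq> 0 \<Longrightarrow> q \<in> J \<Longrightarrow> Polynomial.degree p0 \<le> Polynomial.degree q"
    unfolding p0_def by auto
  define n where "n = Polynomial.degree p0"
  have I': "0 \<in> I" "\<And>x y. x \<in> I \<Longrightarrow> y \<in> I \<Longrightarrow> x + y \<in> I" "\<And>x. x \<in> I \<Longrightarrow> sg x \<in> I"
    "\<And>b x. b \<in> adjoin B \<tau> \<Longrightarrow> x \<in> I \<Longrightarrow> b * x \<in> I"
    using I by (auto simp: sg_ideal_def)
  have bI: "b * x \<in> I" if "b \<in> B" "x \<in> I" for b x
    using I'(4)[OF _ that(2)] adjoin_supset[OF sub_B] that by blast
  have J_diff: "q - r \<in> J" if "q \<in> J" "r \<in> J" for q r
  proof -
    have "(- 1) * poly r \<tau> \<in> I"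
      using that bI[of "- 1" "poly r \<tau>"] BD by (simp add: J_def)
    then have "poly q \<tau> + (- 1) * poly r \<tau> \<in> I"
      using that I'(2)[of "poly q \<tau>" "(- 1) * poly r \<tau>"] by (auto simp: J_def)
    then show ?thesis using that by (simp add: J_def BP)
  qed
  have J_sg: "sg_poly_shift q \<in> J" if "q \<in> J" for q
    using that I'(3) by (simp add: J_def poly_over_sg poly_sg_poly_shift)
  define A where "A = {Polynomial.coeff q n | q. q \<in> J \<and> (\<forall>i>n. Polynomial.coeff q i = 0)}"
  have "sg_ideal B A"
    unfolding sg_ideal_def
  proof (intro conjI ballI)
    show "A \<subseteq> B" by (auto simp: A_def J_def poly_over_def)
    show "0 \<in> A" unfolding A_def J_def using I'(1) BP(1) by (intro CollectI exI[of _ 0]) simp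
  next
    fix x y assume "x \<in> A" "y \<in> A"
    then obtain q r where *: "q \<in> J" "r \<in> J" "\<forall>i>n. Polynomial.coeff q i = 0" "\<forall>i>n. Polynomial.coeff r i = 0"
      "x = Polynomial.coeff q n" "y = Polynomial.coeff r n" by (auto simp: A_def)
    have "q + r \<in> J" using * I'(2) by (simp add: J_def BP)
    then show "x + y \<in> A" unfolding A_def using * by (intro CollectI exI[of _ "q + r"]) simp
  next
    fix b x assume "b \<in> B" "x \<in> A"
    then obtain q where *: "q \<in> J" "\<forall>i>n. Polynomial.coeff q i = 0" "x = Polynomial.coeff q n" by (auto simp: A_def)
    have "[:b:] * q \<in> J" using * bI \<open>b \<in> B\<close> BP(5)[of "[:b:]" q] by (simp add: J_def BP)
    then show "b * x \<in> A" unfolding A_def using * by (intro CollectI exI[of _ "[:b:] * q"]) simp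
  next
    fix x assume "x \<in> A"
    then obtain q where *: "q \<in> J" "\<forall>i>n. Polynomial.coeff q i = 0" "x = Polynomial.coeff q n" by (auto simp: A_def)
    then show "sg x \<in> A" unfolding A_def
      using J_sg[OF *(1)] sg_poly_shift_coeff[of n q] by (intro CollectI exI[of _ "sg_poly_shift q"]) auto
  qed
  moreover have "Polynomial.coeff p0 n \<in> A" "Polynomial.coeff p0 n \<noteq> 0"
    using p0 by (auto simp: A_def n_def coeff_eq_0)
  ultimately have "1 \<in> A" using B by (auto simp: sg_simple_def)
  then obtain q where q: "q \<in> J" "\<And>i. i > n \<Longrightarrow> Polynomial.coeff q i = 0" "Polynomial.coeff q n = 1" by (auto simp: A_def)
  show ?thesis
  proof (cases "n = 0")
    case True
    then have "q = [:1:]" using q by (intro poly_eqI) (auto simp: coeff_pCons split: nat.splits)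
    then show ?thesis using q(1) by (simp add: J_def)
  next
    case False
    define r where "r = sg_poly_shift q - q"
    have "r \<in> J" unfolding r_def using q(1) J_sg J_diff by blast
    have "Polynomial.coeff r i = 0" if "i \<ge> n" for i
      using sg_poly_shift_coeff[of n q, OF q(2)] q(2)[of i] q(3) that sg_1
      by (cases "i = n") (auto simp: r_def)
    then have "r = 0 \<or> Polynomial.degree r < n"
      using leading_coeff_0_iff[of r] by (meson not_le)
    then have "r = 0" using min[OF _ \<open>r \<in> J\<close>] n_def by force
    then have "Polynomial.coeff r (n - 1) = 0" by simp
    then have "sg (Polynomial.coeff q (n - 1)) + of_nat n * \<omega> * e 1 - Polynomial.coeff q (n - 1) = 0"
      using sg_poly_shift_coeff(3)[of n q, OF q(2)] False q(3) by (simp add: r_def sg_1 e_1)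
    moreover have "Polynomial.coeff q (n - 1) \<in> B" using q(1) by (simp add: J_def poly_over_def)
    ultimately show ?thesis using not_summable_coeff[of "Polynomial.coeff q (n - 1)" n 1] False by simp
  qed
qed

lemma transcendental_adjoin: "poly_over B p \<Longrightarrow> poly p \<tau> = 0 \<Longrightarrow> p = 0"
  using relation_imp_unit[OF sg_ideal_0, of p] subring_setD(2)[OF subring_set_adjoin[OF sub_B]] by auto

lemma sg_simple_adjoin: "sg_simple (adjoin B \<tau>)"
  unfolding sg_simple_def
proof (intro conjI allI impI)
  show "subring_set (adjoin B \<tau>)" by (rule subring_set_adjoin[OF sub_B])
  show "range e \<subseteq> adjoin B \<tau>" using adjoin_supset[OF sub_B] e_B by blast
  show "sg ` adjoin B \<tau> \<subseteq> adjoin B \<tau>"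
    by (auto simp: adjoin_def poly_sg_poly_shift[symmetric] intro: poly_over_sg)
next
  fix I assume I: "sg_ideal (adjoin B \<tau>) I"
  show "I = {0} \<or> 1 \<in> I"
  proof (cases "I = {0}")
    case False
    then obtain x where x: "x \<in> I" "x \<noteq> 0" using I by (auto simp: sg_ideal_def)
    then obtain p where "poly_over B p" "x = poly p \<tau>" using I by (auto simp: sg_ideal_def adjoin_def)
    moreover from this have "p \<noteq> 0" using \<open>x \<noteq> 0\<close> by auto
    ultimately show ?thesis using relation_imp_unit[OF I, of p] \<open>x \<in> I\<close> by auto
  qed simp
qed

text \<open>
  Comparing the two top coefficients of \<open>\<sigma>(p)\<close> and \<open>p\<close>: a solution in \<open>B[\<tau>]\<close> of an additive equation over \<open>B\<close>
  is linear in \<open>\<tau>\<close> with constant leading coefficient.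
\<close>

lemma summable_adjoin:
  assumes g: "g \<in> adjoin B \<tau>" and d: "sg g - g \<in> B"
  shows "\<exists>c. g - e c * \<tau> \<in> B"
proof -
  from g obtain p where p: "poly_over B p" "g = poly p \<tau>" by (auto simp: adjoin_def)
  define n where "n = Polynomial.degree p"
  define q where "q = sg_poly_shift p - p - [:sg g - g:]"
  have "poly_over B q" unfolding q_def using p d by (auto intro!: BP poly_over_sg simp: BP)
  moreover have "poly q \<tau> = 0" by (simp add: q_def poly_sg_poly_shift p)
  ultimately have q: "q = 0" by (rule transcendental_adjoin)
  have pi: "\<And>i. i > n \<Longrightarrow> Polynomial.coeff p i = 0" by (simp add: n_def coeff_eq_0)
  note sh = sg_poly_shift_coeff[of n p, OF pi]
  have q': "Polynomial.coeff (sg_poly_shift p) i - Polynomial.coeff p i = (if i = 0 then sg g - g else 0)" for i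
    using arg_cong[OF q, of "\<lambda>q. Polynomial.coeff q i"] by (simp add: q_def coeff_pCons split: nat.splits)
  show ?thesis
  proof (cases "n = 0")
    case True
    then obtain c where "p = [:c:]" unfolding n_def by (rule degree_eq_zeroE)
    then have "g \<in> B" using p by (simp add: BP)
    then show ?thesis by (intro exI[of _ 0]) (simp add: e_0)
  next
    case False
    then have "sg (Polynomial.coeff p n) = Polynomial.coeff p n" using q'[of n] sh(2) by simp
    then obtain c where c: "Polynomial.coeff p n = e c" using sg_fixed by blast
    have "e c \<noteq> 0" using False c unfolding n_def by (metis degree_0 leading_coeff_0_iff)
    have "n = 1"
    proof (rule ccontr)
      assume "n \<noteq> 1"
      then have "n > 1" using False by simp
      then have "sg (Polynomial.coeff p (n - 1)) + of_nat n * \<omega> * e c - Polynomial.coeff p (n - 1) = 0"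
        using q'[of "n - 1"] sh(3) c by simp
      moreover have "Polynomial.coeff p (n - 1) \<in> B" using p by (simp add: poly_over_def)
      ultimately show False using not_summable_coeff \<open>e c \<noteq> 0\<close> \<open>n > 1\<close> by auto
    qed
    then have "p = [:Polynomial.coeff p 0, e c:]"
      using c pi by (intro poly_eqI) (auto simp: coeff_pCons split: nat.splits)
    then have "g = Polynomial.coeff p 0 + \<tau> * e c"
      unfolding p(2) by (metis poly_pCons poly_0 mult_zero_right add_0_right)
    then show ?thesis using p(1) by (intro exI[of _ c]) (simp add: poly_over_def mult.commute)
  qed
qed

end

text \<open>
  The additive case of the Kolchin-Ostrowski theorem: the elements \<open>\<xi> 0, \<xi> 1, \<dots>\<close> are algebraically independent
  over \<open>B\<close> as soon as no nontrivial \<open>C\<close>-linear combination of their increments \<open>\<omega> n\<close> is summable in \<open>B\<close>. The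
  invariant carried up the tower is the description of all solutions of additive equations over \<open>B\<close>; it
  shows that \<open>\<omega> n\<close> stays unsummable.
\<close>

theorem sg_tower:
  assumes B: "sg_simple B" and \<xi>: "\<And>n. sg (\<xi> n) = \<xi> n + \<omega> n" and \<omega>: "\<And>n. \<omega> n \<in> B"
    and indep: "\<And>n c g. g \<in> B \<Longrightarrow> (\<Sum>j<n. e (c j) * \<omega> j) = sg g - g \<Longrightarrow> \<forall>j<n. c j = 0"
  shows "sg_simple (tower B \<xi> n) \<and> B \<subseteq> tower B \<xi> n \<and>
    (\<forall>g\<in>tower B \<xi> n. sg g - g \<in> B \<longrightarrow> (\<exists>c. g - (\<Sum>j<n. e (c j) * \<xi> j) \<in> B))"
    and "g \<in> tower B \<xi> n \<Longrightarrow> sg g - g \<noteq> \<omega> n"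
proof -
  have sub: "subring_set B" and e_B: "e c \<in> B" for c using B by (auto simp: sg_simple_def)
  note BD = subring_setD[OF sub]
  have ns: "sg g - g \<noteq> \<omega> n"
    if g: "g \<in> tower B \<xi> n" and IH: "\<forall>g\<in>tower B \<xi> n. sg g - g \<in> B \<longrightarrow> (\<exists>c. g - (\<Sum>j<n. e (c j) * \<xi> j) \<in> B)"
    for g n
  proof
    assume eq: "sg g - g = \<omega> n"
    then obtain c where c: "g - (\<Sum>j<n. e (c j) * \<xi> j) \<in> B" using IH g \<omega> by metis
    define h where "h = g - (\<Sum>j<n. e (c j) * \<xi> j)"
    have "sg h - h = \<omega> n - (\<Sum>j<n. e (c j) * \<omega> j)"
      unfolding h_def sg_diff sg_sum sg_mult sg_e \<xi> using eq
      by (simp add: algebra_simps sum.distrib)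
    then have "(\<Sum>j<Suc n. e (if j = n then 1 else - c j) * \<omega> j) = sg h - h"
      by (simp add: e_1 e_uminus sum_negf)
    from indep[OF c[folded h_def] this] have "(1 :: 'c) = 0" by (metis (full_types) lessI)
    then show False by simp
  qed
  have main: "sg_simple (tower B \<xi> n) \<and> B \<subseteq> tower B \<xi> n \<and>
    (\<forall>g\<in>tower B \<xi> n. sg g - g \<in> B \<longrightarrow> (\<exists>c. g - (\<Sum>j<n. e (c j) * \<xi> j) \<in> B))" for n
  proof (induction n)
    case 0
    show ?case using B by simp
  next
    case (Suc n)
    let ?T = "tower B \<xi> n"
    from Suc have T: "sg_simple ?T" "B \<subseteq> ?T" and
      IH: "\<forall>g\<in>?T. sg g - g \<in> B \<longrightarrow> (\<exists>c. g - (\<Sum>j<n. e (c j) * \<xi> j) \<in> B)" by auto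
    have \<omega>T: "\<omega> n \<in> ?T" using T \<omega> by blast
    have ns': "\<And>g. g \<in> ?T \<Longrightarrow> sg g - g \<noteq> \<omega> n" using ns IH by blast
    have "sg_simple (tower B \<xi> (Suc n))"
      using sg_simple_adjoin[OF T(1) \<xi> \<omega>T ns'] by simp
    moreover have "B \<subseteq> tower B \<xi> (Suc n)"
      using T adjoin_supset[of ?T "\<xi> n"] by (auto simp: sg_simple_def)
    moreover have "\<exists>c. g - (\<Sum>j<Suc n. e (c j) * \<xi> j) \<in> B"
      if g: "g \<in> tower B \<xi> (Suc n)" "sg g - g \<in> B" for g
    proof -
      obtain d where d: "g - e d * \<xi> n \<in> ?T"
        using summable_adjoin[OF T(1) \<xi> \<omega>T ns', of g] g T(2) by auto
      have "sg (g - e d * \<xi> n) - (g - e d * \<xi> n) = (sg g - g) - e d * \<omega> n"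
        by (simp add: sg_diff sg_mult \<xi> algebra_simps)
      also have "\<dots> \<in> B" using g(2) \<omega> e_B BD(3)[of "sg g - g" "e d * \<omega> n"] BD(4) by blast
      finally have "sg (g - e d * \<xi> n) - (g - e d * \<xi> n) \<in> B" .
      then obtain c where c: "g - e d * \<xi> n - (\<Sum>j<n. e (c j) * \<xi> j) \<in> B" using IH d by blast
      have "(\<Sum>j<n. e (if j = n then d else c j) * \<xi> j) = (\<Sum>j<n. e (c j) * \<xi> j)"
        by (intro sum.cong) auto
      then show ?thesis using c
        by (intro exI[of _ "\<lambda>j. if j = n then d else c j"]) (simp add: algebra_simps)
    qed
    ultimately show ?case by blast
  qed
  show "sg_simple (tower B \<xi> n) \<and> B \<subseteq> tower B \<xi> n \<and>
    (\<forall>g\<in>tower B \<xi> n. sg g - g \<in> B \<longrightarrow> (\<exists>c. g - (\<Sum>j<n. e (c j) * \<xi> j) \<in> B))" by (rule main)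
  show "g \<in> tower B \<xi> n \<Longrightarrow> sg g - g \<noteq> \<omega> n" using ns main by blast
qed

lemma adjoin_rel_functional:
  assumes tr: "\<And>p. poly_over B p \<Longrightarrow> poly p x = 0 \<Longrightarrow> p = 0"
    and \<Gamma>: "\<And>r s. (r, s) \<in> \<Gamma> \<Longrightarrow> r \<in> B" "\<And>s. (0, s) \<in> \<Gamma> \<Longrightarrow> s = 0"
    and 0: "(0, s) \<in> adjoin_rel \<Gamma> x x'"
  shows "s = 0"
proof -
  from 0 obtain p p' where p: "poly_rel \<Gamma> p p'" "poly p x = 0" "s = poly p' x'"
    by (auto simp: adjoin_rel_def)
  have "p = 0" using tr p \<Gamma>(1) by (auto simp: poly_over_def poly_rel_def)
  then have "p' = 0" using p(1) \<Gamma>(2) by (intro poly_eqI) (auto simp: poly_rel_def)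
  then show ?thesis using p by simp
qed

text \<open>
  Independent elements can be sent anywhere: a single-valued relation stays single-valued after adjoining
  arbitrary images \<open>\<xi>' n\<close> of the \<open>\<xi> n\<close>.
\<close>

lemma rel_lim_functional:
  assumes B: "sg_simple B" and \<xi>: "\<And>n. sg (\<xi> n) = \<xi> n + \<omega> n" and \<omega>: "\<And>n. \<omega> n \<in> B"
    and indep: "\<And>n c g. g \<in> B \<Longrightarrow> (\<Sum>j<n. e (c j) * \<omega> j) = sg g - g \<Longrightarrow> \<forall>j<n. c j = 0"
    and \<Gamma>: "\<And>r s. (r, s) \<in> \<Gamma> \<Longrightarrow> r \<in> B" "\<And>s. (0, s) \<in> \<Gamma> \<Longrightarrow> s = 0"
    and 0: "(0, s) \<in> rel_lim \<Gamma> \<xi> \<xi>'"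
  shows "s = 0"
proof -
  have "(\<forall>r s. (r, s) \<in> rel_tower \<Gamma> \<xi> \<xi>' n \<longrightarrow> r \<in> tower B \<xi> n) \<and> (\<forall>s. (0, s) \<in> rel_tower \<Gamma> \<xi> \<xi>' n \<longrightarrow> s = 0)" for n
  proof (induction n)
    case (Suc n)
    have "sg_simple (tower B \<xi> n) \<and> B \<subseteq> tower B \<xi> n \<and>
      (\<forall>g\<in>tower B \<xi> n. sg g - g \<in> B \<longrightarrow> (\<exists>c. g - (\<Sum>j<n. e (c j) * \<xi> j) \<in> B))"
      by (rule sg_tower(1)[of B \<xi> \<omega>, OF B \<xi> \<omega>]) (rule indep)
    then have T: "sg_simple (tower B \<xi> n)" "B \<subseteq> tower B \<xi> n" by blast+
    have ns: "sg g - g \<noteq> \<omega> n" if "g \<in> tower B \<xi> n" for g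
      by (rule sg_tower(2)[of B \<xi> \<omega>, OF B \<xi> \<omega> _ that]) (rule indep)
    have \<omega>T: "\<omega> n \<in> tower B \<xi> n" using T \<omega> by blast
    have tr: "poly_over (tower B \<xi> n) p \<Longrightarrow> poly p (\<xi> n) = 0 \<Longrightarrow> p = 0" for p
      by (rule transcendental_adjoin[of "tower B \<xi> n" "\<xi> n" "\<omega> n"]) (use T \<xi> \<omega>T ns in auto)
    have mem: "r \<in> tower B \<xi> n" if "(r, s) \<in> rel_tower \<Gamma> \<xi> \<xi>' n" for r s
      using Suc that by blast
    have "r \<in> tower B \<xi> (Suc n)" if "(r, s) \<in> rel_tower \<Gamma> \<xi> \<xi>' (Suc n)" for r s
      using that mem unfolding rel_tower.simps tower.simps adjoin_rel_def adjoin_def poly_rel_def poly_over_def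
      by blast
    moreover have "s = 0" if "(0, s) \<in> rel_tower \<Gamma> \<xi> \<xi>' (Suc n)" for s
    proof (rule adjoin_rel_functional[where B = "tower B \<xi> n" and \<Gamma> = "rel_tower \<Gamma> \<xi> \<xi>' n"])
      show "(0, s) \<in> adjoin_rel (rel_tower \<Gamma> \<xi> \<xi>' n) (\<xi> n) (\<xi>' n)" using that by simp
      show "\<And>p. poly_over (tower B \<xi> n) p \<Longrightarrow> poly p (\<xi> n) = 0 \<Longrightarrow> p = 0" by (rule tr)
      show "\<And>r s. (r, s) \<in> rel_tower \<Gamma> \<xi> \<xi>' n \<Longrightarrow> r \<in> tower B \<xi> n" by (rule mem)
      show "\<And>s. (0, s) \<in> rel_tower \<Gamma> \<xi> \<xi>' n \<Longrightarrow> s = 0" using Suc by simp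
    qed
    ultimately show ?case by blast
  qed (use \<Gamma> in auto)
  then show ?thesis using 0 by (auto simp: rel_lim_def)
qed

end

section \<open>Adjoining solutions of multiplicative equations\<close>

locale sigma_algebra = sigma_ring sg e
  for sg :: "'r::comm_ring_1 \<Rightarrow> 'r" and e :: "'c::field_char_0 \<Rightarrow> 'r" +
  fixes \<iota> :: "'k::field \<Rightarrow> 'r" and sK :: "'k \<Rightarrow> 'k"
  assumes \<iota>_add: "\<iota> (f + g) = \<iota> f + \<iota> g" and \<iota>_mult: "\<iota> (f * g) = \<iota> f * \<iota> g" and \<iota>_1: "\<iota> 1 = 1"
    and sg_\<iota>: "sg (\<iota> f) = \<iota> (sK f)" and e_\<iota>: "e c \<in> range \<iota>"
begin

lemma \<iota>_0: "\<iota> 0 = 0" using \<iota>_add[of 0 0] by (metis add.right_neutral add_left_cancel)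

lemma \<iota>_uminus: "\<iota> (- f) = - \<iota> f"
  using \<iota>_add[of f "- f"] by (simp add: \<iota>_0 eq_neg_iff_add_eq_0 add.commute)

lemma \<iota>_diff: "\<iota> (f - g) = \<iota> f - \<iota> g"
  using \<iota>_add[of f "- g"] by (simp add: \<iota>_uminus)

lemma \<iota>_inverse: "f \<noteq> 0 \<Longrightarrow> \<iota> f * \<iota> (inverse f) = 1"
  by (simp add: \<iota>_1 flip: \<iota>_mult)

lemma \<iota>_eq_0_iff [simp]: "\<iota> f = 0 \<longleftrightarrow> f = 0"
  using \<iota>_inverse[of f] by (cases "f = 0") (auto simp: \<iota>_0)

lemma \<iota>_eq_iff: "\<iota> f = \<iota> g \<longleftrightarrow> f = g"
  using \<iota>_eq_0_iff[of "f - g"] by (simp add: \<iota>_diff)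

lemma \<iota>_sum: "\<iota> (sum f A) = (\<Sum>i\<in>A. \<iota> (f i))"
  by (induction A rule: infinite_finite_induct) (simp_all add: \<iota>_0 \<iota>_add)

lemma sK_mult: "sK (f * g) = sK f * sK g"
proof -
  have "\<iota> (sK (f * g)) = \<iota> (sK f * sK g)" by (simp only: sg_\<iota>[symmetric] \<iota>_mult sg_mult)
  then show ?thesis by (simp only: \<iota>_eq_iff)
qed

lemma sK_1: "sK 1 = 1"
proof -
  have "\<iota> (sK 1) = \<iota> 1" by (simp only: sg_\<iota>[symmetric] \<iota>_1 sg_1)
  then show ?thesis by (simp only: \<iota>_eq_iff)
qed

lemma sK_nonzero: "f \<noteq> 0 \<Longrightarrow> sK f \<noteq> 0"
  using sK_mult[of f "inverse f"] by (auto simp: sK_1)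

lemma fixed_quotient:
  assumes m: "m * m' = 1" and W: "sg W * m = sg m * W"
  shows "\<exists>c. W = e c * m"
proof -
  have sm: "sg m * sg m' = 1" using m by (metis sg_1 sg_mult)
  have "sg (W * m') = sg W * sg m' * (m * m')" by (simp add: m sg_mult)
  also have "\<dots> = (sg W * m) * (sg m' * m')" by (simp add: mult_ac)
  also have "\<dots> = (sg m * sg m') * (W * m')" unfolding W by (simp add: mult_ac)
  finally have "sg (W * m') = W * m'" by (simp add: sm)
  then obtain c where "W * m' = e c" using sg_fixed by blast
  then have "e c * m = W * (m * m')" by (simp add: mult_ac flip: \<open>W * m' = e c\<close>)
  then show ?thesis using m by (intro exI[of _ c]) simp
qed

text \<open>
  Multiplying each monomial \<open>Y j\<close> by a constant \<open>\<psi> j\<close> preserves all \<open>k\<close>-linear relations, provided \<open>\<psi>\<close> agrees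
  on monomials that are proportional over \<open>k\<close>, i.e. have \<open>U i / U j = \<sigma>(h)/h\<close>. For a shortest counterexample,
  applying \<open>\<sigma>\<close> and eliminating the \<open>i\<close>-th term gives a shorter relation, which is therefore preserved.
  Hence the twisted sum \<open>W\<close> satisfies the same first-order equation as each of its terms and is a constant
  multiple of each of them; but then all these terms have the same \<open>\<psi> j\<close>.
\<close>

theorem monomial_twist:
  fixes Y :: "'j \<Rightarrow> 'r" and U f :: "'j \<Rightarrow> 'k" and \<psi> :: "'j \<Rightarrow> 'c"
  assumes F: "finite F" and Y: "\<And>j. sg (Y j) = \<iota> (U j) * Y j" and unit: "\<And>j. \<exists>y. Y j * y = 1"
    and sum0: "(\<Sum>j\<in>F. \<iota> (f j) * Y j) = 0"
    and \<psi>: "\<And>i j h. i \<in> F \<Longrightarrow> j \<in> F \<Longrightarrow> h \<noteq> 0 \<Longrightarrow> U i * h = sK h * U j \<Longrightarrow> \<psi> i = \<psi> j"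
  shows "(\<Sum>j\<in>F. \<iota> (f j) * e (\<psi> j) * Y j) = 0"
  using F sum0 \<psi>
proof (induction "card F" arbitrary: F f rule: less_induct)
  case less
  show ?case
  proof (cases "\<exists>i\<in>F. f i = 0")
    case True
    then obtain i where i: "i \<in> F" "f i = 0" by blast
    have 1: "(\<Sum>j\<in>F. \<iota> (f j) * Y j) = (\<Sum>j\<in>F - {i}. \<iota> (f j) * Y j)"
      and 2: "(\<Sum>j\<in>F. \<iota> (f j) * e (\<psi> j) * Y j) = (\<Sum>j\<in>F - {i}. \<iota> (f j) * e (\<psi> j) * Y j)"
      using i less.prems(1) by (simp_all add: sum.remove \<iota>_0)
    have "card (F - {i}) < card F" using i less.prems(1) by (intro psubset_card_mono) auto
    from less.hyps[OF this] show ?thesis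
      unfolding 2 using less.prems by (simp add: 1)
  next
    case False
    define W where "W = (\<Sum>j\<in>F. \<iota> (f j) * e (\<psi> j) * Y j)"
    have key: "\<exists>c. W = e c * (\<iota> (f i) * Y i)" if i: "i \<in> F" for i
    proof -
      \<comment> \<open>The coefficients of \<open>f\<^sub>i \<sigma>(r) - \<sigma>(f\<^sub>i) U\<^sub>i r\<close>, where \<open>r\<close> is the given relation.\<close>
      define g where "g j = f i * sK (f j) * U j - sK (f i) * U i * f j" for j
      have "g i = 0" by (simp add: g_def)
      have "(\<Sum>j\<in>F. \<iota> (g j) * Y j) = \<iota> (f i) * sg (\<Sum>j\<in>F. \<iota> (f j) * Y j) - \<iota> (sK (f i) * U i) * (\<Sum>j\<in>F. \<iota> (f j) * Y j)"
        unfolding sg_sum sg_mult sg_\<iota> Y g_def sum_distrib_left sum_subtractf[symmetric]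
        by (intro sum.cong) (simp_all add: \<iota>_diff \<iota>_mult algebra_simps)
      then have "(\<Sum>j\<in>F. \<iota> (g j) * Y j) = 0" by (simp add: less.prems(2) sg_0)
      then have "(\<Sum>j\<in>F - {i}. \<iota> (g j) * Y j) = 0"
        using i less.prems(1) \<open>g i = 0\<close> by (simp add: sum.remove \<iota>_0)
      moreover have "card (F - {i}) < card F" using i less.prems(1) by (intro psubset_card_mono) auto
      ultimately have "(\<Sum>j\<in>F - {i}. \<iota> (g j) * e (\<psi> j) * Y j) = 0"
        using less.hyps[of "F - {i}" g] less.prems by blast
      then have "(\<Sum>j\<in>F. \<iota> (g j) * e (\<psi> j) * Y j) = 0"
        using i less.prems(1) \<open>g i = 0\<close> by (simp add: sum.remove \<iota>_0)
      moreover have "(\<Sum>j\<in>F. \<iota> (g j) * e (\<psi> j) * Y j) = \<iota> (f i) * sg W - \<iota> (sK (f i) * U i) * W"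
        unfolding W_def sg_sum sg_mult sg_\<iota> Y g_def sum_distrib_left sum_subtractf[symmetric]
        by (intro sum.cong) (simp_all add: \<iota>_diff \<iota>_mult algebra_simps)
      ultimately have W: "\<iota> (f i) * sg W = \<iota> (sK (f i) * U i) * W" by simp
      obtain y where y: "Y i * y = 1" using unit by blast
      have "f i \<noteq> 0" using False i by blast
      then have "(\<iota> (f i) * Y i) * (\<iota> (inverse (f i)) * y) = 1"
        using y \<iota>_inverse[of "f i"] by (metis mult.assoc mult.left_commute mult_1)
      moreover have "sg W * (\<iota> (f i) * Y i) = sg (\<iota> (f i) * Y i) * W"
        using arg_cong[OF W, of "\<lambda>x. x * Y i"] by (simp add: sg_mult sg_\<iota> Y \<iota>_mult mult_ac)
      ultimately show ?thesis by (rule fixed_quotient)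
    qed
    show ?thesis
    proof (rule ccontr)
      assume "\<not> ?thesis"
      then have W0: "W \<noteq> 0" by (simp add: W_def)
      then obtain i where i: "i \<in> F" unfolding W_def by (metis sum.not_neutral_contains_not_neutral)
      have same: "\<psi> j = \<psi> i" if j: "j \<in> F" for j
      proof -
        obtain c d where c: "W = e c * (\<iota> (f i) * Y i)" and d: "W = e d * (\<iota> (f j) * Y j)"
          using key[OF i] key[OF j] by blast
        have cd: "c \<noteq> 0" "d \<noteq> 0" using c d W0 by (auto simp: e_0)
        have fi: "f i \<noteq> 0" "f j \<noteq> 0" using False i j by auto
        obtain y where y: "Y i * y = 1" using unit by blast
        have eq: "e c * (\<iota> (f i) * Y i) = e d * (\<iota> (f j) * Y j)" using c d by simp
        from arg_cong[OF this, of sg]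
        have eq2: "e c * (\<iota> (sK (f i) * U i) * Y i) = e d * (\<iota> (sK (f j) * U j) * Y j)"
          by (simp add: sg_mult sg_\<iota> Y \<iota>_mult mult_ac)
        have "e c * \<iota> (f j * (sK (f i) * U i)) * Y i = \<iota> (f j) * (e c * (\<iota> (sK (f i) * U i) * Y i))"
          by (simp add: \<iota>_mult mult_ac)
        also have "\<dots> = \<iota> (sK (f j) * U j) * (e d * (\<iota> (f j) * Y j))"
          unfolding eq2 by (simp add: mult_ac)
        also have "\<dots> = e c * \<iota> (f i * (sK (f j) * U j)) * Y i"
          unfolding eq[symmetric] by (simp add: \<iota>_mult mult_ac)
        finally have "e (inverse c) * (e c * \<iota> (f j * (sK (f i) * U i)) * Y i) * y =
            e (inverse c) * (e c * \<iota> (f i * (sK (f j) * U j)) * Y i) * y" by simp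
        moreover have "e (inverse c) * (e c * r * Y i) * y = (e c * e (inverse c)) * (Y i * y) * r" for r
          by (simp add: mult_ac)
        ultimately have "\<iota> (f j * (sK (f i) * U i)) = \<iota> (f i * (sK (f j) * U j))"
          using e_inverse[OF cd(1)] y by simp
        then have eq3: "f j * (sK (f i) * U i) = f i * (sK (f j) * U j)" by (simp add: \<iota>_eq_iff)
        define h where "h = f i / f j"
        have "sK h * sK (f j) = sK (f i)" unfolding h_def sK_mult[symmetric] using fi by simp
        then have sKh: "sK h = sK (f i) / sK (f j)" using sK_nonzero[OF fi(2)] by (simp add: field_simps)
        have "U j * h = sK h * U i"
          unfolding sKh using eq3 fi sK_nonzero[OF fi(1)] sK_nonzero[OF fi(2)] by (simp add: h_def field_simps)
        then show "\<psi> j = \<psi> i" using less.prems(3)[OF j i, of h] fi by (simp add: h_def)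
      qed
      have "W = e (\<psi> i) * (\<Sum>j\<in>F. \<iota> (f j) * Y j)"
        unfolding W_def sum_distrib_left by (intro sum.cong) (simp_all add: same mult_ac)
      then show False using W0 less.prems(2) by simp
    qed
  qed
qed

definition monomial_ring :: "('j \<Rightarrow> 'r) \<Rightarrow> 'r set" where
  "monomial_ring Y = {\<Sum>j\<in>F. \<iota> (f j) * Y j | F f. finite F}"

text \<open>
  The graph of \<open>Y j \<mapsto> \<psi> j Y j\<close>, as a relation; \<open>monomial_twist\<close> says when it is single-valued.
\<close>

inductive_set twist_rel :: "('j \<Rightarrow> 'r) \<Rightarrow> ('j \<Rightarrow> 'c) \<Rightarrow> ('r \<times> 'r) set" for Y and \<psi> where
  monomial: "(\<iota> f * Y j, \<iota> f * e (\<psi> j) * Y j) \<in> twist_rel Y \<psi>"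
| add: "(r, r') \<in> twist_rel Y \<psi> \<Longrightarrow> (s, s') \<in> twist_rel Y \<psi> \<Longrightarrow> (r + s, r' + s') \<in> twist_rel Y \<psi>"

lemma twist_rel_sum:
  fixes Y :: "'j \<Rightarrow> 'r"
  assumes "(r, s) \<in> twist_rel Y \<psi>"
  shows "\<exists>F f. finite F \<and> r = (\<Sum>j\<in>F. \<iota> (f j) * Y j) \<and> s = (\<Sum>j\<in>F. \<iota> (f j) * e (\<psi> j) * Y j)"
  using assms
proof induction
  case (monomial f j)
  show ?case by (intro exI[of _ "{j}"] exI[of _ "\<lambda>_. f"]) simp
next
  case (add r r' s s')
  then obtain F f G g where *: "finite F" "r = (\<Sum>j\<in>F. \<iota> (f j) * Y j)" "r' = (\<Sum>j\<in>F. \<iota> (f j) * e (\<psi> j) * Y j)"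
    "finite G" "s = (\<Sum>j\<in>G. \<iota> (g j) * Y j)" "s' = (\<Sum>j\<in>G. \<iota> (g j) * e (\<psi> j) * Y j)" by blast
  define f' g' where "f' j = (if j \<in> F then f j else 0)" and "g' j = (if j \<in> G then g j else 0)" for j
  have 1: "(\<Sum>j\<in>F. \<iota> (f j) * z j) = (\<Sum>j\<in>F \<union> G. \<iota> (f' j) * z j)" for z :: "'j \<Rightarrow> 'r"
    using * by (intro sum.mono_neutral_cong_left) (auto simp: f'_def \<iota>_0)
  have 2: "(\<Sum>j\<in>G. \<iota> (g j) * z j) = (\<Sum>j\<in>F \<union> G. \<iota> (g' j) * z j)" for z :: "'j \<Rightarrow> 'r"
    using * by (intro sum.mono_neutral_cong_left) (auto simp: g'_def \<iota>_0)
  show ?case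
    by (intro exI[of _ "F \<union> G"] exI[of _ "\<lambda>j. f' j + g' j"])
      (use * in \<open>simp add: 1 2 \<iota>_add distrib_right sum.distrib mult.assoc\<close>)
qed

lemma twist_rel_sumI:
  assumes "finite F"
  shows "(\<Sum>j\<in>F. \<iota> (f j) * Y j, \<Sum>j\<in>F. \<iota> (f j) * e (\<psi> j) * Y j) \<in> twist_rel Y \<psi>"
  using assms
proof induction
  case empty
  show ?case using twist_rel.monomial[of 0] by (simp add: \<iota>_0)
next
  case (insert j F)
  then show ?case using twist_rel.add[OF twist_rel.monomial insert.IH] by simp
qed

lemma monomial_ring_eq: "monomial_ring Y = fst ` twist_rel Y \<psi>"
proof (rule Set.set_eqI, rule iffI)
  fix x assume "x \<in> monomial_ring Y"
  then obtain F f where F: "finite F" "x = (\<Sum>j\<in>F. \<iota> (f j) * Y j)"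
    unfolding monomial_ring_def by blast
  show "x \<in> fst ` twist_rel Y \<psi>"
    unfolding F(2) by (rule image_eqI[OF _ twist_rel_sumI[OF F(1)]]) simp
next
  fix x assume "x \<in> fst ` twist_rel Y \<psi>"
  then obtain s where "(x, s) \<in> twist_rel Y \<psi>" by auto
  from twist_rel_sum[OF this] show "x \<in> monomial_ring Y"
    unfolding monomial_ring_def by blast
qed

lemma twist_rel_fst: "(r, s) \<in> twist_rel Y \<psi> \<Longrightarrow> r \<in> monomial_ring Y"
  unfolding monomial_ring_eq[of Y \<psi>] by (rule image_eqI[of _ _ "(r, s)"]) simp

lemma twist_rel_functional:
  assumes Y: "\<And>j. sg (Y j) = \<iota> (U j) * Y j" and unit: "\<And>j. \<exists>y. Y j * y = 1"
    and \<psi>: "\<And>i j h. h \<noteq> 0 \<Longrightarrow> U i * h = sK h * U j \<Longrightarrow> \<psi> i = \<psi> j"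
    and 0: "(0, s) \<in> twist_rel Y \<psi>"
  shows "s = 0"
proof -
  obtain F f where F: "finite F" "0 = (\<Sum>j\<in>F. \<iota> (f j) * Y j)" "s = (\<Sum>j\<in>F. \<iota> (f j) * e (\<psi> j) * Y j)"
    using twist_rel_sum[OF 0] by blast
  show ?thesis
    unfolding F(3) by (rule monomial_twist[OF F(1) Y unit F(2)[symmetric]]) (rule \<psi>)
qed

lemma subring_rel_twist:
  fixes Y :: "'j::comm_monoid_add \<Rightarrow> 'r"
  assumes Y: "Y 0 = 1" "\<And>i j. Y (i + j) = Y i * Y j" and \<psi>: "\<psi> 0 = 1" "\<And>i j. \<psi> (i + j) = \<psi> i * \<psi> j"
  shows "subring_rel (twist_rel Y \<psi>)"
proof -
  have m: "(- r, - s) \<in> twist_rel Y \<psi>" if "(r, s) \<in> twist_rel Y \<psi>" for r s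
    using that
  proof induction
    case (monomial f j)
    show ?case using twist_rel.monomial[of "- f" Y j \<psi>] by (simp add: \<iota>_uminus)
  next
    case (add r r' s s')
    then show ?case using twist_rel.add[of "- r" "- r'" Y \<psi> "- s" "- s'"] by simp
  qed
  have mon: "(\<iota> f * Y j * s, \<iota> f * e (\<psi> j) * Y j * s') \<in> twist_rel Y \<psi>" if "(s, s') \<in> twist_rel Y \<psi>" for f j s s'
    using that
  proof induction
    case (monomial g i)
    show ?case using twist_rel.monomial[of "f * g" Y "j + i" \<psi>] by (simp add: \<iota>_mult e_mult Y \<psi> mult_ac)
  next
    case (add r r' s s')
    then show ?case by (simp add: distrib_left twist_rel.add)
  qed
  have mult: "(r * s, r' * s') \<in> twist_rel Y \<psi>" if "(r, r') \<in> twist_rel Y \<psi>" "(s, s') \<in> twist_rel Y \<psi>" for r r' s s'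
    using that(1)
  proof induction
    case (monomial g i)
    show ?case by (rule mon[OF that(2)])
  next
    case (add a a' b b')
    then show ?case by (simp add: distrib_right twist_rel.add)
  qed
  show ?thesis
    unfolding subring_rel_def
  proof (intro conjI ballI, goal_cases)
    case 1
    show ?case using twist_rel.monomial[of 1 Y 0 \<psi>] by (simp add: \<iota>_1 Y \<psi> e_1)
  next
    case (2 a)
    show ?case
    proof (cases a, clarsimp)
      fix r r' s s' assume "a = (r, r')" "(s, s') \<in> twist_rel Y \<psi>"
      then show "(r - s, r' - s') \<in> twist_rel Y \<psi> \<and> (r * s, r' * s') \<in> twist_rel Y \<psi>"
        using 2 twist_rel.add[of r r' Y \<psi> "- s" "- s'"] m[of s s'] mult[of r r' s s'] by simp
    qed
  qed
qed

context
  fixes Y :: "'j::ab_group_add \<Rightarrow> 'r" and U :: "'j \<Rightarrow> 'k"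
  assumes Y: "Y 0 = 1" "\<And>i j. Y (i + j) = Y i * Y j" and sgY: "\<And>j. sg (Y j) = \<iota> (U j) * Y j"
begin

lemma Y_unit: "Y j * Y (- j) = 1"
  using Y(2)[of j "- j"] Y(1) by simp

lemma subring_monomial_ring: "subring_set (monomial_ring Y)"
proof -
  have "subring_rel (twist_rel Y (\<lambda>_. 1))" by (rule subring_rel_twist) (use Y in auto)
  then show ?thesis
    unfolding monomial_ring_eq[of Y "\<lambda>_. 1"] by (rule subring_set_fst)
qed

lemma monomial_in_ring: "\<iota> f * Y j \<in> monomial_ring Y"
  by (rule twist_rel_fst[OF twist_rel.monomial])

lemma \<iota>_in_monomial_ring: "\<iota> f \<in> monomial_ring Y"
  using monomial_in_ring[of f 0] by (simp add: Y)

text \<open>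
  A shortest nonzero element of a \<open>\<sigma>\<close>-stable ideal satisfies, by the same elimination, the first-order equation
  of any of its terms. So it is a constant multiple of a monomial, which is a unit.
\<close>

theorem sg_simple_monomial_ring: "sg_simple (monomial_ring Y)"
  unfolding sg_simple_def
proof (intro conjI allI impI)
  show "subring_set (monomial_ring Y)" by (rule subring_monomial_ring)
  show "range e \<subseteq> monomial_ring Y" using e_\<iota> \<iota>_in_monomial_ring by (metis image_subset_iff rangeE)
  show "sg ` monomial_ring Y \<subseteq> monomial_ring Y"
  proof (rule image_subsetI)
    fix x assume "x \<in> monomial_ring Y"
    then obtain F f where F: "finite F" "x = (\<Sum>j\<in>F. \<iota> (f j) * Y j)"
      unfolding monomial_ring_def by blast
    have "sg x = (\<Sum>j\<in>F. \<iota> (sK (f j) * U j) * Y j)"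
      unfolding F(2) by (simp add: sg_sum sg_mult sg_\<iota> sgY \<iota>_mult mult.assoc)
    then show "sg x \<in> monomial_ring Y"
      unfolding monomial_ring_def using F(1) by (intro CollectI exI conjI)
  qed
next
  fix I assume I: "sg_ideal (monomial_ring Y) I"
  then have I': "\<And>x y. x \<in> I \<Longrightarrow> y \<in> I \<Longrightarrow> x + y \<in> I" "\<And>b x. b \<in> monomial_ring Y \<Longrightarrow> x \<in> I \<Longrightarrow> b * x \<in> I"
    "\<And>x. x \<in> I \<Longrightarrow> sg x \<in> I" "I \<subseteq> monomial_ring Y" "0 \<in> I" by (auto simp: sg_ideal_def)
  show "I = {0} \<or> 1 \<in> I"
  proof (cases "I = {0}")
    case False
    then obtain x0 where x0: "x0 \<in> I" "x0 \<noteq> 0" using I'(5) by auto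
    define P where "P = (\<lambda>(F, f). finite F \<and> (\<Sum>j\<in>F. \<iota> (f j) * Y j) \<in> I \<and> (\<Sum>j\<in>F. \<iota> (f j) * Y j) \<noteq> 0)"
    obtain F0 f0 where "P (F0, f0)" using x0 I'(4) unfolding P_def monomial_ring_def by blast
    from arg_min_nat_lemma[of P, OF this, of "card \<circ> fst"] obtain F f
      where "P (F, f)" and min: "\<And>G g. P (G, g) \<Longrightarrow> card F \<le> card G"
      by (metis comp_apply fst_conv surj_pair)
    define x where "x = (\<Sum>j\<in>F. \<iota> (f j) * Y j)"
    have F: "finite F" and x: "x \<in> I" "x \<noteq> 0" using \<open>P (F, f)\<close> by (auto simp: P_def x_def)
    then obtain i where i: "i \<in> F" unfolding x_def by (metis sum.not_neutral_contains_not_neutral)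
    have less: "card (F - {i}) < card F" using i F by (intro psubset_card_mono) auto
    have vanish: "(\<Sum>j\<in>F. \<iota> (g j) * Y j) = 0" if "(\<Sum>j\<in>F. \<iota> (g j) * Y j) \<in> I" "g i = 0" for g
    proof -
      have "(\<Sum>j\<in>F. \<iota> (g j) * Y j) = (\<Sum>j\<in>F - {i}. \<iota> (g j) * Y j)"
        using i F that by (simp add: sum.remove \<iota>_0)
      then show ?thesis using min[of "F - {i}" g] less F that(1) by (auto simp: P_def)
    qed
    have fi: "f i \<noteq> 0" using vanish[of f] x by (auto simp: x_def)
    define g where "g j = f i * sK (f j) * U j - sK (f i) * U i * f j" for j
    have eq: "(\<Sum>j\<in>F. \<iota> (g j) * Y j) = \<iota> (f i) * sg x + \<iota> (- (sK (f i) * U i)) * x"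
      unfolding x_def sg_sum sg_mult sg_\<iota> sgY g_def sum_distrib_left sum.distrib[symmetric]
      by (intro sum.cong) (simp_all add: \<iota>_diff \<iota>_uminus \<iota>_mult algebra_simps)
    then have "(\<Sum>j\<in>F. \<iota> (g j) * Y j) \<in> I" using x I' \<iota>_in_monomial_ring by auto
    then have "(\<Sum>j\<in>F. \<iota> (g j) * Y j) = 0" by (rule vanish) (simp add: g_def)
    then have "\<iota> (f i) * sg x = \<iota> (sK (f i) * U i) * x" by (simp add: eq \<iota>_uminus)
    then have W: "sg x * (\<iota> (f i) * Y i) = sg (\<iota> (f i) * Y i) * x"
      using arg_cong[of "\<iota> (f i) * sg x" _ "\<lambda>x. x * Y i"] by (simp add: sg_mult sg_\<iota> sgY \<iota>_mult mult_ac)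
    have m: "(\<iota> (f i) * Y i) * (\<iota> (inverse (f i)) * Y (- i)) = 1"
      using Y_unit[of i] \<iota>_inverse[OF fi] by (metis mult.assoc mult.left_commute mult_1)
    obtain c where c: "x = e c * (\<iota> (f i) * Y i)" using fixed_quotient[OF m W] by blast
    have "c \<noteq> 0" using c x by (auto simp: e_0)
    have "e (inverse c) * (\<iota> (inverse (f i)) * Y (- i)) * x =
      (e c * e (inverse c)) * ((\<iota> (f i) * Y i) * (\<iota> (inverse (f i)) * Y (- i)))"
      unfolding c by (simp only: mult_ac)
    then have "e (inverse c) * (\<iota> (inverse (f i)) * Y (- i)) * x = 1"
      by (simp only: m e_inverse[OF \<open>c \<noteq> 0\<close>] mult_1)
    moreover have "e (inverse c) * (\<iota> (inverse (f i)) * Y (- i)) \<in> monomial_ring Y"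
    proof -
      obtain k where "e (inverse c) = \<iota> k" using e_\<iota> by blast
      then show ?thesis
        using subring_setD(4)[OF subring_monomial_ring \<iota>_in_monomial_ring monomial_in_ring] by simp
    qed
    ultimately show ?thesis using I'(2) x(1) by metis
  qed simp
qed

text \<open>
  If no monomial except \<open>Y 0 = 1\<close> is proportional to an element of \<open>k\<close>, then the projection to the coefficient
  of \<open>Y 0\<close> commutes with \<open>\<sigma>\<close>, so it maps a solution in the monomial ring to one in \<open>k\<close>.
\<close>

lemma summable_monomial_ring:
  assumes g: "g \<in> monomial_ring Y" "sg g - g = \<iota> \<omega>"
    and indep: "\<And>j h. h \<noteq> 0 \<Longrightarrow> U j * h = sK h \<Longrightarrow> j = 0"
  shows "\<exists>h. \<omega> = sK h - h"
proof -
  obtain F f where F: "finite F" "g = (\<Sum>j\<in>F. \<iota> (f j) * Y j)" using g(1) by (auto simp: monomial_ring_def)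
  have U0: "U 0 = 1"
    using sgY[of 0] by (simp add: Y sg_1) (metis \<iota>_1 \<iota>_eq_iff)
  define f' where "f' j = (if j \<in> F then f j else 0)" for j
  define G where "G = insert 0 F"
  have G: "finite G" "0 \<in> G" using F by (auto simp: G_def)
  have g': "g = (\<Sum>j\<in>G. \<iota> (f' j) * Y j)"
    unfolding F(2) G_def using F by (intro sum.mono_neutral_cong_left) (auto simp: f'_def \<iota>_0)
  define k where "k j = sK (f' j) * U j - f' j - (if j = 0 then \<omega> else 0)" for j
  have "(\<Sum>j\<in>G. \<iota> (k j) * Y j) = (sg g - g) - (\<Sum>j\<in>G. \<iota> (if j = 0 then \<omega> else 0) * Y j)"
    unfolding g' sg_sum sum_subtractf[symmetric]
    by (intro sum.cong) (simp_all add: k_def sg_mult sg_\<iota> sgY \<iota>_diff \<iota>_mult \<iota>_0 \<iota>_add algebra_simps)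
  also have "(\<Sum>j\<in>G. \<iota> (if j = 0 then \<omega> else 0) * Y j) = \<iota> \<omega>"
    using G by (subst sum.remove[of _ 0]) (simp_all add: Y \<iota>_0)
  finally have k0: "(\<Sum>j\<in>G. \<iota> (k j) * Y j) = 0" using g(2) by simp
  \<comment> \<open>The twist by the indicator of \<open>0\<close> extracts the coefficient of \<open>Y 0\<close>.\<close>
  have "(\<Sum>j\<in>G. \<iota> (k j) * e (if j = 0 then 1 else 0) * Y j) = 0"
  proof (rule monomial_twist[OF G(1) sgY _ k0, where \<psi> = "\<lambda>j. if j = 0 then 1 else 0"])
    show "\<exists>y. Y j * y = 1" for j using Y_unit by blast
    fix i j h assume h: "h \<noteq> 0" "U i * h = sK h * U j"
    have Um: "U (i + j) = U i * U j" for i j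
    proof -
      have "\<iota> (U (i + j)) * Y (i + j) = \<iota> (U i * U j) * Y (i + j)"
        using sgY[of "i + j"] by (simp add: Y sg_mult sgY \<iota>_mult mult_ac)
      then have "\<iota> (U (i + j)) * (Y (i + j) * Y (- (i + j))) = \<iota> (U i * U j) * (Y (i + j) * Y (- (i + j)))"
        by (simp flip: mult.assoc)
      then show ?thesis unfolding Y_unit by (simp add: \<iota>_eq_iff)
    qed
    have "U (i + - j) * h = sK h * U (j + - j)" unfolding Um using h by (simp add: mult_ac)
    then have "i + - j = 0" by (intro indep[OF h(1)]) (simp add: U0)
    then have "i = j" by simp
    then show "(if i = 0 then 1 else 0) = (if j = 0 then 1 else (0 :: 'c))" by simp
  qed
  moreover have "(\<Sum>j\<in>G. \<iota> (k j) * e (if j = 0 then 1 else 0) * Y j) = \<iota> (k 0)"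
    using G by (subst sum.remove[of _ 0]) (simp_all add: Y e_1 e_0)
  ultimately have "k 0 = 0" by simp
  then have "\<omega> = sK (f' 0) - f' 0" by (simp add: k_def U0)
  then show ?thesis by blast
qed

end

end

section \<open>Matrices of size two\<close>

lemma mat2_nth [simp]:
  "mat2 p q r s $ 1 $ 1 = p" "mat2 p q r s $ 1 $ 2 = q"
  "mat2 p q r s $ 2 $ 1 = r" "mat2 p q r s $ 2 $ 2 = s"
  by (simp_all add: mat2_def)

lemma mat2_eq_iff: "A = mat2 p q r s \<longleftrightarrow> A $ 1 $ 1 = p \<and> A $ 1 $ 2 = q \<and> A $ 2 $ 1 = r \<and> A $ 2 $ 2 = s"
  by (auto simp: vec_eq_iff forall_2)

lemma map_matrix_mat2: "map_matrix f (mat2 p q r s) = mat2 (f p) (f q) (f r) (f s)"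
  by (simp add: mat2_eq_iff map_matrix_def)

lemma mat2_mult:
  "mat2 p q r s ** mat2 p' q' r' s' = mat2 (p * p' + q * r') (p * q' + q * s') (r * p' + s * r') (r * q' + s * s')"
  by (simp add: mat2_eq_iff matrix_matrix_mult_def sum_2)

lemma det_mat2: "det (mat2 p q r s) = p * s - q * r"
  by (simp add: det_2)

lemma mem_Gm_Ga_iff: "T \<in> Gm_Ga \<longleftrightarrow> T $ 1 $ 1 \<noteq> 0 \<and> T = mat2 (T $ 1 $ 1) (T $ 1 $ 2) 0 (T $ 1 $ 1)"
proof
  show "T \<in> Gm_Ga \<Longrightarrow> T $ 1 $ 1 \<noteq> 0 \<and> T = mat2 (T $ 1 $ 1) (T $ 1 $ 2) 0 (T $ 1 $ 1)"
    by (auto simp: Gm_Ga_def)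
qed (unfold Gm_Ga_def, blast)

section \<open>Graphs of automorphisms\<close>

lemma graph_ring_iso:
  fixes \<Gamma> :: "('r::comm_ring_1 \<times> 'r) set"
  assumes G: "subring_rel \<Gamma>" and fun_0: "\<And>s. (0, s) \<in> \<Gamma> \<Longrightarrow> s = 0" and inj_0: "\<And>r. (r, 0) \<in> \<Gamma> \<Longrightarrow> r = 0"
    and D: "fst ` \<Gamma> = D" "snd ` \<Gamma> = D"
  obtains \<gamma> where "\<gamma> \<in> ring_iso (ring_of_type_algebra\<lparr>carrier := D\<rparr>) (ring_of_type_algebra\<lparr>carrier := D\<rparr>)"
    "\<And>r s. (r, s) \<in> \<Gamma> \<Longrightarrow> \<gamma> r = s"
proof -
  note G' = subring_relD[OF G]
  have uniq: "s = s'" if "(r, s) \<in> \<Gamma>" "(r, s') \<in> \<Gamma>" for r s s'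
    using fun_0[of "s - s'"] G'(3)[OF that] by simp
  have inj: "r = r'" if "(r, s) \<in> \<Gamma>" "(r', s) \<in> \<Gamma>" for r r' s
    using inj_0[of "r - r'"] G'(3)[OF that] by simp
  define \<gamma> where "\<gamma> r = (THE s. (r, s) \<in> \<Gamma>)" for r
  have \<gamma>: "\<gamma> r = s" if "(r, s) \<in> \<Gamma>" for r s
    unfolding \<gamma>_def using that uniq by blast
  have mem: "(r, \<gamma> r) \<in> \<Gamma>" if "r \<in> D" for r
    using that D(1) \<gamma> by force
  have rng: "\<gamma> r \<in> D" if "r \<in> D" for r
    using mem[OF that] D(2) by force
  have "bij_betw \<gamma> D D"
    unfolding bij_betw_def
  proof
    show "inj_on \<gamma> D" by (rule inj_onI) (metis inj mem)
    show "\<gamma> ` D = D"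
    proof
      show "\<gamma> ` D \<subseteq> D" using rng by blast
      show "D \<subseteq> \<gamma> ` D"
      proof
        fix s assume "s \<in> D"
        then obtain r where r: "(r, s) \<in> \<Gamma>" using D(2) by force
        then have "r \<in> D" using D(1) by force
        then show "s \<in> \<gamma> ` D" using \<gamma>[OF r] by blast
      qed
    qed
  qed
  moreover have "\<gamma> (r + s) = \<gamma> r + \<gamma> s" "\<gamma> (r * s) = \<gamma> r * \<gamma> s" if "r \<in> D" "s \<in> D" for r s
    using \<gamma> G'(4,6) mem[OF that(1)] mem[OF that(2)] by blast+
  moreover have "\<gamma> 1 = 1" using \<gamma> G'(1) by blast
  ultimately have "\<gamma> \<in> ring_iso (ring_of_type_algebra\<lparr>carrier := D\<rparr>) (ring_of_type_algebra\<lparr>carrier := D\<rparr>)"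
    using rng by (auto simp: ring_iso_def ring_hom_def)
  with \<gamma> that show ?thesis by blast
qed

section \<open>Integer powers of units\<close>

text \<open>
  Powers of \<open>y\<close> with an inverse \<open>y'\<close> supplied explicitly, since \<open>R\<close> is only a ring.
\<close>

definition zpow :: "'r::comm_ring_1 \<Rightarrow> 'r \<Rightarrow> int \<Rightarrow> 'r" where
  "zpow y y' n = (if n \<ge> 0 then y ^ nat n else y' ^ nat (- n))"

lemma zpow_0 [simp]: "zpow y y' 0 = 1" and zpow_1 [simp]: "zpow y y' 1 = y" and zpow_m1 [simp]: "zpow y y' (- 1) = y'"
  by (simp_all add: zpow_def)

lemma zpow_succ:
  assumes "y * y' = 1" shows "zpow y y' (n + 1) = zpow y y' n * y"
proof (cases "n \<ge> 0")
  case True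
  then show ?thesis by (simp add: zpow_def nat_add_distrib mult.commute)
next
  case False
  define m where "m = nat (- n - 1)"
  have n: "n = - int m - 1" using False by (simp add: m_def)
  have 1: "zpow y y' n = y' ^ Suc m" by (simp add: zpow_def n nat_add_distrib)
  have 2: "zpow y y' (n + 1) = y' ^ m" proof -
    have "n + 1 = - int m" by (simp add: n)
    then show ?thesis by (cases "m = 0") (simp_all add: zpow_def)
  qed
  have "y' ^ Suc m * y = y' ^ m * (y * y')" by (simp add: mult_ac)
  then show ?thesis unfolding 1 2 using assms by simp
qed

lemma zpow_pred:
  assumes "y * y' = 1" shows "zpow y y' (n - 1) = zpow y y' n * y'"
  using zpow_succ[OF assms, of "n - 1"] assms by (simp add: mult.assoc)

lemma zpow_add:
  assumes "y * y' = 1" shows "zpow y y' (m + n) = zpow y y' m * zpow y y' n"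
proof (induction n rule: int_induct[where k = 0])
  case (step1 i)
  then show ?case using zpow_succ[OF assms, of i] zpow_succ[OF assms, of "m + i"] by (simp add: add.assoc mult.assoc)
next
  case (step2 i)
  then show ?case using zpow_pred[OF assms, of i] zpow_pred[OF assms, of "m + i"] by (simp add: mult.assoc algebra_simps)
qed simp

lemma zpow_mem:
  assumes "subring_set B" "y \<in> B" "y' \<in> B" shows "zpow y y' n \<in> B"
proof -
  have "x ^ k \<in> B" if "x \<in> B" for x and k :: nat
    by (induction k) (use that subring_setD[OF assms(1)] in auto)
  then show ?thesis using assms by (simp add: zpow_def)
qed

section \<open>Subgroups and characters of the integer lattice\<close>

lemma int_subgroup:
  fixes Q :: "int set"
  assumes "0 \<in> Q" "\<And>m n. m \<in> Q \<Longrightarrow> n \<in> Q \<Longrightarrow> m - n \<in> Q"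
  shows "\<exists>N\<ge>0. \<forall>n. n \<in> Q \<longleftrightarrow> N dvd n"
proof (cases "Q = {0}")
  case True
  then show ?thesis by (intro exI[of _ 0]) auto
next
  case False
  have neg: "- n \<in> Q" if "n \<in> Q" for n using assms(2)[OF assms(1) that] by simp
  have add: "m + n \<in> Q" if "m \<in> Q" "n \<in> Q" for m n using assms(2)[OF that(1) neg[OF that(2)]] by simp
  obtain q where q: "q \<in> Q" "q \<noteq> 0" using False assms(1) by auto
  define M where "M = (LEAST n::nat. n > 0 \<and> int n \<in> Q)"
  have "nat \<bar>q\<bar> > 0 \<and> int (nat \<bar>q\<bar>) \<in> Q" using q neg[of q] by (auto simp: abs_if)
  then have M: "M > 0 \<and> int M \<in> Q" unfolding M_def by (rule LeastI)
  have least: "M \<le> n" if "n > 0" "int n \<in> Q" for n unfolding M_def by (rule Least_le) (use that in simp)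
  have mult: "int M * k \<in> Q" for k
    by (induction k rule: int_induct[where k = 0]) (use M assms add in \<open>auto simp: algebra_simps\<close>)
  have "n \<in> Q \<longleftrightarrow> int M dvd n" for n
  proof
    assume n: "n \<in> Q"
    have "n mod int M = n - int M * (n div int M)" by (simp add: minus_mult_div_eq_mod)
    then have "n mod int M \<in> Q" using assms(2)[OF n mult] by simp
    moreover have "n mod int M \<ge> 0" "n mod int M < int M" using M by simp_all
    ultimately have "n mod int M = 0" using least[of "nat (n mod int M)"] by (cases "n mod int M > 0") auto
    then show "int M dvd n" by auto
  qed (use mult in auto)
  then show ?thesis by (intro exI[of _ "int M"]) simp
qed

text \<open>
  The vanishing of the geometric sum is kept because it, and not only \<open>\<zeta> \<noteq> 1\<close>, is an equation cutting out the
  nontrivial roots of unity.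
\<close>

lemma ex_root_of_unity:
  fixes N :: nat
  assumes root: "\<And>p :: 'c::field_char_0 poly. Polynomial.degree p > 0 \<Longrightarrow> \<exists>x. poly p x = 0"
    and N: "N \<ge> 2"
  shows "\<exists>\<zeta> :: 'c. \<zeta> \<noteq> 1 \<and> \<zeta> \<noteq> 0 \<and> \<zeta> ^ N = 1 \<and> (\<Sum>i<N. \<zeta> ^ i) = 0"
proof -
  define p :: "'c poly" where "p = (\<Sum>i<N. Polynomial.monom 1 i)"
  have c: "Polynomial.coeff p (N - 1) = 1" using N by (simp add: p_def coeff_sum)
  then have "Polynomial.degree p \<ge> N - 1" by (intro le_degree) simp
  then have "Polynomial.degree p > 0" using N by linarith
  then obtain \<zeta> where "poly p \<zeta> = 0" using root[of p] by blast
  then have s: "(\<Sum>i<N. \<zeta> ^ i) = 0" by (simp add: p_def poly_sum poly_monom)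
  have "\<zeta> ^ N = 1" using s power_diff_1_eq[of \<zeta> N] by simp
  moreover have "\<zeta> \<noteq> 1" using s N by auto
  moreover have "\<zeta> \<noteq> 0" using \<open>\<zeta> ^ N = 1\<close> N by (auto simp: power_0_left)
  ultimately show ?thesis using s by blast
qed

text \<open>
  An algebraically closed field has enough characters: a subgroup \<open>P\<close> of \<open>\<int>\<^sup>2\<close> without \<open>(0, 1)\<close> is killed by a
  character that is nontrivial on \<open>(0, 1)\<close>. In echelon form, \<open>P\<close> is generated by \<open>(M, n0)\<close> and \<open>(0, N)\<close> with
  \<open>N \<noteq> 1\<close>; choose \<open>\<mu>\<close> with \<open>\<mu>\<^sup>N = 1\<close> and then \<open>\<alpha>\<close> with \<open>\<alpha>\<^sup>M = \<mu>\<^sup>-\<^sup>n\<^sup>0\<close>.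
\<close>

lemma ex_character:
  fixes P :: "(int \<times> int) set"
  assumes root: "\<And>p :: 'c::field_char_0 poly. Polynomial.degree p > 0 \<Longrightarrow> \<exists>x. poly p x = 0"
    and P: "(0, 0) \<in> P" "\<And>m n m' n'. (m, n) \<in> P \<Longrightarrow> (m', n') \<in> P \<Longrightarrow> (m - m', n - n') \<in> P"
    and not: "(0, 1) \<notin> P"
  shows "\<exists>\<alpha> \<mu> :: 'c. \<alpha> \<noteq> 0 \<and> \<mu> \<noteq> 0 \<and> \<mu> \<noteq> 1 \<and> (\<forall>(m, n)\<in>P. \<alpha> powi m * \<mu> powi n = 1)"
proof -
  obtain N where N: "N \<ge> 0" "\<And>n. (0, n) \<in> P \<longleftrightarrow> N dvd n"
    using int_subgroup[of "{n. (0, n) \<in> P}"] P by force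
  have "\<exists>M\<ge>0. \<forall>n. n \<in> fst ` P \<longleftrightarrow> M dvd n"
    by (rule int_subgroup) (use P in force)+
  then obtain M where M: "M \<ge> 0" "\<And>m. m \<in> fst ` P \<longleftrightarrow> M dvd m" by blast
  have "M \<in> fst ` P" using M(2) by simp
  then obtain n0 where n0: "(M, n0) \<in> P" by auto
  have "N \<noteq> 1" using N(2)[of 1] not by auto
  obtain \<mu> :: 'c where \<mu>: "\<mu> \<noteq> 0" "\<mu> \<noteq> 1" "\<mu> powi N = 1"
  proof (cases "N = 0")
    case True
    then show ?thesis using that[of 2] by simp
  next
    case False
    then have "nat N \<ge> 2" using N(1) \<open>N \<noteq> 1\<close> by linarith
    from ex_root_of_unity[OF root this] obtain \<zeta> :: 'c where "\<zeta> \<noteq> 1" "\<zeta> \<noteq> 0" "\<zeta> ^ nat N = 1" by blast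
    then show ?thesis using that[of \<zeta>] N(1) by (simp add: power_int_def)
  qed
  obtain \<alpha> :: 'c where \<alpha>: "\<alpha> \<noteq> 0" "M = 0 \<or> \<alpha> powi M = \<mu> powi (- n0)"
  proof (cases "M = 0")
    case True
    then show ?thesis using that[of 1] by simp
  next
    case False
    then have M0: "nat M > 0" using M(1) by simp
    define q :: "'c poly" where "q = Polynomial.monom 1 (nat M) - [:\<mu> powi (- n0):]"
    have "Polynomial.coeff q (nat M) = 1" using M0 by (simp add: q_def coeff_pCons split: nat.splits)
    then have "Polynomial.degree q \<ge> nat M" by (intro le_degree) simp
    then obtain \<alpha> where "poly q \<alpha> = 0" using root[of q] M0 by auto
    then have *: "\<alpha> ^ nat M = \<mu> powi (- n0)" by (simp add: q_def poly_monom)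
    moreover have "\<alpha> \<noteq> 0" using * \<mu>(1) M0 by (auto simp: power_0_left)
    ultimately show ?thesis using that[of \<alpha>] M(1) by (simp add: power_int_def)
  qed
  have "\<alpha> powi m * \<mu> powi n = 1" if mn: "(m, n) \<in> P" for m n
  proof -
    have "m \<in> fst ` P" using mn by force
    then obtain q where q: "m = M * q" using M(2) by auto
    have neg: "(- a, - b) \<in> P" if "(a, b) \<in> P" for a b using P(2)[OF P(1) that] by simp
    have add: "(a + c, b + d) \<in> P" if "(a, b) \<in> P" "(c, d) \<in> P" for a b c d
      using P(2)[OF that(1) neg[OF that(2)]] by simp
    have mult: "(M * k, n0 * k) \<in> P" for k
    proof (induction k rule: int_induct[where k = 0])
      case (step1 i)
      from add[OF this(2) n0] show ?case by (simp add: algebra_simps)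
    next
      case (step2 i)
      from P(2)[OF this(2) n0] show ?case by (simp add: algebra_simps)
    qed (use P(1) in simp)
    have "(0, n - n0 * q) \<in> P" using P(2)[OF mn mult[of q]] q by simp
    then obtain k where k: "n - n0 * q = N * k" using N(2) by auto
    have 1: "\<mu> powi n = \<mu> powi (n0 * q)"
    proof -
      have "\<mu> powi n = \<mu> powi (n0 * q) * \<mu> powi (N * k)"
      proof -
        have "n = n0 * q + N * k" using k by simp
        then show ?thesis using \<mu>(1) by (simp add: power_int_add)
      qed
      then show ?thesis using \<mu>(3) by (simp add: power_int_mult)
    qed
    show ?thesis
    proof (cases "M = 0")
      case True
      then have "N dvd n" using mn q N(2) by simp
      then obtain k where "n = N * k" by auto
      then show ?thesis using True q \<mu>(3) by (simp add: power_int_mult)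
    next
      case False
      then have "\<alpha> powi m = (\<mu> powi (- n0)) powi q" using \<alpha>(2) q by (simp add: power_int_mult)
      also have "\<dots> = \<mu> powi (- n0 * q)" by (simp only: power_int_mult)
      finally have "\<alpha> powi m = \<mu> powi (- n0 * q)" .
      then show ?thesis unfolding 1 using \<mu>(1) by (simp flip: power_int_add)
    qed
  qed
  then show ?thesis using \<alpha> \<mu> by blast
qed

section \<open>The Picard-Vessiot ring\<close>

locale riccati_pv =
  fixes dC :: "'c::field_char_0 \<Rightarrow> 'c"
    and sK dK :: "'c poly fract \<Rightarrow> 'c poly fract"
    and \<iota> :: "'c poly fract \<Rightarrow> 'r::comm_ring_1"
    and sR dR :: "'r \<Rightarrow> 'r"
    and a b u :: "'c poly fract"
    and y1 y2 y0 w :: 'r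
    and Z :: "'r^2^2"
    and G H :: "('c^2^2) set"
  assumes C: "d_closure_of_Qbar dC"
    and k: "shift_base_field dC sK dK"
    and ab: "a \<in> Qbar_x" "b \<in> Qbar_x" "b \<noteq> 0"
    and u: "u \<in> Qbar_x" "riccati_solution sK a b u"
    and R: "sd_pv_ring sK dK (companion a b) \<iota> sR dR"
    and basis: "riccati_basis \<iota> sR a b u y1 y2 y0 w"
    and Z: "Z = mat2 y1 y2 (sR y1) (sR y2)"
    and G: "G = sd_galois_group \<iota> sR dR Z"
    and H: "H = s_galois_group \<iota> sR Z"
    and H_sub: "H \<subseteq> Gm_Ga"
    and H_conn: "connectedin zariski_topology H"
    and H_Ru: "Ru H = UNIV"
begin

lemma d_closed: "d_closed ring_of_type_algebra dC"
  using C by (simp add: d_closure_of_Qbar_def)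

sublocale shift_field dC sK dK
proof
  show "shift_base_field dC sK dK" by (rule k)
  show "derivation ring_of_type_algebra dC" using d_closed by (simp add: d_closed_def d_field_def)
  show "\<And>p :: 'c poly. Polynomial.degree p > 0 \<Longrightarrow> \<exists>x. poly p x = 0"
    by (rule d_closed_imp_root[OF d_closed])
qed

definition e :: "'c \<Rightarrow> 'r" where "e c = \<iota> (const c)"

lemma sR_hom: "sR (x + y) = sR x + sR y" "sR (x * y) = sR x * sR y" "sR 1 = 1"
  and der_dR: "derivation ring_of_type_algebra dR" and sR_dR: "sR (dR x) = dR (sR x)"
  and \<iota>_hom: "\<iota> (f + g) = \<iota> f + \<iota> g" "\<iota> (f * g) = \<iota> f * \<iota> g" "\<iota> 1 = 1"
  and sR_\<iota>: "sR (\<iota> f) = \<iota> (sK f)" and dR_\<iota>: "dR (\<iota> f) = \<iota> (dK f)"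
  and sd_simple: "ideal I ring_of_type_algebra \<Longrightarrow> sR ` I \<subseteq> I \<Longrightarrow> dR ` I \<subseteq> I \<Longrightarrow> I = {0} \<or> I = UNIV"
  using R by (auto simp: sd_pv_ring_def sd_ring_def ring_iso_def ring_hom_def)

lemmas dR = derivation_typeD[OF der_dR]

lemma e_hom: "e (c + d) = e c + e d" "e (c * d) = e c * e d" "e 1 = 1"
  by (simp_all add: e_def const_hom \<iota>_hom)

lemma sols: "sR (sR y) + \<iota> a * sR y + \<iota> b * y = 0 \<longleftrightarrow>
    (\<exists>!c. y = \<iota> (const (fst c)) * y1 + \<iota> (const (snd c)) * y2)"
  and y1_ne: "y1 \<noteq> 0" and y0_ne: "y0 \<noteq> 0"
  and sR_y1: "sR y1 = \<iota> u * y1" and sR_y2: "sR y2 = \<iota> u * y2 + y0" and sR_y0: "sR y0 = \<iota> (b / u) * y0"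
  and w_eq: "w * (\<iota> u * y1) = y0"
  using basis by (auto simp: riccati_basis_def algebra_simps)

definition y1i :: 'r where "y1i = (SOME y. y1 * y = 1)"
definition y0i :: 'r where "y0i = (SOME y. y0 * y = 1)"

lemma y1i: "y1 * y1i = 1" and y0i: "y0 * y0i = 1"
proof -
  have "\<exists>y. y1 * y = 1" "\<exists>y. y0 * y = 1"
    using basis by (auto simp: riccati_basis_def dvd_def)
  then show "y1 * y1i = 1" "y0 * y0i = 1"
    unfolding y1i_def y0i_def by (metis (mono_tags, lifting) someI_ex)+
qed

lemma u_ne: "u \<noteq> 0"
  using u(2) ab(3) by (auto simp: riccati_solution_def)

text \<open>
  The two solutions are replaced by the unit \<open>y1\<close>, with \<open>\<sigma>(y1) = u y1\<close>, and the quotient \<open>t = y2/y1\<close>, with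
  \<open>\<sigma>(t) = t + w\<close>.
\<close>

definition t :: 'r where "t = y2 * y1i"

lemma \<iota>_unit: "f \<noteq> 0 \<Longrightarrow> \<iota> f * \<iota> (1 / f) = 1"
  by (simp add: \<iota>_hom flip: \<iota>_hom(2))

lemma sR_y1i: "sR y1i = \<iota> (1 / u) * y1i"
proof -
  have 1: "\<iota> u * y1 * sR y1i = 1" using y1i sR_hom(2)[of y1 y1i] by (simp add: sR_hom sR_y1)
  have "sR y1i = (\<iota> u * \<iota> (1 / u)) * (y1 * y1i) * sR y1i" using \<iota>_unit[OF u_ne] y1i by simp
  also have "\<dots> = \<iota> (1 / u) * y1i * (\<iota> u * y1 * sR y1i)" by (simp only: mult_ac)
  finally show ?thesis unfolding 1 by simp
qed

lemma w_y0: "w = \<iota> (1 / u) * (y0 * y1i)"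
proof -
  have "w = w * (\<iota> u * \<iota> (1 / u)) * (y1 * y1i)" using \<iota>_unit[OF u_ne] y1i by simp
  also have "\<dots> = \<iota> (1 / u) * (w * (\<iota> u * y1) * y1i)" by (simp only: mult_ac)
  finally show ?thesis unfolding w_eq .
qed

lemma sR_t: "sR t = t + w"
proof -
  have "sR t = (\<iota> u * \<iota> (1 / u)) * (y2 * y1i) + \<iota> (1 / u) * (y0 * y1i)"
    unfolding t_def sR_hom sR_y2 sR_y1i by (simp add: algebra_simps)
  then show ?thesis using \<iota>_unit[OF u_ne] w_y0 by (simp add: t_def)
qed

lemma w_unit: "w * (\<iota> u * y1 * y0i) = 1"
  using w_eq y0i by (metis mult.assoc)

text \<open>
  The fixed ring of \<open>\<sigma>\<close> is \<open>C\<close>. If \<open>\<sigma>(x) = x\<close>, then \<open>x y1\<close> is again a solution, hence \<open>x = c1 + c2 t\<close> with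
  \<open>c1, c2\<close> in \<open>C\<close>; applying \<open>\<sigma>\<close> gives \<open>c2 w = 0\<close>, and \<open>w\<close> is a unit.
\<close>

sublocale sigma_algebra sR e \<iota> sK
proof
  fix x :: 'r and c d :: 'c and f g
  show "sR (x + y) = sR x + sR y" "sR (x * y) = sR x * sR y" "sR 1 = 1" for y by (rule sR_hom)+
  show "e (c + d) = e c + e d" "e (c * d) = e c * e d" "e 1 = 1" by (rule e_hom)+
  show "\<iota> (f + g) = \<iota> f + \<iota> g" "\<iota> (f * g) = \<iota> f * \<iota> g" "\<iota> 1 = 1" by (rule \<iota>_hom)+
  show "sR (\<iota> f) = \<iota> (sK f)" by (rule sR_\<iota>)
  show "e c \<in> range \<iota>" by (simp add: e_def)
  show "sR x = x \<longleftrightarrow> x \<in> range e"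
  proof
    assume x: "sR x = x"
    have "\<exists>!c. y1 = \<iota> (const (fst c)) * y1 + \<iota> (const (snd c)) * y2"
    proof -
      have "sR (sR y1) + \<iota> a * sR y1 + \<iota> b * y1 = \<iota> (u * sK u + a * u + b) * y1"
        unfolding sR_y1 sR_hom sR_\<iota> \<iota>_hom by (simp add: algebra_simps)
      also have "u * sK u + a * u + b = 0" using u(2) by (simp add: riccati_solution_def)
      also have "\<iota> 0 = 0" using \<iota>_hom(1)[of 0 0] by (metis add.right_neutral add_left_cancel)
      finally show ?thesis using sols[of y1] by simp
    qed
    then have s1: "sR (sR y1) + \<iota> a * sR y1 + \<iota> b * y1 = 0" using sols[of y1] by simp
    have "sR (sR (x * y1)) + \<iota> a * sR (x * y1) + \<iota> b * (x * y1) = x * (sR (sR y1) + \<iota> a * sR y1 + \<iota> b * y1)"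
      by (simp add: sR_hom x algebra_simps)
    then have "\<exists>!c. x * y1 = \<iota> (const (fst c)) * y1 + \<iota> (const (snd c)) * y2"
      unfolding s1 using sols[of "x * y1"] by simp
    then obtain c1 c2 where c: "x * y1 = e c1 * y1 + e c2 * y2"
      by (auto simp: e_def)
    have "x = (x * y1) * y1i" using y1i by (simp add: mult.assoc)
    also have "\<dots> = e c1 * (y1 * y1i) + e c2 * t" unfolding c t_def by (simp add: algebra_simps)
    finally have x': "x = e c1 + e c2 * t" using y1i by simp
    have se: "sR (e c) = e c" for c by (simp add: e_def sR_\<iota>)
    have "sR x - x = e c2 * w" unfolding x' by (simp add: sR_hom se sR_t algebra_simps)
    then have "e c2 * w * (\<iota> u * y1 * y0i) = 0" using x by simp
    then have "e c2 = 0" using w_unit by (simp add: mult.assoc)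
    then show "x \<in> range e" using x' by simp
  next
    assume "x \<in> range e"
    then show "sR x = x" by (auto simp: e_def sR_\<iota>)
  qed
qed

lemma dR_e: "dR (e c) = e (dC c)"
  by (simp add: e_def dR_\<iota>)

lemma subring_iff_subring_set: "subring B (ring_of_type_algebra :: 'r ring) \<longleftrightarrow> subring_set B"
proof
  show "subring B (ring_of_type_algebra :: 'r ring) \<Longrightarrow> subring_set B"
    unfolding subring_ring_of_type_algebra_iff subring_set_def
    by (metis add_uminus_conv_diff)
  show "subring_set B \<Longrightarrow> subring B (ring_of_type_algebra :: 'r ring)"
    unfolding subring_ring_of_type_algebra_iff by (auto dest: subring_setD)
qed

text \<open>
  The fundamental matrix that generates \<open>R\<close> may differ from the given one, but its first row consists of
  solutions, so all its entries are \<open>C\<close>-combinations of \<open>y1\<close>, \<open>y2\<close> and their images under \<open>\<sigma>\<close>.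
\<close>

lemma R_generated:
  assumes B: "subring_set B" and d: "dR ` B \<subseteq> B" and \<iota>B: "\<And>f. \<iota> f \<in> B"
    and y: "y1 \<in> B" "y1i \<in> B" "y2 \<in> B" "y0 \<in> B" "y0i \<in> B"
  shows "B = UNIV"
proof -
  obtain Z' where Z': "fundamental_matrix \<iota> sR (companion a b) Z'"
    and gen: "\<And>B. subring B (ring_of_type_algebra :: 'r ring) \<Longrightarrow> pv_generators \<iota> Z' \<subseteq> B \<Longrightarrow> dR ` B \<subseteq> B \<Longrightarrow> B = UNIV"
    using R by (auto simp: sd_pv_ring_def)
  note BD = subring_setD[OF B]
  have eB: "e c \<in> B" for c by (simp add: e_def \<iota>B)
  define z where "z j = Z' $ 1 $ j" for j
  have eqs: "map_matrix sR Z' = map_matrix \<iota> (companion a b) ** Z'"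
    using Z' by (simp add: fundamental_matrix_def)
  have z2: "Z' $ 2 $ j = sR (z j)" for j
  proof -
    have "sR (Z' $ 1 $ j) = Z' $ 2 $ j"
      using arg_cong[OF eqs, of "\<lambda>A :: 'r^2^2. A $ 1 $ j"]
      by (simp add: map_matrix_def companion_def matrix_matrix_mult_def sum_2 \<iota>_0 \<iota>_1)
    then show ?thesis by (simp add: z_def)
  qed
  have sol: "sR (sR (z j)) + \<iota> a * sR (z j) + \<iota> b * z j = 0" for j
    using arg_cong[OF eqs, of "\<lambda>A :: 'r^2^2. A $ 2 $ j"]
    by (simp add: map_matrix_def companion_def matrix_matrix_mult_def sum_2 \<iota>_uminus z2 z_def)
  have "\<exists>c1 c2. z j = e c1 * y1 + e c2 * y2" for j
    using sol[of j] unfolding sols e_def by auto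
  then obtain c1 c2 where z: "z j = e (c1 j) * y1 + e (c2 j) * y2" for j by metis
  have sz: "sR (z j) = \<iota> u * z j + e (c2 j) * y0" for j
    unfolding z sg_add sg_mult sg_e sR_y1 sR_y2 by (simp add: algebra_simps)
  have zB: "z j \<in> B" "sR (z j) \<in> B" for j
  proof -
    show "z j \<in> B" unfolding z using eB y by (intro BD)
    then show "sR (z j) \<in> B" unfolding sz using eB y \<iota>B by (intro BD)
  qed
  have entries: "Z' $ i $ j \<in> B" for i j
    using zB[of j] z2[of j] exhaust_2[of i] by (auto simp: z_def)
  have det: "det Z' = e (c1 1 * c2 2 - c1 2 * c2 1) * (y1 * y0)"
    unfolding det_2 z2 z_def[symmetric] sz unfolding z e_diff e_mult by (simp add: algebra_simps)
  have "v \<in> B" if v: "v * det Z' = 1" for v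
  proof -
    define D where "D = c1 1 * c2 2 - c1 2 * c2 1"
    have D: "D \<noteq> 0" using v unfolding det D_def[symmetric] by (auto simp: e_0)
    have "v = v * (e D * e (inverse D)) * (y1 * y1i) * (y0 * y0i)"
      using e_inverse[OF D] y1i y0i by simp
    also have "\<dots> = (v * det Z') * (e (inverse D) * y1i * y0i)"
      unfolding det D_def[symmetric] by (simp only: mult_ac)
    also have "\<dots> \<in> B" unfolding v using eB y BD by simp
    finally show ?thesis .
  qed
  then have "pv_generators \<iota> Z' \<subseteq> B"
    unfolding pv_generators_def using entries \<iota>B by auto
  then show ?thesis using gen[of B] B d by (simp add: subring_iff_subring_set)
qed

definition S :: "'r set" where "S = s_pv_subring \<iota> Z"

lemma det_Z: "det Z = y1 * y0"
  unfolding Z det_mat2 sR_y1 sR_y2 by (simp add: algebra_simps)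

lemma sub_S: "subring_set S"
proof -
  interpret cring "ring_of_type_algebra :: 'r ring" by (rule cring_from_type_algebra)
  show ?thesis
    unfolding S_def s_pv_subring_def subring_iff_subring_set[symmetric]
    by (rule generate_ring_is_subring) simp
qed

lemma gen_S: "x \<in> pv_generators \<iota> Z \<Longrightarrow> x \<in> S"
  unfolding S_def s_pv_subring_def by (rule generate_ring.incl)

lemma S_mem: "\<iota> f \<in> S" "y1 \<in> S" "y2 \<in> S" "sR y1 \<in> S" "sR y2 \<in> S" "y0 \<in> S" "y1i \<in> S" "y0i \<in> S" "e c \<in> S"
proof -
  show \<iota>S: "\<iota> f \<in> S" for f by (rule gen_S) (simp add: pv_generators_def)
  then show "e c \<in> S" by (simp add: e_def)
  have entries: "Z $ i $ j \<in> S" for i j by (rule gen_S) (auto simp: pv_generators_def)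
  show y: "y1 \<in> S" "y2 \<in> S" "sR y1 \<in> S" "sR y2 \<in> S"
    using entries[of 1 1] entries[of 1 2] entries[of 2 1] entries[of 2 2] by (simp_all add: Z)
  have "y0 = sR y2 - \<iota> u * y2" using sR_y2 by simp
  then show y0: "y0 \<in> S" using y \<iota>S subring_setD[OF sub_S] by simp
  have "(y1i * y0i) * det Z = (y1 * y1i) * (y0 * y0i)" unfolding det_Z by (simp only: mult_ac)
  then have "(y1i * y0i) * det Z = 1" using y1i y0i by simp
  then have i: "y1i * y0i \<in> S" by (intro gen_S) (simp add: pv_generators_def)
  have "y1i * y0i * y0 = y1i * (y0 * y0i)" by (simp only: mult_ac)
  then have "y1i = y1i * y0i * y0" using y0i by simp
  then show "y1i \<in> S" using i y0 subring_setD(4)[OF sub_S] by metis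
  have "y1i * y0i * y1 = y0i * (y1 * y1i)" by (simp only: mult_ac)
  then have "y0i = y1i * y0i * y1" using y1i by simp
  then show "y0i \<in> S" using i y subring_setD(4)[OF sub_S] by metis
qed

lemma S_least:
  assumes B: "subring_set B" and \<iota>B: "\<And>f. \<iota> f \<in> B"
    and y: "y1 \<in> B" "y1i \<in> B" "y2 \<in> B" "y0 \<in> B" "y0i \<in> B"
  shows "S \<subseteq> B"
proof -
  interpret cring "ring_of_type_algebra :: 'r ring" by (rule cring_from_type_algebra)
  note BD = subring_setD[OF B]
  have "v \<in> B" if v: "v * det Z = 1" for v
  proof -
    have "v = v * (y1 * y1i) * (y0 * y0i)" using y1i y0i by simp
    also have "\<dots> = (v * det Z) * (y1i * y0i)" unfolding det_Z by (simp only: mult_ac)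
    also have "\<dots> \<in> B" unfolding v using y BD by simp
    finally show ?thesis .
  qed
  moreover have "Z $ i $ j \<in> B" for i j
  proof -
    have "sR y1 \<in> B" "sR y2 \<in> B" unfolding sR_y1 sR_y2 using y \<iota>B by (auto intro!: BD)
    then show ?thesis using exhaust_2[of i] exhaust_2[of j] y by (auto simp: Z)
  qed
  ultimately have "pv_generators \<iota> Z \<subseteq> B" unfolding pv_generators_def using \<iota>B by auto
  then show ?thesis
    unfolding S_def s_pv_subring_def using B
    by (intro generate_ring_min_subring1) (simp_all add: subring_iff_subring_set)
qed

lemma mem_H_iff: "T \<in> H \<longleftrightarrow> (\<exists>\<gamma> \<in> ring_iso (ring_of_type_algebra\<lparr>carrier := S\<rparr>) (ring_of_type_algebra\<lparr>carrier := S\<rparr>).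
    (\<forall>f. \<gamma> (\<iota> f) = \<iota> f) \<and> (\<forall>r\<in>S. \<gamma> (sR r) = sR (\<gamma> r)) \<and>
    \<gamma> y1 = y1 * e (T $ 1 $ 1) + y2 * e (T $ 2 $ 1) \<and> \<gamma> y2 = y1 * e (T $ 1 $ 2) + y2 * e (T $ 2 $ 2))"
  (is "_ \<longleftrightarrow> ?R")
proof
  assume "T \<in> H"
  then obtain \<gamma> where *: "\<gamma> \<in> ring_iso (ring_of_type_algebra\<lparr>carrier := S\<rparr>) (ring_of_type_algebra\<lparr>carrier := S\<rparr>)"
    "\<forall>f. \<gamma> (\<iota> f) = \<iota> f" "\<forall>r\<in>S. \<gamma> (sR r) = sR (\<gamma> r)"
    "map_matrix \<gamma> Z = Z ** map_matrix (\<lambda>c. \<iota> (const c)) T"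
    unfolding H s_galois_group_def Let_def S_def by blast
  have "\<gamma> y1 = y1 * e (T $ 1 $ 1) + y2 * e (T $ 2 $ 1)" "\<gamma> y2 = y1 * e (T $ 1 $ 2) + y2 * e (T $ 2 $ 2)"
    using arg_cong[OF *(4), of "\<lambda>A :: 'r^2^2. A $ 1 $ 1"] arg_cong[OF *(4), of "\<lambda>A :: 'r^2^2. A $ 1 $ 2"]
    by (simp_all add: map_matrix_def matrix_matrix_mult_def sum_2 Z e_def)
  then show ?R using * by blast
next
  assume ?R
  then obtain \<gamma> where *: "\<gamma> \<in> ring_iso (ring_of_type_algebra\<lparr>carrier := S\<rparr>) (ring_of_type_algebra\<lparr>carrier := S\<rparr>)"
    "\<forall>f. \<gamma> (\<iota> f) = \<iota> f" "\<forall>r\<in>S. \<gamma> (sR r) = sR (\<gamma> r)"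
    "\<gamma> y1 = y1 * e (T $ 1 $ 1) + y2 * e (T $ 2 $ 1)" "\<gamma> y2 = y1 * e (T $ 1 $ 2) + y2 * e (T $ 2 $ 2)" by blast
  have "map_matrix \<gamma> Z = Z ** map_matrix (\<lambda>c. \<iota> (const c)) T"
    using * S_mem(2,3)
    by (simp add: vec_eq_iff forall_2 map_matrix_def matrix_matrix_mult_def sum_2 Z sg_add sg_mult flip: e_def)
  then show "T \<in> H" unfolding H s_galois_group_def Let_def S_def[symmetric] using * by blast
qed

section \<open>Torus elements of the difference Galois group\<close>

text \<open>
  The quotient \<open>y0/y1\<close> is a unit which \<open>\<sigma>\<close> multiplies by \<open>b/u\<^sup>2\<close>; together with \<open>y1\<close> it generates the
  monomials below.
\<close>

definition ep :: 'r where "ep = y0 * y1i"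
definition epi :: 'r where "epi = y1 * y0i"
definition sr :: "'c poly fract" where "sr = b / (u * u)"

lemma sr_ne: "sr \<noteq> 0" using ab u_ne by (simp add: sr_def)

lemma ep_inv: "ep * epi = 1"
proof -
  have "ep * epi = (y0 * y0i) * (y1 * y1i)" unfolding ep_def epi_def by (simp only: mult_ac)
  then show ?thesis using y0i y1i by simp
qed

lemma sR_ep: "sR ep = \<iota> sr * ep"
proof -
  have "sR ep = (\<iota> (b / u) * \<iota> (1 / u)) * ep"
    unfolding ep_def sg_mult sR_y0 sR_y1i by (simp only: mult_ac)
  also have "\<iota> (b / u) * \<iota> (1 / u) = \<iota> sr" by (simp add: sr_def flip: \<iota>_mult)
  finally show ?thesis .
qed

lemma sR_inverse:
  assumes "y * y' = 1" "sR y = \<iota> v * y" "v \<noteq> 0"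
  shows "sR y' = \<iota> (inverse v) * y'"
proof -
  have 1: "\<iota> v * y * sR y' = 1" using assms(1,2) sg_mult[of y y'] by (simp add: sg_1)
  have "sR y' = (\<iota> v * \<iota> (inverse v)) * (y * y') * sR y'" using \<iota>_inverse[OF assms(3)] assms(1) by simp
  also have "\<dots> = \<iota> (inverse v) * y' * (\<iota> v * y * sR y')" by (simp only: mult_ac)
  finally show ?thesis unfolding 1 by simp
qed

lemma sR_zpow:
  assumes "y * y' = 1" "sR y = \<iota> v * y" "v \<noteq> 0"
  shows "sR (zpow y y' n) = \<iota> (v powi n) * zpow y y' n"
proof -
  have pw: "sR (x ^ m) = sR x ^ m" for x and m :: nat by (induction m) (simp_all add: sg_1 sg_mult)
  have ip: "\<iota> f ^ m = \<iota> (f ^ m)" for f and m :: nat by (induction m) (simp_all add: \<iota>_1 \<iota>_mult)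
  show ?thesis
    unfolding zpow_def power_int_def
    by (simp add: pw assms(2) sR_inverse[OF assms] power_mult_distrib ip)
qed

definition Y :: "int \<times> int \<Rightarrow> 'r" where "Y p = zpow y1 y1i (fst p) * zpow ep epi (snd p)"
definition U :: "int \<times> int \<Rightarrow> 'c poly fract" where "U p = u powi fst p * sr powi snd p"

lemma Y_mon: "Y 0 = 1" "Y (i + j) = Y i * Y j" "sR (Y j) = \<iota> (U j) * Y j"
proof -
  show "Y 0 = 1" by (simp add: Y_def)
  show "Y (i + j) = Y i * Y j"
    by (simp add: Y_def zpow_add[OF y1i] zpow_add[OF ep_inv] mult_ac)
  show "sR (Y j) = \<iota> (U j) * Y j"
    by (simp add: Y_def U_def sg_mult sR_zpow[OF y1i sR_y1 u_ne] sR_zpow[OF ep_inv sR_ep sr_ne] \<iota>_mult mult_ac)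
qed

lemma U_add: "U (i + j) = U i * U j"
  using u_ne sr_ne by (simp add: U_def power_int_add mult_ac)

lemma U_0: "U 0 = 1" by (simp add: U_def)

lemma Y_values: "Y (1, 0) = y1" "Y (- 1, 0) = y1i" "Y (0, 1) = ep" "Y (0, - 1) = epi"
  by (simp_all add: Y_def)

text \<open>
  The subring \<open>k[y1, 1/y1, y0/y1, y1/y0]\<close> of \<open>S\<close>, over which \<open>S\<close> is generated by \<open>t\<close>.
\<close>

definition A :: "'r set" where "A = monomial_ring Y"

lemma sub_A: "subring_set A" and simple_A: "sg_simple A" and \<iota>_A: "\<iota> f \<in> A" and mon_A: "\<iota> f * Y j \<in> A"
  unfolding A_def
  by (rule subring_monomial_ring[of Y U] sg_simple_monomial_ring[of Y U] \<iota>_in_monomial_ring[of Y U] monomial_in_ring[of Y U]; rule Y_mon)+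

lemma Y_A: "Y j \<in> A" using mon_A[of 1 j] by (simp add: \<iota>_1)

lemma A_least:
  assumes B: "subring_set B" and "\<And>f. \<iota> f \<in> B" "y1 \<in> B" "y1i \<in> B" "ep \<in> B" "epi \<in> B"
  shows "A \<subseteq> B"
proof -
  have "Y j \<in> B" for j unfolding Y_def using assms by (intro subring_setD(4)[OF B] zpow_mem)
  then show ?thesis
    unfolding A_def monomial_ring_def using assms(2)
    by (auto intro!: subring_set_sum[OF B] subring_setD(4)[OF B])
qed

lemma w_ep: "w = \<iota> (1 / u) * ep" by (simp add: w_y0 ep_def)

lemma w_A: "w \<in> A"
  using mon_A[of "1 / u" "(0, 1)"] by (simp add: w_ep Y_values)

lemma t_y1: "t * y1 = y2"
proof -
  have "t * y1 = y2 * (y1 * y1i)" by (simp only: t_def mult_ac)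
  then show ?thesis using y1i by simp
qed

lemma ep_y1: "ep * y1 = y0"
proof -
  have "ep * y1 = y0 * (y1 * y1i)" by (simp only: ep_def mult_ac)
  then show ?thesis using y1i by simp
qed

lemma epi_y1i: "epi * y1i = y0i"
proof -
  have "epi * y1i = y0i * (y1 * y1i)" by (simp only: epi_def mult_ac)
  then show ?thesis using y1i by simp
qed

lemma iso_S_D:
  assumes "\<gamma> \<in> ring_iso (ring_of_type_algebra\<lparr>carrier := S\<rparr>) (ring_of_type_algebra\<lparr>carrier := S\<rparr>)"
  shows "x \<in> S \<Longrightarrow> y \<in> S \<Longrightarrow> \<gamma> (x + y) = \<gamma> x + \<gamma> y" "x \<in> S \<Longrightarrow> y \<in> S \<Longrightarrow> \<gamma> (x * y) = \<gamma> x * \<gamma> y" "\<gamma> 1 = 1"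
    "x \<in> S \<Longrightarrow> \<gamma> x \<in> S" "x \<in> S \<Longrightarrow> y \<in> S \<Longrightarrow> \<gamma> (x - y) = \<gamma> x - \<gamma> y"
proof -
  show a: "x \<in> S \<Longrightarrow> y \<in> S \<Longrightarrow> \<gamma> (x + y) = \<gamma> x + \<gamma> y" and "x \<in> S \<Longrightarrow> y \<in> S \<Longrightarrow> \<gamma> (x * y) = \<gamma> x * \<gamma> y" and "\<gamma> 1 = 1"
    and "x \<in> S \<Longrightarrow> \<gamma> x \<in> S" for x y using assms by (auto simp: ring_iso_def ring_hom_def)
  show "x \<in> S \<Longrightarrow> y \<in> S \<Longrightarrow> \<gamma> (x - y) = \<gamma> x - \<gamma> y"
    using a[of "x - y" y] subring_setD[OF sub_S] by (simp add: algebra_simps)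
qed

text \<open>
  Here the hypothesis \<open>Ru H = UNIV\<close> enters. If \<open>w\<close> were summable in \<open>A\<close>, then \<open>t\<close> would lie in \<open>A\<close>. But the
  automorphism of \<open>S\<close> with \<open>y1 \<mapsto> y1\<close>, \<open>y2 \<mapsto> y2 + y1\<close> fixes \<open>A\<close> pointwise and moves \<open>t\<close>.
\<close>

lemma w_not_summable: "g \<in> A \<Longrightarrow> sR g - g \<noteq> w"
proof
  assume g: "g \<in> A" "sR g - g = w"
  have "mat2 1 1 0 1 \<in> H" using H_Ru unfolding Ru_def by blast
  then obtain \<gamma> where \<gamma>: "\<gamma> \<in> ring_iso (ring_of_type_algebra\<lparr>carrier := S\<rparr>) (ring_of_type_algebra\<lparr>carrier := S\<rparr>)"
    "\<And>f. \<gamma> (\<iota> f) = \<iota> f" "\<And>r. r \<in> S \<Longrightarrow> \<gamma> (sR r) = sR (\<gamma> r)" "\<gamma> y1 = y1" "\<gamma> y2 = y1 + y2"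
    unfolding mem_H_iff by (auto simp: e_0 e_1)
  note D = iso_S_D[OF \<gamma>(1)] and SD = subring_setD[OF sub_S]
  have inv: "\<gamma> x' = x'" if "\<gamma> x = x" "x * x' = 1" "x \<in> S" "x' \<in> S" for x x'
  proof -
    have "x * \<gamma> x' = 1" using D(2)[of x x'] that D(3) by simp
    then have "x' = x' * (x * \<gamma> x')" by simp
    also have "\<dots> = (x * x') * \<gamma> x'" by (simp only: mult_ac)
    finally show ?thesis using that(2) by simp
  qed
  have "y0 = sR y2 - \<iota> u * y2" using sR_y2 by simp
  then have "\<gamma> y0 = sR (y1 + y2) - \<iota> u * (y1 + y2)"
    using D SD S_mem \<gamma> by simp
  then have g0: "\<gamma> y0 = y0" by (simp add: sg_add sR_y1 sR_y2 algebra_simps)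
  have g0i: "\<gamma> y0i = y0i" "\<gamma> y1i = y1i" using inv[OF g0 y0i] inv[OF \<gamma>(4) y1i] S_mem by auto
  have "subring_set {r \<in> S. \<gamma> r = r}"
    unfolding subring_set_def using D SD by auto
  then have "A \<subseteq> {r \<in> S. \<gamma> r = r}"
  proof (rule A_least)
    show "ep \<in> {r \<in> S. \<gamma> r = r}" "epi \<in> {r \<in> S. \<gamma> r = r}"
      unfolding ep_def epi_def using D SD S_mem g0 g0i \<gamma> by simp_all
  qed (use S_mem \<gamma> g0i in auto)
  moreover have "t \<in> A"
  proof -
    have "sR (t - g) = t - g" using g(2) by (simp add: sg_diff sR_t algebra_simps)
    then obtain c where "t - g = e c" using sg_fixed by blast
    then have "t = g + e c" by (simp add: algebra_simps)
    moreover have "e c \<in> A" by (simp add: e_def \<iota>_A)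
    ultimately show ?thesis using g subring_setD[OF sub_A] by simp
  qed
  ultimately have "\<gamma> t = t" "t \<in> S" by auto
  then have "\<gamma> (t * y1) = t * y1" using D(2) S_mem \<gamma>(4) by simp
  then have "\<gamma> y2 = y2" by (simp only: t_y1)
  then show False using \<gamma>(5) y1_ne by simp
qed

lemma adjoin_A_t: "adjoin A t = S"
proof
  have sub: "subring_set (adjoin A t)" by (rule subring_set_adjoin[OF sub_A])
  have A_S: "A \<subseteq> S"
    using subring_setD[OF sub_S] S_mem by (intro A_least sub_S) (auto simp: ep_def epi_def)
  have tS: "t \<in> S" unfolding t_def using S_mem subring_setD[OF sub_S] by simp
  show "adjoin A t \<subseteq> S"
    using subring_set_poly[OF sub_S _ tS] A_S unfolding adjoin_def poly_over_def by blast
  have A': "A \<subseteq> adjoin A t" by (rule adjoin_supset[OF sub_A])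
  have t': "t \<in> adjoin A t"
    unfolding adjoin_def
    by (intro CollectI exI[of _ "[:0, 1:]"]) (simp add: poly_over_closed[OF sub_A] subring_setD[OF sub_A])
  have Ym: "y1 \<in> A" "y1i \<in> A" "ep \<in> A" "epi \<in> A"
    using Y_A[of "(1, 0)"] Y_A[of "(- 1, 0)"] Y_A[of "(0, 1)"] Y_A[of "(0, - 1)"] by (simp_all add: Y_values)
  show "S \<subseteq> adjoin A t"
  proof (rule S_least[OF sub])
    have "t * y1 \<in> adjoin A t" "ep * y1 \<in> adjoin A t" "epi * y1i \<in> adjoin A t"
      using t' A' Ym subring_setD(4)[OF sub] by blast+
    then show "y2 \<in> adjoin A t" "y0 \<in> adjoin A t" "y0i \<in> adjoin A t"
      unfolding t_y1 ep_y1 epi_y1i .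
  qed (use A' Ym \<iota>_A in auto)
qed

lemma simple_S: "sg_simple S"
  unfolding adjoin_A_t[symmetric]
  by (rule sg_simple_adjoin[OF simple_A sR_t w_A w_not_summable])

text \<open>
  Scaling \<open>y1\<close> by \<open>\<alpha>\<close> and both \<open>y0/y1\<close> and \<open>t\<close> by \<open>\<mu>\<close> is compatible with \<open>\<sigma>(t) = t + w\<close>, because \<open>w\<close> is a
  \<open>k\<close>-multiple of \<open>y0/y1\<close>. It is an automorphism if it respects the relations between the monomials, since \<open>t\<close> is
  transcendental over \<open>A\<close>. The proof works with the graph: it is single-valued on \<open>A\<close> by \<open>monomial_twist\<close> and on
  \<open>S = A[t]\<close> by transcendence, and it is injective because \<open>S\<close> is \<open>\<sigma>\<close>-simple.
\<close>

theorem torus_in_H: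
  assumes nz: "\<alpha> \<noteq> 0" "\<mu> \<noteq> 0"
    and triv: "\<And>m n h. h \<noteq> 0 \<Longrightarrow> U (m, n) * h = sK h \<Longrightarrow> \<alpha> powi m * \<mu> powi n = 1"
  shows "mat2 \<alpha> 0 0 (\<alpha> * \<mu>) \<in> H"
proof -
  define \<psi> where "\<psi> p = \<alpha> powi fst p * \<mu> powi snd p" for p :: "int \<times> int"
  have \<psi>: "\<psi> 0 = 1" "\<psi> (i + j) = \<psi> i * \<psi> j" for i j
    using nz by (simp_all add: \<psi>_def power_int_add mult_ac)
  define \<Gamma>0 where "\<Gamma>0 = twist_rel Y \<psi>"
  have sub0: "subring_rel \<Gamma>0" unfolding \<Gamma>0_def by (rule subring_rel_twist) (simp_all add: Y_mon \<psi>)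
  have fun0: "s = 0" if "(0, s) \<in> \<Gamma>0" for s
  proof (rule twist_rel_functional[OF Y_mon(3) _ _ that[unfolded \<Gamma>0_def]])
    show "\<exists>y. Y j * y = 1" for j using Y_unit[of Y U j] Y_mon by blast
    fix i j h assume h: "h \<noteq> 0" "U i * h = sK h * U j"
    have "U (i + - j) * h = sK h * U (j + - j)" unfolding U_add using h by (simp add: mult_ac)
    then have *: "U (i - j) * h = sK h" by (simp add: U_0)
    have "i - j = (fst (i - j), snd (i - j))" by (rule prod.collapse[symmetric])
    then have "\<psi> (i - j) = 1" unfolding \<psi>_def by (intro triv[OF h(1)]) (use * in argo)
    then show "\<psi> i = \<psi> j" using \<psi>(2)[of "i - j" j] by simp
  qed
  define \<Gamma> where "\<Gamma> = adjoin_rel \<Gamma>0 t (e \<mu> * t)"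
  have sub: "subring_rel \<Gamma>" and \<Gamma>0: "\<Gamma>0 \<subseteq> \<Gamma>" and t\<Gamma>: "(t, e \<mu> * t) \<in> \<Gamma>"
    unfolding \<Gamma>_def by (rule subring_rel_adjoin[OF sub0])+
  have funct: "s = 0" if "(0, s) \<in> \<Gamma>" for s
  proof (rule adjoin_rel_functional[where B = A and \<Gamma> = \<Gamma>0])
    show "(0, s) \<in> adjoin_rel \<Gamma>0 t (e \<mu> * t)" using that by (simp add: \<Gamma>_def)
    show "\<And>p. poly_over A p \<Longrightarrow> poly p t = 0 \<Longrightarrow> p = 0"
      by (rule transcendental_adjoin[OF simple_A sR_t w_A w_not_summable])
    show "\<And>r s. (r, s) \<in> \<Gamma>0 \<Longrightarrow> r \<in> A" unfolding \<Gamma>0_def A_def by (rule twist_rel_fst)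
    show "\<And>s. (0, s) \<in> \<Gamma>0 \<Longrightarrow> s = 0" by (rule fun0)
  qed
  have mon: "(\<iota> f * Y j, \<iota> f * e (\<psi> j) * Y j) \<in> \<Gamma>" for f j
    by (rule subsetD[OF \<Gamma>0[unfolded \<Gamma>0_def]]) (rule twist_rel.monomial)
  have \<iota>\<Gamma>: "(\<iota> f, \<iota> f) \<in> \<Gamma>" for f using mon[of f 0] by (simp add: Y_mon \<psi> e_1)
  have Ym: "(Y j, e (\<psi> j) * Y j) \<in> \<Gamma>" for j using mon[of 1 j] by (simp add: \<iota>_1)
  have y: "(y1, e \<alpha> * y1) \<in> \<Gamma>" "(y1i, e (inverse \<alpha>) * y1i) \<in> \<Gamma>" "(ep, e \<mu> * ep) \<in> \<Gamma>" "(epi, e (inverse \<mu>) * epi) \<in> \<Gamma>"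
    using Ym[of "(1, 0)"] Ym[of "(- 1, 0)"] Ym[of "(0, 1)"] Ym[of "(0, - 1)"]
    by (simp_all add: Y_values \<psi>_def power_int_minus)
  note D = subring_relD[OF sub]
  have SS: "r \<in> S" "s \<in> S" if "(r, s) \<in> \<Gamma>" for r s
  proof -
    have "\<Gamma> \<subseteq> S \<times> S"
      unfolding \<Gamma>_def
    proof (rule adjoin_rel_least)
      show "subring_rel (S \<times> S)" unfolding subring_rel_def using subring_setD[OF sub_S] by auto
      have tS: "t \<in> S" unfolding t_def using S_mem subring_setD[OF sub_S] by simp
      then show "(t, e \<mu> * t) \<in> S \<times> S" using S_mem subring_setD[OF sub_S] by simp
      have AS: "A \<subseteq> S" using adjoin_supset[OF sub_A] adjoin_A_t by blast
      show "\<Gamma>0 \<subseteq> S \<times> S"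
      proof clarify
        fix r s assume "(r, s) \<in> \<Gamma>0"
        then show "r \<in> S \<and> s \<in> S" unfolding \<Gamma>0_def
        proof induction
          case (monomial f j)
          have "Y j \<in> S" using Y_A AS by blast
          then show ?case using S_mem subring_setD[OF sub_S] by simp
        qed (use subring_setD[OF sub_S] in auto)
      qed
    qed
    then show "r \<in> S" "s \<in> S" using that by auto
  qed
  have prod: "(y0, e (\<alpha> * \<mu>) * y0) \<in> \<Gamma>" "(y2, e (\<alpha> * \<mu>) * y2) \<in> \<Gamma>" "(y0i, e (inverse (\<alpha> * \<mu>)) * y0i) \<in> \<Gamma>"
  proof -
    have 1: "(e \<mu> * x) * (e \<alpha> * y) = e (\<alpha> * \<mu>) * (x * y)"
      "(e (inverse \<mu>) * x) * (e (inverse \<alpha>) * y) = e (inverse (\<alpha> * \<mu>)) * (x * y)" for x y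
      by (simp_all add: e_mult mult_ac)
    show "(y0, e (\<alpha> * \<mu>) * y0) \<in> \<Gamma>" "(y2, e (\<alpha> * \<mu>) * y2) \<in> \<Gamma>" "(y0i, e (inverse (\<alpha> * \<mu>)) * y0i) \<in> \<Gamma>"
      using D(4)[OF y(3) y(1)] D(4)[OF t\<Gamma> y(1)] D(4)[OF y(4) y(2)]
      unfolding 1 t_y1 ep_y1 epi_y1i .
  qed
  have dom: "fst ` \<Gamma> = S"
  proof
    show "fst ` \<Gamma> \<subseteq> S" using SS by auto
    show "S \<subseteq> fst ` \<Gamma>"
      by (rule S_least[OF subring_set_fst[OF sub]]) (use \<iota>\<Gamma> y prod in \<open>force+\<close>)
  qed
  have ran: "snd ` \<Gamma> = S"
  proof
    show "snd ` \<Gamma> \<subseteq> S" using SS by auto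
    have ee: "(e c, e c) \<in> \<Gamma>" for c by (simp add: e_def \<iota>\<Gamma>)
    have *: "x \<in> snd ` \<Gamma>" if "(x, e c * x) \<in> \<Gamma>" "c \<noteq> 0" for x c
    proof -
      have "(e (inverse c) * x, e (inverse c) * (e c * x)) \<in> \<Gamma>" by (rule D(4)[OF ee that(1)])
      moreover have "e (inverse c) * (e c * x) = x" using e_inverse[OF that(2)] by (metis mult.assoc mult.commute mult_1)
      ultimately show ?thesis by force
    qed
    show "S \<subseteq> snd ` \<Gamma>"
    proof (rule S_least[OF subring_set_snd[OF sub]])
      show "\<iota> f \<in> snd ` \<Gamma>" for f using \<iota>\<Gamma>[of f] by force
    qed (use *[OF y(1)] *[OF y(2)] *[OF prod(1)] *[OF prod(2)] *[OF prod(3)] nz in auto)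
  qed
  have sg\<Gamma>: "(sR r, sR s) \<in> \<Gamma>" if "(r, s) \<in> \<Gamma>" for r s
  proof -
    define \<Delta> where "\<Delta> = {(r, s). (sR r, sR s) \<in> \<Gamma>}"
    have "\<Gamma> \<subseteq> \<Delta>"
      unfolding \<Gamma>_def
    proof (rule adjoin_rel_least)
      show "subring_rel \<Delta>" unfolding subring_rel_def \<Delta>_def using D by (auto simp: sg_diff sg_mult sg_1)
      have "(w, e \<mu> * w) \<in> \<Gamma>" using D(4)[OF \<iota>\<Gamma>[of "1 / u"] y(3)] by (simp add: w_ep mult_ac)
      from D(6)[OF t\<Gamma> this] show "(t, e \<mu> * t) \<in> \<Delta>" by (simp add: \<Delta>_def sg_mult sR_t algebra_simps)
      show "\<Gamma>0 \<subseteq> \<Delta>"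
      proof clarify
        fix r s assume "(r, s) \<in> \<Gamma>0"
        then show "(r, s) \<in> \<Delta>" unfolding \<Gamma>0_def
        proof induction
          case (monomial f j)
          have "sR (\<iota> f * Y j) = \<iota> (sK f * U j) * Y j" "sR (\<iota> f * e (\<psi> j) * Y j) = \<iota> (sK f * U j) * e (\<psi> j) * Y j"
            by (simp_all add: sg_mult sg_\<iota> Y_mon \<iota>_mult mult_ac)
          then show ?case using mon[of "sK f * U j" j] by (simp add: \<Delta>_def)
        next
          case (add r r' s s')
          then show ?case using D by (simp add: \<Delta>_def sg_add)
        qed
      qed
    qed
    then show ?thesis using that by (auto simp: \<Delta>_def)
  qed
  have inj: "r = 0" if r: "(r, 0) \<in> \<Gamma>" for r
  proof -
    define I where "I = {r. (r, 0) \<in> \<Gamma>}"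
    have "sg_ideal S I"
      unfolding sg_ideal_def
    proof (intro conjI ballI)
      fix x z assume "x \<in> S" "z \<in> I"
      then obtain x' where "(x, x') \<in> \<Gamma>" using dom by force
      from D(4)[OF this, of z 0] \<open>z \<in> I\<close> show "x * z \<in> I" by (simp add: I_def)
    next
      show "I \<subseteq> S" using SS by (auto simp: I_def)
      show "0 \<in> I" using D(2) by (simp add: I_def)
    next
      fix x y assume "x \<in> I" "y \<in> I"
      then show "x + y \<in> I" using D(6)[of x 0 y 0] by (simp add: I_def)
    next
      fix x assume "x \<in> I"
      then show "sR x \<in> I" using sg\<Gamma>[of x 0] by (simp add: I_def sg_0)
    qed
    then have "I = {0} \<or> 1 \<in> I" using simple_S by (simp add: sg_simple_def)
    moreover have "1 \<notin> I"
    proof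
      assume "1 \<in> I"
      then have "(1 - 1, 0 - 1) \<in> \<Gamma>" using D(1,3) unfolding I_def by blast
      then show False using funct[of "- 1"] by simp
    qed
    ultimately show ?thesis using r by (auto simp: I_def)
  qed
  obtain \<gamma> where \<gamma>: "\<gamma> \<in> ring_iso (ring_of_type_algebra\<lparr>carrier := S\<rparr>) (ring_of_type_algebra\<lparr>carrier := S\<rparr>)"
    "\<And>r s. (r, s) \<in> \<Gamma> \<Longrightarrow> \<gamma> r = s"
    using graph_ring_iso[OF sub funct inj dom ran] by blast
  have "\<gamma> (sR r) = sR (\<gamma> r)" if rS: "r \<in> S" for r
  proof -
    obtain s where s: "(r, s) \<in> \<Gamma>" using dom rS by force
    show ?thesis using \<gamma>(2)[OF s] \<gamma>(2)[OF sg\<Gamma>[OF s]] by simp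
  qed
  moreover have "\<gamma> (\<iota> f) = \<iota> f" for f by (rule \<gamma>(2)[OF \<iota>\<Gamma>])
  ultimately show ?thesis
    unfolding mem_H_iff using \<gamma>(1) \<gamma>(2)[OF y(1)] \<gamma>(2)[OF prod(2)]
    by (intro bexI[of _ \<gamma>]) (simp_all add: e_0 mult.commute)
qed

end

lemma closedin_zariski: "closedin zariski_topology V \<longleftrightarrow> zariski_closed (V :: ('a::idom^'n^'m) set)"
proof -
  have "zariski_closed ({} :: ('a^'n^'m) set)"
    unfolding zariski_closed_def
    by (rule exI[of _ "{\<lambda>_. 1}"]) (auto intro: matrix_polys.intros)
  then have "openin zariski_topology (UNIV :: ('a^'n^'m) set)" by (simp add: openin_zariski)
  then have "topspace (zariski_topology :: ('a^'n^'m) topology) = UNIV"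
    using openin_subset by blast
  then show ?thesis by (simp add: closedin_def openin_zariski Compl_eq_Diff_UNIV[symmetric])
qed

section \<open>Coboundaries and connectedness\<close>

context riccati_pv begin

abbreviation cob :: "'c poly fract \<Rightarrow> bool" where
  "cob f \<equiv> \<exists>h. h \<noteq> 0 \<and> f * h = sK h"

lemma cob_divide: "cob f \<Longrightarrow> cob g \<Longrightarrow> cob (f / g)"
proof -
  assume "cob f" "cob g"
  then obtain h h' where h: "h \<noteq> 0" "f * h = sK h" "h' \<noteq> 0" "g * h' = sK h'" by blast
  have "g \<noteq> 0" using h by auto
  then have "f / g * (h / h') = sK (h / h')" unfolding sK_divide h(2)[symmetric] h(4)[symmetric]
    using h by (simp add: field_simps)
  then show ?thesis using h by (intro exI[of _ "h / h'"]) simp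
qed

lemma U_diff: "U (m - m', n - n') = U (m, n) / U (m', n')"
  using u_ne sr_ne by (simp add: U_def power_int_diff)

text \<open>
  Otherwise the relations between \<open>y1\<close> and \<open>y0/y1\<close> leave room for a torus element of \<open>H\<close> with \<open>\<mu> \<noteq> 1\<close>, whose
  diagonal entries \<open>\<alpha>\<close> and \<open>\<alpha> \<mu>\<close> differ. But elements of \<open>Gm_Ga\<close> have equal diagonal entries.
\<close>

theorem cob_sr: "cob sr"
proof (rule ccontr)
  assume not: "\<not> cob sr"
  define P where "P = {p. cob (U p)}"
  have "\<exists>\<alpha> \<mu> :: 'c. \<alpha> \<noteq> 0 \<and> \<mu> \<noteq> 0 \<and> \<mu> \<noteq> 1 \<and> (\<forall>(m, n)\<in>P. \<alpha> powi m * \<mu> powi n = 1)"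
  proof (rule ex_character)
    show "\<And>p :: 'c poly. Polynomial.degree p > 0 \<Longrightarrow> \<exists>x. poly p x = 0" by (rule root)
    show "(0, 0) \<in> P" by (auto simp: P_def U_def sK_hom intro!: exI[of _ 1])
    show "(m - m', n - n') \<in> P" if "(m, n) \<in> P" "(m', n') \<in> P" for m n m' n'
      using cob_divide[of "U (m, n)" "U (m', n')"] that by (simp only: P_def mem_Collect_eq U_diff)
    show "(0, 1) \<notin> P" using not by (simp add: P_def U_def)
  qed
  then obtain \<alpha> \<mu> :: 'c where *: "\<alpha> \<noteq> 0" "\<mu> \<noteq> 0" "\<mu> \<noteq> 1" "\<And>m n. (m, n) \<in> P \<Longrightarrow> \<alpha> powi m * \<mu> powi n = 1" by blast
  have "mat2 \<alpha> 0 0 (\<alpha> * \<mu>) \<in> H"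
    by (rule torus_in_H[OF *(1,2)]) (use *(4) in \<open>auto simp: P_def\<close>)
  then have "mat2 \<alpha> 0 0 (\<alpha> * \<mu>) \<in> Gm_Ga" using H_sub by blast
  then have "\<alpha> * \<mu> = \<alpha>" by (auto simp: mem_Gm_Ga_iff mat2_eq_iff)
  then show False using *(1,3) by simp
qed

text \<open>
  The quotient of two solutions of the same first-order multiplicative equation is fixed by \<open>\<sigma>\<close>.
\<close>

lemma cob_eq_fixed:
  assumes "y * y' = 1" "sR y = \<iota> v * y" "v * h = sK h" "h \<noteq> 0"
  shows "\<exists>c. y = e c * \<iota> h"
proof (rule fixed_quotient)
  show "\<iota> h * \<iota> (inverse h) = 1" by (rule \<iota>_inverse[OF assms(4)])
  show "sR y * \<iota> h = sR (\<iota> h) * y"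
    by (simp add: assms(2) sg_\<iota> mult_ac flip: assms(3) \<iota>_mult)
qed

text \<open>
  \<open>y0/y1\<close> is a constant times a rational function, and the latter can be taken over the algebraic numbers.
  The constant is removed by rescaling \<open>y1\<close>.
\<close>

theorem w_normal_form: "\<exists>c w0. c \<noteq> 0 \<and> w0 \<in> Qbar_x \<and> w = \<iota> (const c * w0)"
proof -
  obtain h where h: "h \<noteq> 0" "sr * h = sK h" using cob_sr by blast
  have "sr \<in> Qbar_x" unfolding sr_def using ab u by (intro Qbar_x_closed)
  then obtain d h' where h': "d \<noteq> 0" "h' \<in> Qbar_x" "h = const d * h'"
    using multiplicative_descent[of sr h] h by metis
  obtain c where c: "ep = e c * \<iota> h" using cob_eq_fixed[OF ep_inv sR_ep h(2,1)] by blast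
  have c0: "c \<noteq> 0" using c ep_inv by (auto simp: e_0)
  have "w = \<iota> (const (c * d) * (h' / u))"
    unfolding w_ep c e_def h'(3) const_hom by (simp add: \<iota>_mult mult_ac divide_inverse)
  moreover have "h' / u \<in> Qbar_x" using h' u by (intro Qbar_x_closed)
  moreover have "c * d \<noteq> 0" using c0 h' by simp
  ultimately show ?thesis by blast
qed

lemma case_i_iff_cob: "case_i sK u \<longleftrightarrow> cob u"
proof
  assume "cob u"
  then obtain h where h: "h \<noteq> 0" "u * h = sK h" by blast
  then obtain d h' where h': "d \<noteq> 0" "h' \<in> Qbar_x" "h = const d * h'"
    using multiplicative_descent[OF u(1)] by metis
  have "h' \<noteq> 0" using h h' by auto
  moreover have "u = sK h' / h'" using h(2) h'(1) \<open>h' \<noteq> 0\<close> unfolding h'(3) sK_hom sK_const by (simp add: field_simps)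
  ultimately show "case_i sK u" using h' by (auto simp: case_i_def)
qed (auto simp: case_i_def)

lemma H_elim:
  assumes "T \<in> H"
  shows "\<exists>\<alpha> \<beta> \<gamma>. T = mat2 \<alpha> \<beta> 0 \<alpha> \<and> \<alpha> \<noteq> 0 \<and>
    \<gamma> \<in> ring_iso (ring_of_type_algebra\<lparr>carrier := S\<rparr>) (ring_of_type_algebra\<lparr>carrier := S\<rparr>) \<and>
    (\<forall>f. \<gamma> (\<iota> f) = \<iota> f) \<and> \<gamma> y1 = e \<alpha> * y1"
proof -
  obtain \<alpha> \<beta> where T: "T = mat2 \<alpha> \<beta> 0 \<alpha>" "\<alpha> \<noteq> 0" using assms H_sub by (auto simp: Gm_Ga_def)
  from assms obtain \<gamma> where "\<gamma> \<in> ring_iso (ring_of_type_algebra\<lparr>carrier := S\<rparr>) (ring_of_type_algebra\<lparr>carrier := S\<rparr>)"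
    "\<forall>f. \<gamma> (\<iota> f) = \<iota> f" "\<gamma> y1 = y1 * e (T $ 1 $ 1) + y2 * e (T $ 2 $ 1)" unfolding mem_H_iff by blast
  then show ?thesis using T by (intro exI[of _ \<alpha>] exI[of _ \<beta>] exI[of _ \<gamma>]) (simp add: e_0 mult.commute)
qed

text \<open>
  The exponents \<open>m\<close> for which \<open>u\<^sup>m\<close> is a coboundary form a subgroup \<open>N \<int>\<close>. If \<open>N > 1\<close>, then \<open>y1\<^sup>N\<close> lies in \<open>k\<close> up to a
  constant, so the diagonal entry of every element of \<open>H\<close> is an \<open>N\<close>-th root of unity, and a nontrivial one
  occurs by \<open>torus_in_H\<close>. The factorisation \<open>X\<^sup>N - 1 = (X - 1)(1 + X + \<dots> + X\<^sup>N\<^sup>-\<^sup>1)\<close> then splits \<open>H\<close> into two nonempty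
  closed parts, contrary to connectedness.
\<close>

theorem cob_power_imp_cob:
  assumes "m \<noteq> 0" "cob (u powi m)"
  shows "cob u"
proof -
  define Q where "Q = {m. cob (u powi m)}"
  have "0 \<in> Q" by (auto simp: Q_def sK_hom intro!: exI[of _ 1])
  moreover have "m - n \<in> Q" if "m \<in> Q" "n \<in> Q" for m n
    using cob_divide[of "u powi m" "u powi n"] that by (simp only: Q_def mem_Collect_eq power_int_diff u_ne not_False_eq_True simp_thms)
  ultimately obtain N where N: "N \<ge> 0" "\<And>n. n \<in> Q \<longleftrightarrow> N dvd n" using int_subgroup by blast
  have "N \<noteq> 0" using N(2)[of m] assms by (auto simp: Q_def)
  have "N = 1"
  proof (rule ccontr)
    assume "N \<noteq> 1"
    define n where "n = nat N"
    have n: "n \<ge> 2" "N = int n" using \<open>N \<noteq> 0\<close> \<open>N \<noteq> 1\<close> N(1) by (auto simp: n_def)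
    from ex_root_of_unity[OF root n(1)] obtain \<zeta> :: 'c
      where \<zeta>: "\<zeta> \<noteq> 1" "\<zeta> \<noteq> 0" "\<zeta> ^ n = 1" "(\<Sum>i<n. \<zeta> ^ i) = 0" by blast
    have "mat2 \<zeta> 0 0 (\<zeta> * 1) \<in> H"
    proof (rule torus_in_H)
      fix i j h assume h: "h \<noteq> 0" "U (i, j) * h = sK h"
      have 1: "cob (U (0, j))"
      proof -
        obtain k where k: "k \<noteq> 0" "sr * k = sK k" using cob_sr by blast
        have pw: "sK (f ^ l) = sK f ^ l" for f l by (induction l) (simp_all add: sK_hom)
        have "sK (k powi j) = sK k powi j"
          by (simp add: power_int_def pw sK_divide inverse_eq_divide sK_hom)
        also have "\<dots> = U (0, j) * k powi j"
          unfolding k(2)[symmetric] by (simp add: U_def power_int_mult_distrib)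
        finally have "U (0, j) * k powi j = sK (k powi j)" by simp
        moreover have "k powi j \<noteq> 0" using k(1) by simp
        ultimately show ?thesis by blast
      qed
      have "cob (U (i, j) / U (0, j))" using cob_divide[OF _ 1] h by blast
      then have "cob (u powi i)" using sr_ne by (simp add: U_def)
      then have "N dvd i" using N(2) by (simp add: Q_def)
      then obtain l where "i = int n * l" using n by auto
      then have "\<zeta> powi i = 1" using \<zeta>(3) by (simp add: power_int_mult)
      then show "\<zeta> powi i * 1 powi j = 1" by simp
    qed (use \<zeta> in auto)
    then have \<zeta>H: "mat2 \<zeta> 0 0 \<zeta> \<in> H" by simp
    have "mat2 1 0 0 1 \<in> H" using H_Ru unfolding Ru_def by blast
    have pow: "(T $ 1 $ 1) ^ n = 1" if "T \<in> H" for T :: "'c^2^2"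
    proof -
      from that obtain \<alpha> \<beta> \<gamma> where T: "T = mat2 \<alpha> \<beta> 0 \<alpha>" "\<alpha> \<noteq> 0"
        and \<gamma>: "\<gamma> \<in> ring_iso (ring_of_type_algebra\<lparr>carrier := S\<rparr>) (ring_of_type_algebra\<lparr>carrier := S\<rparr>)"
        "\<And>f. \<gamma> (\<iota> f) = \<iota> f" "\<gamma> y1 = e \<alpha> * y1" using H_elim by blast
      note D = iso_S_D[OF \<gamma>(1)] and SD = subring_setD[OF sub_S]
      have "int n \<in> Q" using N(2) n by simp
      then obtain h where h: "h \<noteq> 0" "u powi int n * h = sK h" by (auto simp: Q_def)
      have zi: "zpow y1 y1i (int n) * zpow y1 y1i (- int n) = 1"
        using zpow_add[OF y1i, of "int n" "- int n"] by simp
      obtain c where c: "zpow y1 y1i (int n) = e c * \<iota> h"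
        using cob_eq_fixed[OF zi sR_zpow[OF y1i sR_y1 u_ne] h(2,1)] by blast
      have yn: "y1 ^ n = e c * \<iota> h" using c by (simp add: zpow_def)
      have ypS: "y1 ^ l \<in> S" for l by (induction l) (use SD S_mem in auto)
      have "\<gamma> (y1 ^ l) = e (\<alpha> ^ l) * y1 ^ l" for l
      proof (induction l)
        case (Suc l)
        then show ?case using D(2)[of y1 "y1 ^ l"] ypS S_mem \<gamma>(3) by (simp add: e_mult mult_ac)
      qed (simp add: D(3) e_1)
      moreover have "\<gamma> (y1 ^ n) = y1 ^ n"
        unfolding yn e_def \<iota>_mult[symmetric] \<gamma>(2) ..
      ultimately have "(e (\<alpha> ^ n) - 1) * y1 ^ n = 0" by (simp add: algebra_simps)
      moreover have "y1 ^ n * y1i ^ n = 1" by (simp add: y1i flip: power_mult_distrib)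
      ultimately have "e (\<alpha> ^ n) - 1 = 0" by (metis mult.assoc mult.right_neutral mult_zero_left)
      then have "e (\<alpha> ^ n) = e 1" by (simp add: e_1)
      then show ?thesis by (simp add: e_eq_iff T)
    qed
    define V1 V2 :: "('c^2^2) set" where "V1 = {T. T $ 1 $ 1 - 1 = 0}" and "V2 = {T. (\<Sum>i<n. (T $ 1 $ 1) ^ i) = 0}"
    have powp: "(\<lambda>T :: 'c^2^2. (T $ 1 $ 1) ^ i) \<in> matrix_polys" for i
      by (induction i) (auto intro: matrix_polys.intros)
    have "(\<lambda>T :: 'c^2^2. \<Sum>i<l. (T $ 1 $ 1) ^ i) \<in> matrix_polys" for l
      by (induction l) (use powp in \<open>auto intro: matrix_polys.intros\<close>)
    then have V2: "closedin zariski_topology V2"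
      unfolding closedin_zariski zariski_closed_def V2_def
      by (intro exI[of _ "{\<lambda>T :: 'c^2^2. \<Sum>i<n. (T $ 1 $ 1) ^ i}"]) auto
    have "(\<lambda>T :: 'c^2^2. T $ 1 $ 1 + (- 1)) \<in> matrix_polys" by (intro matrix_polys.intros)
    then have V1: "closedin zariski_topology V1"
      unfolding closedin_zariski zariski_closed_def V1_def
      by (intro exI[of _ "{\<lambda>T :: 'c^2^2. T $ 1 $ 1 + (- 1)}"]) auto
    have "H \<subseteq> V1 \<union> V2"
    proof
      fix T :: "'c^2^2" assume "T \<in> H"
      then have "(T $ 1 $ 1 - 1) * (\<Sum>i<n. (T $ 1 $ 1) ^ i) = 0"
        using pow by (simp flip: power_diff_1_eq)
      then show "T \<in> V1 \<union> V2" by (auto simp: V1_def V2_def)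
    qed
    moreover have "V1 \<inter> V2 \<inter> H = {}" using n by (auto simp: V1_def V2_def)
    moreover have "V1 \<inter> H \<noteq> {}"
    proof -
      have "mat2 1 0 0 1 \<in> V1" by (simp add: V1_def)
      then show ?thesis using \<open>mat2 1 0 0 1 \<in> H\<close> by blast
    qed
    moreover have "V2 \<inter> H \<noteq> {}"
    proof -
      have "mat2 \<zeta> 0 0 \<zeta> \<in> V2" using \<zeta> by (simp add: V2_def)
      then show ?thesis using \<zeta>H by blast
    qed
    ultimately show False using H_conn V1 V2 unfolding connectedin_closedin by blast
  qed
  then have "1 \<in> Q" using N(2) by simp
  then show ?thesis by (simp add: Q_def)
qed

section \<open>Shape of the elements of the differential Galois group\<close>

lemma mem_G_iff: "T \<in> G \<longleftrightarrow> (\<exists>\<gamma> \<in> ring_iso ring_of_type_algebra ring_of_type_algebra.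
    (\<forall>f. \<gamma> (\<iota> f) = \<iota> f) \<and> (\<forall>r. \<gamma> (sR r) = sR (\<gamma> r)) \<and> (\<forall>r. \<gamma> (dR r) = dR (\<gamma> r)) \<and>
    \<gamma> y1 = y1 * e (T $ 1 $ 1) + y2 * e (T $ 2 $ 1) \<and> \<gamma> y2 = y1 * e (T $ 1 $ 2) + y2 * e (T $ 2 $ 2))"
  (is "_ \<longleftrightarrow> ?R")
proof
  assume "T \<in> G"
  then obtain \<gamma> where *: "\<gamma> \<in> ring_iso ring_of_type_algebra ring_of_type_algebra"
    "\<forall>f. \<gamma> (\<iota> f) = \<iota> f" "\<forall>r. \<gamma> (sR r) = sR (\<gamma> r)" "\<forall>r. \<gamma> (dR r) = dR (\<gamma> r)"
    "map_matrix \<gamma> Z = Z ** map_matrix (\<lambda>c. \<iota> (const c)) T"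
    unfolding G sd_galois_group_def by blast
  have "\<gamma> y1 = y1 * e (T $ 1 $ 1) + y2 * e (T $ 2 $ 1)" "\<gamma> y2 = y1 * e (T $ 1 $ 2) + y2 * e (T $ 2 $ 2)"
    using arg_cong[OF *(5), of "\<lambda>A :: 'r^2^2. A $ 1 $ 1"] arg_cong[OF *(5), of "\<lambda>A :: 'r^2^2. A $ 1 $ 2"]
    by (simp_all add: map_matrix_def matrix_matrix_mult_def sum_2 Z e_def)
  then show ?R using * by blast
next
  assume ?R
  then obtain \<gamma> where *: "\<gamma> \<in> ring_iso ring_of_type_algebra ring_of_type_algebra"
    "\<forall>f. \<gamma> (\<iota> f) = \<iota> f" "\<forall>r. \<gamma> (sR r) = sR (\<gamma> r)" "\<forall>r. \<gamma> (dR r) = dR (\<gamma> r)"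
    "\<gamma> y1 = y1 * e (T $ 1 $ 1) + y2 * e (T $ 2 $ 1)" "\<gamma> y2 = y1 * e (T $ 1 $ 2) + y2 * e (T $ 2 $ 2)" by blast
  have "map_matrix \<gamma> Z = Z ** map_matrix (\<lambda>c. \<iota> (const c)) T"
    using *
    by (simp add: vec_eq_iff forall_2 map_matrix_def matrix_matrix_mult_def sum_2 Z sg_add sg_mult flip: e_def)
  then show "T \<in> G" unfolding G sd_galois_group_def using * by blast
qed

text \<open>
  Restriction to \<open>S\<close> embeds \<open>G\<close> into \<open>H\<close>, so the matrices in \<open>G\<close> have the shape of those in \<open>Gm_Ga\<close>.
\<close>

theorem G_elim:
  assumes "T \<in> G"
  shows "T \<in> H"
    and "\<exists>\<alpha> \<beta> \<gamma>. T = mat2 \<alpha> \<beta> 0 \<alpha> \<and> \<alpha> \<noteq> 0 \<and> \<gamma> 1 = 1 \<and>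
      (\<forall>x y. \<gamma> (x + y) = \<gamma> x + \<gamma> y) \<and> (\<forall>x y. \<gamma> (x * y) = \<gamma> x * \<gamma> y) \<and>
      (\<forall>f. \<gamma> (\<iota> f) = \<iota> f) \<and> (\<forall>r. \<gamma> (dR r) = dR (\<gamma> r)) \<and> \<gamma> y1 = e \<alpha> * y1 \<and> \<gamma> y2 = e \<alpha> * y2 + e \<beta> * y1"
proof -
  define p q r s where "p = T $ 1 $ 1" and "q = T $ 1 $ 2" and "r = T $ 2 $ 1" and "s = T $ 2 $ 2"
  from assms obtain \<gamma> where iso: "\<gamma> \<in> ring_iso ring_of_type_algebra ring_of_type_algebra"
    and \<iota>: "\<And>f. \<gamma> (\<iota> f) = \<iota> f" and sg: "\<And>r. \<gamma> (sR r) = sR (\<gamma> r)" and d: "\<And>r. \<gamma> (dR r) = dR (\<gamma> r)"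
    and y: "\<gamma> y1 = y1 * e p + y2 * e r" "\<gamma> y2 = y1 * e q + y2 * e s"
    unfolding mem_G_iff p_def q_def r_def s_def by blast
  have hom: "\<gamma> (x + y) = \<gamma> x + \<gamma> y" "\<gamma> (x * y) = \<gamma> x * \<gamma> y" "\<gamma> 1 = 1" for x y
    using iso by (auto simp: ring_iso_def ring_hom_def)
  have inj: "inj \<gamma>" using iso by (auto simp: ring_iso_def bij_betw_def)
  have \<gamma>0: "\<gamma> 0 = 0" using hom(1)[of 0 0] by (metis add.right_neutral add_left_cancel)
  have diff: "\<gamma> (x - y) = \<gamma> x - \<gamma> y" for x y using hom(1)[of "x - y" y] by (simp add: algebra_simps)
  have \<gamma>e: "\<gamma> (e c) = e c" for c by (simp add: e_def \<iota>)
  have "sR (\<gamma> y1) = \<iota> u * \<gamma> y1" using sg[of y1] by (simp add: sR_y1 hom \<iota>)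
  then have "y0 * e r = 0" unfolding y by (simp add: sg_add sg_mult sR_y1 sR_y2 algebra_simps)
  then have "y0i * (y0 * e r) = 0" by simp
  then have "(y0 * y0i) * e r = 0" by (simp only: mult_ac)
  then have r0: "r = 0" using y0i by simp
  have y1': "\<gamma> y1 = e p * y1" using y r0 by (simp add: e_0 mult.commute)
  have "\<gamma> y0 = sR (\<gamma> y2) - \<iota> u * \<gamma> y2" using sg[of y2] unfolding sR_y2 hom \<iota> by (metis add_diff_cancel_left')
  then have y0': "\<gamma> y0 = e s * y0" unfolding y by (simp add: sg_add sg_mult sR_y1 sR_y2 algebra_simps)
  have p: "p \<noteq> 0" using y1' injD[OF inj, of y1 0] y1_ne by (auto simp: \<gamma>0 e_0)
  have s: "s \<noteq> 0" using y0' injD[OF inj, of y0 0] y0_ne by (auto simp: \<gamma>0 e_0)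
  have inverse: "\<gamma> x' = e (inverse c) * x'" if "x * x' = 1" "\<gamma> x = e c * x" "c \<noteq> 0" for x x' c
  proof -
    have "e c * x * \<gamma> x' = 1" using hom(2)[of x x'] hom(3) that by simp
    then have "e (inverse c) * x' = e (inverse c) * x' * (e c * x * \<gamma> x')" by simp
    also have "\<dots> = (e c * e (inverse c)) * (x * x') * \<gamma> x'" by (simp only: mult_ac)
    finally show ?thesis using e_inverse[OF that(3)] that(1) by simp
  qed
  note y1i' = inverse[OF y1i y1' p] and y0i' = inverse[OF y0i y0' s]
  note SD = subring_setD[OF sub_S]
  have "subring_set {x. \<gamma> x \<in> S}" unfolding subring_set_def using SD by (auto simp: diff hom)
  then have sub: "S \<subseteq> {x. \<gamma> x \<in> S}"
    by (rule S_least) (use SD S_mem in \<open>auto simp: \<iota> y1' y0' y1i' y0i' y(2)\<close>)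
  have "subring_set (\<gamma> ` S)"
    unfolding subring_set_def using SD by (auto simp flip: diff hom(2)) (metis hom(3) imageI)
  then have sup: "S \<subseteq> \<gamma> ` S"
  proof (rule S_least)
    have *: "x \<in> \<gamma> ` S" if "\<gamma> x = e c * x" "c \<noteq> 0" "x \<in> S" for x c
    proof (rule image_eqI)
      have "\<gamma> (e (inverse c) * x) = (e c * e (inverse c)) * x" by (simp only: hom \<gamma>e that(1) mult_ac)
      then show "x = \<gamma> (e (inverse c) * x)" using e_inverse[OF that(2)] by simp
    qed (use SD S_mem that in auto)
    show "y1 \<in> \<gamma> ` S" "y0 \<in> \<gamma> ` S" "y1i \<in> \<gamma> ` S" "y0i \<in> \<gamma> ` S"
      using *[OF y1'] *[OF y0'] *[OF y1i'] *[OF y0i'] p s S_mem by simp_all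
    show "\<iota> f \<in> \<gamma> ` S" for f using \<iota>[of f] S_mem(1)[of f] by (metis imageI)
    show "y2 \<in> \<gamma> ` S"
    proof (rule image_eqI)
      have "\<gamma> (e (inverse s) * (y2 - e (q * inverse p) * y1)) = e (inverse s) * (y1 * e q + y2 * e s - e q * (e p * e (inverse p)) * y1)"
        unfolding hom diff \<gamma>e y(2) y1' e_mult by (simp only: mult_ac)
      also have "\<dots> = (e s * e (inverse s)) * y2" using e_inverse[OF p] by (simp add: algebra_simps)
      finally show "y2 = \<gamma> (e (inverse s) * (y2 - e (q * inverse p) * y1))" using e_inverse[OF s] by simp
    qed (use SD S_mem in auto)
  qed
  have "bij_betw \<gamma> S S" unfolding bij_betw_def using inj sub sup by (auto intro: inj_on_subset)
  then have "\<gamma> \<in> ring_iso (ring_of_type_algebra\<lparr>carrier := S\<rparr>) (ring_of_type_algebra\<lparr>carrier := S\<rparr>)"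
    using sub by (auto simp: ring_iso_def ring_hom_def hom)
  then show "T \<in> H" unfolding mem_H_iff using \<iota> sg y p_def q_def r_def s_def by blast
  then have "T \<in> Gm_Ga" using H_sub by blast
  then have "T = mat2 p q 0 p" "s = p" unfolding mem_Gm_Ga_iff mat2_eq_iff p_def q_def r_def s_def by auto
  then show "\<exists>\<alpha> \<beta> \<gamma>. T = mat2 \<alpha> \<beta> 0 \<alpha> \<and> \<alpha> \<noteq> 0 \<and> \<gamma> 1 = 1 \<and>
      (\<forall>x y. \<gamma> (x + y) = \<gamma> x + \<gamma> y) \<and> (\<forall>x y. \<gamma> (x * y) = \<gamma> x * \<gamma> y) \<and>
      (\<forall>f. \<gamma> (\<iota> f) = \<iota> f) \<and> (\<forall>r. \<gamma> (dR r) = dR (\<gamma> r)) \<and> \<gamma> y1 = e \<alpha> * y1 \<and> \<gamma> y2 = e \<alpha> * y2 + e \<beta> * y1"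
    using p hom \<iota> d y1' y(2)
    by (intro exI[of _ p] exI[of _ q] exI[of _ \<gamma>]) (simp add: mult.commute add.commute)
qed

lemma ideal_ring_of_type_algebraI:
  fixes I :: "'r set"
  assumes "0 \<in> I" "\<And>x y. x \<in> I \<Longrightarrow> y \<in> I \<Longrightarrow> x + y \<in> I" "\<And>r x. x \<in> I \<Longrightarrow> r * x \<in> I"
  shows "ideal I ring_of_type_algebra"
proof -
  interpret cring "ring_of_type_algebra :: 'r ring" by (rule cring_from_type_algebra)
  have m: "- x \<in> I" if "x \<in> I" for x using assms(3)[OF that, of "- 1"] by simp
  have "subgroup I (add_monoid ring_of_type_algebra)"
    by (rule add.subgroupI) (use assms m in \<open>auto simp flip: a_inv_def\<close>)
  then show ?thesis
    by (intro idealI) (use assms ring_axioms in \<open>auto simp: mult.commute\<close>)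
qed

end

section \<open>Logarithmic derivatives of constants\<close>

primrec lin_dpoly :: "(nat \<Rightarrow> 'a) \<Rightarrow> 'a d_poly \<Rightarrow> nat \<Rightarrow> 'a d_poly" where
  "lin_dpoly m q 0 = DMult (DConst (m 0)) q"
| "lin_dpoly m q (Suc n) = DAdd (lin_dpoly m q n) (DMult (DConst (m (Suc n))) ((DDeriv ^^ Suc n) q))"

lemma d_eval_DDeriv_pow: "d_eval E D \<phi> y ((DDeriv ^^ n) q) = (D ^^ n) (d_eval E D \<phi> y q)"
  by (induction n) simp_all

lemma d_eval_lin_dpoly:
  fixes \<phi> :: "'a \<Rightarrow> 'b::comm_ring_1"
  shows "d_eval ring_of_type_algebra D \<phi> y (lin_dpoly m q n) = (\<Sum>i\<le>n. \<phi> (m i) * (D ^^ i) (d_eval ring_of_type_algebra D \<phi> y q))"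
proof (induction n)
  case (Suc n)
  then show ?case using d_eval_DDeriv_pow[of ring_of_type_algebra D \<phi> y "Suc n" q]
    by (simp only: lin_dpoly.simps d_eval.simps ring_of_type_algebra_simps sum.atMost_Suc)
qed simp

context riccati_pv begin

text \<open>
  By \<open>\<delta>\<close>-closedness a solution may be sought in an extension, and in \<open>C(x)\<close> with \<open>\<alpha> = x\<close> the orbit sum at \<open>0\<close>
  of \<open>M(1/x)\<close> is \<open>M\<close>. Inequations are expressed by invertibility, which is where the extra variables come from.
\<close>

lemma ex_log_deriv_ne_zero:
  fixes M :: "'c poly"
  assumes "M \<noteq> 0"
  shows "\<exists>\<alpha>. \<alpha> \<noteq> 0 \<and> lin_d_eval id dC M (dC \<alpha> / \<alpha>) \<noteq> 0"
proof -
  define q :: "'c d_poly" where "q = lin_dpoly (Polynomial.coeff M) (DMult (DDeriv (DVar 0)) (DVar 1)) (Polynomial.degree M)"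
  define P where "P = {DAdd (DMult (DVar 0) (DVar 1)) (DConst (- 1)), DAdd (DMult q (DVar 2)) (DConst (- 1))}"
  define x :: "'c poly fract" where "x = to_fract [:0, 1:]"
  have x0: "x \<noteq> 0" by (simp add: x_def)
  define m where "m = L M (dK x / x)"
  have m0: "m \<noteq> 0" unfolding m_def x_def by (rule ex_L_log_deriv_ne_zero[OF assms])
  have field: "d_field (ring_of_type_algebra :: 'c poly fract ring) dK"
  proof -
    have "(of_nat n :: 'c poly fract) \<noteq> 0" if "n > 0" for n :: nat
      unfolding const_hom(8)[symmetric] using that by simp
    moreover have eq: "(ring_of_type_algebra :: 'c poly fract ring)\<lparr>carrier := UNIV\<rparr> = ring_of_type_algebra"
      by (simp add: ring_of_type_algebra_def)
    moreover note add_pow_ring_of_type_algebra[of UNIV _ "1 :: 'c poly fract", unfolded eq]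
    moreover have "Ring.field (ring_of_type_algebra :: 'c poly fract ring)"
      by (rule field_from_type_algebra)
    ultimately show ?thesis
      unfolding d_field_def using der_dK by simp
  qed
  moreover have "const \<in> d_hom ring_of_type_algebra dC ring_of_type_algebra dK"
    by (auto simp: d_hom_def ring_hom_def const_hom)
  moreover obtain j :: "'c poly fract \<Rightarrow> 'c" where "inj j" using ex_inj_fract by blast
  then have "inj_on j (carrier ring_of_type_algebra)" by simp
  moreover have "d_solvable (ring_of_type_algebra :: 'c poly fract ring) dK const P"
  proof -
    define y where "y i = (if i = 0 then x else if i = 1 then 1 / x else 1 / m)" for i :: nat
    have "d_eval ring_of_type_algebra dK const y q = m"
      unfolding q_def d_eval_lin_dpoly m_def lin_d_eval_def by (simp add: y_def)
    then have "\<forall>p\<in>P. d_eval ring_of_type_algebra dK const y p = 0"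
      unfolding P_def using x0 m0 by (simp add: y_def const_hom(4,5) del: to_fract_uminus)
    then show ?thesis unfolding d_solvable_def by (intro exI[of _ y]) simp
  qed
  moreover have "finite P" by (simp add: P_def)
  ultimately have "d_solvable ring_of_type_algebra dC id P"
    using d_closed_imp_solvable[OF d_closed] by blast
  then obtain y :: "nat \<Rightarrow> 'c" where y: "y 0 * y 1 = 1" "(\<Sum>i\<le>Polynomial.degree M. Polynomial.coeff M i * (dC ^^ i) (dC (y 0) * y 1)) * y 2 = 1"
    unfolding d_solvable_def P_def q_def by (auto simp: d_eval_lin_dpoly)
  have 0: "y 0 \<noteq> 0" using y by auto
  then have "dC (y 0) * y 1 = dC (y 0) / y 0" using y(1) by (simp add: field_simps)
  then have "lin_d_eval id dC M (dC (y 0) / y 0) \<noteq> 0" using y(2) by (auto simp: lin_d_eval_def)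
  then show ?thesis using 0 by blast
qed

lemma dR_pow: "(dR ^^ n) (x + y) = (dR ^^ n) x + (dR ^^ n) y" "(dR ^^ n) (e c) = e ((dC ^^ n) c)"
  "sR ((dR ^^ n) x) = (dR ^^ n) (sR x)" "(dR ^^ n) (\<iota> f) = \<iota> ((dK ^^ n) f)"
  by (induction n) (simp_all add: dR dR_e sR_dR dR_\<iota>)

text \<open>
  The logarithmic derivative of \<open>y1\<close>. It satisfies \<open>\<sigma>(z) = z + v\<close> with \<open>v = \<delta>(u)/u\<close>, and \<open>R\<close> is generated over
  \<open>k\<close> by \<open>y1\<close>, \<open>1/y1\<close> and the derivatives of \<open>z\<close> and \<open>t\<close>.
\<close>

definition z :: 'r where "z = dR y1 * y1i"

lemma z_y1: "dR y1 = z * y1"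
proof -
  have "z * y1 = dR y1 * (y1 * y1i)" unfolding z_def by (simp only: mult_ac)
  then show ?thesis using y1i by simp
qed

abbreviation v :: "'c poly fract" where "v \<equiv> dK u / u"

lemma v_Qbar_x: "v \<in> Qbar_x"
  using u by (auto intro: Qbar_x_closed)

lemma sR_z: "sR z = z + \<iota> v"
proof -
  have 1: "sR (dR y1) = \<iota> (dK u) * y1 + \<iota> u * dR y1"
    unfolding sR_dR sR_y1 by (simp add: dR dR_\<iota>)
  have "sR z = (\<iota> (dK u) * \<iota> (1 / u)) * (y1 * y1i) + (\<iota> u * \<iota> (1 / u)) * z"
    unfolding z_def sg_mult 1 sR_y1i by (simp add: algebra_simps)
  also have "\<iota> (dK u) * \<iota> (1 / u) = \<iota> v" by (simp flip: \<iota>_mult)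
  finally show ?thesis using y1i \<iota>_unit[OF u_ne] by simp
qed

lemma sR_z_pow: "sR ((dR ^^ n) z) = (dR ^^ n) z + \<iota> ((dK ^^ n) v)"
  by (simp add: dR_pow sR_z)

lemma L_monoms: "(\<Sum>j<n. const (c j) * (dK ^^ j) f) = L (\<Sum>j<n. Polynomial.monom (c j) j) f"
proof -
  define M where "M = (\<Sum>j<n. Polynomial.monom (c j) j)"
  have cf: "Polynomial.coeff M i = (if i < n then c i else 0)" for i
    by (simp add: M_def coeff_sum)
  have "Polynomial.degree M \<le> n" by (rule degree_le) (simp add: cf)
  then have "L M f = (\<Sum>i\<le>n. const (Polynomial.coeff M i) * (dK ^^ i) f)" by (rule L_superset)
  also have "\<dots> = (\<Sum>j<n. const (c j) * (dK ^^ j) f)"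
    by (intro sum.mono_neutral_cong_right) (auto simp: cf)
  finally show ?thesis by (simp add: M_def)
qed

lemma monoms_eq_0: "(\<Sum>j<n. Polynomial.monom (c j) j) = (0 :: 'c poly) \<Longrightarrow> \<forall>j<n. c j = 0"
proof (intro allI impI)
  fix j assume "(\<Sum>j<n. Polynomial.monom (c j) j) = (0 :: 'c poly)" "j < n"
  from arg_cong[OF this(1), of "\<lambda>p. Polynomial.coeff p j"] this(2) show "c j = 0"
    by (simp add: coeff_sum)
qed

text \<open>
  If \<open>u = \<sigma>(h)/h\<close>, then \<open>v\<close> is summable by \<open>\<delta>(h)/h\<close>.
\<close>

lemma qsummable_v_iff: "qsummable v \<longleftrightarrow> case_i sK u \<or> case_ii sK dK u"
proof
  assume "case_i sK u \<or> case_ii sK dK u"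
  moreover have "qsummable v" if ci: "case_i sK u"
  proof -
    obtain h where h: "h \<in> Qbar_x" "h \<noteq> 0" "u = sK h / h" using ci by (auto simp: case_i_def)
    then have eq: "sK h = u * h" by simp
    have "dK (u * h) / (u * h) = v + dK h / h" using h(2) u_ne by (intro log_deriv_mult)
    moreover have "dK (u * h) / (u * h) = sK (dK h / h)" unfolding eq[symmetric] sK_divide sK_dK ..
    ultimately have "v = sK (dK h / h) - dK h / h" by simp
    moreover have "dK h / h \<in> Qbar_x" using h by (auto intro: Qbar_x_closed)
    ultimately show ?thesis unfolding qsummable_def by blast
  qed
  ultimately show "qsummable v" by (auto simp: case_ii_def qsummable_def)
qed (auto simp: case_ii_def qsummable_def)

end

section \<open>Automorphisms of the differential Picard-Vessiot ring\<close>

text \<open>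
  The constant \<open>c0\<close> records how \<open>y1\<close> is scaled relative to a basis for which \<open>w\<close> has algebraic coefficients. It
  exists for every basis by \<open>w_normal_form\<close>; the classification is proved for all bases at once.
\<close>

locale riccati_pv_normal = riccati_pv +
  fixes c0 :: 'a and w0 :: "'a poly fract"
  assumes c0: "c0 \<noteq> 0" and w0: "w0 \<in> Qbar_x" and w: "w = \<iota> (const c0 * w0)"
begin

text \<open>
  \<open>t/c0\<close>, which belongs to the rescaled basis.
\<close>

definition tt :: 'b where "tt = e (inverse c0) * t"

lemma t_tt: "t = e c0 * tt"
  unfolding tt_def using e_inverse[OF c0] by (simp flip: mult.assoc)

lemma sR_tt: "sR tt = tt + \<iota> w0"
proof -
  have "e (inverse c0) * w = (e c0 * e (inverse c0)) * \<iota> w0"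
    unfolding w \<iota>_mult e_def by (simp only: mult_ac)
  then show ?thesis unfolding tt_def sg_mult sR_t using e_inverse[OF c0] by (simp add: distrib_left)
qed

lemma sR_tt_pow: "sR ((dR ^^ n) tt) = (dR ^^ n) tt + \<iota> ((dK ^^ n) w0)"
  by (simp add: dR_pow sR_tt)

lemma w0_not_qsummable: "\<not> qsummable w0"
proof
  assume "qsummable w0"
  then obtain g where g: "w0 = sK g - g" by (auto simp: qsummable_def)
  have "sR (\<iota> (const c0 * g)) - \<iota> (const c0 * g) = w"
    unfolding w g by (simp add: sg_\<iota> sK_hom right_diff_distrib \<iota>_diff)
  then show False using w_not_summable[OF \<iota>_A] by blast
qed

text \<open>
  The action of an element of \<open>G\<close> in the coordinates \<open>y1\<close>, \<open>z\<close>, \<open>tt\<close>. The upper right entry is written as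
  \<open>\<alpha> c0 \<beta>\<close> so that \<open>\<beta>\<close> is the translation of \<open>tt\<close>.
\<close>

lemma G_elim':
  assumes "T \<in> G"
  shows "\<exists>\<alpha> \<beta> \<gamma>. T = mat2 \<alpha> (\<alpha> * c0 * \<beta>) 0 \<alpha> \<and> \<alpha> \<noteq> 0 \<and> \<gamma> 1 = 1 \<and>
    (\<forall>x y. \<gamma> (x + y) = \<gamma> x + \<gamma> y) \<and> (\<forall>x y. \<gamma> (x * y) = \<gamma> x * \<gamma> y) \<and>
    (\<forall>f. \<gamma> (\<iota> f) = \<iota> f) \<and> (\<forall>r. \<gamma> (dR r) = dR (\<gamma> r)) \<and> \<gamma> y1 = e \<alpha> * y1 \<and>
    \<gamma> z = z + e (dC \<alpha> / \<alpha>) \<and> \<gamma> tt = tt + e \<beta>"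
proof -
  from G_elim(2)[OF assms] obtain \<alpha> \<beta>' \<gamma> where T: "T = mat2 \<alpha> \<beta>' 0 \<alpha>" "\<alpha> \<noteq> 0" and hom: "\<gamma> 1 = 1"
    "\<And>x y. \<gamma> (x + y) = \<gamma> x + \<gamma> y" "\<And>x y. \<gamma> (x * y) = \<gamma> x * \<gamma> y"
    "\<And>f. \<gamma> (\<iota> f) = \<iota> f" "\<And>r. \<gamma> (dR r) = dR (\<gamma> r)"
    and y: "\<gamma> y1 = e \<alpha> * y1" "\<gamma> y2 = e \<alpha> * y2 + e \<beta>' * y1" by blast
  have \<gamma>e: "\<gamma> (e c) = e c" for c by (simp add: e_def hom)
  have y1i': "\<gamma> y1i = e (inverse \<alpha>) * y1i"
  proof -
    have "e \<alpha> * y1 * \<gamma> y1i = 1" using hom(3)[of y1 y1i] hom(1) y1i y by simp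
    then have "e (inverse \<alpha>) * y1i = e (inverse \<alpha>) * y1i * (e \<alpha> * y1 * \<gamma> y1i)" by simp
    also have "\<dots> = (e \<alpha> * e (inverse \<alpha>)) * (y1 * y1i) * \<gamma> y1i" by (simp only: mult_ac)
    finally show ?thesis using e_inverse[OF T(2)] y1i by simp
  qed
  define \<beta> where "\<beta> = \<beta>' / (\<alpha> * c0)"
  have T': "T = mat2 \<alpha> (\<alpha> * c0 * \<beta>) 0 \<alpha>" using T c0 by (simp add: \<beta>_def)
  have "\<gamma> z = (e (dC \<alpha>) * y1 + e \<alpha> * dR y1) * (e (inverse \<alpha>) * y1i)"
    unfolding z_def hom(3,5) y(1) y1i' dR(2) dR_e ..
  also have "\<dots> = (e (dC \<alpha>) * e (inverse \<alpha>)) * (y1 * y1i) + (e \<alpha> * e (inverse \<alpha>)) * (dR y1 * y1i)"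
    by (simp only: distrib_left distrib_right mult_ac)
  finally have z': "\<gamma> z = z + e (dC \<alpha> / \<alpha>)"
    using e_inverse[OF T(2)] y1i by (simp add: z_def divide_inverse e_mult add.commute)
  have "\<gamma> t = (e \<alpha> * e (inverse \<alpha>)) * t + e (\<beta>' * inverse \<alpha>) * (y1 * y1i)"
    unfolding t_def hom(3) y y1i' e_mult by (simp add: algebra_simps)
  then have "\<gamma> t = t + e (\<beta>' / \<alpha>)" using e_inverse[OF T(2)] y1i by (simp add: divide_inverse)
  then have "\<gamma> tt = e (inverse c0) * (t + e (\<beta>' / \<alpha>))" unfolding tt_def hom(3) \<gamma>e by simp
  also have "\<dots> = tt + e \<beta>" unfolding tt_def \<beta>_def by (simp add: distrib_left divide_inverse mult_ac flip: e_mult)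
  finally have tt': "\<gamma> tt = tt + e \<beta>" .
  show ?thesis
    by (intro exI[of _ \<alpha>] exI[of _ \<beta>] exI[of _ \<gamma>]) (simp add: T' T(2) hom y(1) z' tt')
qed

definition Y1 :: "int \<Rightarrow> 'b" where "Y1 m = zpow y1 y1i m"

lemma Y1_mon: "Y1 0 = 1" "Y1 (i + j) = Y1 i * Y1 j" "sR (Y1 j) = \<iota> (u powi j) * Y1 j"
  by (simp_all add: Y1_def zpow_add[OF y1i] sR_zpow[OF y1i sR_y1 u_ne])

definition \<Gamma>0 :: "'a \<Rightarrow> ('b \<times> 'b) set" where "\<Gamma>0 \<alpha> = twist_rel Y1 (\<lambda>m. \<alpha> powi m)"

lemma sub_\<Gamma>0: "\<alpha> \<noteq> 0 \<Longrightarrow> subring_rel (\<Gamma>0 \<alpha>)"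
  unfolding \<Gamma>0_def by (rule subring_rel_twist) (simp_all add: Y1_mon power_int_add)

lemma \<Gamma>0_mem: "(\<iota> f, \<iota> f) \<in> \<Gamma>0 \<alpha>" "(y1, e \<alpha> * y1) \<in> \<Gamma>0 \<alpha>" "(y1i, e (inverse \<alpha>) * y1i) \<in> \<Gamma>0 \<alpha>" "(e c, e c) \<in> \<Gamma>0 \<alpha>"
proof -
  have m: "(\<iota> f * Y1 j, \<iota> f * e (\<alpha> powi j) * Y1 j) \<in> \<Gamma>0 \<alpha>" for f j unfolding \<Gamma>0_def by (rule twist_rel.monomial)
  show i: "(\<iota> f, \<iota> f) \<in> \<Gamma>0 \<alpha>" for f using m[of f 0] by (simp add: Y1_mon e_1)
  then show "(e c, e c) \<in> \<Gamma>0 \<alpha>" by (simp add: e_def)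
  show "(y1, e \<alpha> * y1) \<in> \<Gamma>0 \<alpha>" "(y1i, e (inverse \<alpha>) * y1i) \<in> \<Gamma>0 \<alpha>"
    using m[of 1 1] m[of 1 "- 1"] by (simp_all add: Y1_def \<iota>_1 power_int_minus)
qed

lemma \<Gamma>0_least:
  assumes D: "subring_rel \<Delta>" and \<iota>\<Delta>: "\<And>f. (\<iota> f, \<iota> f) \<in> \<Delta>" and \<alpha>: "\<alpha> \<noteq> 0"
    and y: "(y1, e \<alpha> * y1) \<in> \<Delta>" "(y1i, e (inverse \<alpha>) * y1i) \<in> \<Delta>"
  shows "\<Gamma>0 \<alpha> \<subseteq> \<Delta>"
proof clarify
  note DD = subring_relD[OF D]
  have pw: "(x ^ n, x' ^ n) \<in> \<Delta>" if "(x, x') \<in> \<Delta>" for x x' and n :: nat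
    by (induction n) (use that DD in auto)
  have epow: "e c ^ n = e (c ^ n)" for c and n :: nat by (induction n) (simp_all add: e_1 e_mult)
  have Yj: "(Y1 j, e (\<alpha> powi j) * Y1 j) \<in> \<Delta>" for j
    using pw[OF y(1), of "nat j"] pw[OF y(2), of "nat (- j)"]
    by (auto simp: Y1_def zpow_def power_int_def power_mult_distrib epow)
  fix r s assume "(r, s) \<in> \<Gamma>0 \<alpha>"
  then show "(r, s) \<in> \<Delta>" unfolding \<Gamma>0_def
  proof induction
    case (monomial f j)
    show ?case using DD(4)[OF \<iota>\<Delta>[of f] Yj[of j]] by (simp add: mult.assoc)
  qed (use DD in auto)
qed

text \<open>
  A solution in \<open>k[y1, 1/y1]\<close> of an additive equation over \<open>k\<close> can be replaced by one in \<open>k\<close>. Either \<open>y1\<close> lies in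
  \<open>k\<close>, or no nontrivial power of it is proportional to an element of \<open>k\<close>, by \<open>cob_power_imp_cob\<close>.
\<close>

lemma summable_monomial_ring_Y1:
  assumes g: "g \<in> monomial_ring Y1" "sR g - g = \<iota> \<omega>"
  shows "\<exists>h. \<omega> = sK h - h"
proof (cases "cob u")
  case True
  then obtain h where h: "h \<noteq> 0" "u * h = sK h" by blast
  obtain d where d: "y1 = e d * \<iota> h" using cob_eq_fixed[OF y1i sR_y1 h(2,1)] by blast
  then have dd: "y1 = \<iota> (const d * h)" by (simp add: \<iota>_mult e_def)
  then have nz: "const d * h \<noteq> 0" using y1_ne by (metis \<iota>_0)
  have "y1i = y1i * (\<iota> (const d * h) * \<iota> (inverse (const d * h)))" using \<iota>_inverse[OF nz] by simp
  also have "\<dots> = (y1 * y1i) * \<iota> (inverse (const d * h))" unfolding dd[symmetric] by (simp only: mult_ac)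
  finally have ddi: "y1i = \<iota> (inverse (const d * h))" using y1i by simp
  have pw: "\<iota> f ^ m \<in> range \<iota>" for f and m :: nat
    by (induction m) (auto simp: \<iota>_1[symmetric] simp flip: \<iota>_mult)
  have Yr: "Y1 j \<in> range \<iota>" for j
    using pw[of "const d * h" "nat j"] pw[of "inverse (const d * h)" "nat (- j)"]
    unfolding Y1_def zpow_def dd[symmetric] ddi[symmetric] by simp
  have "monomial_ring Y1 \<subseteq> range \<iota>"
  proof
    fix b assume "b \<in> monomial_ring Y1"
    then obtain F f where "b = (\<Sum>j\<in>F. \<iota> (f j) * Y1 j)" unfolding monomial_ring_def by blast
    moreover have "\<forall>j. \<exists>k. Y1 j = \<iota> k" using Yr by (simp add: image_iff)
    then obtain k where "\<forall>j. Y1 j = \<iota> (k j)" by (rule choice[THEN exE])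
    ultimately have "b = \<iota> (\<Sum>j\<in>F. f j * k j)" by (simp add: \<iota>_sum \<iota>_mult)
    then show "b \<in> range \<iota>" by simp
  qed
  then obtain k where k: "g = \<iota> k" using g(1) by auto
  then have "\<iota> (sK k - k) = \<iota> \<omega>" using g(2) by (simp add: sg_\<iota> \<iota>_diff)
  then have "\<omega> = sK k - k" by (simp only: \<iota>_eq_iff)
  then show ?thesis by blast
next
  case False
  show ?thesis
  proof (rule summable_monomial_ring[of Y1 "\<lambda>j. u powi j"])
    show "g \<in> monomial_ring Y1" by (rule g(1))
    show "sR g - g = \<iota> \<omega>" by (rule g(2))
    fix j h assume "h \<noteq> 0" "u powi j * h = sK h"
    then show "j = 0" using cob_power_imp_cob False by blast
  qed (rule Y1_mon)+
qed

text \<open>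
  The converse of \<open>G_elim'\<close>. Let \<open>x 0, x 1, \<dots>\<close> be additive generators of \<open>R\<close> over \<open>k[y1, 1/y1]\<close> whose increments \<open>\<omega> n\<close>
  admit no nontrivial summable \<open>C\<close>-linear combination. Then \<open>y1 \<mapsto> \<alpha> y1\<close> and arbitrary translations \<open>x n \<mapsto> x n + av n\<close> define a
  single-valued relation \<open>\<Gamma>\<close>. If \<open>\<Gamma>\<close> contains the intended values at \<open>z\<close> and \<open>tt\<close> and is stable under \<open>\<delta>\<close> on the
  generators, then it is stable under \<open>\<sigma>\<close> and \<open>\<delta>\<close> and defined on all of \<open>R\<close>, and its kernel is a proper ideal
  stable under \<open>\<sigma>\<close> and \<open>\<delta>\<close>, hence \<open>0\<close>: it is the graph of an automorphism.
\<close>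

theorem G_intro:
  fixes x :: "nat \<Rightarrow> 'b" and \<omega> :: "nat \<Rightarrow> 'a poly fract" and av :: "nat \<Rightarrow> 'a"
  assumes \<alpha>: "\<alpha> \<noteq> 0" "\<And>m h. h \<noteq> 0 \<Longrightarrow> u powi m * h = sK h \<Longrightarrow> \<alpha> powi m = 1"
    and x: "\<And>n. sR (x n) = x n + \<iota> (\<omega> n)"
    and indep: "\<And>n c g. (\<Sum>j<n. const (c j) * \<omega> j) = sK g - g \<Longrightarrow> \<forall>j<n. c j = 0"
    and \<Gamma>: "\<Gamma> = rel_lim (\<Gamma>0 \<alpha>) x (\<lambda>n. x n + e (av n))"
    and z: "(z, z + e (dC \<alpha> / \<alpha>)) \<in> \<Gamma>" and tt: "(tt, tt + e \<beta>) \<in> \<Gamma>"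
    and d: "\<And>n. (dR (x n), dR (x n + e (av n))) \<in> \<Gamma>"
  shows "mat2 \<alpha> (\<alpha> * c0 * \<beta>) 0 \<alpha> \<in> G"
proof -
  define B where "B = monomial_ring Y1"
  have B: "sg_simple B" unfolding B_def by (rule sg_simple_monomial_ring) (rule Y1_mon)+
  have \<iota>B: "\<iota> f \<in> B" for f unfolding B_def by (rule \<iota>_in_monomial_ring) (rule Y1_mon)+
  have indepB: "\<forall>j<n. c j = 0" if g: "g \<in> B" "(\<Sum>j<n. e (c j) * \<iota> (\<omega> j)) = sR g - g" for n c g
  proof -
    have "sR g - g = \<iota> (\<Sum>j<n. const (c j) * \<omega> j)" using g(2) by (simp add: \<iota>_sum \<iota>_mult e_def)
    then have "\<exists>h. (\<Sum>j<n. const (c j) * \<omega> j) = sK h - h"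
      using g(1) unfolding B_def by (rule summable_monomial_ring_Y1[rotated])
    then show ?thesis using indep by blast
  qed
  have sub: "subring_rel \<Gamma>" and \<Gamma>0\<Gamma>: "\<Gamma>0 \<alpha> \<subseteq> \<Gamma>" and x\<Gamma>: "(x n, x n + e (av n)) \<in> \<Gamma>" for n
    unfolding \<Gamma> using rel_lim_subring[OF sub_\<Gamma>0[OF \<alpha>(1)], where \<xi>' = "\<lambda>n. x n + e (av n)"] by blast+
  note D = subring_relD[OF sub]
  have mem: "(\<iota> f, \<iota> f) \<in> \<Gamma>" "(y1, e \<alpha> * y1) \<in> \<Gamma>" "(y1i, e (inverse \<alpha>) * y1i) \<in> \<Gamma>" "(e c, e c) \<in> \<Gamma>" for f c
    using \<Gamma>0\<Gamma> \<Gamma>0_mem by blast+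
  have funct: "s = 0" if "(0, s) \<in> \<Gamma>" for s
  proof (rule rel_lim_functional[where B = B and \<omega> = "\<lambda>n. \<iota> (\<omega> n)", OF B x \<iota>B])
    show "(0, s) \<in> rel_lim (\<Gamma>0 \<alpha>) x (\<lambda>n. x n + e (av n))" using that by (simp add: \<Gamma>)
    show "\<And>n c g. g \<in> B \<Longrightarrow> (\<Sum>j<n. e (c j) * \<iota> (\<omega> j)) = sR g - g \<Longrightarrow> \<forall>j<n. c j = 0" by (rule indepB)
    show "\<And>r s. (r, s) \<in> \<Gamma>0 \<alpha> \<Longrightarrow> r \<in> B" unfolding \<Gamma>0_def B_def by (rule twist_rel_fst)
    fix s assume s: "(0, s) \<in> \<Gamma>0 \<alpha>"
    show "s = 0"
    proof (rule twist_rel_functional[OF Y1_mon(3) _ _ s[unfolded \<Gamma>0_def]])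
      show "\<exists>y. Y1 j * y = 1" for j using Y_unit[of Y1 "\<lambda>j. u powi j" j] Y1_mon by blast
      fix i j h assume h: "h \<noteq> 0" "u powi i * h = sK h * u powi j"
      then have "u powi (i - j) * h = sK h" using u_ne by (simp add: power_int_diff field_simps)
      then have "\<alpha> powi (i - j) = 1" by (rule \<alpha>(2)[OF h(1)])
      then show "\<alpha> powi i = \<alpha> powi j" using \<alpha>(1) by (simp add: power_int_diff)
    qed
  qed
  \<comment> \<open>\<open>\<Gamma>\<close> is stable under \<open>\<sigma>\<close> and \<open>\<delta>\<close>: the pairs with image in \<open>\<Gamma>\<close> form a subring containing the generators.\<close>
  have sg\<Gamma>: "(sR r, sR s) \<in> \<Gamma>" if "(r, s) \<in> \<Gamma>" for r s
  proof -
    define \<Delta> where "\<Delta> = {(r, s). (sR r, sR s) \<in> \<Gamma>}"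
    have sub\<Delta>: "subring_rel \<Delta>" unfolding subring_rel_def \<Delta>_def using D by (auto simp: sg_diff sg_mult sg_1)
    have "(\<iota> u * y1, \<iota> u * (e \<alpha> * y1)) \<in> \<Gamma>" "(\<iota> (1 / u) * y1i, \<iota> (1 / u) * (e (inverse \<alpha>) * y1i)) \<in> \<Gamma>"
      using D(4)[OF mem(1) mem(2)] D(4)[OF mem(1) mem(3)] by blast+
    then have "\<Gamma>0 \<alpha> \<subseteq> \<Delta>"
      by (intro \<Gamma>0_least sub\<Delta> \<alpha>(1)) (auto simp: \<Delta>_def sg_\<iota> mem(1) sg_mult sR_y1 sR_y1i mult_ac)
    moreover have "(x n, x n + e (av n)) \<in> \<Delta>" for n
      using D(6)[OF x\<Gamma>[of n] mem(1)[of "\<omega> n"]] by (simp add: \<Delta>_def sg_add x algebra_simps)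
    ultimately have "\<Gamma> \<subseteq> \<Delta>" unfolding \<Gamma> by (intro rel_lim_least sub\<Delta>)
    then show ?thesis using that by (auto simp: \<Delta>_def)
  qed
  have d\<Gamma>: "(dR r, dR s) \<in> \<Gamma>" if "(r, s) \<in> \<Gamma>" for r s
  proof -
    define \<Delta> where "\<Delta> = {(r, s). (r, s) \<in> \<Gamma> \<and> (dR r, dR s) \<in> \<Gamma>}"
    have sub\<Delta>: "subring_rel \<Delta>" unfolding subring_rel_def \<Delta>_def using D by (auto simp: dR)
    have dy1: "(dR y1, dR (e \<alpha> * y1)) \<in> \<Gamma>"
    proof -
      have "e (dC \<alpha> / \<alpha>) * e \<alpha> = e (dC \<alpha>)" using \<alpha>(1) by (simp flip: e_mult)
      moreover have "(z + e (dC \<alpha> / \<alpha>)) * (e \<alpha> * y1) = (e (dC \<alpha> / \<alpha>) * e \<alpha>) * y1 + e \<alpha> * (z * y1)"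
        by (simp only: distrib_left distrib_right mult_ac add_ac)
      ultimately have "(z + e (dC \<alpha> / \<alpha>)) * (e \<alpha> * y1) = dR (e \<alpha> * y1)"
        unfolding dR(2) dR_e z_y1 by simp
      then show ?thesis using D(4)[OF z mem(2)] by (simp add: z_y1)
    qed
    have inv_d: "dR y' = - (y' * y' * dR y)" if "y * y' = 1" for y y'
    proof -
      have "dR y * y' + y * dR y' = 0" using dR(2)[of y y'] that by (simp add: dR)
      then have "y' * (dR y * y' + y * dR y') = 0" by simp
      then have "y' * y' * dR y + (y * y') * dR y' = 0" by (simp add: distrib_left mult_ac)
      then show ?thesis using that by (simp add: eq_neg_iff_add_eq_0 add.commute)
    qed
    have inv\<alpha>: "(e \<alpha> * y1) * (e (inverse \<alpha>) * y1i) = 1"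
    proof -
      have "(e \<alpha> * y1) * (e (inverse \<alpha>) * y1i) = (e \<alpha> * e (inverse \<alpha>)) * (y1 * y1i)" by (simp only: mult_ac)
      then show ?thesis using e_inverse[OF \<alpha>(1)] y1i by simp
    qed
    have dy1i: "(dR y1i, dR (e (inverse \<alpha>) * y1i)) \<in> \<Gamma>"
      unfolding inv_d[OF y1i] inv_d[OF inv\<alpha>] by (intro D dy1 mem)
    have "\<Gamma>0 \<alpha> \<subseteq> \<Delta>"
      by (intro \<Gamma>0_least sub\<Delta> \<alpha>(1)) (use mem dy1 dy1i in \<open>simp_all add: \<Delta>_def dR_\<iota>\<close>)
    moreover have "(x n, x n + e (av n)) \<in> \<Delta>" for n using x\<Gamma> d by (simp add: \<Delta>_def)
    ultimately have "\<Gamma> \<subseteq> \<Delta>" unfolding \<Gamma> by (intro rel_lim_least sub\<Delta>)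
    then show ?thesis using that by (auto simp: \<Delta>_def)
  qed
  have pair: "(y0, e \<alpha> * y0) \<in> \<Gamma>" "(y0i, e (inverse \<alpha>) * y0i) \<in> \<Gamma>" "(y2, e \<alpha> * y2 + e (\<alpha> * c0 * \<beta>) * y1) \<in> \<Gamma>"
  proof -
    define f where "f = const c0 * w0 * u"
    have y0f: "y0 = \<iota> f * y1" using w_eq unfolding w f_def \<iota>_mult by (simp add: mult_ac)
    have f0: "f \<noteq> 0" using y0f y0_ne by (auto simp: \<iota>_0)
    show "(y0, e \<alpha> * y0) \<in> \<Gamma>" using D(4)[OF mem(1)[of f] mem(2)] by (simp add: y0f mult_ac)
    have "y0i = y0i * (\<iota> f * \<iota> (inverse f)) * (y1 * y1i)" using \<iota>_inverse[OF f0] y1i by simp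
    also have "\<dots> = (\<iota> f * y1 * y0i) * (\<iota> (inverse f) * y1i)" by (simp only: mult_ac)
    also have "\<dots> = \<iota> (inverse f) * y1i" unfolding y0f[symmetric] using y0i by simp
    finally have y0if: "\<iota> (inverse f) * y1i = y0i" ..
    have "\<iota> (inverse f) * (e (inverse \<alpha>) * y1i) = e (inverse \<alpha>) * (\<iota> (inverse f) * y1i)" by (simp only: mult_ac)
    then show "(y0i, e (inverse \<alpha>) * y0i) \<in> \<Gamma>"
      using D(4)[OF mem(1)[of "inverse f"] mem(3)] by (simp only: y0if)
    have 1: "e c0 * tt * y1 = y2" using t_tt t_y1 by simp
    have "e c0 * (tt + e \<beta>) * (e \<alpha> * y1) = e \<alpha> * (e c0 * tt * y1) + e (\<alpha> * c0 * \<beta>) * y1"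
      by (simp add: distrib_left distrib_right e_mult mult_ac)
    then show "(y2, e \<alpha> * y2 + e (\<alpha> * c0 * \<beta>) * y1) \<in> \<Gamma>"
      using D(4)[OF D(4)[OF mem(4)[of c0] tt] mem(2)] by (simp only: 1)
  qed
  \<comment> \<open>\<open>\<Gamma>\<close> is defined everywhere and onto, because both projections contain the generators of \<open>R\<close>.\<close>
  have dom: "fst ` \<Gamma> = UNIV"
  proof (rule R_generated[OF subring_set_fst[OF sub]])
    show "dR ` fst ` \<Gamma> \<subseteq> fst ` \<Gamma>"
    proof clarify
      fix r s assume "(r, s) \<in> \<Gamma>"
      from d\<Gamma>[OF this] show "dR (fst (r, s)) \<in> fst ` \<Gamma>" by (auto intro: rev_image_eqI)
    qed
    show "\<iota> f \<in> fst ` \<Gamma>" for f using mem(1)[of f] by (auto intro: rev_image_eqI)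
    show "y1 \<in> fst ` \<Gamma>" "y1i \<in> fst ` \<Gamma>" "y2 \<in> fst ` \<Gamma>" "y0 \<in> fst ` \<Gamma>" "y0i \<in> fst ` \<Gamma>"
      by (rule image_eqI[OF _ mem(2)] image_eqI[OF _ mem(3)] image_eqI[OF _ pair(3)] image_eqI[OF _ pair(1)] image_eqI[OF _ pair(2)], simp)+
  qed
  have ran: "snd ` \<Gamma> = UNIV"
  proof (rule R_generated[OF subring_set_snd[OF sub]])
    note S = subring_setD[OF subring_set_snd[OF sub]]
    show "dR ` snd ` \<Gamma> \<subseteq> snd ` \<Gamma>"
    proof clarify
      fix r s assume "(r, s) \<in> \<Gamma>"
      from d\<Gamma>[OF this] show "dR (snd (r, s)) \<in> snd ` \<Gamma>" by (auto intro: rev_image_eqI)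
    qed
    show \<iota>S: "\<iota> f \<in> snd ` \<Gamma>" for f using mem(1)[of f] by (auto intro: rev_image_eqI)
    then have eS: "e c \<in> snd ` \<Gamma>" for c by (simp add: e_def)
    have *: "r \<in> snd ` \<Gamma>" if "e c * r \<in> snd ` \<Gamma>" "c \<noteq> 0" for c r
    proof -
      have "e (inverse c) * (e c * r) \<in> snd ` \<Gamma>" using S(4)[OF eS that(1)] .
      moreover have "e (inverse c) * (e c * r) = (e c * e (inverse c)) * r" by (simp only: mult_ac)
      ultimately show ?thesis using e_inverse[OF that(2)] by simp
    qed
    have in_snd: "s \<in> snd ` \<Gamma>" if "(r, s) \<in> \<Gamma>" for r s using that by (auto intro: rev_image_eqI)
    show y1S: "y1 \<in> snd ` \<Gamma>" using *[OF in_snd[OF mem(2)]] \<alpha>(1) by blast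
    show "y1i \<in> snd ` \<Gamma>" "y0 \<in> snd ` \<Gamma>" "y0i \<in> snd ` \<Gamma>"
      using *[OF in_snd[OF mem(3)]] *[OF in_snd[OF pair(1)]] *[OF in_snd[OF pair(2)]] \<alpha>(1) by auto
    have "e \<alpha> * y2 \<in> snd ` \<Gamma>"
      using S(3)[OF in_snd[OF pair(3)] S(4)[OF eS[of "\<alpha> * c0 * \<beta>"] y1S]] by simp
    then show "y2 \<in> snd ` \<Gamma>" using * \<alpha>(1) by blast
  qed
  \<comment> \<open>\<open>\<Gamma>\<close> is injective, because \<open>R\<close> is simple.\<close>
  have inj: "r = 0" if r: "(r, 0) \<in> \<Gamma>" for r
  proof -
    define I where "I = {r. (r, 0) \<in> \<Gamma>}"
    have "ideal I ring_of_type_algebra"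
    proof (rule ideal_ring_of_type_algebraI)
      show "0 \<in> I" using D(2) by (simp add: I_def)
      show "r + s \<in> I" if "r \<in> I" "s \<in> I" for r s using D(6)[of r 0 s 0] that by (simp add: I_def)
      show "q * r \<in> I" if "r \<in> I" for q r
      proof -
        have "q \<in> fst ` \<Gamma>" using dom by simp
        then obtain q' where "(q, q') \<in> \<Gamma>" by force
        from D(4)[OF this, of r 0] that show ?thesis by (simp add: I_def)
      qed
    qed
    moreover have "sR ` I \<subseteq> I" "dR ` I \<subseteq> I" using sg\<Gamma>[of _ 0] d\<Gamma>[of _ 0] by (auto simp: I_def sg_0 dR)
    ultimately have "I = {0} \<or> I = UNIV" by (rule sd_simple)
    moreover have "1 \<notin> I"
    proof
      assume "1 \<in> I"
      then have "(1 - 1, 0 - 1) \<in> \<Gamma>" using D(1,3) unfolding I_def by blast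
      then show False using funct[of "- 1"] by simp
    qed
    ultimately show ?thesis using r by (auto simp: I_def)
  qed
  obtain \<gamma> where \<gamma>: "\<gamma> \<in> ring_iso (ring_of_type_algebra\<lparr>carrier := UNIV\<rparr>) (ring_of_type_algebra\<lparr>carrier := UNIV\<rparr>)"
    "\<And>r s. (r, s) \<in> \<Gamma> \<Longrightarrow> \<gamma> r = s"
    using graph_ring_iso[OF sub funct inj dom ran] by blast
  have iso: "\<gamma> \<in> ring_iso ring_of_type_algebra ring_of_type_algebra"
    using \<gamma>(1) by (simp add: ring_of_type_algebra_def)
  have ex: "\<exists>s. (r, s) \<in> \<Gamma>" for r
  proof -
    have "r \<in> fst ` \<Gamma>" using dom by simp
    then show ?thesis by force
  qed
  have "\<gamma> (sR r) = sR (\<gamma> r)" "\<gamma> (dR r) = dR (\<gamma> r)" for r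
  proof -
    obtain s where s: "(r, s) \<in> \<Gamma>" using ex by blast
    show "\<gamma> (sR r) = sR (\<gamma> r)" "\<gamma> (dR r) = dR (\<gamma> r)"
      using \<gamma>(2)[OF s] \<gamma>(2)[OF sg\<Gamma>[OF s]] \<gamma>(2)[OF d\<Gamma>[OF s]] by simp_all
  qed
  moreover have "\<gamma> (\<iota> f) = \<iota> f" for f by (rule \<gamma>(2)[OF mem(1)])
  ultimately show ?thesis
    unfolding mem_G_iff using iso \<gamma>(2)[OF mem(2)] \<gamma>(2)[OF pair(3)]
    by (intro bexI[of _ \<gamma>]) (simp_all add: e_0 mult.commute add.commute)
qed

end

section \<open>The four groups\<close>

lemma (in riccati_pv) cob_fixes_y1:
  assumes "case_i sK u" and \<gamma>: "\<forall>f. \<gamma> (\<iota> f) = \<iota> f" "\<gamma> y1 = e \<alpha> * y1"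
  shows "\<alpha> = 1"
proof -
  obtain h where h: "h \<noteq> 0" "u * h = sK h" using assms case_i_iff_cob by blast
  obtain d where "y1 = e d * \<iota> h" using cob_eq_fixed[OF y1i sR_y1 h(2,1)] by blast
  then have "y1 = \<iota> (const d * h)" by (simp add: \<iota>_mult e_def)
  then have "e \<alpha> * y1 = y1" using \<gamma> by metis
  then have "e \<alpha> * (y1 * y1i) = y1 * y1i" by (simp flip: mult.assoc)
  then have "e \<alpha> = e 1" using y1i by (simp add: e_1)
  then show ?thesis by (simp add: e_eq_iff)
qed

context riccati_pv_normal begin

lemma z_in_base:
  assumes "v = sK f - f"
  shows "z \<in> range \<iota>"
proof -
  have "sR (z - \<iota> f) = z - \<iota> f"
    unfolding sg_diff sR_z sg_\<iota> by (subst assms) (simp add: \<iota>_diff)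
  then obtain c where "z - \<iota> f = e c" using sg_fixed by blast
  then have "z = \<iota> (f + const c)" by (simp add: \<iota>_add e_def algebra_simps)
  then show ?thesis by blast
qed

text \<open>
  The generators \<open>x n = \<delta>\<^sup>n(tt)\<close> suffice when \<open>z\<close> lies in \<open>k\<close>. Their increments \<open>\<delta>\<^sup>n(w0)\<close> are independent modulo
  \<open>\<sigma> - 1\<close> because \<open>w0\<close> is not summable.
\<close>

lemma additive_in_G:
  assumes \<alpha>: "\<alpha> \<noteq> 0" "\<And>m h. h \<noteq> 0 \<Longrightarrow> u powi m * h = sK h \<Longrightarrow> \<alpha> powi m = 1" "dC \<alpha> = 0"
    and z: "z \<in> range \<iota>"
  shows "mat2 \<alpha> (\<alpha> * c0 * \<beta>) 0 \<alpha> \<in> G"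
proof (rule G_intro[OF \<alpha>(1,2) sR_tt_pow _ refl, where av = "\<lambda>n. (dC ^^ n) \<beta>"])
  fix n c g assume "(\<Sum>j<n. const (c j) * (dK ^^ j) w0) = sK g - g"
  then show "\<forall>j<n. c j = 0"
    unfolding L_monoms using L_summable_imp_zero[OF w0 w0_not_qsummable] monoms_eq_0 by blast
next
  let ?\<Gamma> = "rel_lim (\<Gamma>0 \<alpha>) (\<lambda>n. (dR ^^ n) tt) (\<lambda>n. (dR ^^ n) tt + e ((dC ^^ n) \<beta>))"
  note \<Gamma> = rel_lim_subring[OF sub_\<Gamma>0[OF \<alpha>(1)], where \<xi> = "\<lambda>n. (dR ^^ n) tt" and \<xi>' = "\<lambda>n. (dR ^^ n) tt + e ((dC ^^ n) \<beta>)"]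
  show "(z, z + e (dC \<alpha> / \<alpha>)) \<in> ?\<Gamma>"
    using z \<Gamma>0_mem(1) \<Gamma>(2) by (auto simp: \<alpha>(3) e_0)
  show "(tt, tt + e \<beta>) \<in> ?\<Gamma>" using \<Gamma>(3)[of 0] by simp
  show "(dR ((dR ^^ n) tt), dR ((dR ^^ n) tt + e ((dC ^^ n) \<beta>))) \<in> ?\<Gamma>" for n
    using \<Gamma>(3)[of "Suc n"] by (simp add: dR dR_e)
qed

text \<open>
  \<open>y1\<close> and \<open>z\<close> lie in \<open>k\<close>, so only \<open>t\<close> moves.
\<close>

theorem G_case_i:
  assumes "case_i sK u"
  shows "G = {mat2 1 \<beta> 0 1 | \<beta>. True}"
proof
  show "G \<subseteq> {mat2 1 \<beta> 0 1 | \<beta>. True}"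
  proof
    fix T assume T_G: "T \<in> G"
    obtain \<alpha> \<beta> \<gamma> where T: "T = mat2 \<alpha> (\<alpha> * c0 * \<beta>) 0 \<alpha>" "\<alpha> \<noteq> 0"
      and hom: "\<gamma> 1 = 1" "\<And>x y. \<gamma> (x + y) = \<gamma> x + \<gamma> y" "\<And>x y. \<gamma> (x * y) = \<gamma> x * \<gamma> y"
        "\<And>f. \<gamma> (\<iota> f) = \<iota> f" "\<And>r. \<gamma> (dR r) = dR (\<gamma> r)"
      and \<gamma>: "\<gamma> y1 = e \<alpha> * y1" "\<gamma> z = z + e (dC \<alpha> / \<alpha>)" "\<gamma> tt = tt + e \<beta>"
      using G_elim'[OF T_G] by blast
    have "\<alpha> = 1" by (rule cob_fixes_y1[OF assms, where \<gamma> = \<gamma>]) (use hom(4) \<gamma>(1) in simp_all)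
    then show "T \<in> {mat2 1 \<beta> 0 1 | \<beta>. True}" using T by auto
  qed
  obtain f where f: "v = sK f - f" using assms qsummable_v_iff by (auto simp: qsummable_def)
  have "mat2 1 (1 * c0 * (\<beta> / c0)) 0 1 \<in> G" for \<beta>
    by (rule additive_in_G) (use z_in_base[OF f] in \<open>simp_all add: dC\<close>)
  then show "{mat2 1 \<beta> 0 1 | \<beta>. True} \<subseteq> G" using c0 by auto
qed

lemma not_case_i_power:
  assumes "\<not> case_i sK u" "h \<noteq> 0" "u powi m * h = sK h"
  shows "m = 0"
  using assms cob_power_imp_cob case_i_iff_cob by blast

text \<open>
  \<open>z\<close> lies in \<open>k\<close> and is fixed, which forces \<open>\<delta>(\<alpha>) = 0\<close>; no nontrivial power of \<open>y1\<close> lies in \<open>k\<close>, so there is no other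
  condition.
\<close>

theorem G_case_ii:
  assumes "case_ii sK dK u"
  shows "G = {mat2 \<alpha> \<beta> 0 \<alpha> | \<alpha> \<beta>. \<alpha> \<noteq> 0 \<and> dC \<alpha> = 0}"
proof
  from assms have ni: "\<not> case_i sK u" by (simp add: case_ii_def)
  obtain f where f: "v = sK f - f" using assms by (auto simp: case_ii_def)
  obtain k where k: "z = \<iota> k" using z_in_base[OF f] by blast
  show "G \<subseteq> {mat2 \<alpha> \<beta> 0 \<alpha> | \<alpha> \<beta>. \<alpha> \<noteq> 0 \<and> dC \<alpha> = 0}"
  proof
    fix T assume T_G: "T \<in> G"
    obtain \<alpha> \<beta> \<gamma> where T: "T = mat2 \<alpha> (\<alpha> * c0 * \<beta>) 0 \<alpha>" "\<alpha> \<noteq> 0"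
      and hom: "\<gamma> 1 = 1" "\<And>x y. \<gamma> (x + y) = \<gamma> x + \<gamma> y" "\<And>x y. \<gamma> (x * y) = \<gamma> x * \<gamma> y"
        "\<And>f. \<gamma> (\<iota> f) = \<iota> f" "\<And>r. \<gamma> (dR r) = dR (\<gamma> r)"
      and \<gamma>: "\<gamma> y1 = e \<alpha> * y1" "\<gamma> z = z + e (dC \<alpha> / \<alpha>)" "\<gamma> tt = tt + e \<beta>"
      using G_elim'[OF T_G] by blast
    have "z = z + e (dC \<alpha> / \<alpha>)" using \<gamma>(2) hom(4) k by metis
    then have "e (dC \<alpha> / \<alpha>) = 0" by (metis add_cancel_left_right)
    then have "dC \<alpha> = 0" using T by simp
    then show "T \<in> {mat2 \<alpha> \<beta> 0 \<alpha> | \<alpha> \<beta>. \<alpha> \<noteq> 0 \<and> dC \<alpha> = 0}" using T by blast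
  qed
  show "{mat2 \<alpha> \<beta> 0 \<alpha> | \<alpha> \<beta>. \<alpha> \<noteq> 0 \<and> dC \<alpha> = 0} \<subseteq> G"
  proof clarify
    fix \<alpha> \<beta> assume \<alpha>: "\<alpha> \<noteq> 0" "dC \<alpha> = 0"
    have "mat2 \<alpha> (\<alpha> * c0 * (\<beta> / (\<alpha> * c0))) 0 \<alpha> \<in> G"
    proof (rule additive_in_G[OF \<alpha>(1) _ \<alpha>(2) z_in_base[OF f]])
      show "\<alpha> powi m = 1" if "h \<noteq> 0" "u powi m * h = sK h" for m h
        using not_case_i_power[OF ni that] by simp
    qed
    then show "mat2 \<alpha> \<beta> 0 \<alpha> \<in> G" using \<alpha> c0 by simp
  qed
qed

lemma sR_lin: "sR (lin_d_eval e dR M z) = lin_d_eval e dR M z + \<iota> (L M v)"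
  unfolding lin_d_eval_def
  by (simp add: sg_sum sg_mult sR_z_pow \<iota>_sum \<iota>_mult distrib_left sum.distrib flip: e_def)

lemma tt_eq:
  assumes "L M v - w0 = sK g - g"
  shows "\<exists>d. tt = lin_d_eval e dR M z - \<iota> g + e d"
proof -
  have "\<iota> (L M v) - \<iota> w0 = \<iota> (sK g) - \<iota> g" using assms by (simp flip: \<iota>_diff)
  then have "sR (tt - lin_d_eval e dR M z + \<iota> g) = tt - lin_d_eval e dR M z + \<iota> g"
    by (simp add: sg_add sg_diff sR_tt sR_lin sg_\<iota> algebra_simps)
  then obtain d where "tt - lin_d_eval e dR M z + \<iota> g = e d" using sg_fixed by blast
  then show ?thesis by (intro exI[of _ d]) (simp add: algebra_simps)
qed

lemma lin_add: "lin_d_eval e dR M (x + e c) = lin_d_eval e dR M x + e (lin_d_eval id dC M c)"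
proof -
  have esum: "e (sum f A) = (\<Sum>i\<in>A. e (f i))" for f and A :: "nat set"
    by (induction A rule: infinite_finite_induct) (simp_all add: e_0 e_add)
  show ?thesis
    unfolding lin_d_eval_def dR_pow esum by (simp add: distrib_left sum.distrib e_mult)
qed

text \<open>
  Now \<open>tt = M(z) - g + d\<close> with \<open>g\<close> in \<open>k\<close> and \<open>d\<close> in \<open>C\<close>, so the translation of \<open>z\<close> by \<open>\<delta>(\<alpha>)/\<alpha>\<close> determines that of
  \<open>tt\<close>. The generators are \<open>x n = \<delta>\<^sup>n(z)\<close>, independent because \<open>v\<close> is not summable.
\<close>

theorem G_case_iii:
  assumes ni: "\<not> case_i sK u" and nii: "\<not> case_ii sK dK u" and M: "qsummable (L M v - w0)"
  shows "G = {mat2 \<alpha> (\<alpha> * c0 * lin_d_eval id dC M (dC \<alpha> / \<alpha>)) 0 \<alpha> | \<alpha>. \<alpha> \<noteq> 0}"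
proof
  obtain g where g: "L M v - w0 = sK g - g" using M by (auto simp: qsummable_def)
  obtain d where d: "tt = lin_d_eval e dR M z - \<iota> g + e d" using tt_eq[OF g] by blast
  show "G \<subseteq> {mat2 \<alpha> (\<alpha> * c0 * lin_d_eval id dC M (dC \<alpha> / \<alpha>)) 0 \<alpha> | \<alpha>. \<alpha> \<noteq> 0}"
  proof
    fix T assume T_G: "T \<in> G"
    obtain \<alpha> \<beta> \<gamma> where T: "T = mat2 \<alpha> (\<alpha> * c0 * \<beta>) 0 \<alpha>" "\<alpha> \<noteq> 0"
      and hom: "\<gamma> 1 = 1" "\<And>x y. \<gamma> (x + y) = \<gamma> x + \<gamma> y" "\<And>x y. \<gamma> (x * y) = \<gamma> x * \<gamma> y"
        "\<And>f. \<gamma> (\<iota> f) = \<iota> f" "\<And>r. \<gamma> (dR r) = dR (\<gamma> r)"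
      and \<gamma>: "\<gamma> y1 = e \<alpha> * y1" "\<gamma> z = z + e (dC \<alpha> / \<alpha>)" "\<gamma> tt = tt + e \<beta>"
      using G_elim'[OF T_G] by blast
    have \<gamma>0: "\<gamma> 0 = 0" using hom(4)[of 0] by (simp add: \<iota>_0)
    have \<gamma>sum: "\<gamma> (sum f A) = (\<Sum>i\<in>A. \<gamma> (f i))" for f and A :: "nat set"
      by (induction A rule: infinite_finite_induct) (simp_all add: \<gamma>0 hom)
    have \<gamma>d: "\<gamma> ((dR ^^ n) r) = (dR ^^ n) (\<gamma> r)" for n r by (induction n) (simp_all add: hom)
    have \<gamma>e: "\<gamma> (e c) = e c" for c by (simp add: e_def hom)
    have "\<gamma> (lin_d_eval e dR M z) = lin_d_eval e dR M (z + e (dC \<alpha> / \<alpha>))"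
      unfolding lin_d_eval_def by (simp add: \<gamma>sum hom(3) \<gamma>e \<gamma>d \<gamma>(2))
    then have lin: "\<gamma> (lin_d_eval e dR M z) = lin_d_eval e dR M z + e (lin_d_eval id dC M (dC \<alpha> / \<alpha>))"
      by (simp add: lin_add)
    have "tt + \<iota> g = lin_d_eval e dR M z + e d" unfolding d by simp
    then have "\<gamma> tt + \<iota> g = \<gamma> (lin_d_eval e dR M z) + e d" by (metis hom(2,4) \<gamma>e)
    then have "tt + e \<beta> + \<iota> g = (lin_d_eval e dR M z + e d) + e (lin_d_eval id dC M (dC \<alpha> / \<alpha>))"
      unfolding \<gamma>(3) lin by (simp add: add_ac)
    then have "(tt + \<iota> g) + e \<beta> = (tt + \<iota> g) + e (lin_d_eval id dC M (dC \<alpha> / \<alpha>))"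
      unfolding \<open>tt + \<iota> g = lin_d_eval e dR M z + e d\<close>[symmetric] by (simp add: add_ac)
    then have "\<beta> = lin_d_eval id dC M (dC \<alpha> / \<alpha>)" by (simp only: add_left_cancel e_eq_iff)
    then show "T \<in> {mat2 \<alpha> (\<alpha> * c0 * lin_d_eval id dC M (dC \<alpha> / \<alpha>)) 0 \<alpha> | \<alpha>. \<alpha> \<noteq> 0}" using T by blast
  qed
  have nv: "\<not> qsummable v" using ni nii qsummable_v_iff by blast
  show "{mat2 \<alpha> (\<alpha> * c0 * lin_d_eval id dC M (dC \<alpha> / \<alpha>)) 0 \<alpha> | \<alpha>. \<alpha> \<noteq> 0} \<subseteq> G"
  proof clarify
    fix \<alpha> :: 'a assume \<alpha>: "\<alpha> \<noteq> 0"
    define a' where "a' = dC \<alpha> / \<alpha>"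
    show "mat2 \<alpha> (\<alpha> * c0 * lin_d_eval id dC M (dC \<alpha> / \<alpha>)) 0 \<alpha> \<in> G"
    proof (rule G_intro[OF \<alpha> _ sR_z_pow _ refl, where av = "\<lambda>n. (dC ^^ n) a'"])
      show "\<alpha> powi m = 1" if "h \<noteq> 0" "u powi m * h = sK h" for m h
        using not_case_i_power[OF ni that] by simp
    next
      fix n c g assume "(\<Sum>j<n. const (c j) * (dK ^^ j) v) = sK g - g"
      then show "\<forall>j<n. c j = 0"
        unfolding L_monoms using L_summable_imp_zero[OF v_Qbar_x nv] monoms_eq_0 by blast
    next
      let ?\<Gamma> = "rel_lim (\<Gamma>0 \<alpha>) (\<lambda>n. (dR ^^ n) z) (\<lambda>n. (dR ^^ n) z + e ((dC ^^ n) a'))"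
      note \<Gamma> = rel_lim_subring[OF sub_\<Gamma>0[OF \<alpha>], where \<xi> = "\<lambda>n. (dR ^^ n) z" and \<xi>' = "\<lambda>n. (dR ^^ n) z + e ((dC ^^ n) a')"]
      note D = subring_relD[OF \<Gamma>(1)]
      have base: "(\<iota> f, \<iota> f) \<in> ?\<Gamma>" "(e c, e c) \<in> ?\<Gamma>" for f c using \<Gamma>0_mem \<Gamma>(2) by blast+
      show "(z, z + e (dC \<alpha> / \<alpha>)) \<in> ?\<Gamma>" using \<Gamma>(3)[of 0] by (simp add: a'_def)
      show "(dR ((dR ^^ n) z), dR ((dR ^^ n) z + e ((dC ^^ n) a'))) \<in> ?\<Gamma>" for n
        using \<Gamma>(3)[of "Suc n"] by (simp add: dR dR_e)
      have "(lin_d_eval e dR M z, lin_d_eval e dR M (z + e a')) \<in> ?\<Gamma>"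
        unfolding lin_d_eval_def dR_pow
        by (intro subring_rel_sum[OF \<Gamma>(1)] D(4) base(2) \<Gamma>(3))
      then have "(lin_d_eval e dR M z - \<iota> g + e d, lin_d_eval e dR M (z + e a') - \<iota> g + e d) \<in> ?\<Gamma>"
        by (intro D base)
      moreover have "lin_d_eval e dR M (z + e a') - \<iota> g + e d = tt + e (lin_d_eval id dC M (dC \<alpha> / \<alpha>))"
        unfolding d lin_add a'_def by simp
      ultimately show "(tt, tt + e (lin_d_eval id dC M (dC \<alpha> / \<alpha>))) \<in> ?\<Gamma>"
        by (simp flip: d)
    qed
  qed
qed

lemma L_monom: "L (Polynomial.monom c n) f = const c * (dK ^^ n) f"
proof -
  have "L (Polynomial.monom c n) f = (\<Sum>i\<le>n. const (Polynomial.coeff (Polynomial.monom c n) i) * (dK ^^ i) f)"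
    by (rule L_superset) (rule degree_monom_le)
  also have "\<dots> = const c * (dK ^^ n) f"
    by (subst sum.mono_neutral_right[of _ "{n}"]) auto
  finally show ?thesis .
qed

lemma L_sum: "L (\<Sum>i\<in>A. f i) x = (\<Sum>i\<in>A. L (f i) x)" for A :: "nat set"
  by (induction A rule: infinite_finite_induct) (simp_all add: L_add)

text \<open>
  The derivatives of \<open>z\<close> and of \<open>tt\<close> are independent by \<open>L_log_deriv_summable_imp_zero\<close>, so \<open>\<alpha>\<close> and \<open>\<beta>\<close> are
  unrestricted. The sequence \<open>x\<close> interleaves the two families.
\<close>

theorem G_case_iv:
  assumes ni: "\<not> case_i sK u" and nii: "\<not> case_ii sK dK u"
    and nM: "\<And>M. qpoly M \<Longrightarrow> \<not> qsummable (L M v - w0)"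
  shows "G = Gm_Ga"
proof
  show "G \<subseteq> Gm_Ga" using G_elim(1) H_sub by blast
  have nv: "\<not> qsummable v" using ni nii qsummable_v_iff by blast
  show "Gm_Ga \<subseteq> G"
  proof
    fix T :: "'a^2^2" assume "T \<in> Gm_Ga"
    then obtain \<alpha> \<beta>' where T: "T = mat2 \<alpha> \<beta>' 0 \<alpha>" "\<alpha> \<noteq> 0" by (auto simp: Gm_Ga_def)
    define \<beta> where "\<beta> = \<beta>' / (\<alpha> * c0)"
    define x where "x n = (dR ^^ (n div 2)) (if even n then z else tt)" for n :: nat
    define \<omega> where "\<omega> n = (dK ^^ (n div 2)) (if even n then v else w0)" for n :: nat
    define av where "av n = (dC ^^ (n div 2)) (if even n then dC \<alpha> / \<alpha> else \<beta>)" for n :: nat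
    have "mat2 \<alpha> (\<alpha> * c0 * \<beta>) 0 \<alpha> \<in> G"
    proof (rule G_intro[OF T(2) _ _ _ refl, where x = x and \<omega> = \<omega> and av = av])
      show "\<alpha> powi m = 1" if "h \<noteq> 0" "u powi m * h = sK h" for m h
        using not_case_i_power[OF ni that] by simp
      show "sR (x n) = x n + \<iota> (\<omega> n)" for n by (simp add: x_def \<omega>_def sR_z_pow sR_tt_pow)
    next
      fix n c g assume eq: "(\<Sum>j<n. const (c j) * \<omega> j) = sK g - g"
      \<comment> \<open>The operators applied to \<open>v\<close> and to \<open>w0\<close> in the given combination.\<close>
      define M where "M = (\<Sum>j<n. if even j then Polynomial.monom (c j) (j div 2) else 0)"
      define N where "N = (\<Sum>j<n. if even j then 0 else Polynomial.monom (c j) (j div 2))"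
      have "L M v + L N w0 = (\<Sum>j<n. const (c j) * \<omega> j)"
        unfolding M_def N_def L_sum sum.distrib[symmetric] \<omega>_def
        by (intro sum.cong) (auto simp: L_monom)
      from this[unfolded eq] have MN: "M = 0 \<and> N = 0"
        by (intro L_log_deriv_summable_imp_zero[OF u(1) u_ne w0 nv]) (rule nM)
      show "\<forall>j<n. c j = 0"
      proof (intro allI impI)
        fix j assume j: "j < n"
        have 1: "Polynomial.coeff M (j div 2) = (\<Sum>i<n. if i = j then c j else 0)" if "even j"
          unfolding M_def coeff_sum using that by (intro sum.cong) (auto elim!: evenE)
        have 2: "Polynomial.coeff N (j div 2) = (\<Sum>i<n. if i = j then c j else 0)" if "odd j"
          unfolding N_def coeff_sum using that by (intro sum.cong) (auto elim!: oddE)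
        show "c j = 0"
          using 1 2 j MN by (cases "even j") simp_all
      qed
    next
      let ?\<Gamma> = "rel_lim (\<Gamma>0 \<alpha>) x (\<lambda>n. x n + e (av n))"
      note \<Gamma> = rel_lim_subring[OF sub_\<Gamma>0[OF T(2)], where \<xi> = x and \<xi>' = "\<lambda>n. x n + e (av n)"]
      show "(z, z + e (dC \<alpha> / \<alpha>)) \<in> ?\<Gamma>" using \<Gamma>(3)[of 0] by (simp add: x_def av_def)
      show "(tt, tt + e \<beta>) \<in> ?\<Gamma>" using \<Gamma>(3)[of 1] by (simp add: x_def av_def)
      show "(dR (x n), dR (x n + e (av n))) \<in> ?\<Gamma>" for n
      proof -
        have "x (n + 2) = dR (x n)" "av (n + 2) = dC (av n)" by (simp_all add: x_def av_def)
        then show ?thesis using \<Gamma>(3)[of "n + 2"] by (simp add: dR dR_e)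
      qed
    qed
    then show "T \<in> G" using T c0 by (simp add: \<beta>_def)
  qed
qed

end

section \<open>Recognising the case from the group\<close>

lemma Ru_mat2: "\<beta> \<in> Ru {mat2 \<alpha> (f \<alpha>) 0 \<alpha> | \<alpha>. \<alpha> \<noteq> 0} \<longleftrightarrow> \<beta> = f (1 :: 'c::field)"
  by (auto simp: Ru_def mat2_eq_iff)

lemma Ru_unipotent: "Ru {mat2 1 \<beta> 0 1 | \<beta>. True} = (UNIV :: 'c::field set)"
  and Ru_Gm_Ga: "Ru (Gm_Ga :: ('c^2^2) set) = UNIV"
  by (force simp: Ru_def Gm_Ga_def)+

lemma (in riccati_pv) Ru_constants: "Ru {mat2 \<alpha> \<beta> 0 \<alpha> | \<alpha> \<beta>. \<alpha> \<noteq> 0 \<and> dC \<alpha> = 0} = UNIV"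
  by (force simp: Ru_def dC)

context riccati_pv_normal begin

definition G3 :: "'a poly \<Rightarrow> ('a^2^2) set" where
  "G3 M = {mat2 \<alpha> (\<alpha> * c0 * lin_d_eval id dC M (dC \<alpha> / \<alpha>)) 0 \<alpha> | \<alpha>. \<alpha> \<noteq> 0}"

lemma dC_pow_0: "(dC ^^ i) 0 = 0" by (induction i) (simp_all add: dC)

text \<open>
  This separates the third kind of group from the others. Scalar matrices separate these from each other.
\<close>

lemma Ru_G3: "Ru (G3 M) \<noteq> UNIV"
proof -
  have "1 \<notin> Ru (G3 M)"
    unfolding G3_def Ru_mat2 by (simp add: dC lin_d_eval_def dC_pow_0)
  then show ?thesis by blast
qed

text \<open>
  The hypotheses of the four cases are exhaustive. Since the four kinds of groups are pairwise distinct, each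
  group determines its case.
\<close>

lemma four_cases:
  obtains (i) "case_i sK u" "G = {mat2 1 \<beta> 0 1 | \<beta>. True}"
  | (ii) "\<not> case_i sK u" "case_ii sK dK u" "G = {mat2 \<alpha> \<beta> 0 \<alpha> | \<alpha> \<beta>. \<alpha> \<noteq> 0 \<and> dC \<alpha> = 0}"
  | (iii) M where "\<not> case_i sK u" "\<not> case_ii sK dK u" "qpoly M" "qsummable (L M v - w0)" "G = G3 M"
  | (iv) "\<not> case_i sK u" "\<not> case_ii sK dK u" "\<And>M. qpoly M \<Longrightarrow> \<not> qsummable (L M v - w0)" "G = Gm_Ga"
proof -
  consider "case_i sK u" | "case_ii sK dK u" | M where "\<not> case_i sK u" "\<not> case_ii sK dK u" "qpoly M" "qsummable (L M v - w0)"
    | "\<not> case_i sK u" "\<not> case_ii sK dK u" "\<And>M. qpoly M \<Longrightarrow> \<not> qsummable (L M v - w0)" by blast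
  then show thesis
  proof cases
    case 1
    then show ?thesis using i G_case_i by blast
  next
    case 2
    then show ?thesis using ii G_case_ii by (simp add: case_ii_def)
  next
    case 3
    then show ?thesis using iii[of M] G_case_iii by (simp add: G3_def)
  next
    case 4
    then show ?thesis using iv G_case_iv by blast
  qed
qed

lemma dC_2: "dC 2 = 0" by (rule dC_Qbar) (use Qbar_of_nat[of 2] in simp)

lemma scalar_two_mem: "mat2 2 0 0 2 \<in> {mat2 \<alpha> \<beta> 0 \<alpha> | \<alpha> \<beta>. \<alpha> \<noteq> 0 \<and> dC \<alpha> = 0}" "mat2 2 0 0 2 \<in> (Gm_Ga :: ('a^2^2) set)"
  "mat2 2 0 0 2 \<notin> {mat2 1 \<beta> 0 (1 :: 'a) | \<beta>. True}"
  by (auto simp: Gm_Ga_def mat2_eq_iff dC_2 intro!: exI[of _ 2] exI[of _ 0])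

lemma G2_ne_Gm_Ga: "{mat2 \<alpha> \<beta> 0 \<alpha> | \<alpha> \<beta>. \<alpha> \<noteq> 0 \<and> dC \<alpha> = 0} \<noteq> Gm_Ga"
proof
  assume eq: "{mat2 \<alpha> \<beta> 0 \<alpha> | \<alpha> \<beta>. \<alpha> \<noteq> 0 \<and> dC \<alpha> = 0} = Gm_Ga"
  obtain \<alpha> where \<alpha>: "\<alpha> \<noteq> 0" "lin_d_eval id dC 1 (dC \<alpha> / \<alpha>) \<noteq> 0"
    using ex_log_deriv_ne_zero[of 1] by auto
  then have "dC \<alpha> \<noteq> 0" by (auto simp: lin_d_eval_def)
  moreover have "mat2 \<alpha> 0 0 \<alpha> \<in> Gm_Ga" using \<alpha> by (auto simp: Gm_Ga_def)
  ultimately show False unfolding eq[symmetric] by (auto simp: mat2_eq_iff)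
qed

theorem case_i_iff: "case_i sK u \<longleftrightarrow> G = {mat2 1 \<beta> 0 1 | \<beta>. True}"
proof (cases rule: four_cases)
  case i then show ?thesis by blast
next
  case ii then show ?thesis using scalar_two_mem by blast
next
  case (iii M) then show ?thesis using Ru_G3[of M] Ru_unipotent by metis
next
  case iv then show ?thesis using scalar_two_mem by blast
qed

theorem case_ii_iff: "case_ii sK dK u \<longleftrightarrow> G = {mat2 \<alpha> \<beta> 0 \<alpha> | \<alpha> \<beta>. \<alpha> \<noteq> 0 \<and> dC \<alpha> = 0}"
proof (cases rule: four_cases)
  case i then show ?thesis using scalar_two_mem by (auto simp: case_ii_def)
next
  case ii then show ?thesis by blast
next
  case (iii M) then show ?thesis using Ru_G3[of M] Ru_constants by metis
next
  case iv then show ?thesis using G2_ne_Gm_Ga by metis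
qed

text \<open>
  Values \<open>\<alpha>\<close> with \<open>(M - N)(\<delta>(\<alpha>)/\<alpha>) \<noteq> 0\<close> exist unless \<open>M = N\<close>.
\<close>

lemma G3_inj: "G3 M = G3 N \<Longrightarrow> M = N"
proof (rule ccontr)
  assume eq: "G3 M = G3 N" and "M \<noteq> N"
  then obtain \<alpha> where \<alpha>: "\<alpha> \<noteq> 0" "lin_d_eval id dC (M - N) (dC \<alpha> / \<alpha>) \<noteq> 0"
    using ex_log_deriv_ne_zero[of "M - N"] by auto
  have superset: "lin_d_eval id dC P x = (\<Sum>i\<le>n. Polynomial.coeff P i * (dC ^^ i) x)" if "Polynomial.degree P \<le> n" for P x n
    unfolding lin_d_eval_def using that by (intro sum.mono_neutral_cong_left) (auto simp: coeff_eq_0)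
  define n where "n = max (Polynomial.degree M) (Polynomial.degree N)"
  have "Polynomial.degree (M - N) \<le> n" "Polynomial.degree M \<le> n" "Polynomial.degree N \<le> n"
    unfolding n_def by (auto intro: degree_diff_le_max)
  note this[THEN superset]
  then have "lin_d_eval id dC (M - N) x = lin_d_eval id dC M x - lin_d_eval id dC N x" for x
    by (simp add: left_diff_distrib sum_subtractf)
  moreover have "mat2 \<alpha> (\<alpha> * c0 * lin_d_eval id dC M (dC \<alpha> / \<alpha>)) 0 \<alpha> \<in> G3 N"
    unfolding eq[symmetric] unfolding G3_def using \<alpha> by blast
  then have "\<alpha> * c0 * lin_d_eval id dC M (dC \<alpha> / \<alpha>) = \<alpha> * c0 * lin_d_eval id dC N (dC \<alpha> / \<alpha>)"
    by (auto simp: G3_def mat2_eq_iff)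
  ultimately show False using \<alpha> c0 by simp
qed

text \<open>
  If \<open>G = G3 M\<close>, then case (iii) holds for some operator \<open>N\<close>, and \<open>G = G3 N\<close> forces \<open>N = M\<close>. The operator \<open>M\<close> may have
  arbitrary coefficients.
\<close>

theorem case_iii_iff:
  "\<not> case_i sK u \<and> \<not> case_ii sK dK u \<and> qsummable (L M v - w0) \<longleftrightarrow> G = G3 M"
proof
  show "\<not> case_i sK u \<and> \<not> case_ii sK dK u \<and> qsummable (L M v - w0) \<Longrightarrow> G = G3 M"
    unfolding G3_def by (intro G_case_iii) auto
  assume G: "G = G3 M"
  show "\<not> case_i sK u \<and> \<not> case_ii sK dK u \<and> qsummable (L M v - w0)"
  proof (cases rule: four_cases)
    case i then show ?thesis using G Ru_G3[of M] Ru_unipotent by metis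
  next
    case ii then show ?thesis using G Ru_G3[of M] Ru_constants by metis
  next
    case (iii N) then show ?thesis using G G3_inj by metis
  next
    case iv then show ?thesis using G Ru_G3[of M] Ru_Gm_Ga by metis
  qed
qed

end

lemma bij_ex1_iff: "bij f \<Longrightarrow> (\<exists>!x. P (f x)) \<longleftrightarrow> (\<exists>!x. P x)"
  by (metis bij_iff)

lemma Gm_Ga_Collect:
  "{T \<in> Gm_Ga. P (T $ 1 $ 1) (T $ 1 $ 2)} = {mat2 \<alpha> \<beta> 0 \<alpha> | \<alpha> \<beta>. \<alpha> \<noteq> 0 \<and> P \<alpha> (\<beta> :: 'c::field)}"
  by (auto simp: Gm_Ga_def) blast

lemma (in riccati_pv) riccati_basis_scale:
  assumes c: "c \<noteq> 0" and w': "w = e c * w'"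
  shows "riccati_basis \<iota> sR a b u (e c * y1) y2 y0 w'"
proof -
  have sol: "sR (sR y) + \<iota> a * sR y + \<iota> b * y = 0 \<longleftrightarrow>
      (\<exists>!p. y = \<iota> (const (fst p)) * (e c * y1) + \<iota> (const (snd p)) * y2)" for y
  proof -
    have "bij (\<lambda>p :: 'c \<times> 'c. (c * fst p, snd p))"
      by (rule o_bij[of "\<lambda>p. (fst p / c, snd p)"]) (use c in \<open>auto simp: fun_eq_iff\<close>)
    from bij_ex1_iff[OF this, of "\<lambda>p. y = \<iota> (const (fst p)) * y1 + \<iota> (const (snd p)) * y2"]
    show ?thesis unfolding sols by (simp only: fst_conv snd_conv e_def const_hom \<iota>_mult mult_ac)
  qed
  have e_inv: "e c * e (inverse c) = 1" by (rule e_inverse[OF c])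
  have scaled: "mat2 (e c * y1) y2 (sR (e c * y1)) (sR y2) = mat2 y1 y2 (sR y1) (sR y2) ** mat2 (e c) 0 0 1"
    by (simp add: mat2_mult sg_mult mult_ac)
  have fm: "fundamental_matrix \<iota> sR (companion a b) (mat2 (e c * y1) y2 (sR (e c * y1)) (sR y2))"
    unfolding fundamental_matrix_def
  proof
    have "mat2 (e c) 0 0 1 ** mat2 (e (inverse c)) 0 0 1 = mat 1" "mat2 (e (inverse c)) 0 0 1 ** mat2 (e c) 0 0 1 = mat 1"
      using e_inv by (simp_all add: mat2_mult mat_def vec_eq_iff forall_2 mult.commute)
    then have "invertible (mat2 (e c) 0 0 (1 :: 'r))" unfolding invertible_def by blast
    then show "invertible (mat2 (e c * y1) y2 (sR (e c * y1)) (sR y2))"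
      unfolding scaled using basis by (intro invertible_mult) (auto simp: riccati_basis_def fundamental_matrix_def)
    have "map_matrix sR (mat2 y1 y2 (sR y1) (sR y2) ** mat2 (e c) 0 0 1) =
        map_matrix sR (mat2 y1 y2 (sR y1) (sR y2)) ** mat2 (e c) 0 0 1"
      by (simp add: mat2_mult map_matrix_mat2 sg_mult)
    moreover have "map_matrix sR (mat2 y1 y2 (sR y1) (sR y2)) = map_matrix \<iota> (companion a b) ** mat2 y1 y2 (sR y1) (sR y2)"
      using basis by (auto simp: riccati_basis_def fundamental_matrix_def)
    ultimately show "map_matrix sR (mat2 (e c * y1) y2 (sR (e c * y1)) (sR y2)) =
        map_matrix \<iota> (companion a b) ** mat2 (e c * y1) y2 (sR (e c * y1)) (sR y2)"
      unfolding scaled by (simp only: matrix_mul_assoc)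
  qed
  have "(e c * y1) * (e (inverse c) * y1i) = (e c * e (inverse c)) * (y1 * y1i)" by (simp only: mult_ac)
  then have unit: "(e c * y1) * (e (inverse c) * y1i) = 1" using e_inv y1i by simp
  then have "e c * y1 dvd 1" by (metis dvd_triv_left)
  moreover have "e c * y1 \<noteq> 0" using unit by fastforce
  moreover have "w' * (\<iota> u * (e c * y1)) = w * (\<iota> u * y1)" unfolding w' by (simp only: mult_ac)
  moreover have "sR (e c * y1) = \<iota> u * (e c * y1)" by (simp add: sg_mult sR_y1 mult_ac)
  ultimately show ?thesis
    unfolding riccati_basis_def using basis sol fm by (auto simp: riccati_basis_def)
qed

text \<open>
  The logarithmic derivative turns products into sums, so the map is always an injective homomorphism; being an
  isomorphism onto \<open>G\<close> is a statement about its image.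
\<close>

lemma (in riccati_pv) log_deriv_embedding_iso_iff:
  "log_deriv_embedding dC M \<in> iso (mult_of ring_of_type_algebra) (matrix_group G) \<longleftrightarrow>
   G = {mat2 \<alpha> (\<alpha> * lin_d_eval id dC M (dC \<alpha> / \<alpha>)) 0 \<alpha> | \<alpha>. \<alpha> \<noteq> 0}"
proof -
  let ?\<phi> = "log_deriv_embedding dC M"
  have dC_sum: "(dC ^^ i) (x + y) = (dC ^^ i) x + (dC ^^ i) y" for i x y
    by (induction i) (simp_all add: dC)
  have add: "lin_d_eval id dC M (x + y) = lin_d_eval id dC M x + lin_d_eval id dC M y" for x y
    unfolding lin_d_eval_def by (simp add: dC_sum distrib_left sum.distrib)
  have mult: "?\<phi> (\<alpha> * \<beta>) = ?\<phi> \<alpha> ** ?\<phi> \<beta>" if "\<alpha> \<noteq> 0" "\<beta> \<noteq> 0" for \<alpha> \<beta>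
  proof -
    have "dC (\<alpha> * \<beta>) / (\<alpha> * \<beta>) = dC \<alpha> / \<alpha> + dC \<beta> / \<beta>" using that by (simp add: dC field_simps)
    then show ?thesis
      unfolding log_deriv_embedding_def by (simp add: mat2_mult add algebra_simps)
  qed
  have inj: "inj_on ?\<phi> (UNIV - {0})"
    by (rule inj_onI) (auto simp: log_deriv_embedding_def mat2_eq_iff)
  have image: "?\<phi> ` (UNIV - {0}) = {mat2 \<alpha> (\<alpha> * lin_d_eval id dC M (dC \<alpha> / \<alpha>)) 0 \<alpha> | \<alpha>. \<alpha> \<noteq> 0}"
    by (auto simp: log_deriv_embedding_def)
  have "?\<phi> \<in> iso (mult_of ring_of_type_algebra) (matrix_group G) \<longleftrightarrow> ?\<phi> ` (UNIV - {0}) = G"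
    using mult inj by (auto simp: iso_def hom_def bij_betw_def matrix_group_def)
  then show ?thesis unfolding image by blast
qed

lemma (in riccati_pv) H_of_case_i:
  assumes "case_i sK u"
  shows "H = {mat2 1 \<beta> 0 1 | \<beta>. True}"
proof
  show "H \<subseteq> {mat2 1 \<beta> 0 1 | \<beta>. True}"
  proof
    fix T assume "T \<in> H"
    then obtain \<alpha> \<beta> \<gamma> where T: "T = mat2 \<alpha> \<beta> 0 \<alpha>" and \<gamma>: "\<forall>f. \<gamma> (\<iota> f) = \<iota> f" "\<gamma> y1 = e \<alpha> * y1"
      using H_elim by blast
    have "\<alpha> = 1" by (rule cob_fixes_y1[OF assms \<gamma>])
    then show "T \<in> {mat2 1 \<beta> 0 1 | \<beta>. True}" using T by blast
  qed
  show "{mat2 1 \<beta> 0 1 | \<beta>. True} \<subseteq> H" using H_Ru by (auto simp: Ru_def)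
qed

theorem (in riccati_pv) normalisation: "\<exists>c w'. c \<noteq> 0 \<and> riccati_basis \<iota> sR a b u (\<iota> (const c) * y1) y2 y0 w' \<and> w' \<in> \<iota> ` Qbar_x"
proof -
  obtain c w0 where cw: "c \<noteq> 0" "w0 \<in> Qbar_x" "w = \<iota> (const c * w0)" using w_normal_form by blast
  have "riccati_basis \<iota> sR a b u (e c * y1) y2 y0 (\<iota> w0)"
    by (rule riccati_basis_scale[OF cw(1)]) (simp add: cw(3) e_def \<iota>_mult)
  then show ?thesis using cw(1,2) unfolding e_def by blast
qed

theorem (in riccati_pv) cases_i_ii:
  "case_i sK u \<longleftrightarrow> G = {mat2 1 \<beta> 0 1 | \<beta>. True}"
  "case_ii sK dK u \<longleftrightarrow> G = {mat2 \<alpha> \<beta> 0 \<alpha> | \<alpha> \<beta>. \<alpha> \<noteq> 0 \<and> dC \<alpha> = 0}"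
proof -
  obtain c w0 where cw: "c \<noteq> 0" "w0 \<in> Qbar_x" "w = \<iota> (const c * w0)" using w_normal_form by blast
  interpret n: riccati_pv_normal dC sK dK \<iota> sR dR a b u y1 y2 y0 w Z G H c w0
    by (intro riccati_pv_normal.intro riccati_pv_axioms riccati_pv_normal_axioms.intro cw)
  show "case_i sK u \<longleftrightarrow> G = {mat2 1 \<beta> 0 1 | \<beta>. True}"
    "case_ii sK dK u \<longleftrightarrow> G = {mat2 \<alpha> \<beta> 0 \<alpha> | \<alpha> \<beta>. \<alpha> \<noteq> 0 \<and> dC \<alpha> = 0}"
    by (rule n.case_i_iff n.case_ii_iff)+
qed

text \<open>
  Here \<open>w\<close> itself has algebraic coefficients, so the constant \<open>c0\<close> can be taken to be \<open>1\<close> and \<open>G3 M\<close> is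
  the subgroup defined by \<open>\<beta> = \<alpha> M(\<delta>(\<alpha>)/\<alpha>)\<close>.
\<close>

theorem (in riccati_pv) cases_iii_iv:
  assumes "w \<in> \<iota> ` Qbar_x"
  shows "case_iii_for sK dK \<iota> u w M \<longleftrightarrow>
      G = {mat2 \<alpha> (\<alpha> * lin_d_eval id dC M (dC \<alpha> / \<alpha>)) 0 \<alpha> | \<alpha>. \<alpha> \<noteq> 0}"
    and "\<not> case_i sK u \<Longrightarrow> \<not> case_ii sK dK u \<Longrightarrow> (\<And>M. qpoly M \<Longrightarrow> \<not> case_iii_for sK dK \<iota> u w M) \<Longrightarrow>
      G = Gm_Ga"
proof -
  obtain w1 where w1: "w1 \<in> Qbar_x" "w = \<iota> w1" using assms by blast
  interpret n: riccati_pv_normal dC sK dK \<iota> sR dR a b u y1 y2 y0 w Z G H 1 w1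
    by (intro riccati_pv_normal.intro riccati_pv_axioms riccati_pv_normal_axioms.intro)
      (simp_all add: const_hom(5) w1)
  have iii: "case_iii_for sK dK \<iota> u w M \<longleftrightarrow>
      \<not> case_i sK u \<and> \<not> case_ii sK dK u \<and> qsummable (L M v - w1)" for M
    unfolding case_iii_for_def qsummable_def w1(2) \<iota>_diff[symmetric] \<iota>_eq_iff ..
  show "case_iii_for sK dK \<iota> u w M \<longleftrightarrow>
      G = {mat2 \<alpha> (\<alpha> * lin_d_eval id dC M (dC \<alpha> / \<alpha>)) 0 \<alpha> | \<alpha>. \<alpha> \<noteq> 0}"
    unfolding iii n.case_iii_iff n.G3_def by simp
  assume "\<not> case_i sK u" "\<not> case_ii sK dK u" "\<And>M. qpoly M \<Longrightarrow> \<not> case_iii_for sK dK \<iota> u w M"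
  then show "G = Gm_Ga" unfolding iii by (intro n.G_case_iv) auto
qed

theorem proposition5p2:
  fixes dC :: "'c::field_char_0 \<Rightarrow> 'c"
    and sK dK :: "'c poly fract \<Rightarrow> 'c poly fract"
    and \<iota> :: "'c poly fract \<Rightarrow> 'r::comm_ring_1"
    and sR dR :: "'r \<Rightarrow> 'r"
    and a b u :: "'c poly fract"
    and y1 y2 y0 w :: 'r
    and Z :: "'r^2^2"
    and G H :: "('c^2^2) set"
  assumes C: "d_closure_of_Qbar dC"
    and k: "shift_base_field dC sK dK"
    and ab: "a \<in> Qbar_x" "b \<in> Qbar_x" "b \<noteq> 0"
    and unique: "\<exists>!v. v \<in> Qbar_x \<and> riccati_solution sK a b v"
    and u: "u \<in> Qbar_x" "riccati_solution sK a b u"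
    and R: "sd_pv_ring sK dK (companion a b) \<iota> sR dR"
    and basis: "riccati_basis \<iota> sR a b u y1 y2 y0 w"
    and Z: "Z = mat2 y1 y2 (sR y1) (sR y2)"
    and G: "G = sd_galois_group \<iota> sR dR Z"
    and H: "H = s_galois_group \<iota> sR Z"
    and H_sub: "H \<subseteq> Gm_Ga"
    and H_conn: "connectedin zariski_topology H"
    and H_Ru: "Ru H = UNIV"
  shows "(\<exists>c w'. c \<noteq> 0 \<and> riccati_basis \<iota> sR a b u (\<iota> (const c) * y1) y2 y0 w' \<and> w' \<in> \<iota> ` Qbar_x)
    \<and> (case_i sK u \<longleftrightarrow> G = {T \<in> Gm_Ga. T $ 1 $ 1 = 1} \<and> Ru G = UNIV)
    \<and> (case_i sK u \<longleftrightarrow> G = H \<and> H = {mat2 1 \<beta> 0 1 | \<beta>. True})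
    \<and> (case_ii sK dK u \<longleftrightarrow> G = {T \<in> Gm_Ga. dC (T $ 1 $ 1) = 0} \<and> Ru G = UNIV)
    \<and> (case_ii sK dK u \<longleftrightarrow> G = {mat2 \<alpha> \<beta> 0 \<alpha> | \<alpha> \<beta>. \<alpha> \<noteq> 0 \<and> dC \<alpha> = 0})
    \<and> (w \<in> \<iota> ` Qbar_x \<longrightarrow>
        (\<forall>L. (\<forall>i. Polynomial.coeff L i \<in> Qbar) \<longrightarrow>
           (case_iii_for sK dK \<iota> u w L \<longleftrightarrow>
              G = {T \<in> Gm_Ga.
                     T $ 1 $ 2 = T $ 1 $ 1 * lin_d_eval id dC L (dC (T $ 1 $ 1) / T $ 1 $ 1)}) \<and>
           (case_iii_for sK dK \<iota> u w L \<longleftrightarrow>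
              log_deriv_embedding dC L \<in> iso (mult_of ring_of_type_algebra) (matrix_group G))) \<and>
        (\<not> case_i sK u \<and> \<not> case_ii sK dK u \<and>
         \<not> (\<exists>L. (\<forall>i. Polynomial.coeff L i \<in> Qbar) \<and> case_iii_for sK dK \<iota> u w L) \<longrightarrow>
           G = H \<and> H = Gm_Ga))"
proof -
  interpret riccati_pv dC sK dK \<iota> sR dR a b u y1 y2 y0 w Z G H
    by (rule riccati_pv.intro) (fact C k ab u R basis Z G H H_sub H_conn H_Ru)+
  \<comment> \<open>The subgroups in the statement are cut out by conditions on the two entries \<open>\<alpha>\<close> and \<open>\<beta>\<close>.\<close>
  note slices = Gm_Ga_Collect[of "\<lambda>\<alpha> \<beta>. \<alpha> = (1 :: 'c)"] Gm_Ga_Collect[of "\<lambda>\<alpha> \<beta>. dC \<alpha> = 0"]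
    Gm_Ga_Collect[of "\<lambda>\<alpha> \<beta>. \<beta> = \<alpha> * lin_d_eval id dC M (dC \<alpha> / \<alpha>)" for M]
  have 1: "{mat2 \<alpha> \<beta> 0 \<alpha> | \<alpha> \<beta>. \<alpha> \<noteq> 0 \<and> \<alpha> = (1 :: 'c)} = {mat2 1 \<beta> 0 1 | \<beta>. True}" by auto
  have 2: "{mat2 \<alpha> \<beta> 0 \<alpha> | \<alpha> \<beta>. \<alpha> \<noteq> 0 \<and> \<beta> = \<alpha> * lin_d_eval id dC M (dC \<alpha> / \<alpha>)} =
      {mat2 \<alpha> (\<alpha> * lin_d_eval id dC M (dC \<alpha> / \<alpha>)) 0 \<alpha> | \<alpha>. \<alpha> \<noteq> 0}" for M by blast
  have i: "case_i sK u \<longleftrightarrow> G = {mat2 1 \<beta> 0 1 | \<beta>. True} \<and> Ru G = UNIV"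
    using cases_i_ii(1) Ru_unipotent by auto
  have i': "case_i sK u \<longleftrightarrow> G = H \<and> H = {mat2 1 \<beta> 0 1 | \<beta>. True}"
    using cases_i_ii(1) H_of_case_i by metis
  have ii: "case_ii sK dK u \<longleftrightarrow> G = {mat2 \<alpha> \<beta> 0 \<alpha> | \<alpha> \<beta>. \<alpha> \<noteq> 0 \<and> dC \<alpha> = 0} \<and> Ru G = UNIV"
    using cases_i_ii(2) Ru_constants by auto
  have iv: "G = H \<and> H = Gm_Ga"
    if "w \<in> \<iota> ` Qbar_x" "\<not> case_i sK u" "\<not> case_ii sK dK u"
      "\<not> (\<exists>M. (\<forall>i. Polynomial.coeff M i \<in> Qbar) \<and> case_iii_for sK dK \<iota> u w M)"
  proof -
    have "G = Gm_Ga" by (rule cases_iii_iv(2)[OF that(1-3)]) (use that(4) in \<open>auto simp: qpoly_def\<close>)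
    moreover have "G \<subseteq> H" using G_elim(1) by blast
    ultimately show ?thesis using H_sub by blast
  qed
  show ?thesis
    unfolding slices 1 2 log_deriv_embedding_iso_iff
    by (intro conjI impI allI normalisation i i' ii cases_i_ii(2) cases_iii_iv(1)) (use iv in blast)+
qed

end
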